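(* Let $\mu,\nu$ be non-degenerate measures on $\mathcal N'$ with analytic Laplace transforms (Assumptions 1 and 2 of the context), and let $B:(\mathcal N)^1\to(\mathcal N)^1$ be a continuous linear operator. Then for any integer $p_o\ge0$ and any $\varepsilon>0$ there exist $C>0$ and a $0$-neighborhood $U\subset\mathcal N_{\mathbb C}$ such that the local $CS_{\mu\nu}$-symbol $\check B_{\mu\nu}(\xi,\eta)$ of $B$ is holomorphic in the cylinder $\mathcal N_{\mathbb C}\times U$ and satisfies the estimate $$|\check B_{\mu\nu}(\xi,\eta)|\le C e^{\varepsilon|\xi|_{-p_o}},\qquad \xi\in\mathcal N_{\mathbb C},\ \eta\in U.$$
   Context: **Nuclear triple.** $\mathcal N\subset H\subset\mathcal N'$ is a real nuclear Gel'fand triple; $\langle\cdot|\cdot\rangle$ is the canonical bilinear pairing between $\mathcal N'$ and $\mathcal N$, extending the inner product of $H$. The nuclear Fréchet space $\mathcal N$ is the projective limit of Hilbert spaces $H=H_0\supset H_1\supset H_2\supset\dots$ with norms $|\cdot|=|\cdot|_0\le|\cdot|_1\le|\cdot|_2\le\dots$, and for every $p$ there is $p'>p$ such that the embedding $H_{p'}\hookrightarrow H_p$ is Hilbert-Schmidt. $H_{-p}$ is the dual of $H_p$ with Hilbert norm $|\cdot|_{-p}$, so that $\mathcal N'=\mathrm{ind}\lim_p H_{-p}$. The subscript $\mathbb C$ denotes complexification, $\otimes$ (Hilbert, resp. nuclear) tensor product, $\hat\otimes$ symmetric tensor product; the notations $|\cdot|_{\pm p}$ and $\langle\cdot|\cdot\rangle$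 (bilinear) are kept for tensor powers and complexifications. **Measures.** A measure $\mu$ on the cylinder $\sigma$-algebra of $\mathcal N'$ is considered under: (Assumption 1) the Laplace transform $\xi\mapsto \mathrm E_\mu(\exp\langle\cdot|\xi\rangle)=\int_{\mathcal N'}e^{\langle x|\xi\rangle}d\mu(x)$ is holomorphic in a neighborhood of $0\in\mathcal N_{\mathbb C}$; (Assumption 2) $\mu$ is non-degenerate: a continuous polynomial $\phi(x)=\sum_{n=0}^N\langle x^{\otimes n}|\phi_n\rangle$, $\phi_n\in\mathcal N_{\mathbb C}^{\hat\otimes n}$, vanishes $\mu$-a.e. if and only if $\phi\equiv0$. $\mathcal P(\mathcal N')$ denotes the space of continuous polynomials. **Appell polynomials.** The normalized exponential is $e_\mu(\xi;x)=\exp\langle x|\xi\rangle/\mathrm E_\mu(\exp\langle \cdot|\xi\rangle)$, for $\xi$ in a neighborhood of $0\in\mathcal N_{\mathbb C}$. Its Taylor expansion at $\xi=0$ is $e_\mu(\xi;x)=\sum_{n\ge0}\frac1{n!}\langle P_{n,\mu}(x)|\xi^{\otimes n}\rangle$, which defines the symmetric kernels $P_{n,\mu}(x)$. Every $\phi\in\mathcal P(\mathcal N')$ is uniquely a finite sum $\phi=\sum_n\langle P_{n,\mu}(\cdot)|\phi_n\rangle$ with $\phi_n\in\mathcal N_{\mathbb C}^{\hat\otimes n}$. **Test space.** $(H_{p,q,\mu})$ is the completion of $\mathcal P(\mathcal N')$ in the norm $\|\phi\|_{p,q,\mu}^2=\sum_n(n!)^22^{qn}|\phi_n|_p^2$;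 its elements are the formal series $\sum_n\langle P_{n,\mu}(\cdot)|\phi_n\rangle$ with $\phi_n\in H_{p,\mathbb C}^{\hat\otimes n}$ and finite norm. The test space is $(\mathcal N)^1=\mathrm{proj}\lim_{p,q\in\mathbb N}(H_{p,q,\mu})$. It is known (Kondratiev et al.) that $(\mathcal N)^1$ is a nuclear space which, as a topological vector space of functions on $\mathcal N'$, does not depend on the choice of $\mu$ satisfying Assumptions 1 and 2: it coincides with the space of restrictions to $\mathcal N'$ of entire functions $G$ on $\mathcal N'_{\mathbb C}$ of growth 1 and minimal type (i.e. $G$ is holomorphic on every $H_{-p,\mathbb C}$ and for all $p,\varepsilon>0$ there is $C$ with $|G(z)|\le C\exp(\varepsilon|z|_{-p})$), with the norms $\sup_{z\in H_{-p,\mathbb C}}|G(z)|\exp(-2^{-l}|z|_{-p})$. **Dual system.** For $\Phi_n\in\mathcal N_{\mathbb C}^{\prime\hat\otimes n}$, $Q_{n,\mu}(\Phi_n)$ is the generalized function (linear functional on $\mathcal P(\mathcal N')$ through the bilinear pairing $\langle\!\langle\cdot|\cdot\rangle\!\rangle_\mu$ extending $\int\phi\psi\,d\mu$) characterized by $\langle\!\langle Q_{n,\mu}(\Phi_n)|\langle P_{m,\mu}|\phi_m\rangle\rangle\!\rangle_\mu=\delta_{m,n}\,n!\,\langle\Phi_n|\phi_n\rangle$. The dual $(H_{-p,-q,\mu})$ of $(H_{p,q,\mu})$ consists of the $\Phi=\sum_nQ_{n,\mu}(\Phi_n)$ with $\|\Phi\|^2_{-p,-q,\mu}=\sum_n2^{-qn}|\Phi_n|_{-p}^2<\infty$.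 For $\xi\in\mathcal N'_{\mathbb C}$ put $\rho_\mu(\xi)=\sum_{n\ge0}(-1)^nQ_{n,\mu}(\xi^{\otimes n}/n!)$; for $\xi\in H_{-p_o,\mathbb C}$ one has $\rho_\mu(-\xi)\in(H_{-p_o,-q_o,\mu})$ for all $q_o\ge0$. **Local $CS_{\mu\nu}$-symbol.** Let $B:(\mathcal N)^1\to(\mathcal N)^1$ be linear and continuous. For any integers $p_o,q_o\ge0$ there are integers $p,q\ge0$ such that $B$ extends to a continuous linear operator $(H_{p,q,\nu})\to(H_{p_o,q_o,\mu})$. For $\eta\in U_{p,q}=\{\eta\in\mathcal N_{\mathbb C}:|\eta|_p^2<2^{-q-1}\}$ one has $e_\nu(\eta;\cdot)=\sum_n\frac1{n!}\langle P_{n,\nu}(\cdot)|\eta^{\otimes n}\rangle\in(H_{p,q,\nu})$, and one defines $$\check B_{\mu\nu}(\xi,\eta):=\langle\!\langle\rho_\mu(-\xi)\,|\,Be_\nu(\eta;\cdot)\rangle\!\rangle_\mu,\qquad(\xi,\eta)\in\mathcal N_{\mathbb C}\times U_{p,q},$$ the pairing being that of $(H_{-p_o,-q_o,\mu})$ with $(H_{p_o,q_o,\mu})$. The functions obtained from different choices of $p_o,q_o,p,q$ agree on the intersections of their domains; $\check B_{\mu\nu}$ is understood as this locally defined function (different restrictions to cylinders $\mathcal N_{\mathbb C}\times U$ are identified), called the local $CS_{\mu\nu}$-symbol of $B$. **Holomorphy.** A function on an open subset of a complex locally convex space is holomorphic if it is G-holomorphic (for every point $z_0$ of the domain and every direction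 $z$, the one-variable function $\lambda\mapsto G(z_0+\lambda z)$ is analytic at $0\in\mathbb C$) and locally bounded. *)

theory Defs
  imports "HOL-Analysis.Analysis"
begin

text \<open>
  \<^bold>\<open>Conventions.\<close> The real nuclear space \<open>N\<close> is a whole type \<open>'n\<close>, given with a sequence
  \<open>ip 0, ip 1, \<dots>\<close> of inner products; \<open>H\<^sub>p\<close> is the completion of \<open>N\<close> for \<open>ip p\<close>. Its elements
  are needed only through pairings, so tensors are represented through duality:

  \<^item> \<open>N\<close> complexified is \<open>'n \<times> 'n\<close>, where \<open>(a, b)\<close> stands for \<open>a + \<i> b\<close>;
  \<^item> an element of the \<open>n\<close>-th tensor power of the complexified dual \<open>H\<^bsub>-p\<^esub>\<close> is a complex
    \<open>n\<close>-linear form on the complexified \<open>N\<close> of Hilbert-Schmidt type with respect to \<open>ip p\<close>,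
    and the tensor norm is the Hilbert-Schmidt norm;
  \<^item> an element of the \<open>n\<close>-th tensor power of the complexified \<open>H\<^sub>p\<close> is a bounded linear
    functional on the previous Hilbert space, with the dual norm (Hilbert spaces are reflexive),
    so that the bilinear pairing of \<open>\<Phi>\<close> with \<open>\<phi>\<close> is the application \<open>\<phi> \<Phi>\<close>.
\<close>

section \<open>Holomorphic functions on complex locally convex spaces\<close>

text \<open>The topology is given by a family \<open>S\<close> of seminorms that is directed upwards, so
  neighbourhoods are described by single seminorms.\<close>

definition lc_open :: "('i \<Rightarrow> 'a::ab_group_add \<Rightarrow> real) \<Rightarrow> 'a set \<Rightarrow> bool" where
  "lc_open S U \<longleftrightarrow> (\<forall>z\<in>U. \<exists>i. \<exists>\<delta>>0. \<forall>w. S i (w - z) < \<delta> \<longrightarrow> w \<in> U)"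

definition lc_holomorphic_on ::
  "(complex \<Rightarrow> 'a \<Rightarrow> 'a) \<Rightarrow> ('i \<Rightarrow> 'a::ab_group_add \<Rightarrow> real) \<Rightarrow> ('a \<Rightarrow> complex) \<Rightarrow> 'a set \<Rightarrow> bool"
where
  "lc_holomorphic_on scl S G U \<longleftrightarrow> lc_open S U
     \<and> (\<forall>z0\<in>U. \<forall>z. (\<lambda>l. G (z0 + scl l z)) analytic_on {0})
     \<and> (\<forall>z0\<in>U. \<exists>i. \<exists>\<delta>>0. \<exists>M. \<forall>w\<in>U. S i (w - z0) < \<delta> \<longrightarrow> cmod (G w) \<le> M)"

section \<open>Nuclear triples\<close>

definition hnorm :: "(nat \<Rightarrow> 'n \<Rightarrow> 'n \<Rightarrow> real) \<Rightarrow> nat \<Rightarrow> 'n \<Rightarrow> real" where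
  "hnorm ip p x = sqrt (ip p x x)"

definition orthonormal :: "(nat \<Rightarrow> 'n \<Rightarrow> 'n \<Rightarrow> real) \<Rightarrow> nat \<Rightarrow> 'n set \<Rightarrow> bool" where
  "orthonormal ip p A \<longleftrightarrow> (\<forall>e\<in>A. \<forall>f\<in>A. ip p e f = (if e = f then 1 else 0))"

text \<open>\<open>compatible\<close> says that the canonical maps between the completions, from \<open>H\<^bsub>p+1\<^esub>\<close> to
  \<open>H\<^sub>p\<close>, are injective; \<open>complete\<close> says that \<open>N\<close> is the projective limit of the \<open>H\<^sub>p\<close>.
  As \<open>N\<close> is dense in \<open>H\<^bsub>p'\<^esub>\<close>, the Hilbert-Schmidt property of an embedding can be expressed
  by finite orthonormal systems contained in \<open>N\<close>.\<close>

locale nuclear_triple =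
  fixes ip :: "nat \<Rightarrow> 'n::real_vector \<Rightarrow> 'n \<Rightarrow> real"
  assumes ip_commute: "ip p x y = ip p y x"
    and ip_add: "ip p (x + y) z = ip p x z + ip p y z"
    and ip_scaleR: "ip p (r *\<^sub>R x) y = r * ip p x y"
    and ip_pos: "x \<noteq> 0 \<Longrightarrow> ip p x x > 0"
    and hnorm_mono: "hnorm ip p x \<le> hnorm ip (Suc p) x"
    and compatible: "(\<forall>\<epsilon>>0. \<exists>K. \<forall>m\<ge>K. \<forall>n\<ge>K. hnorm ip (Suc p) (s m - s n) < \<epsilon>)
          \<Longrightarrow> (\<lambda>n. hnorm ip p (s n)) \<longlonglongrightarrow> 0 \<Longrightarrow> (\<lambda>n. hnorm ip (Suc p) (s n)) \<longlonglongrightarrow> 0"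
    and complete: "(\<forall>p. \<forall>\<epsilon>>0. \<exists>K. \<forall>m\<ge>K. \<forall>n\<ge>K. hnorm ip p (s m - s n) < \<epsilon>)
          \<Longrightarrow> \<exists>x. \<forall>p. (\<lambda>n. hnorm ip p (s n - x)) \<longlonglongrightarrow> 0"
    and hilbert_schmidt: "\<exists>p'>p. \<exists>M. \<forall>A. finite A \<and> orthonormal ip p' A
          \<longrightarrow> (\<Sum>e\<in>A. (hnorm ip p e)\<^sup>2) \<le> M"

subsection \<open>Complexification\<close>

type_synonym 'n cx = "'n \<times> 'n"

definition cscale :: "complex \<Rightarrow> 'n::real_vector cx \<Rightarrow> 'n cx" where
  "cscale c z = (Re c *\<^sub>R fst z - Im c *\<^sub>R snd z, Im c *\<^sub>R fst z + Re c *\<^sub>R snd z)"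

definition cnorm :: "(nat \<Rightarrow> 'n \<Rightarrow> 'n \<Rightarrow> real) \<Rightarrow> nat \<Rightarrow> 'n cx \<Rightarrow> real" where
  "cnorm ip p z = sqrt ((hnorm ip p (fst z))\<^sup>2 + (hnorm ip p (snd z))\<^sup>2)"

text \<open>Scalar multiplication and norms on the product of two copies of the complexified \<open>N\<close>.\<close>

definition cscale2 :: "complex \<Rightarrow> 'n::real_vector cx \<times> 'n cx \<Rightarrow> 'n cx \<times> 'n cx" where
  "cscale2 c w = (cscale c (fst w), cscale c (snd w))"

definition cnorm2 :: "(nat \<Rightarrow> 'n \<Rightarrow> 'n \<Rightarrow> real) \<Rightarrow> nat \<Rightarrow> 'n cx \<times> 'n cx \<Rightarrow> real" where
  "cnorm2 ip p w = cnorm ip p (fst w) + cnorm ip p (snd w)"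

subsection \<open>The dual space\<close>

definition dual :: "(nat \<Rightarrow> 'n::real_vector \<Rightarrow> 'n \<Rightarrow> real) \<Rightarrow> ('n \<Rightarrow> real) set" where
  "dual ip = {x. linear x \<and> (\<exists>p K. \<forall>\<xi>. \<bar>x \<xi>\<bar> \<le> K * hnorm ip p \<xi>)}"

text \<open>The bilinear pairing of a real functional with the complexified \<open>N\<close>; thus \<open>cext\<close> is also
  the inclusion of the dual into its complexification.\<close>

definition cext :: "('n \<Rightarrow> real) \<Rightarrow> 'n cx \<Rightarrow> complex" where
  "cext x \<xi> = Complex (x (fst \<xi>)) (x (snd \<xi>))"

text \<open>The inclusion of the complexified \<open>N\<close> into its dual: the complex bilinear extension of the
  inner product of \<open>H = H\<^sub>0\<close>.\<close>

definition cembed :: "(nat \<Rightarrow> 'n \<Rightarrow> 'n \<Rightarrow> real) \<Rightarrow> 'n cx \<Rightarrow> 'n cx \<Rightarrow> complex" where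
  "cembed ip \<xi> \<zeta> = Complex (ip 0 (fst \<xi>) (fst \<zeta>) - ip 0 (snd \<xi>) (snd \<zeta>))
                         (ip 0 (fst \<xi>) (snd \<zeta>) + ip 0 (snd \<xi>) (fst \<zeta>))"

definition neg_norm :: "(nat \<Rightarrow> 'n \<Rightarrow> 'n \<Rightarrow> real) \<Rightarrow> nat \<Rightarrow> ('n cx \<Rightarrow> complex) \<Rightarrow> real" where
  "neg_norm ip p x = Sup {cmod (x \<zeta>) |\<zeta>. cnorm ip p \<zeta> \<le> 1}"

section \<open>Tensor powers\<close>

subsection \<open>Tensor powers of the dual\<close>

type_synonym 'n form = "'n cx list \<Rightarrow> complex"

definition multilinear_form :: "nat \<Rightarrow> 'n::real_vector form \<Rightarrow> bool" where
  "multilinear_form n \<Phi> \<longleftrightarrow>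
     (\<forall>es. length es \<noteq> n \<longrightarrow> \<Phi> es = 0) \<and>
     (\<forall>es i c \<xi> \<zeta>. length es = n \<and> i < n \<longrightarrow>
        \<Phi> (es[i := cscale c \<xi> + \<zeta>]) = c * \<Phi> (es[i := \<xi>]) + \<Phi> (es[i := \<zeta>]))"

text \<open>The partial sums of the squared Hilbert-Schmidt norm. A real orthonormal basis of \<open>H\<^sub>p\<close> is
  an orthonormal basis of its complexification.\<close>

definition hs_sums :: "(nat \<Rightarrow> 'n::real_vector \<Rightarrow> 'n \<Rightarrow> real) \<Rightarrow> nat \<Rightarrow> nat \<Rightarrow> 'n form \<Rightarrow> real set" where
  "hs_sums ip p n \<Phi> =
     {\<Sum>es | set es \<subseteq> A \<and> length es = n. (cmod (\<Phi> (map (\<lambda>e. (e, 0)) es)))\<^sup>2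
       |A. finite A \<and> orthonormal ip p A}"

definition Hneg :: "(nat \<Rightarrow> 'n::real_vector \<Rightarrow> 'n \<Rightarrow> real) \<Rightarrow> nat \<Rightarrow> nat \<Rightarrow> 'n form set" where
  "Hneg ip p n = {\<Phi>. multilinear_form n \<Phi> \<and> bdd_above (hs_sums ip p n \<Phi>)}"

definition Hneg_norm :: "(nat \<Rightarrow> 'n::real_vector \<Rightarrow> 'n \<Rightarrow> real) \<Rightarrow> nat \<Rightarrow> nat \<Rightarrow> 'n form \<Rightarrow> real" where
  "Hneg_norm ip p n \<Phi> = sqrt (Sup (hs_sums ip p n \<Phi>))"

definition dual_tensors :: "(nat \<Rightarrow> 'n::real_vector \<Rightarrow> 'n \<Rightarrow> real) \<Rightarrow> nat \<Rightarrow> 'n form set" where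
  "dual_tensors ip n = (\<Union>p. Hneg ip p n)"

definition permute_form :: "nat \<Rightarrow> (nat \<Rightarrow> nat) \<Rightarrow> 'n form \<Rightarrow> 'n form" where
  "permute_form n \<pi> \<Phi> = (\<lambda>es. if length es = n then \<Phi> (permute_list \<pi> es) else 0)"

definition sym_dual_tensors :: "(nat \<Rightarrow> 'n::real_vector \<Rightarrow> 'n \<Rightarrow> real) \<Rightarrow> nat \<Rightarrow> 'n form set" where
  "sym_dual_tensors ip n =
     {\<Phi> \<in> dual_tensors ip n. \<forall>\<pi>. \<pi> permutes {..<n} \<longrightarrow> permute_form n \<pi> \<Phi> = \<Phi>}"

definition form_power :: "nat \<Rightarrow> ('n cx \<Rightarrow> complex) \<Rightarrow> 'n form" where
  "form_power n x = (\<lambda>es. if length es = n then prod_list (map x es) else 0)"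

subsection \<open>Tensor powers of the test function side\<close>

type_synonym 'n tensor = "'n form \<Rightarrow> complex"

text \<open>A symmetric linear functional on a set \<open>D\<close> of \<open>n\<close>-linear forms, set to \<open>0\<close> off \<open>D\<close>.\<close>

definition sym_functional :: "nat \<Rightarrow> 'n form set \<Rightarrow> 'n tensor \<Rightarrow> bool" where
  "sym_functional n D \<phi> \<longleftrightarrow>
     (\<forall>\<Phi>. \<Phi> \<notin> D \<longrightarrow> \<phi> \<Phi> = 0) \<and>
     (\<forall>\<Phi>\<in>D. \<forall>\<Psi>\<in>D. \<forall>c. \<phi> (\<lambda>es. c * \<Phi> es + \<Psi> es) = c * \<phi> \<Phi> + \<phi> \<Psi>) \<and>
     (\<forall>\<Phi>\<in>D. \<forall>\<pi>. \<pi> permutes {..<n} \<longrightarrow> \<phi> (permute_form n \<pi> \<Phi>) = \<phi> \<Phi>)"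

text \<open>The symmetric tensor power of the complexified Hilbert space \<open>H\<^sub>p\<close>, and its norm.\<close>

definition Hpos :: "(nat \<Rightarrow> 'n::real_vector \<Rightarrow> 'n \<Rightarrow> real) \<Rightarrow> nat \<Rightarrow> nat \<Rightarrow> 'n tensor set" where
  "Hpos ip p n = {\<phi>. sym_functional n (Hneg ip p n) \<phi> \<and>
     (\<exists>K. \<forall>\<Phi>\<in>Hneg ip p n. cmod (\<phi> \<Phi>) \<le> K * Hneg_norm ip p n \<Phi>)}"

definition Hpos_norm :: "(nat \<Rightarrow> 'n::real_vector \<Rightarrow> 'n \<Rightarrow> real) \<Rightarrow> nat \<Rightarrow> nat \<Rightarrow> 'n tensor \<Rightarrow> real" where
  "Hpos_norm ip p n \<phi> = Sup {cmod (\<phi> \<Phi>) |\<Phi>. \<Phi> \<in> Hneg ip p n \<and> Hneg_norm ip p n \<Phi> \<le> 1}"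

text \<open>The symmetric tensor power of the complexified nuclear space, the projective limit over \<open>p\<close>
  of the preceding spaces. The canonical map into \<open>Hpos ip p n\<close> is the restriction of functionals.\<close>

definition sym_tensors :: "(nat \<Rightarrow> 'n::real_vector \<Rightarrow> 'n \<Rightarrow> real) \<Rightarrow> nat \<Rightarrow> 'n tensor set" where
  "sym_tensors ip n = {\<phi>. sym_functional n (dual_tensors ip n) \<phi> \<and>
     (\<forall>p. \<exists>K. \<forall>\<Phi>\<in>Hneg ip p n. cmod (\<phi> \<Phi>) \<le> K * Hneg_norm ip p n \<Phi>)}"

definition res_kernels ::
  "(nat \<Rightarrow> 'n::real_vector \<Rightarrow> 'n \<Rightarrow> real) \<Rightarrow> nat \<Rightarrow> (nat \<Rightarrow> 'n tensor) \<Rightarrow> nat \<Rightarrow> 'n tensor" where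
  "res_kernels ip p f n = (\<lambda>\<Phi>. if \<Phi> \<in> Hneg ip p n then f n \<Phi> else 0)"

definition tensor_power :: "nat \<Rightarrow> 'n cx \<Rightarrow> 'n tensor" where
  "tensor_power n \<eta> = (\<lambda>\<Phi>. \<Phi> (replicate n \<eta>))"

section \<open>Measures and Appell polynomials\<close>

definition polynomials :: "(nat \<Rightarrow> 'n::real_vector \<Rightarrow> 'n \<Rightarrow> real) \<Rightarrow> (('n \<Rightarrow> real) \<Rightarrow> complex) set" where
  "polynomials ip =
     {\<phi>. \<exists>d f. (\<forall>n. f n \<in> sym_tensors ip n) \<and>
        (\<forall>x. \<phi> x = (if x \<in> dual ip then \<Sum>n\<le>d. f n (form_power n (cext x)) else 0))}"

definition cylinder_algebra :: "(nat \<Rightarrow> 'n::real_vector \<Rightarrow> 'n \<Rightarrow> real) \<Rightarrow> ('n \<Rightarrow> real) measure" where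
  "cylinder_algebra ip = sigma (dual ip) {{x \<in> dual ip. x \<xi> \<in> A} |\<xi> A. A \<in> sets borel}"

definition laplace :: "('n \<Rightarrow> real) measure \<Rightarrow> 'n cx \<Rightarrow> complex" where
  "laplace \<mu> \<xi> = (\<integral>x. exp (cext x \<xi>) \<partial>\<mu>)"

definition analytic_laplace ::
  "(nat \<Rightarrow> 'n::real_vector \<Rightarrow> 'n \<Rightarrow> real) \<Rightarrow> ('n \<Rightarrow> real) measure \<Rightarrow> bool" where
  "analytic_laplace ip \<mu> \<longleftrightarrow>
     (\<exists>U. lc_open (cnorm ip) U \<and> 0 \<in> U \<and> (\<forall>\<xi>\<in>U. integrable \<mu> (\<lambda>x. exp (cext x \<xi>)))
        \<and> lc_holomorphic_on cscale (cnorm ip) (laplace \<mu>) U)"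

definition nondegenerate ::
  "(nat \<Rightarrow> 'n::real_vector \<Rightarrow> 'n \<Rightarrow> real) \<Rightarrow> ('n \<Rightarrow> real) measure \<Rightarrow> bool" where
  "nondegenerate ip \<mu> \<longleftrightarrow>
     (\<forall>\<phi>\<in>polynomials ip. (AE x in \<mu>. \<phi> x = 0) \<longleftrightarrow> (\<forall>x\<in>dual ip. \<phi> x = 0))"

definition normalized_exp :: "('n \<Rightarrow> real) measure \<Rightarrow> 'n cx \<Rightarrow> ('n \<Rightarrow> real) \<Rightarrow> complex" where
  "normalized_exp \<mu> \<xi> x = exp (cext x \<xi>) / laplace \<mu> \<xi>"

text \<open>The kernel of the \<open>n\<close>-th Taylor coefficient at \<open>0\<close>, times \<open>n!\<close>; \<open>\<Phi> (replicate n \<xi>)\<close> is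
  the pairing of \<open>\<Phi>\<close> with the \<open>n\<close>-th tensor power of \<open>\<xi>\<close>.\<close>

definition appell_kernel ::
  "(nat \<Rightarrow> 'n::real_vector \<Rightarrow> 'n \<Rightarrow> real) \<Rightarrow> ('n \<Rightarrow> real) measure \<Rightarrow> nat \<Rightarrow> ('n \<Rightarrow> real) \<Rightarrow> 'n form" where
  "appell_kernel ip \<mu> n x = (THE \<Phi>. \<Phi> \<in> sym_dual_tensors ip n \<and>
     (\<forall>\<xi>. \<Phi> (replicate n \<xi>) = (deriv ^^ n) (\<lambda>t. normalized_exp \<mu> (cscale t \<xi>) x) 0))"

section \<open>Test functions\<close>

text \<open>A formal series \<open>\<Sum>n. \<langle>P\<^sub>n | f n\<rangle>\<close> is represented by its sequence of kernels \<open>f\<close>. The measure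
  enters through the function on the dual that the series defines.\<close>

definition pq_terms ::
  "(nat \<Rightarrow> 'n::real_vector \<Rightarrow> 'n \<Rightarrow> real) \<Rightarrow> nat \<Rightarrow> nat \<Rightarrow> (nat \<Rightarrow> 'n tensor) \<Rightarrow> nat \<Rightarrow> real" where
  "pq_terms ip p q f n = (fact n)\<^sup>2 * 2 ^ (q * n) * (Hpos_norm ip p n (f n))\<^sup>2"

definition pq_norm ::
  "(nat \<Rightarrow> 'n::real_vector \<Rightarrow> 'n \<Rightarrow> real) \<Rightarrow> nat \<Rightarrow> nat \<Rightarrow> (nat \<Rightarrow> 'n tensor) \<Rightarrow> real" where
  "pq_norm ip p q f = sqrt (\<Sum>n. pq_terms ip p q f n)"

definition Hpq ::
  "(nat \<Rightarrow> 'n::real_vector \<Rightarrow> 'n \<Rightarrow> real) \<Rightarrow> nat \<Rightarrow> nat \<Rightarrow> (nat \<Rightarrow> 'n tensor) set" where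
  "Hpq ip p q = {f. (\<forall>n. f n \<in> Hpos ip p n) \<and> summable (pq_terms ip p q f)}"

definition test_kernels :: "(nat \<Rightarrow> 'n::real_vector \<Rightarrow> 'n \<Rightarrow> real) \<Rightarrow> (nat \<Rightarrow> 'n tensor) set" where
  "test_kernels ip =
     {f. (\<forall>n. f n \<in> sym_tensors ip n) \<and> (\<forall>p q. summable (pq_terms ip p q f))}"

definition appell_expansion ::
  "(nat \<Rightarrow> 'n::real_vector \<Rightarrow> 'n \<Rightarrow> real) \<Rightarrow> ('n \<Rightarrow> real) measure \<Rightarrow> (('n \<Rightarrow> real) \<Rightarrow> complex)
     \<Rightarrow> (nat \<Rightarrow> 'n tensor) \<Rightarrow> bool" where
  "appell_expansion ip \<mu> \<phi> f \<longleftrightarrow> f \<in> test_kernels ip \<and>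
     (\<forall>x\<in>dual ip. (\<lambda>n. f n (appell_kernel ip \<mu> n x)) sums \<phi> x) \<and> (\<forall>x. x \<notin> dual ip \<longrightarrow> \<phi> x = 0)"

text \<open>The test space \<open>(N)\<^sup>1\<close> as a space of functions on the dual, constructed from \<open>\<mu>\<close> as the
  projective limit over \<open>p\<close>, \<open>q\<close> of the spaces \<open>(H\<^bsub>p,q,\<mu>\<^esub>)\<close>, that is, of \<open>Hpq ip p q\<close>. Functions
  are set to \<open>0\<close> off the dual.\<close>

definition test_space ::
  "(nat \<Rightarrow> 'n::real_vector \<Rightarrow> 'n \<Rightarrow> real) \<Rightarrow> ('n \<Rightarrow> real) measure \<Rightarrow> (('n \<Rightarrow> real) \<Rightarrow> complex) set" where
  "test_space ip \<mu> = {\<phi>. \<exists>f. appell_expansion ip \<mu> \<phi> f}"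

definition kernels ::
  "(nat \<Rightarrow> 'n::real_vector \<Rightarrow> 'n \<Rightarrow> real) \<Rightarrow> ('n \<Rightarrow> real) measure \<Rightarrow> (('n \<Rightarrow> real) \<Rightarrow> complex)
     \<Rightarrow> nat \<Rightarrow> 'n tensor" where
  "kernels ip \<mu> \<phi> = (THE f. appell_expansion ip \<mu> \<phi> f)"

definition test_norm ::
  "(nat \<Rightarrow> 'n::real_vector \<Rightarrow> 'n \<Rightarrow> real) \<Rightarrow> ('n \<Rightarrow> real) measure \<Rightarrow> nat \<Rightarrow> nat
     \<Rightarrow> (('n \<Rightarrow> real) \<Rightarrow> complex) \<Rightarrow> real" where
  "test_norm ip \<mu> p q \<phi> = pq_norm ip p q (kernels ip \<mu> \<phi>)"

text \<open>Linear operators on \<open>(N)\<^sup>1\<close> that are continuous at every point. As a topological vector space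
  of functions on the dual, \<open>(N)\<^sup>1\<close> does not depend on the measure from which it is constructed;
  here it is constructed from \<open>\<nu>\<close> on the source side and from \<open>\<mu>\<close> on the target side, the norms
  in which the symbol of the operator is expressed.\<close>

definition continuous_operator ::
  "(nat \<Rightarrow> 'n::real_vector \<Rightarrow> 'n \<Rightarrow> real) \<Rightarrow> ('n \<Rightarrow> real) measure \<Rightarrow> ('n \<Rightarrow> real) measure
     \<Rightarrow> ((('n \<Rightarrow> real) \<Rightarrow> complex) \<Rightarrow> (('n \<Rightarrow> real) \<Rightarrow> complex)) \<Rightarrow> bool" where
  "continuous_operator ip \<mu> \<nu> B \<longleftrightarrow>
     B ` test_space ip \<nu> \<subseteq> test_space ip \<mu> \<and>
     (\<forall>\<phi>\<in>test_space ip \<nu>. \<forall>\<psi>\<in>test_space ip \<nu>. \<forall>c.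
        B (\<lambda>x. c * \<phi> x + \<psi> x) = (\<lambda>x. c * B \<phi> x + B \<psi> x)) \<and>
     (\<forall>\<phi>\<in>test_space ip \<nu>. \<forall>p\<^sub>o q\<^sub>o. \<forall>\<epsilon>>0. \<exists>p q. \<exists>\<delta>>0. \<forall>\<psi>\<in>test_space ip \<nu>.
        test_norm ip \<nu> p q (\<lambda>x. \<psi> x - \<phi> x) < \<delta> \<longrightarrow>
        test_norm ip \<mu> p\<^sub>o q\<^sub>o (\<lambda>x. B \<psi> x - B \<phi> x) < \<epsilon>)"

section \<open>The local symbol\<close>

text \<open>Generalized functions act on formal series; \<open>Q n \<Phi>\<close> and \<open>rho x\<close> are given by their bilinear
  pairing with \<open>\<Sum>m. \<langle>P\<^sub>m | f m\<rangle>\<close>.\<close>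

definition Q :: "nat \<Rightarrow> 'n form \<Rightarrow> (nat \<Rightarrow> 'n tensor) \<Rightarrow> complex" where
  "Q n \<Phi> f = fact n * f n \<Phi>"

definition rho :: "('n cx \<Rightarrow> complex) \<Rightarrow> (nat \<Rightarrow> 'n tensor) \<Rightarrow> complex" where
  "rho x f = (\<Sum>n. (-1) ^ n * Q n (\<lambda>es. form_power n x es / fact n) f)"

text \<open>The kernels of \<open>e\<^sub>\<nu>(\<eta>; \<cdot>)\<close>, read off from the Taylor expansion that defines the
  Appell kernels of \<open>\<nu>\<close>.\<close>

definition exp_kernels :: "'n cx \<Rightarrow> nat \<Rightarrow> 'n tensor" where
  "exp_kernels \<eta> n = (\<lambda>\<Phi>. tensor_power n \<eta> \<Phi> / fact n)"

definition Upq :: "(nat \<Rightarrow> 'n \<Rightarrow> 'n \<Rightarrow> real) \<Rightarrow> nat \<Rightarrow> nat \<Rightarrow> 'n cx set" where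
  "Upq ip p q = {\<eta>. (cnorm ip p \<eta>)\<^sup>2 < 1 / 2 ^ (q + 1)}"

text \<open>\<open>T\<close> is a continuous linear operator from \<open>(H\<^bsub>p,q,\<nu>\<^esub>)\<close> to \<open>(H\<^bsub>p\<^sub>o,q\<^sub>o,\<mu>\<^esub>)\<close> extending \<open>B\<close>.\<close>

definition extends_to ::
  "(nat \<Rightarrow> 'n::real_vector \<Rightarrow> 'n \<Rightarrow> real) \<Rightarrow> ('n \<Rightarrow> real) measure \<Rightarrow> ('n \<Rightarrow> real) measure
     \<Rightarrow> ((('n \<Rightarrow> real) \<Rightarrow> complex) \<Rightarrow> (('n \<Rightarrow> real) \<Rightarrow> complex)) \<Rightarrow> nat \<Rightarrow> nat \<Rightarrow> nat \<Rightarrow> nat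
     \<Rightarrow> ((nat \<Rightarrow> 'n tensor) \<Rightarrow> (nat \<Rightarrow> 'n tensor)) \<Rightarrow> bool" where
  "extends_to ip \<mu> \<nu> B p\<^sub>o q\<^sub>o p q T \<longleftrightarrow>
     T ` Hpq ip p q \<subseteq> Hpq ip p\<^sub>o q\<^sub>o \<and>
     (\<forall>f\<in>Hpq ip p q. \<forall>g\<in>Hpq ip p q. \<forall>c.
        T (\<lambda>n \<Phi>. c * f n \<Phi> + g n \<Phi>) = (\<lambda>n \<Phi>. c * T f n \<Phi> + T g n \<Phi>)) \<and>
     (\<exists>K. \<forall>f\<in>Hpq ip p q. pq_norm ip p\<^sub>o q\<^sub>o (T f) \<le> K * pq_norm ip p q f) \<and>
     (\<forall>\<phi>\<in>test_space ip \<nu>.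
        T (res_kernels ip p (kernels ip \<nu> \<phi>)) = res_kernels ip p\<^sub>o (kernels ip \<mu> (B \<phi>)))"

text \<open>The values at \<open>(\<xi>, \<eta>)\<close> of the local symbol obtained from the various choices of
  \<open>p\<^sub>o, q\<^sub>o, p, q\<close>. They all agree, so the symbol is their common value, on the union of the
  cylinders.\<close>

definition symbol_value ::
  "(nat \<Rightarrow> 'n::real_vector \<Rightarrow> 'n \<Rightarrow> real) \<Rightarrow> ('n \<Rightarrow> real) measure \<Rightarrow> ('n \<Rightarrow> real) measure
     \<Rightarrow> ((('n \<Rightarrow> real) \<Rightarrow> complex) \<Rightarrow> (('n \<Rightarrow> real) \<Rightarrow> complex)) \<Rightarrow> 'n cx \<Rightarrow> 'n cx \<Rightarrow> complex \<Rightarrow> bool" where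
  "symbol_value ip \<mu> \<nu> B \<xi> \<eta> v \<longleftrightarrow>
     (\<exists>p\<^sub>o q\<^sub>o p q T. extends_to ip \<mu> \<nu> B p\<^sub>o q\<^sub>o p q T \<and> \<eta> \<in> Upq ip p q \<and>
        v = rho (\<lambda>\<zeta>. - cembed ip \<xi> \<zeta>) (T (res_kernels ip p (exp_kernels \<eta>))))"

definition symbol_domain ::
  "(nat \<Rightarrow> 'n::real_vector \<Rightarrow> 'n \<Rightarrow> real) \<Rightarrow> ('n \<Rightarrow> real) measure \<Rightarrow> ('n \<Rightarrow> real) measure
     \<Rightarrow> ((('n \<Rightarrow> real) \<Rightarrow> complex) \<Rightarrow> (('n \<Rightarrow> real) \<Rightarrow> complex)) \<Rightarrow> ('n cx \<times> 'n cx) set" where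
  "symbol_domain ip \<mu> \<nu> B = {(\<xi>, \<eta>). \<exists>!v. symbol_value ip \<mu> \<nu> B \<xi> \<eta> v}"

definition symbol ::
  "(nat \<Rightarrow> 'n::real_vector \<Rightarrow> 'n \<Rightarrow> real) \<Rightarrow> ('n \<Rightarrow> real) measure \<Rightarrow> ('n \<Rightarrow> real) measure
     \<Rightarrow> ((('n \<Rightarrow> real) \<Rightarrow> complex) \<Rightarrow> (('n \<Rightarrow> real) \<Rightarrow> complex)) \<Rightarrow> 'n cx \<Rightarrow> 'n cx \<Rightarrow> complex" where
  "symbol ip \<mu> \<nu> B \<xi> \<eta> = (THE v. symbol_value ip \<mu> \<nu> B \<xi> \<eta> v)"

end

theory Submission
  imports Defs "HOL-Complex_Analysis.Cauchy_Integral_Formula"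
begin

text \<open>
  The symbol at \<open>(\<xi>, \<eta>)\<close> is the pairing of \<open>\<rho>(-\<xi>)\<close> with the image of \<open>e\<^sub>\<nu>(\<eta>; \<cdot>)\<close>. The norm of
  \<open>\<rho>(-\<xi>)\<close> in \<open>(H\<^bsub>-p,-q\<^esub>)\<close> grows at most like \<open>exp (2\<^bsup>-q/2\<^esup> \<bar>\<xi>\<bar>\<^bsub>-p\<^esub>)\<close>, so the exponent
  is made small by a large \<open>q\<close>, while \<open>e\<^sub>\<nu>(\<eta>; \<cdot>)\<close> stays bounded for small \<open>\<eta>\<close>. Holomorphy holds because,
  on complex lines, the symbol is a locally uniform limit of polynomials: the pairings of partial sums.
  These partial sums are test functions, so they also show that the symbol does not depend on the
  chosen extension of \<open>B\<close>.

  The norms of \<open>(N)\<^sup>1\<close> are those of the kernels of an Appell expansion, and these have to be shown to be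
  unique. Write \<open>L\<^sub>n\<close> for the \<open>n\<close>-th moment tensor and \<open>h\<^sub>n\<close> for the \<open>n\<close>-th coefficient tensor of the
  reciprocal Laplace transform, so that \<open>P\<^sub>n(x) = \<Sum>k. (n choose k) h\<^sub>k \<otimes> x\<^bsup>n-k\<^esup>\<close> and
  \<open>\<Sum>k. (n choose k) h\<^sub>k \<otimes> L\<^bsub>n-k\<^esub> = 0\<close> for \<open>n > 0\<close>, up to symmetrization. If
  \<open>\<Sum>n. \<langle>P\<^sub>n(x) | f\<^sub>n\<rangle> = 0\<close> for all \<open>x\<close>, then replacing \<open>x\<close> by \<open>t x\<close> and comparing coefficients of \<open>t\<close> gives
  \<open>\<Sum>k. (m + k choose k) \<langle>h\<^sub>k \<otimes> \<Phi> | f\<^bsub>m+k\<^esub>\<rangle> = 0\<close> for \<open>\<Phi> = x\<^sup>m\<close>, hence for every \<open>\<Phi>\<close> of degree \<open>m\<close> because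
  powers are dense; the choices \<open>\<Phi> = L\<^sub>j \<otimes> \<Psi>\<close>, weighted and summed over \<open>j\<close>, leave \<open>\<langle>\<Psi> | f\<^sub>i\<rangle> = 0\<close>.
\<close>

section \<open>Tuples\<close>

text \<open>Tensor norms are suprema over finite orthonormal systems of vectors of N; no orthonormal
  basis of H_p is at hand. Estimates are therefore made on a finite system, which Gram-Schmidt
  enlarges until it spans the vectors involved, and approximation means choosing a system whose
  partial sum is near the supremum.

  Extending B to (H_pq) requires kernels of test functions to be dense there. A functional composed
  with a finite-rank projection evaluates forms on finitely many vectors of N only, so it is defined
  on dual tensors of every level and lies in the nuclear tensor power.

  The growth of L_n and h_n rests on nuclearity: the Laplace transform bounds the moments merely as
  multilinear forms, and a Hilbert-Schmidt embedding turns this into tensor norms at a higher level.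
  Both then grow like n! E^n, which the weights n! 2^(qn/2) beat for large q.

  The total mass is not normalized; non-degeneracy makes it positive, so that the Laplace transform
  can be inverted at 0.\<close>

definition tuples :: "'a set \<Rightarrow> nat \<Rightarrow> 'a list set" where
  "tuples A n = {es. set es \<subseteq> A \<and> length es = n}"

lemma tuples_0 [simp]: "tuples A 0 = {[]}"
  by (auto simp: tuples_def)

lemma tuples_Suc: "tuples A (Suc n) = (\<lambda>(e, es). e # es) ` (A \<times> tuples A n)"
  by (auto simp: tuples_def image_iff length_Suc_conv)

lemma finite_tuples [simp]: "finite A \<Longrightarrow> finite (tuples A n)"
  unfolding tuples_def by (rule finite_lists_length_eq)

lemma length_tuples: "es \<in> tuples A n \<Longrightarrow> length es = n"
  by (simp add: tuples_def)

lemma tuples_mono: "A \<subseteq> B \<Longrightarrow> tuples A n \<subseteq> tuples B n"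
  by (auto simp: tuples_def)

lemma sum_tuples_Suc:
  assumes "finite A"
  shows "(\<Sum>es\<in>tuples A (Suc n). f es) = (\<Sum>e\<in>A. \<Sum>es\<in>tuples A n. f (e # es))"
proof -
  have "(\<Sum>es\<in>tuples A (Suc n). f es) = (\<Sum>x\<in>A \<times> tuples A n. f (case x of (e, es) \<Rightarrow> e # es))"
    unfolding tuples_Suc by (subst sum.reindex) (auto simp: inj_on_def)
  also have "\<dots> = (\<Sum>e\<in>A. \<Sum>es\<in>tuples A n. f (e # es))"
    by (subst sum.cartesian_product) (simp add: case_prod_beta)
  finally show ?thesis .
qed

text \<open>Splitting a tuple at position \<open>k\<close> is a bijection with pairs of tuples. In
  this summed form it bounds the Hilbert-Schmidt norm of a \<open>tprod\<close>.\<close>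

lemma sum_tuples_add:
  fixes g h :: "'a list \<Rightarrow> 'b::comm_semiring_1"
  assumes "finite A"
  shows "(\<Sum>es\<in>tuples A (k + m). g (take k es) * h (drop k es))
       = (\<Sum>es\<in>tuples A k. g es) * (\<Sum>es\<in>tuples A m. h es)"
proof (induction k arbitrary: g)
  case 0
  then show ?case by (simp add: sum_distrib_left)
next
  case (Suc k)
  have "(\<Sum>es\<in>tuples A (Suc k + m). g (take (Suc k) es) * h (drop (Suc k) es))
     = (\<Sum>e\<in>A. \<Sum>es\<in>tuples A (k + m). g (e # take k es) * h (drop k es))"
    using assms by (simp add: sum_tuples_Suc)
  also have "\<dots> = (\<Sum>e\<in>A. (\<Sum>es\<in>tuples A k. g (e # es)) * (\<Sum>es\<in>tuples A m. h es))"
    using Suc[of "\<lambda>es. g (_ # es)"] by simp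
  also have "\<dots> = (\<Sum>es\<in>tuples A (Suc k). g es) * (\<Sum>es\<in>tuples A m. h es)"
    using assms by (simp add: sum_tuples_Suc sum_distrib_right)
  finally show ?case .
qed

lemma sum_tuples_permute:
  assumes "\<pi> permutes {..<n}"
  shows "(\<Sum>es\<in>tuples A n. g (permute_list \<pi> es)) = (\<Sum>es\<in>tuples A n. g es)"
proof (rule sum.reindex_bij_witness[where j = "permute_list \<pi>" and i = "permute_list (inv \<pi>)"])
  fix es assume es: "es \<in> tuples A n"
  then have l: "length es = n" by (rule length_tuples)
  have pi: "inv \<pi> permutes {..<n}" by (rule permutes_inv[OF assms])
  show "permute_list \<pi> es \<in> tuples A n" "permute_list (inv \<pi>) es \<in> tuples A n"
    using es assms pi by (auto simp: tuples_def)
  show "permute_list (inv \<pi>) (permute_list \<pi> es) = es"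
    using permute_list_compose[of "inv \<pi>" es \<pi>] pi l permutes_inv_o[OF assms] by simp
  show "permute_list \<pi> (permute_list (inv \<pi>) es) = es"
    using permute_list_compose[of \<pi> es "inv \<pi>"] assms l permutes_inv_o[OF assms] by simp
qed simp

section \<open>Multilinear forms\<close>

lemma cscale_of_real: "cscale (of_real r) z = r *\<^sub>R z"
  by (simp add: cscale_def prod_eq_iff)

lemma cscale_1 [simp]: "cscale 1 z = z"
  by (simp add: cscale_def)

lemma cscale_0_left [simp]: "cscale 0 z = 0"
  by (simp add: cscale_def zero_prod_def)

lemma cscale_0_right [simp]: "cscale c 0 = 0"
  by (simp add: cscale_def zero_prod_def)

lemma multilinear_form_length:
  "multilinear_form n \<Phi> \<Longrightarrow> length es \<noteq> n \<Longrightarrow> \<Phi> es = 0"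
  by (simp add: multilinear_form_def)

lemma multilinear_form_update:
  "multilinear_form n \<Phi> \<Longrightarrow> length es = n \<Longrightarrow> i < n \<Longrightarrow>
    \<Phi> (es[i := cscale c \<xi> + \<zeta>]) = c * \<Phi> (es[i := \<xi>]) + \<Phi> (es[i := \<zeta>])"
  unfolding multilinear_form_def by blast

lemma multilinear_form_Cons:
  assumes "multilinear_form (Suc n) \<Phi>"
  shows "multilinear_form n (\<lambda>es. \<Phi> (z # es))"
  unfolding multilinear_form_def
proof (intro conjI allI impI)
  fix es :: "'a cx list" assume "length es \<noteq> n"
  then show "\<Phi> (z # es) = 0" using assms by (simp add: multilinear_form_length)
next
  fix es :: "'a cx list" and i c \<xi> \<zeta> assume "length es = n \<and> i < n"
  then show "\<Phi> (z # es[i := cscale c \<xi> + \<zeta>]) = c * \<Phi> (z # es[i := \<xi>]) + \<Phi> (z # es[i := \<zeta>])"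
    using multilinear_form_update[OF assms, of "z # es" "Suc i" c \<xi> \<zeta>] by simp
qed

lemma multilinear_form_head:
  assumes "multilinear_form (Suc n) \<Phi>" "length es = n"
  shows "\<Phi> ((cscale c \<xi> + \<zeta>) # es) = c * \<Phi> (\<xi> # es) + \<Phi> (\<zeta> # es)"
  using multilinear_form_update[OF assms(1), of "\<zeta> # es" 0 c \<xi> \<zeta>] assms(2) by simp

text \<open>Forms are treated by induction on the degree with the head argument split off; this rule
  assembles a form from its slices.\<close>

lemma multilinear_form_SucI:
  assumes "\<Phi> [] = 0" "\<And>z. multilinear_form n (\<lambda>es. \<Phi> (z # es))"
    "\<And>es c \<xi> \<zeta>. length es = n \<Longrightarrow> \<Phi> ((cscale c \<xi> + \<zeta>) # es) = c * \<Phi> (\<xi> # es) + \<Phi> (\<zeta> # es)"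
  shows "multilinear_form (Suc n) \<Phi>"
  unfolding multilinear_form_def
proof (intro conjI allI impI)
  fix es :: "'a cx list" assume "length es \<noteq> Suc n"
  then show "\<Phi> es = 0"
    using assms(1) multilinear_form_length[OF assms(2)] by (cases es) auto
next
  fix es :: "'a cx list" and i c \<xi> \<zeta> assume *: "length es = Suc n \<and> i < Suc n"
  then obtain z zs where es: "es = z # zs" "length zs = n" by (cases es) auto
  show "\<Phi> (es[i := cscale c \<xi> + \<zeta>]) = c * \<Phi> (es[i := \<xi>]) + \<Phi> (es[i := \<zeta>])"
  proof (cases i)
    case 0
    then show ?thesis using es assms(3) by simp
  next
    case (Suc j)
    then show ?thesis using es * multilinear_form_update[OF assms(2), of zs j] by simp
  qed
qed

lemma multilinear_form_0: "multilinear_form 0 \<Phi> \<longleftrightarrow> (\<forall>es. es \<noteq> [] \<longrightarrow> \<Phi> es = 0)"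
  by (simp add: multilinear_form_def)

lemma multilinear_form_head_zero:
  assumes "multilinear_form (Suc n) \<Phi>"
  shows "\<Phi> (0 # es) = 0"
proof (cases "length es = n")
  case True
  \<comment> \<open>With \<open>c = -1\<close> and both vectors zero the head argument is again 0,
    and the right-hand side cancels.\<close>
  then show ?thesis using multilinear_form_head[OF assms True, of "-1" 0 0] by simp
next
  case False
  then show ?thesis using assms by (simp add: multilinear_form_length)
qed

lemma multilinear_form_zero_arg:
  assumes "multilinear_form n \<Phi>" "0 \<in> set es"
  shows "\<Phi> es = 0"
  using assms
proof (induction es arbitrary: n \<Phi>)
  case (Cons z es)
  show ?case
  proof (cases n)
    case 0
    then show ?thesis using Cons.prems by (simp add: multilinear_form_0)
  next
    case (Suc m)
    show ?thesis
    proof (cases "z = 0")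
      case True
      then show ?thesis using Cons.prems(1) unfolding Suc by (simp add: multilinear_form_head_zero)
    next
      case False
      then show ?thesis
        using Cons.IH[OF multilinear_form_Cons[OF Cons.prems(1)[unfolded Suc], of z]] Cons.prems(2)
        by auto
    qed
  qed
qed simp

lemma multilinear_form_head_sum:
  assumes "multilinear_form (Suc n) \<Phi>" "length es = n"
  shows "\<Phi> ((\<Sum>c\<in>C. cscale (u c) (v c)) # es) = (\<Sum>c\<in>C. u c * \<Phi> (v c # es))"
proof (induction C rule: infinite_finite_induct)
  case (insert x F)
  then show ?case using multilinear_form_head[OF assms] by simp
qed (simp_all add: multilinear_form_head_zero[OF assms(1)])

lemma multilinear_form_comb:
  assumes "multilinear_form n \<Phi>" "multilinear_form n \<Psi>"
  shows "multilinear_form n (\<lambda>es. c * \<Phi> es + \<Psi> es)"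
  using assms unfolding multilinear_form_def by (auto simp: algebra_simps)

lemma multilinear_form_zero: "multilinear_form n (\<lambda>es. 0)"
  by (simp add: multilinear_form_def)

lemma multilinear_form_linear_head:
  assumes "multilinear_form (Suc n) \<Phi>"
  shows "linear (\<lambda>e. \<Phi> ((e, 0) # es))"
proof (cases "length es = n")
  case True
  have 1: "\<Phi> ((x + y, 0) # es) = \<Phi> ((x, 0) # es) + \<Phi> ((y, 0) # es)" for x y
    using multilinear_form_head[OF assms True, of 1 "(x, 0)" "(y, 0)"] by simp
  have 2: "\<Phi> ((r *\<^sub>R x, 0) # es) = r *\<^sub>R \<Phi> ((x, 0) # es)" for x r
    using multilinear_form_head[OF assms True, of "of_real r" "(x, 0)" 0]
    by (simp add: cscale_of_real multilinear_form_head_zero[OF assms] scaleR_conv_of_real)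
  show ?thesis by (rule linearI) (simp_all add: 1 2)
next
  case False
  then have "(\<lambda>e. \<Phi> ((e, 0) # es)) = (\<lambda>e. 0)"
    using assms by (auto simp: multilinear_form_length)
  then show ?thesis by (auto simp: linear_iff)
qed

section \<open>Elementary tensors, tensor products and permutations of forms\<close>

fun elem_form :: "('n cx \<Rightarrow> complex) list \<Rightarrow> 'n form" where
  "elem_form [] zs = (if zs = [] then 1 else 0)"
| "elem_form (x # xs) [] = 0"
| "elem_form (x # xs) (z # zs) = x z * elem_form xs zs"

definition clinear_form :: "('n::real_vector cx \<Rightarrow> complex) \<Rightarrow> bool" where
  "clinear_form x \<longleftrightarrow> (\<forall>c \<xi> \<zeta>. x (cscale c \<xi> + \<zeta>) = c * x \<xi> + x \<zeta>)"

lemma clinear_form_zero: "clinear_form x \<Longrightarrow> x 0 = 0"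
  unfolding clinear_form_def by (metis add_cancel_left_left add.right_neutral cscale_1 mult_1)

lemma elem_form_length: "length zs \<noteq> length xs \<Longrightarrow> elem_form xs zs = 0"
  by (induction xs zs rule: elem_form.induct) auto

lemma form_power_eq: "form_power n x = elem_form (replicate n x)"
proof
  show "form_power n x es = elem_form (replicate n x) es" for es
  proof (induction n arbitrary: es)
    case 0 then show ?case by (auto simp: form_power_def)
  next
    case (Suc n)
    then show ?case by (cases es) (auto simp: form_power_def Suc[symmetric])
  qed
qed

lemma multilinear_elem_form:
  assumes "\<forall>x\<in>set xs. clinear_form x"
  shows "multilinear_form (length xs) (elem_form xs)"
  using assms
proof (induction xs)
  case Nil
  then show ?case by (simp add: multilinear_form_0)
next
  case (Cons x xs)
  have IH: "multilinear_form (length xs) (elem_form xs)" using Cons by simp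
  show ?case
    unfolding length_Cons
  proof (rule multilinear_form_SucI)
    show "multilinear_form (length xs) (\<lambda>es. elem_form (x # xs) (z # es))" for z
      using multilinear_form_comb[OF IH multilinear_form_zero, of "x z"] by simp
  qed (use Cons.prems in \<open>simp_all add: clinear_form_def algebra_simps del: split_paired_All\<close>)
qed

lemma clinear_cext: "linear x \<Longrightarrow> clinear_form (cext x)"
  unfolding clinear_form_def cext_def cscale_def
  by (simp add: linear_add linear_diff linear_scale complex_eq_iff)

text \<open>A form is a bare function on lists, so the degree \<open>k\<close> of the first factor
  has to be given. The product is not symmetrized; it is only paired with symmetric functionals, or
  symmetrized afterwards.\<close>

definition tprod :: "nat \<Rightarrow> 'n form \<Rightarrow> 'n form \<Rightarrow> 'n form" where
  "tprod k \<Phi> \<Psi> = (\<lambda>es. \<Phi> (take k es) * \<Psi> (drop k es))"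

lemma multilinear_tprod:
  assumes "multilinear_form k \<Phi>" "multilinear_form m \<Psi>"
  shows "multilinear_form (k + m) (tprod k \<Phi> \<Psi>)"
  unfolding multilinear_form_def tprod_def
proof (intro conjI allI impI)
  fix es :: "'a cx list" assume "length es \<noteq> k + m"
  then have "length (take k es) \<noteq> k \<or> length (drop k es) \<noteq> m" by auto
  then show "\<Phi> (take k es) * \<Psi> (drop k es) = 0" using assms by (auto simp: multilinear_form_length)
next
  fix es :: "'a cx list" and i c \<xi> \<zeta> assume *: "length es = k + m \<and> i < k + m"
  show "\<Phi> (take k (es[i := cscale c \<xi> + \<zeta>])) * \<Psi> (drop k (es[i := cscale c \<xi> + \<zeta>])) =
       c * (\<Phi> (take k (es[i := \<xi>])) * \<Psi> (drop k (es[i := \<xi>]))) +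
       \<Phi> (take k (es[i := \<zeta>])) * \<Psi> (drop k (es[i := \<zeta>]))"
  proof (cases "i < k")
    case True
    then show ?thesis
      using * multilinear_form_update[OF assms(1), of "take k es" i]
      by (simp add: take_update_swap algebra_simps)
  next
    case False
    then have "i - k < m" using * by linarith
    then show ?thesis
      using False * multilinear_form_update[OF assms(2), of "drop k es" "i - k"]
      by (simp add: drop_update_swap algebra_simps)
  qed
qed

lemma tprod_assoc: "tprod (k + m) (tprod k \<Phi> \<Psi>) \<Theta> = tprod k \<Phi> (tprod m \<Psi> \<Theta>)"
  by (rule ext) (simp add: tprod_def take_drop min_def add.commute mult.assoc)

lemma multilinear_permute_form:
  assumes "multilinear_form n \<Phi>" "\<pi> permutes {..<n}"
  shows "multilinear_form n (permute_form n \<pi> \<Phi>)"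
  unfolding multilinear_form_def
proof (intro conjI allI impI)
  fix es :: "'a cx list" and i c \<xi> \<zeta> assume *: "length es = n \<and> i < n"
  have p: "permute_list \<pi> (es[i := v]) = (permute_list \<pi> es)[inv \<pi> i := v]" for v
  proof (rule nth_equalityI)
    fix j assume "j < length (permute_list \<pi> (es[i := v]))"
    then have j: "j < n" using * by simp
    have "\<pi> j < n" using permutes_in_image[OF assms(2), of j] j by simp
    moreover have "\<pi> j = i \<longleftrightarrow> j = inv \<pi> i"
      using permutes_inv_eq[OF assms(2)] by metis
    ultimately show "permute_list \<pi> (es[i := v]) ! j = (permute_list \<pi> es)[inv \<pi> i := v] ! j"
      using * assms(2) j by (auto simp: permute_list_nth nth_list_update)
  qed simp
  have "inv \<pi> i < n" using permutes_in_image[OF permutes_inv[OF assms(2)], of i] * by simp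
  then show "permute_form n \<pi> \<Phi> (es[i := cscale c \<xi> + \<zeta>])
      = c * permute_form n \<pi> \<Phi> (es[i := \<xi>]) + permute_form n \<pi> \<Phi> (es[i := \<zeta>])"
    using * multilinear_form_update[OF assms(1), of "permute_list \<pi> es" "inv \<pi> i"]
    by (simp add: permute_form_def p)
qed (simp add: permute_form_def)

section \<open>Polarization\<close>

text \<open>The binomial theorem for a symmetric form. The prefix \<open>ys\<close> is there for the
  induction: one copy of \<open>x + t y\<close> is split off and the resulting \<open>x\<close> or
  \<open>y\<close> joins the prefix.\<close>

lemma additive_power_expand:
  fixes F :: "'v::real_vector list \<Rightarrow> complex"
  assumes add: "\<And>zs x y. length zs = n \<Longrightarrow> F ((x + y) # zs) = F (x # zs) + F (y # zs)"
    and scale: "\<And>zs c x. length zs = n \<Longrightarrow> F ((c *\<^sub>R x) # zs) = of_real c * F (x # zs)"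
    and perm: "\<And>xs ys. mset xs = mset ys \<Longrightarrow> F xs = F ys"
    and len: "length ys + m = Suc n"
  shows "F (ys @ replicate m (x + t *\<^sub>R y)) =
    (\<Sum>j\<le>m. of_nat (m choose j) * of_real t ^ j * F (ys @ replicate j y @ replicate (m - j) x))"
  using len
proof (induction m arbitrary: ys)
  case 0
  then show ?case by simp
next
  case (Suc m)
  let ?r = "replicate m (x + t *\<^sub>R y)"
  let ?G = "\<lambda>j. F (ys @ replicate j y @ replicate (Suc m - j) x)"
  have l: "length (ys @ ?r) = n" using Suc.prems by simp
  have "F (ys @ replicate (Suc m) (x + t *\<^sub>R y)) = F ((x + t *\<^sub>R y) # ys @ ?r)"
    by (rule perm) simp
  also have "\<dots> = F (x # ys @ ?r) + of_real t * F (y # ys @ ?r)"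
    using add[OF l] scale[OF l] by simp
  also have "F (x # ys @ ?r) = F ((ys @ [x]) @ ?r)" by (rule perm) simp
  also have "\<dots> = (\<Sum>j\<le>m. of_nat (m choose j) * of_real t ^ j * F ((ys @ [x]) @ replicate j y @ replicate (m - j) x))"
    by (rule Suc.IH) (use Suc.prems in simp)
  also have "\<dots> = (\<Sum>j\<le>m. of_nat (m choose j) * of_real t ^ j * ?G j)"
    by (intro sum.cong refl arg_cong2[where f="(*)"] perm) (simp add: Suc_diff_le)
  also have "F (y # ys @ ?r) = F ((ys @ [y]) @ ?r)" by (rule perm) simp
  also have "\<dots> = (\<Sum>j\<le>m. of_nat (m choose j) * of_real t ^ j * F ((ys @ [y]) @ replicate j y @ replicate (m - j) x))"
    by (rule Suc.IH) (use Suc.prems in simp)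
  also have "\<dots> = (\<Sum>j\<le>m. of_nat (m choose j) * of_real t ^ j * ?G (Suc j))"
    by (intro sum.cong refl arg_cong2[where f="(*)"] perm) simp
  \<comment> \<open>Pascal's rule: the second sum, shifted by one index, is added to the
    first.\<close>
  also have "(\<Sum>j\<le>m. of_nat (m choose j) * of_real t ^ j * ?G j) +
      of_real t * (\<Sum>j\<le>m. of_nat (m choose j) * of_real t ^ j * ?G (Suc j))
    = (\<Sum>j\<le>Suc m. of_nat (Suc m choose j) * of_real t ^ j * ?G j)"
  proof -
    have "(\<Sum>j\<le>m. of_nat (m choose j) * of_real t ^ j * ?G j)
       = (\<Sum>j\<le>Suc m. of_nat (m choose j) * of_real t ^ j * ?G j)" by simp
    also have "\<dots> = ?G 0 + (\<Sum>j\<le>m. of_nat (m choose Suc j) * of_real t ^ Suc j * ?G (Suc j))"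
      by (subst sum.atMost_Suc_shift) simp
    finally show ?thesis
      by (subst sum.atMost_Suc_shift)
        (simp add: sum_distrib_left sum.distrib[symmetric] algebra_simps)
  qed
  finally show ?case .
qed

text \<open>The natural numbers are infinitely many roots of this polynomial.\<close>

lemma sum_powers_zero_imp:
  fixes c :: "nat \<Rightarrow> complex"
  assumes "\<And>t::nat. (\<Sum>j\<le>m. c j * of_nat t ^ j) = 0" "j \<le> m"
  shows "c j = 0"
proof -
  have "infinite {z. (\<Sum>i\<le>m. c i * z ^ i) = 0}"
  proof (rule infinite_super)
    show "range (of_nat :: nat \<Rightarrow> complex) \<subseteq> {z. (\<Sum>i\<le>m. c i * z ^ i) = 0}" using assms(1) by auto
    show "infinite (range (of_nat :: nat \<Rightarrow> complex))"
      by (simp add: finite_image_iff inj_of_nat)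
  qed
  then show ?thesis using polyfun_roots_finite[of c j m] assms(2) by blast
qed

text \<open>In place of the polarization formula, vectors are freed from the diagonal one at a time:
  each new one is read off as a coefficient of \<open>t\<close>. Only a real vector space is
  assumed, so that the lemma applies to N and to its complexification.\<close>

lemma polarization_zero:
  fixes F :: "'v::real_vector list \<Rightarrow> complex"
  assumes add: "\<And>zs x y. length zs = n \<Longrightarrow> F ((x + y) # zs) = F (x # zs) + F (y # zs)"
    and scale: "\<And>zs c x. length zs = n \<Longrightarrow> F ((c *\<^sub>R x) # zs) = of_real c * F (x # zs)"
    and perm: "\<And>xs ys. mset xs = mset ys \<Longrightarrow> F xs = F ys"
    and diag: "\<And>x. F (replicate (Suc n) x) = 0"
    and len: "length xs = Suc n"
  shows "F xs = 0"
proof -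
  \<comment> \<open>Interpolates between the hypothesis on the diagonal (\<open>ys\<close> empty)
    and the goal (\<open>m = 0\<close>).\<close>
  have "F (ys @ replicate m x) = 0" if "length ys + m = Suc n" for ys m x
    using that
  proof (induction ys arbitrary: m x rule: rev_induct)
    case Nil
    then show ?case using diag by simp
  next
    case (snoc y ys)
    have l: "length ys + Suc m = Suc n" using snoc.prems by simp
    let ?c = "\<lambda>j. of_nat (Suc m choose j) * F (ys @ replicate j y @ replicate (Suc m - j) x)"
    have "(\<Sum>j\<le>Suc m. ?c j * of_nat t ^ j) = 0" for t :: nat
    proof -
      have "(\<Sum>j\<le>Suc m. ?c j * of_nat t ^ j) = F (ys @ replicate (Suc m) (x + real t *\<^sub>R y))"
        by (subst additive_power_expand[OF add scale perm l]) (auto simp: algebra_simps intro!: sum.cong)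
      also have "\<dots> = 0" by (rule snoc.IH[OF l])
      finally show ?thesis .
    qed
    \<comment> \<open>The coefficient of \<open>t\<close> itself contains a single \<open>y\<close>,
      chosen from \<open>Suc m\<close> places.\<close>
    from sum_powers_zero_imp[OF this, of 1]
    have "of_nat (Suc m) * F (ys @ [y] @ replicate m x) = 0" by simp
    then show ?case by (simp del: of_nat_Suc)
  qed
  from this[of xs 0] len show ?thesis by simp
qed

section \<open>The norms of a nuclear triple\<close>

context nuclear_triple
begin

lemma ip_add_right: "ip p x (y + z) = ip p x y + ip p x z"
  using ip_add[of p y z x] by (simp add: ip_commute[of p x])

lemma ip_scaleR_right: "ip p x (r *\<^sub>R y) = r * ip p x y"
  using ip_scaleR[of p r y x] by (simp add: ip_commute[of p x])

lemma linear_ip: "linear (ip p x)"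
  by (rule linearI) (simp_all add: ip_add_right ip_scaleR_right)

lemma linear_ip_left: "linear (\<lambda>x. ip p x y)"
  by (rule linearI) (simp_all add: ip_add ip_scaleR)

lemma ip_zero [simp]: "ip p 0 y = 0" "ip p y 0 = 0"
  using linear_0[OF linear_ip_left, of p y] linear_0[OF linear_ip, of p y] by auto

lemma ip_nonneg: "ip p x x \<ge> 0"
  using ip_pos[of x p] by (cases "x = 0") auto

lemma ip_diff: "ip p (x - y) z = ip p x z - ip p y z" "ip p z (x - y) = ip p z x - ip p z y"
  using linear_diff[OF linear_ip_left] linear_diff[OF linear_ip] by auto

lemma ip_sum_left: "ip p (\<Sum>i\<in>A. f i) z = (\<Sum>i\<in>A. ip p (f i) z)"
  using linear_sum[OF linear_ip_left] by auto

lemma ip_sum_right: "ip p z (\<Sum>i\<in>A. f i) = (\<Sum>i\<in>A. ip p z (f i))"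
  using linear_sum[OF linear_ip] by auto

lemma ip_Cauchy_Schwarz: "(ip p x y)\<^sup>2 \<le> ip p x x * ip p y y"
proof (cases "y = 0")
  case False
  \<comment> \<open>The minimizer of the norm of \<open>x - t y\<close>.\<close>
  define t where "t = ip p x y / ip p y y"
  have y: "ip p y y > 0" using ip_pos False by auto
  have "0 \<le> ip p (x - t *\<^sub>R y) (x - t *\<^sub>R y)" by (rule ip_nonneg)
  also have "\<dots> = ip p x x - 2 * t * ip p x y + t\<^sup>2 * ip p y y"
    by (simp add: ip_diff ip_scaleR ip_scaleR_right ip_commute[of p y x] power2_eq_square algebra_simps)
  also have "\<dots> = ip p x x - (ip p x y)\<^sup>2 / ip p y y"
    using y by (simp add: t_def power2_eq_square field_simps)
  finally show ?thesis using y by (simp add: field_simps)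
qed simp

lemma hnorm_nonneg [simp]: "hnorm ip p x \<ge> 0"
  by (simp add: hnorm_def ip_nonneg)

lemma hnorm_power2: "(hnorm ip p x)\<^sup>2 = ip p x x"
  by (simp add: hnorm_def ip_nonneg)

lemma hnorm_zero [simp]: "hnorm ip p 0 = 0"
  by (simp add: hnorm_def)

lemma hnorm_eq_0: "hnorm ip p x = 0 \<longleftrightarrow> x = 0"
  using ip_pos[of x p] by (cases "x = 0") (auto simp: hnorm_def)

lemma abs_ip_le: "\<bar>ip p x y\<bar> \<le> hnorm ip p x * hnorm ip p y"
proof (rule abs_le_square_iff[THEN iffD2, THEN order_trans])
  show "(ip p x y)\<^sup>2 \<le> (hnorm ip p x * hnorm ip p y)\<^sup>2"
    by (simp add: power_mult_distrib hnorm_power2 ip_Cauchy_Schwarz)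
qed simp

lemma hnorm_scaleR: "hnorm ip p (r *\<^sub>R x) = \<bar>r\<bar> * hnorm ip p x"
  by (simp add: hnorm_def ip_scaleR ip_scaleR_right real_sqrt_mult mult.assoc[symmetric])

lemma hnorm_triangle: "hnorm ip p (x + y) \<le> hnorm ip p x + hnorm ip p y"
proof (rule power2_le_imp_le)
  have "(hnorm ip p (x + y))\<^sup>2 = ip p x x + 2 * ip p x y + ip p y y"
    by (simp add: hnorm_power2 ip_add ip_add_right ip_commute[of p y x])
  also have "\<dots> \<le> ip p x x + 2 * (hnorm ip p x * hnorm ip p y) + ip p y y"
    using abs_ip_le[of p x y] by simp
  also have "\<dots> = (hnorm ip p x + hnorm ip p y)\<^sup>2"
    by (simp add: power2_sum hnorm_power2)
  finally show "(hnorm ip p (x + y))\<^sup>2 \<le> (hnorm ip p x + hnorm ip p y)\<^sup>2" .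
qed simp

lemma hnorm_le: "p \<le> p' \<Longrightarrow> hnorm ip p x \<le> hnorm ip p' x"
  by (rule lift_Suc_mono_le[of "\<lambda>p. hnorm ip p x"]) (rule hnorm_mono)

lemma cnorm_nonneg [simp]: "cnorm ip p z \<ge> 0"
  by (simp add: cnorm_def)

lemma cnorm_power2: "(cnorm ip p z)\<^sup>2 = ip p (fst z) (fst z) + ip p (snd z) (snd z)"
  by (simp add: cnorm_def hnorm_power2 ip_nonneg)

lemma cnorm_zero [simp]: "cnorm ip p 0 = 0"
  by (simp add: cnorm_def)

lemma cnorm_eq_0: "cnorm ip p z = 0 \<longleftrightarrow> z = 0"
  by (simp add: cnorm_def sum_power2_eq_zero_iff hnorm_eq_0 prod_eq_iff)

lemma cnorm_le: "p \<le> p' \<Longrightarrow> cnorm ip p z \<le> cnorm ip p' z"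
  unfolding cnorm_def by (intro real_sqrt_le_mono add_mono power_mono hnorm_le) auto

lemma cnorm_real [simp]: "cnorm ip p (a, 0) = hnorm ip p a"
  by (simp add: cnorm_def)

lemma hnorm_fst_le: "hnorm ip p (fst z) \<le> cnorm ip p z"
  unfolding cnorm_def by (rule real_le_rsqrt) simp

lemma hnorm_snd_le: "hnorm ip p (snd z) \<le> cnorm ip p z"
  unfolding cnorm_def by (rule real_le_rsqrt) simp

lemma cnorm_triangle: "cnorm ip p (x + y) \<le> cnorm ip p x + cnorm ip p y"
proof -
  have "cnorm ip p (x + y) \<le> sqrt ((hnorm ip p (fst x) + hnorm ip p (fst y))\<^sup>2
      + (hnorm ip p (snd x) + hnorm ip p (snd y))\<^sup>2)"
    unfolding cnorm_def by (intro real_sqrt_le_mono add_mono power_mono) (auto simp: hnorm_triangle)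
  also have "\<dots> \<le> cnorm ip p x + cnorm ip p y"
    unfolding cnorm_def by (rule real_sqrt_sum_squares_triangle_ineq)
  finally show ?thesis .
qed

lemma cnorm_cscale: "cnorm ip p (cscale c z) = cmod c * cnorm ip p z"
proof (rule power2_eq_imp_eq)
  show "(cnorm ip p (cscale c z))\<^sup>2 = (cmod c * cnorm ip p z)\<^sup>2"
    unfolding power_mult_distrib cnorm_power2 cmod_power2
    by (simp add: cscale_def ip_diff ip_add ip_add_right
        ip_scaleR ip_scaleR_right ip_commute[of p "snd z" "fst z"] power2_eq_square algebra_simps)
qed auto

lemma cnorm_diff_le: "cnorm ip p x \<le> cnorm ip p y + cnorm ip p (x - y)"
  using cnorm_triangle[of p y "x - y"] by simp

subsection \<open>Orthonormal systems\<close>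

lemma orthonormal_ip_sum:
  assumes "finite A" "orthonormal ip p A" "e \<in> A"
  shows "ip p (\<Sum>a\<in>A. u a *\<^sub>R a) e = u e"
proof -
  have "ip p (\<Sum>a\<in>A. u a *\<^sub>R a) e = (\<Sum>a\<in>A. if a = e then u a else 0)"
    unfolding ip_sum_left ip_scaleR
    by (rule sum.cong) (use assms in \<open>auto simp: orthonormal_def\<close>)
  then show ?thesis using assms by simp
qed

lemma orthonormal_expand:
  assumes "finite C" "orthonormal ip p C" "x \<in> span C"
  shows "x = (\<Sum>c\<in>C. ip p x c *\<^sub>R c)"
proof -
  obtain u where u: "x = (\<Sum>c\<in>C. u c *\<^sub>R c)"
    using assms(1,3) by (auto simp: span_finite)
  have "ip p x c = u c" if "c \<in> C" for c
    unfolding u by (rule orthonormal_ip_sum[OF assms(1,2) that])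
  then show ?thesis using u by simp
qed

lemma orthonormal_parseval:
  assumes "finite C" "orthonormal ip p C" "x \<in> span C"
  shows "ip p x y = (\<Sum>c\<in>C. ip p x c * ip p y c)"
proof -
  have "ip p x y = ip p (\<Sum>c\<in>C. ip p x c *\<^sub>R c) y" using orthonormal_expand[OF assms] by simp
  also have "\<dots> = (\<Sum>c\<in>C. ip p x c * ip p y c)"
    by (simp add: ip_sum_left ip_scaleR ip_commute[of p y])
  finally show ?thesis .
qed

text \<open>Gram-Schmidt inside N. It substitutes for an orthonormal basis of H_p: every computation
  picks a finite system whose span contains the vectors at hand.\<close>

lemma orthonormal_extend:
  assumes "finite B" "finite A" "orthonormal ip p A"
  shows "\<exists>C. finite C \<and> orthonormal ip p C \<and> A \<subseteq> C \<and> B \<subseteq> span C"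
  using assms(1)
proof (induction B rule: finite_induct)
  case empty
  then show ?case using assms by auto
next
  case (insert b B)
  then obtain C where C: "finite C" "orthonormal ip p C" "A \<subseteq> C" "B \<subseteq> span C" by auto
  define r where "r = b - (\<Sum>c\<in>C. ip p b c *\<^sub>R c)"
  have s: "(\<Sum>c\<in>C. ip p b c *\<^sub>R c) \<in> span C" by (intro span_sum span_scale span_base)
  show ?case
  proof (cases "r = 0")
    case True
    then have "b \<in> span C" using s by (simp add: r_def)
    then show ?thesis using C by auto
  next
    case False
    then have h: "hnorm ip p r > 0" using hnorm_eq_0[of p r] hnorm_nonneg[of p r] by linarith
    define e where "e = (1 / hnorm ip p r) *\<^sub>R r"
    have rc: "ip p r c = 0" if "c \<in> C" for c
      unfolding r_def ip_diff using orthonormal_ip_sum[OF C(1,2) that] by simp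
    have ec: "ip p e c = 0" "ip p c e = 0" if "c \<in> C" for c
      using rc[OF that] by (auto simp: e_def ip_scaleR ip_commute[of p c])
    have ee: "ip p e e = 1"
      using h unfolding e_def ip_scaleR ip_scaleR_right hnorm_power2[symmetric, of p r]
      by (simp add: power2_eq_square)
    have on: "orthonormal ip p (insert e C)"
      using C(2) ec ee unfolding orthonormal_def by force
    have "hnorm ip p r *\<^sub>R e \<in> span (insert e C)" by (intro span_scale span_base) auto
    then have "r \<in> span (insert e C)" using h by (simp add: e_def)
    moreover have sub: "span C \<subseteq> span (insert e C)" by (rule span_mono) auto
    ultimately have "r + (\<Sum>c\<in>C. ip p b c *\<^sub>R c) \<in> span (insert e C)"
      using s by (intro span_add) auto
    then have "b \<in> span (insert e C)" by (simp add: r_def)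
    then show ?thesis using C on sub by (intro exI[of _ "insert e C"]) auto
  qed
qed

lemma orthonormal_empty: "orthonormal ip p {}"
  by (simp add: orthonormal_def)

text \<open>The left-hand side \<open>S\<close> is attained on the vector \<open>u\<close> that
  represents \<open>f\<close> on the span of \<open>A\<close>: both \<open>f u\<close> and the
  squared norm of \<open>u\<close> at level \<open>p'\<close> are \<open>S\<close>. Expanding
  \<open>u\<close> in \<open>C\<close>, Cauchy-Schwarz bounds \<open>S\<^sup>2\<close> by the
  squared norm of \<open>u\<close> at level \<open>p\<close>, which is at most \<open>S\<close>,
  times the right-hand side.\<close>

lemma functional_sum_le_real:
  assumes "linear f" "finite C" "orthonormal ip p C" "finite A" "orthonormal ip p' A"
    "p \<le> p'" "A \<subseteq> span C"
  shows "(\<Sum>e\<in>A. (f e)\<^sup>2) \<le> (\<Sum>c\<in>C. (f c)\<^sup>2 :: real)"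
proof -
  define S where "S = (\<Sum>e\<in>A. (f e)\<^sup>2)"
  define u where "u = (\<Sum>e\<in>A. f e *\<^sub>R e)"
  have u: "u \<in> span C" unfolding u_def using assms(7) by (intro span_sum span_scale) auto
  have "f u = S"
    unfolding u_def S_def using assms(1) by (simp add: linear_sum linear_scale power2_eq_square)
  have "ip p' u u = S"
  proof -
    have "ip p' u u = (\<Sum>e\<in>A. f e * ip p' u e)"
      unfolding u_def[of] by (subst ip_sum_right) (simp add: ip_scaleR_right)
    also have "\<dots> = S"
      unfolding S_def u_def using orthonormal_ip_sum[OF assms(4,5)] by (simp add: power2_eq_square)
    finally show ?thesis .
  qed
  have "f u = (\<Sum>c\<in>C. ip p u c * f c)"
  proof -
    have "f u = f (\<Sum>c\<in>C. ip p u c *\<^sub>R c)" using orthonormal_expand[OF assms(2,3) u] by simp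
    also have "\<dots> = (\<Sum>c\<in>C. ip p u c * f c)" using assms(1) by (simp add: linear_sum linear_scale)
    finally show ?thesis .
  qed
  then have "S\<^sup>2 \<le> (\<Sum>c\<in>C. (ip p u c)\<^sup>2) * (\<Sum>c\<in>C. (f c)\<^sup>2)"
    using Cauchy_Schwarz_ineq_sum[of "\<lambda>c. ip p u c" f C] \<open>f u = S\<close> by simp
  also have "(\<Sum>c\<in>C. (ip p u c)\<^sup>2) = ip p u u"
    using orthonormal_parseval[OF assms(2,3) u, of u] by (simp add: power2_eq_square)
  also have "ip p u u * (\<Sum>c\<in>C. (f c)\<^sup>2) \<le> ip p' u u * (\<Sum>c\<in>C. (f c)\<^sup>2)"
    using power_mono[OF hnorm_le[OF assms(6), of u] hnorm_nonneg, of 2]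
    by (intro mult_right_mono) (auto simp: hnorm_power2 sum_nonneg)
  finally have "S * S \<le> S * (\<Sum>c\<in>C. (f c)\<^sup>2)" using \<open>ip p' u u = S\<close> by (simp add: power2_eq_square)
  moreover have "S \<ge> 0" "(\<Sum>c\<in>C. (f c)\<^sup>2) \<ge> 0" unfolding S_def by (auto intro: sum_nonneg)
  ultimately have "S \<le> (\<Sum>c\<in>C. (f c)\<^sup>2)"
    by (cases "S = 0") (auto simp: mult_le_cancel_left)
  then show ?thesis by (simp add: S_def)
qed

lemma functional_sum_le:
  fixes f :: "'n \<Rightarrow> complex"
  assumes "linear f" "finite C" "orthonormal ip p C" "finite A" "orthonormal ip p' A"
    "p \<le> p'" "A \<subseteq> span C"
  shows "(\<Sum>e\<in>A. (cmod (f e))\<^sup>2) \<le> (\<Sum>c\<in>C. (cmod (f c))\<^sup>2)"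
proof -
  have "linear (\<lambda>e. Re (f e))" "linear (\<lambda>e. Im (f e))"
    using assms(1) by (auto simp: linear_iff)
  then have "(\<Sum>e\<in>A. (Re (f e))\<^sup>2) \<le> (\<Sum>c\<in>C. (Re (f c))\<^sup>2)" "(\<Sum>e\<in>A. (Im (f e))\<^sup>2) \<le> (\<Sum>c\<in>C. (Im (f c))\<^sup>2)"
    using functional_sum_le_real assms(2-7) by blast+
  then show ?thesis by (simp add: cmod_power2 sum.distrib)
qed

end

section \<open>Tensor powers of the dual\<close>

abbreviation embed :: "'n::real_vector list \<Rightarrow> 'n cx list" where
  "embed es \<equiv> map (\<lambda>e. (e, 0)) es"

abbreviation tsum :: "'n::real_vector set \<Rightarrow> nat \<Rightarrow> 'n form \<Rightarrow> real" where
  "tsum A n \<Phi> \<equiv> \<Sum>es\<in>tuples A n. (cmod (\<Phi> (embed es)))\<^sup>2"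

lemma hs_sums_eq: "hs_sums ip p n \<Phi> = {tsum A n \<Phi> | A. finite A \<and> orthonormal ip p A}"
  unfolding hs_sums_def tuples_def by simp

context nuclear_triple
begin

text \<open>\<open>A\<close> is traded for \<open>C\<close> in one slot at a time. With
  \<open>p = p'\<close> this compares partial sums of systems of the same level; with
  \<open>p < p'\<close> it gives the monotonicity of the norms in the level.\<close>

lemma tsum_le:
  assumes "multilinear_form n \<Phi>" "finite C" "orthonormal ip p C" "finite A" "orthonormal ip p' A"
    "p \<le> p'" "A \<subseteq> span C"
  shows "tsum A n \<Phi> \<le> tsum C n \<Phi>"
  using assms(1)
proof (induction n arbitrary: \<Phi>)
  case 0
  then show ?case by simp
next
  case (Suc n)
  have "tsum A (Suc n) \<Phi> = (\<Sum>e\<in>A. tsum A n (\<lambda>es. \<Phi> ((e, 0) # es)))"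
    using assms(4) by (simp add: sum_tuples_Suc)
  also have "\<dots> \<le> (\<Sum>e\<in>A. tsum C n (\<lambda>es. \<Phi> ((e, 0) # es)))"
    by (intro sum_mono Suc.IH multilinear_form_Cons Suc.prems)
  also have "\<dots> = (\<Sum>es\<in>tuples C n. \<Sum>e\<in>A. (cmod (\<Phi> ((e, 0) # embed es)))\<^sup>2)"
    by (rule sum.swap)
  also have "\<dots> \<le> (\<Sum>es\<in>tuples C n. \<Sum>e\<in>C. (cmod (\<Phi> ((e, 0) # embed es)))\<^sup>2)"
    by (intro sum_mono functional_sum_le[OF _ assms(2-7)] multilinear_form_linear_head[OF Suc.prems])
  also have "\<dots> = (\<Sum>e\<in>C. tsum C n (\<lambda>es. \<Phi> ((e, 0) # es)))" by (rule sum.swap)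
  also have "\<dots> = tsum C (Suc n) \<Phi>"
    using assms(2) by (simp add: sum_tuples_Suc)
  finally show ?case .
qed

lemma Hneg_multilinear: "\<Phi> \<in> Hneg ip p n \<Longrightarrow> multilinear_form n \<Phi>"
  by (simp add: Hneg_def)

lemma HnegI:
  assumes "multilinear_form n \<Phi>" "M \<ge> 0"
    "\<And>A. finite A \<Longrightarrow> orthonormal ip p A \<Longrightarrow> tsum A n \<Phi> \<le> M\<^sup>2"
  shows "\<Phi> \<in> Hneg ip p n" "Hneg_norm ip p n \<Phi> \<le> M"
proof -
  have *: "x \<le> M\<^sup>2" if "x \<in> hs_sums ip p n \<Phi>" for x
    using that assms(3) unfolding hs_sums_eq by auto
  then show "\<Phi> \<in> Hneg ip p n" using assms(1) unfolding Hneg_def by (auto intro!: bdd_aboveI)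
  have "tsum {} n \<Phi> \<in> hs_sums ip p n \<Phi>"
    unfolding hs_sums_eq using orthonormal_empty by blast
  then have "Sup (hs_sums ip p n \<Phi>) \<le> M\<^sup>2" using * by (intro cSup_least) auto
  then show "Hneg_norm ip p n \<Phi> \<le> M"
    unfolding Hneg_norm_def using assms(2) by (intro real_le_lsqrt) auto
qed

lemma Hneg_Sup_upper:
  assumes "\<Phi> \<in> Hneg ip p n" "finite A" "orthonormal ip p A"
  shows "tsum A n \<Phi> \<le> Sup (hs_sums ip p n \<Phi>)"
  using assms unfolding Hneg_def by (intro cSup_upper) (auto simp: hs_sums_eq)

lemma Hneg_Sup_nonneg:
  assumes "\<Phi> \<in> Hneg ip p n"
  shows "Sup (hs_sums ip p n \<Phi>) \<ge> 0"
  by (rule order_trans[OF sum_nonneg Hneg_Sup_upper[OF assms, of "{}"]]) (auto simp: orthonormal_empty)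

lemma Hneg_norm_power2: "\<Phi> \<in> Hneg ip p n \<Longrightarrow> (Hneg_norm ip p n \<Phi>)\<^sup>2 = Sup (hs_sums ip p n \<Phi>)"
  by (simp add: Hneg_norm_def Hneg_Sup_nonneg)

lemma Hneg_norm_nonneg: "\<Phi> \<in> Hneg ip p n \<Longrightarrow> Hneg_norm ip p n \<Phi> \<ge> 0"
  by (simp add: Hneg_norm_def Hneg_Sup_nonneg)

lemma tsum_le_norm:
  assumes "\<Phi> \<in> Hneg ip p n" "finite A" "orthonormal ip p A"
  shows "tsum A n \<Phi> \<le> (Hneg_norm ip p n \<Phi>)\<^sup>2"
  using Hneg_Sup_upper[OF assms] Hneg_norm_power2[OF assms(1)] by simp

lemma Hneg_tsum_approx:
  assumes "\<Phi> \<in> Hneg ip p n" "e > 0"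
  obtains A where "finite A" "orthonormal ip p A" "tsum A n \<Phi> > (Hneg_norm ip p n \<Phi>)\<^sup>2 - e"
proof -
  have "hs_sums ip p n \<Phi> \<noteq> {}" unfolding hs_sums_eq using orthonormal_empty by blast
  then obtain x where "x \<in> hs_sums ip p n \<Phi>" "x > Sup (hs_sums ip p n \<Phi>) - e"
    using less_cSupE[of "Sup (hs_sums ip p n \<Phi>) - e" "hs_sums ip p n \<Phi>"] assms(2) by auto
  then show ?thesis using that unfolding hs_sums_eq Hneg_norm_power2[OF assms(1)] by blast
qed

text \<open>Each argument is expanded in \<open>C\<close> with complex coordinates, whose squared
  moduli add up to its squared \<open>cnorm\<close> by Parseval for the real and the imaginary part.
  Cauchy-Schwarz is then applied slot by slot.\<close>

lemma multilinear_eval_le: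
  assumes "multilinear_form n \<Phi>" "finite C" "orthonormal ip p C" "length zs = n"
    "\<And>z. z \<in> set zs \<Longrightarrow> fst z \<in> span C \<and> snd z \<in> span C"
  shows "(cmod (\<Phi> zs))\<^sup>2 \<le> (\<Prod>z\<leftarrow>zs. (cnorm ip p z)\<^sup>2) * tsum C n \<Phi>"
  using assms(1,4,5)
proof (induction n arbitrary: \<Phi> zs)
  case 0
  then show ?case by simp
next
  case (Suc n)
  from Suc.prems(2) obtain z ws where zs: "zs = z # ws" "length ws = n" by (cases zs) auto
  let ?u = "\<lambda>c. Complex (ip p (fst z) c) (ip p (snd z) c)"
  have sp: "fst z \<in> span C" "snd z \<in> span C" using Suc.prems(3) zs by auto
  have z: "z = (\<Sum>c\<in>C. cscale (?u c) (c, 0))"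
  proof (rule prod_eqI)
    show "fst z = fst (\<Sum>c\<in>C. cscale (?u c) (c, 0))"
      using orthonormal_expand[OF assms(2,3) sp(1)] by (simp add: fst_sum cscale_def)
    show "snd z = snd (\<Sum>c\<in>C. cscale (?u c) (c, 0))"
      using orthonormal_expand[OF assms(2,3) sp(2)] by (simp add: snd_sum cscale_def)
  qed
  have head: "(cmod (\<Phi> (z # es)))\<^sup>2 \<le> (cnorm ip p z)\<^sup>2 * (\<Sum>c\<in>C. (cmod (\<Phi> ((c, 0) # es)))\<^sup>2)"
    if "length es = n" for es
  proof -
    have "\<Phi> (z # es) = (\<Sum>c\<in>C. ?u c * \<Phi> ((c, 0) # es))"
      by (subst (1) z) (rule multilinear_form_head_sum[OF Suc.prems(1) that])
    then have "cmod (\<Phi> (z # es)) \<le> (\<Sum>c\<in>C. cmod (?u c) * cmod (\<Phi> ((c, 0) # es)))"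
      using norm_sum[of "\<lambda>c. ?u c * \<Phi> ((c, 0) # es)" C] by (simp add: norm_mult)
    then have "(cmod (\<Phi> (z # es)))\<^sup>2 \<le> (\<Sum>c\<in>C. cmod (?u c) * cmod (\<Phi> ((c, 0) # es)))\<^sup>2"
      by (rule power_mono) simp
    also have "\<dots> \<le> (\<Sum>c\<in>C. (cmod (?u c))\<^sup>2) * (\<Sum>c\<in>C. (cmod (\<Phi> ((c, 0) # es)))\<^sup>2)"
      by (rule Cauchy_Schwarz_ineq_sum)
    also have "(\<Sum>c\<in>C. (cmod (?u c))\<^sup>2) = (cnorm ip p z)\<^sup>2"
      using orthonormal_parseval[OF assms(2,3) sp(1), of "fst z"]
        orthonormal_parseval[OF assms(2,3) sp(2), of "snd z"]
      unfolding cnorm_power2 cmod_power2 by (simp add: sum.distrib power2_eq_square)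
    finally show ?thesis .
  qed
  have nn: "0 \<le> (\<Prod>z\<leftarrow>ws. (cnorm ip p z)\<^sup>2)" by (rule prod_list_nonneg) auto
  have "(cmod (\<Phi> zs))\<^sup>2 \<le> (\<Prod>z\<leftarrow>ws. (cnorm ip p z)\<^sup>2) * tsum C n (\<lambda>es. \<Phi> (z # es))"
    using Suc.IH[OF multilinear_form_Cons[OF Suc.prems(1)], of ws z] zs Suc.prems(3) by simp
  also have "tsum C n (\<lambda>es. \<Phi> (z # es))
      \<le> (\<Sum>es\<in>tuples C n. (cnorm ip p z)\<^sup>2 * (\<Sum>c\<in>C. (cmod (\<Phi> ((c, 0) # embed es)))\<^sup>2))"
    by (intro sum_mono head) (simp add: length_tuples)
  also have "\<dots> = (cnorm ip p z)\<^sup>2 * tsum C (Suc n) \<Phi>"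
  proof -
    have "tsum C (Suc n) \<Phi> = (\<Sum>es\<in>tuples C n. \<Sum>c\<in>C. (cmod (\<Phi> ((c, 0) # embed es)))\<^sup>2)"
      using assms(2) by (simp add: sum_tuples_Suc) (rule sum.swap)
    then show ?thesis by (simp add: sum_distrib_left)
  qed
  finally have "(cmod (\<Phi> zs))\<^sup>2 \<le> (\<Prod>z\<leftarrow>ws. (cnorm ip p z)\<^sup>2) * ((cnorm ip p z)\<^sup>2 * tsum C (Suc n) \<Phi>)"
    using nn by (simp add: mult_left_mono)
  then show ?case using zs by (simp add: mult_ac)
qed

lemma Hneg_eval_le:
  assumes "\<Phi> \<in> Hneg ip p n" "length zs = n"
  shows "cmod (\<Phi> zs) \<le> (\<Prod>z\<leftarrow>zs. cnorm ip p z) * Hneg_norm ip p n \<Phi>"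
proof -
  \<comment> \<open>A system just large enough to span the real and imaginary parts of all
    arguments.\<close>
  obtain C where C: "finite C" "orthonormal ip p C" "fst ` set zs \<union> snd ` set zs \<subseteq> span C"
    using orthonormal_extend[of "fst ` set zs \<union> snd ` set zs" "{}" p] orthonormal_empty by auto
  have "(cmod (\<Phi> zs))\<^sup>2 \<le> (\<Prod>z\<leftarrow>zs. (cnorm ip p z)\<^sup>2) * tsum C n \<Phi>"
    by (rule multilinear_eval_le[OF Hneg_multilinear[OF assms(1)] C(1,2) assms(2)]) (use C(3) in auto)
  also have "\<dots> \<le> (\<Prod>z\<leftarrow>zs. (cnorm ip p z)\<^sup>2) * (Hneg_norm ip p n \<Phi>)\<^sup>2"
    by (intro mult_left_mono tsum_le_norm assms C prod_list_nonneg) auto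
  also have "(\<Prod>z\<leftarrow>zs. (cnorm ip p z)\<^sup>2) = (\<Prod>z\<leftarrow>zs. cnorm ip p z)\<^sup>2"
    by (induction zs) (auto simp: power_mult_distrib)
  finally have "(cmod (\<Phi> zs))\<^sup>2 \<le> ((\<Prod>z\<leftarrow>zs. cnorm ip p z) * Hneg_norm ip p n \<Phi>)\<^sup>2"
    by (simp add: power_mult_distrib)
  then show ?thesis
    by (rule power2_le_imp_le) (auto intro!: mult_nonneg_nonneg prod_list_nonneg Hneg_norm_nonneg assms)
qed

lemma Hneg_comb:
  assumes "\<Phi> \<in> Hneg ip p n" "\<Psi> \<in> Hneg ip p n"
  shows "(\<lambda>es. c * \<Phi> es + \<Psi> es) \<in> Hneg ip p n"
    "Hneg_norm ip p n (\<lambda>es. c * \<Phi> es + \<Psi> es) \<le> cmod c * Hneg_norm ip p n \<Phi> + Hneg_norm ip p n \<Psi>"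
proof -
  let ?M = "cmod c * Hneg_norm ip p n \<Phi> + Hneg_norm ip p n \<Psi>"
  have M: "?M \<ge> 0" using assms Hneg_norm_nonneg by simp
  have ml: "multilinear_form n (\<lambda>es. c * \<Phi> es + \<Psi> es)"
    using assms Hneg_multilinear by (intro multilinear_form_comb) auto
  have b: "tsum A n (\<lambda>es. c * \<Phi> es + \<Psi> es) \<le> ?M\<^sup>2" if A: "finite A" "orthonormal ip p A" for A
  proof -
    \<comment> \<open>Partial sums are squares of finite L2 norms, so Minkowski's inequality
      applies.\<close>
    let ?L = "\<lambda>\<Phi>. L2_set (\<lambda>es. cmod (\<Phi> (embed es))) (tuples A n)"
    have "?L (\<lambda>es. c * \<Phi> es + \<Psi> es) \<le> L2_set (\<lambda>es. cmod c * cmod (\<Phi> (embed es)) + cmod (\<Psi> (embed es))) (tuples A n)"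
      by (rule L2_set_mono) (auto simp: norm_triangle_le norm_mult)
    also have "\<dots> \<le> L2_set (\<lambda>es. cmod c * cmod (\<Phi> (embed es))) (tuples A n) + ?L \<Psi>"
      by (rule L2_set_triangle_ineq)
    also have "L2_set (\<lambda>es. cmod c * cmod (\<Phi> (embed es))) (tuples A n) = cmod c * ?L \<Phi>"
      by (rule L2_set_right_distrib[symmetric]) simp
    also have "?L \<Phi> \<le> Hneg_norm ip p n \<Phi>"
      unfolding L2_set_def using tsum_le_norm[OF assms(1) A] Hneg_norm_nonneg[OF assms(1)]
      by (intro real_le_lsqrt)
    also have "?L \<Psi> \<le> Hneg_norm ip p n \<Psi>"
      unfolding L2_set_def using tsum_le_norm[OF assms(2) A] Hneg_norm_nonneg[OF assms(2)]
      by (intro real_le_lsqrt)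
    finally have "?L (\<lambda>es. c * \<Phi> es + \<Psi> es) \<le> ?M" by (simp add: mult_left_mono)
    then have "(?L (\<lambda>es. c * \<Phi> es + \<Psi> es))\<^sup>2 \<le> ?M\<^sup>2" by (rule power_mono) (rule L2_set_nonneg)
    then show ?thesis by (simp add: L2_set_def sum_nonneg)
  qed
  show "(\<lambda>es. c * \<Phi> es + \<Psi> es) \<in> Hneg ip p n"
    by (rule HnegI(1)[OF ml M b])
  show "Hneg_norm ip p n (\<lambda>es. c * \<Phi> es + \<Psi> es) \<le> ?M"
    by (rule HnegI(2)[OF ml M b])
qed

lemma Hneg_zero: "(\<lambda>es. 0) \<in> Hneg ip p n" "Hneg_norm ip p n (\<lambda>es. 0) = 0"
proof -
  have b: "tsum A n (\<lambda>es. 0) \<le> 0\<^sup>2" for A by simp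
  show 1: "(\<lambda>es. 0) \<in> Hneg ip p n" by (rule HnegI(1)[OF multilinear_form_zero _ b]) auto
  have "Hneg_norm ip p n (\<lambda>es. 0) \<le> 0" by (rule HnegI(2)[OF multilinear_form_zero _ b]) auto
  then show "Hneg_norm ip p n (\<lambda>es. 0) = 0" using Hneg_norm_nonneg[OF 1] by simp
qed

lemma Hneg_scale:
  assumes "\<Phi> \<in> Hneg ip p n"
  shows "(\<lambda>es. c * \<Phi> es) \<in> Hneg ip p n"
    "Hneg_norm ip p n (\<lambda>es. c * \<Phi> es) \<le> cmod c * Hneg_norm ip p n \<Phi>"
  using Hneg_comb[OF assms Hneg_zero(1), of c] Hneg_zero(2) by auto

lemma Hneg_sum:
  assumes "\<And>i. i \<in> I \<Longrightarrow> \<Phi> i \<in> Hneg ip p n"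
  shows "(\<lambda>es. \<Sum>i\<in>I. c i * \<Phi> i es) \<in> Hneg ip p n"
    "Hneg_norm ip p n (\<lambda>es. \<Sum>i\<in>I. c i * \<Phi> i es) \<le> (\<Sum>i\<in>I. cmod (c i) * Hneg_norm ip p n (\<Phi> i))"
proof -
  have "(\<lambda>es. \<Sum>i\<in>I. c i * \<Phi> i es) \<in> Hneg ip p n \<and>
    Hneg_norm ip p n (\<lambda>es. \<Sum>i\<in>I. c i * \<Phi> i es) \<le> (\<Sum>i\<in>I. cmod (c i) * Hneg_norm ip p n (\<Phi> i))"
    using assms
  proof (induction I rule: infinite_finite_induct)
    case (insert x F)
    then show ?case
      using Hneg_comb[of "\<Phi> x" p n "\<lambda>es. \<Sum>i\<in>F. c i * \<Phi> i es" "c x"] by force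
  qed (auto simp: Hneg_zero)
  then show "(\<lambda>es. \<Sum>i\<in>I. c i * \<Phi> i es) \<in> Hneg ip p n"
    "Hneg_norm ip p n (\<lambda>es. \<Sum>i\<in>I. c i * \<Phi> i es) \<le> (\<Sum>i\<in>I. cmod (c i) * Hneg_norm ip p n (\<Phi> i))" by auto
qed

lemma Hneg_mono:
  assumes "\<Phi> \<in> Hneg ip p n" "p \<le> p'"
  shows "\<Phi> \<in> Hneg ip p' n" "Hneg_norm ip p' n \<Phi> \<le> Hneg_norm ip p n \<Phi>"
proof -
  have b: "tsum A n \<Phi> \<le> (Hneg_norm ip p n \<Phi>)\<^sup>2" if A: "finite A" "orthonormal ip p' A" for A
  proof -
    obtain C where C: "finite C" "orthonormal ip p C" "A \<subseteq> span C"
      using orthonormal_extend[OF A(1), of "{}" p] orthonormal_empty by auto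
    have "tsum A n \<Phi> \<le> tsum C n \<Phi>"
      by (rule tsum_le[OF Hneg_multilinear[OF assms(1)] C(1,2) A assms(2) C(3)])
    also have "\<dots> \<le> (Hneg_norm ip p n \<Phi>)\<^sup>2" by (rule tsum_le_norm[OF assms(1) C(1,2)])
    finally show ?thesis .
  qed
  show "\<Phi> \<in> Hneg ip p' n" "Hneg_norm ip p' n \<Phi> \<le> Hneg_norm ip p n \<Phi>"
    using HnegI[OF Hneg_multilinear[OF assms(1)] Hneg_norm_nonneg[OF assms(1)] b] by auto
qed

lemma tsum_permute:
  fixes \<Phi> :: "'n form"
  assumes "\<pi> permutes {..<n}"
  shows "tsum A n (permute_form n \<pi> \<Phi>) = tsum A n \<Phi>"
proof -
  have "tsum A n (permute_form n \<pi> \<Phi>) = (\<Sum>es\<in>tuples A n. (cmod (\<Phi> (embed (permute_list \<pi> es))))\<^sup>2)"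
  proof (rule sum.cong[OF refl])
    fix es assume "es \<in> tuples A n"
    then have "length es = n" by (rule length_tuples)
    then show "(cmod (permute_form n \<pi> \<Phi> (embed es)))\<^sup>2 = (cmod (\<Phi> (embed (permute_list \<pi> es))))\<^sup>2"
      using permute_list_map[of \<pi> es "\<lambda>e. (e, 0::'n)"] assms by (simp add: permute_form_def)
  qed
  also have "\<dots> = tsum A n \<Phi>"
    by (rule sum_tuples_permute[OF assms, where g = "\<lambda>es. (cmod (\<Phi> (embed es)))\<^sup>2"])
  finally show ?thesis .
qed

lemma Hneg_permute:
  assumes "\<Phi> \<in> Hneg ip p n" "\<pi> permutes {..<n}"
  shows "permute_form n \<pi> \<Phi> \<in> Hneg ip p n" "Hneg_norm ip p n (permute_form n \<pi> \<Phi>) \<le> Hneg_norm ip p n \<Phi>"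
proof -
  have b: "tsum A n (permute_form n \<pi> \<Phi>) \<le> (Hneg_norm ip p n \<Phi>)\<^sup>2" if "finite A" "orthonormal ip p A" for A
    using tsum_le_norm[OF assms(1) that] tsum_permute[OF assms(2)] by simp
  show "permute_form n \<pi> \<Phi> \<in> Hneg ip p n" "Hneg_norm ip p n (permute_form n \<pi> \<Phi>) \<le> Hneg_norm ip p n \<Phi>"
    using HnegI[OF multilinear_permute_form[OF Hneg_multilinear[OF assms(1)] assms(2)]
        Hneg_norm_nonneg[OF assms(1)] b] by auto
qed

lemma Hneg_tprod:
  assumes "\<Phi> \<in> Hneg ip p k" "\<Psi> \<in> Hneg ip p m"
  shows "tprod k \<Phi> \<Psi> \<in> Hneg ip p (k + m)"
    "Hneg_norm ip p (k + m) (tprod k \<Phi> \<Psi>) \<le> Hneg_norm ip p k \<Phi> * Hneg_norm ip p m \<Psi>"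
proof -
  have b: "tsum A (k + m) (tprod k \<Phi> \<Psi>) \<le> (Hneg_norm ip p k \<Phi> * Hneg_norm ip p m \<Psi>)\<^sup>2"
    if A: "finite A" "orthonormal ip p A" for A
  proof -
    have "tsum A (k + m) (tprod k \<Phi> \<Psi>) = (\<Sum>es\<in>tuples A (k + m).
        (cmod (\<Phi> (embed (take k es))))\<^sup>2 * (cmod (\<Psi> (embed (drop k es))))\<^sup>2)"
      by (simp add: tprod_def norm_mult power_mult_distrib take_map drop_map)
    also have "\<dots> = tsum A k \<Phi> * tsum A m \<Psi>" by (rule sum_tuples_add[OF A(1)])
    also have "\<dots> \<le> (Hneg_norm ip p k \<Phi>)\<^sup>2 * (Hneg_norm ip p m \<Psi>)\<^sup>2"
      by (intro mult_mono tsum_le_norm assms A) (auto intro: sum_nonneg)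
    finally show ?thesis by (simp add: power_mult_distrib)
  qed
  have n: "Hneg_norm ip p k \<Phi> * Hneg_norm ip p m \<Psi> \<ge> 0" using assms by (simp add: Hneg_norm_nonneg)
  show "tprod k \<Phi> \<Psi> \<in> Hneg ip p (k + m)"
    "Hneg_norm ip p (k + m) (tprod k \<Phi> \<Psi>) \<le> Hneg_norm ip p k \<Phi> * Hneg_norm ip p m \<Psi>"
    using HnegI[OF multilinear_tprod[OF Hneg_multilinear[OF assms(1)] Hneg_multilinear[OF assms(2)]] n b]
    by auto
qed

lemma Hneg_elem_form:
  assumes "\<And>x. x \<in> set xs \<Longrightarrow> clinear_form x"
    "\<And>x A. x \<in> set xs \<Longrightarrow> finite A \<Longrightarrow> orthonormal ip p A \<Longrightarrow> (\<Sum>e\<in>A. (cmod (x (e, 0)))\<^sup>2) \<le> M\<^sup>2" "M \<ge> 0"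
  shows "elem_form xs \<in> Hneg ip p (length xs)" "Hneg_norm ip p (length xs) (elem_form xs) \<le> M ^ length xs"
proof -
  have b: "tsum A (length xs) (elem_form xs) \<le> (M ^ length xs)\<^sup>2" if A: "finite A" "orthonormal ip p A" for A
    using assms(2)
  proof (induction xs)
    case (Cons x xs)
    have "tsum A (length (x # xs)) (elem_form (x # xs))
      = (\<Sum>e\<in>A. (cmod (x (e, 0)))\<^sup>2) * tsum A (length xs) (elem_form xs)"
      using A by (simp add: sum_tuples_Suc norm_mult power_mult_distrib sum_product)
    also have "\<dots> \<le> M\<^sup>2 * (M ^ length xs)\<^sup>2"
      using Cons A by (intro mult_mono) (auto intro: sum_nonneg)
    finally show ?case by (simp add: power_mult_distrib power2_eq_square algebra_simps)
  qed simp
  have m: "multilinear_form (length xs) (elem_form xs)"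
    using assms(1) by (intro multilinear_elem_form) auto
  show "elem_form xs \<in> Hneg ip p (length xs)" "Hneg_norm ip p (length xs) (elem_form xs) \<le> M ^ length xs"
    using HnegI[OF m _ b] assms(3) by auto
qed

lemma Hneg_form_power:
  assumes "clinear_form x" "\<And>A. finite A \<Longrightarrow> orthonormal ip p A \<Longrightarrow> (\<Sum>e\<in>A. (cmod (x (e, 0)))\<^sup>2) \<le> M\<^sup>2" "M \<ge> 0"
  shows "form_power n x \<in> Hneg ip p n" "Hneg_norm ip p n (form_power n x) \<le> M ^ n"
  using Hneg_elem_form[of "replicate n x" p M] assms by (auto simp: form_power_eq)

end

lemma elem_form_prod_nth:
  "length zs = length xs \<Longrightarrow> elem_form xs zs = (\<Prod>i<length xs. (xs ! i) (zs ! i))"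
  by (induction zs xs rule: list_induct2) (simp_all add: prod.lessThan_Suc_shift del: prod.lessThan_Suc)

lemma elem_form_permute:
  assumes "\<pi> permutes {..<length xs}"
  shows "elem_form (permute_list \<pi> xs) = permute_form (length xs) (inv \<pi>) (elem_form xs)"
proof
  fix zs
  show "elem_form (permute_list \<pi> xs) zs = permute_form (length xs) (inv \<pi>) (elem_form xs) zs"
  proof (cases "length zs = length xs")
    case True
    have pi: "inv \<pi> permutes {..<length xs}" by (rule permutes_inv[OF assms])
    have "elem_form (permute_list \<pi> xs) zs = (\<Prod>i<length xs. (xs ! \<pi> i) (zs ! i))"
      using assms True by (simp add: elem_form_prod_nth permute_list_nth)
    also have "\<dots> = (\<Prod>i<length xs. ((\<lambda>i. (xs ! \<pi> i) (zs ! i)) \<circ> inv \<pi>) i)"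
      by (rule prod.permute[OF pi])
    also have "\<dots> = (\<Prod>i<length xs. (xs ! i) (permute_list (inv \<pi>) zs ! i))"
      using assms pi True by (simp add: permute_list_nth permutes_inverses[OF assms])
    also have "\<dots> = elem_form xs (permute_list (inv \<pi>) zs)"
      using True by (simp add: elem_form_prod_nth)
    finally show ?thesis using True by (simp add: permute_form_def)
  qed (simp add: elem_form_length permute_form_def)
qed

context nuclear_triple
begin

text \<open>For a single functional the Hilbert-Schmidt norm is bounded by the operator norm: on the
  vector \<open>\<zeta>\<close> whose coordinates are the conjugates of the values of
  \<open>x\<close>, the functional takes the value \<open>S\<close> while the squared norm of
  \<open>\<zeta>\<close> is \<open>S\<close>, so \<open>S\<close> is at most
  \<open>K * sqrt S\<close>.\<close>

lemma clinear_bound_sum: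
  assumes "clinear_form x" "\<And>\<zeta>. cmod (x \<zeta>) \<le> K * cnorm ip p \<zeta>" "finite A" "orthonormal ip p A"
  shows "(\<Sum>e\<in>A. (cmod (x (e, 0)))\<^sup>2) \<le> K\<^sup>2"
proof -
  define S where "S = (\<Sum>e\<in>A. (cmod (x (e, 0)))\<^sup>2)"
  define \<zeta> :: "'n cx" where "\<zeta> = (\<Sum>e\<in>A. cscale (cnj (x (e, 0))) (e, 0))"
  have S0: "S \<ge> 0" unfolding S_def by (rule sum_nonneg) simp
  have "x (\<Sum>e\<in>B. cscale (u e) (v e)) = (\<Sum>e\<in>B. u e * x (v e))" for B :: "'n set" and u v
  proof (induction B rule: infinite_finite_induct)
    case (insert e B)
    then show ?case using assms(1) by (simp add: clinear_form_def del: split_paired_All)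
  qed (simp_all add: clinear_form_zero[OF assms(1)])
  then have "x \<zeta> = of_real S"
    unfolding \<zeta>_def S_def by (simp add: complex_norm_square[symmetric] mult.commute del: of_real_power)
  moreover have "(cnorm ip p \<zeta>)\<^sup>2 = S"
  proof -
    have f: "fst \<zeta> = (\<Sum>e\<in>A. Re (x (e, 0)) *\<^sub>R e)" "snd \<zeta> = (\<Sum>e\<in>A. (- Im (x (e, 0))) *\<^sub>R e)"
      unfolding \<zeta>_def by (simp_all add: fst_sum snd_sum cscale_def)
    have "ip p (\<Sum>e\<in>A. u e *\<^sub>R e) (\<Sum>e\<in>A. u e *\<^sub>R e) = (\<Sum>e\<in>A. (u e)\<^sup>2)" for u
    proof -
      have "ip p (\<Sum>e\<in>A. u e *\<^sub>R e) (\<Sum>e\<in>A. u e *\<^sub>R e) = (\<Sum>e\<in>A. u e * ip p (\<Sum>e\<in>A. u e *\<^sub>R e) e)"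
        by (subst ip_sum_right) (simp add: ip_scaleR_right)
      then show ?thesis using orthonormal_ip_sum[OF assms(3,4)] by (simp add: power2_eq_square)
    qed
    then show ?thesis unfolding cnorm_power2 f S_def cmod_power2
      by (simp add: sum.distrib del: scaleR_minus_left)
  qed
  ultimately have "S \<le> K * sqrt S"
    using assms(2)[of \<zeta>] S0 by (metis cnorm_nonneg norm_of_real abs_of_nonneg real_sqrt_unique)
  then have "S * S \<le> (K * sqrt S) * (K * sqrt S)" using S0 by (intro mult_mono) auto
  also have "\<dots> = K\<^sup>2 * S" using S0 by (simp add: power2_eq_square)
  finally have "S \<le> K\<^sup>2" using S0 by (cases "S = 0") (auto simp: mult_le_cancel_right)
  then show ?thesis by (simp add: S_def)
qed

lemma cmod_cext_le:
  assumes "\<And>\<xi>. \<bar>x \<xi>\<bar> \<le> K * hnorm ip p \<xi>" "K \<ge> 0"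
  shows "cmod (cext x \<zeta>) \<le> K * cnorm ip p \<zeta>"
proof -
  have "(x a)\<^sup>2 \<le> K\<^sup>2 * (hnorm ip p a)\<^sup>2" for a
    using power_mono[OF assms(1)[of a], of 2] by (simp add: power_mult_distrib)
  then have "(x (fst \<zeta>))\<^sup>2 + (x (snd \<zeta>))\<^sup>2 \<le> (K * cnorm ip p \<zeta>)\<^sup>2"
    unfolding power_mult_distrib cnorm_power2 hnorm_power2[symmetric] distrib_left by (intro add_mono)
  then show ?thesis
    unfolding cext_def complex_norm by (intro real_le_lsqrt) (simp_all add: assms(2))
qed

lemma Hneg_dual_power:
  assumes "linear x" "\<And>\<xi>. \<bar>x \<xi>\<bar> \<le> K * hnorm ip p \<xi>" "K \<ge> 0"
  shows "form_power n (cext x) \<in> Hneg ip p n" "Hneg_norm ip p n (form_power n (cext x)) \<le> K ^ n"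
proof -
  note b = clinear_bound_sum[OF clinear_cext[OF assms(1)] cmod_cext_le[OF assms(2,3)]]
  show "form_power n (cext x) \<in> Hneg ip p n" "Hneg_norm ip p n (form_power n (cext x)) \<le> K ^ n"
    using Hneg_form_power[OF clinear_cext[OF assms(1)] b assms(3)] by auto
qed

subsection \<open>Elementary tensors and finite-dimensional projections\<close>

text \<open>Vectors of N are sent to the dual by the inner product of H_p, not of H_0. Tuples from
  an orthonormal system thus give an orthonormal system of tensors at level
  \<open>p\<close>.\<close>

definition elem_tensor :: "nat \<Rightarrow> 'n list \<Rightarrow> 'n form" where
  "elem_tensor p cs = elem_form (map (\<lambda>c. cext (ip p c)) cs)"

lemma elem_tensor_replicate: "elem_tensor p (replicate n e) = form_power n (cext (ip p e))"
  by (simp add: elem_tensor_def form_power_eq)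

lemma elem_tensor_Hneg: "length cs = n \<Longrightarrow> elem_tensor p cs \<in> Hneg ip p n"
proof -
  assume l: "length cs = n"
  define M where "M = (\<Sum>c\<in>set cs. hnorm ip p c)"
  have "elem_form (map (\<lambda>c. cext (ip p c)) cs) \<in> Hneg ip p (length (map (\<lambda>c. cext (ip p c)) cs))"
  proof (rule Hneg_elem_form(1))
    show M: "M \<ge> 0" unfolding M_def by (rule sum_nonneg) simp
    fix x assume "x \<in> set (map (\<lambda>c. cext (ip p c)) cs)"
    then obtain c where c: "c \<in> set cs" "x = cext (ip p c)" by auto
    show lx: "clinear_form x" unfolding c by (rule clinear_cext[OF linear_ip])
    have "hnorm ip p c \<le> M" unfolding M_def using c by (intro member_le_sum) auto
    then have "\<bar>ip p c \<xi>\<bar> \<le> M * hnorm ip p \<xi>" for \<xi>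
      using abs_ip_le[of p c \<xi>] mult_right_mono[of "hnorm ip p c" M "hnorm ip p \<xi>"] by simp
    then show "(\<Sum>e\<in>A. (cmod (x (e, 0)))\<^sup>2) \<le> M\<^sup>2" if "finite A" "orthonormal ip p A" for A
      using that unfolding c by (intro clinear_bound_sum[OF clinear_cext[OF linear_ip] cmod_cext_le] M)
  qed
  then show ?thesis using l by (simp add: elem_tensor_def)
qed

lemma elem_tensor_embed:
  assumes "orthonormal ip p D" "cs \<in> tuples D n" "ds \<in> tuples D n"
  shows "elem_tensor p cs (embed ds) = (if cs = ds then 1 else 0)"
proof -
  have "elem_tensor p cs (embed ds) = (if cs = ds then 1 else 0)"
    if "length cs = length ds" "set cs \<subseteq> D" "set ds \<subseteq> D"
    using that
  proof (induction cs ds rule: list_induct2)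
    case (Cons c cs d ds)
    have "ip p c d = (if c = d then 1 else 0)" using Cons.prems assms(1) by (auto simp: orthonormal_def)
    then have "cext (ip p c) (d, 0) = (if c = d then 1 else 0)"
      by (simp add: cext_def complex_eq_iff)
    then show ?case using Cons by (simp add: elem_tensor_def)
  qed (simp add: elem_tensor_def)
  then show ?thesis using assms by (simp add: tuples_def)
qed

lemma elem_tensor_permute:
  assumes "\<pi> permutes {..<length cs}"
  shows "elem_tensor p (permute_list \<pi> cs) = permute_form (length cs) (inv \<pi>) (elem_tensor p cs)"
  using elem_form_permute[of \<pi> "map (\<lambda>c. cext (ip p c)) cs"] assms
  by (simp add: elem_tensor_def permute_list_map)

text \<open>The norm bound has to cover an arbitrary system \<open>B\<close>. A system
  \<open>D\<close> that contains \<open>C\<close> and spans \<open>B\<close> reduces it to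
  \<open>D\<close>, where the coordinates of the sum are \<open>u\<close> on tuples from
  \<open>C\<close> and 0 elsewhere.\<close>

lemma Hneg_elem_tensor_sum:
  fixes n :: nat and u :: "'n list \<Rightarrow> complex"
  assumes C: "finite C" "orthonormal ip p C"
  defines "\<Psi> \<equiv> \<lambda>zs. \<Sum>cs\<in>tuples C n. u cs * elem_tensor p cs zs"
  shows "\<Psi> \<in> Hneg ip p n" "Hneg_norm ip p n \<Psi> \<le> sqrt (\<Sum>cs\<in>tuples C n. (cmod (u cs))\<^sup>2)"
    "\<And>ds D. C \<subseteq> D \<Longrightarrow> orthonormal ip p D \<Longrightarrow> ds \<in> tuples D n \<Longrightarrow>
      \<Psi> (embed ds) = (if ds \<in> tuples C n then u ds else 0)"
proof -
  show 1: "\<Psi> \<in> Hneg ip p n" unfolding \<Psi>_def by (rule Hneg_sum(1)) (auto intro: elem_tensor_Hneg length_tuples)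
  show ev: "\<Psi> (embed ds) = (if ds \<in> tuples C n then u ds else 0)"
    if "C \<subseteq> D" "orthonormal ip p D" "ds \<in> tuples D n" for ds D
  proof -
    have "\<Psi> (embed ds) = (\<Sum>cs\<in>tuples C n. if cs = ds then u cs else 0)"
      unfolding \<Psi>_def
    proof (rule sum.cong[OF refl])
      fix cs assume "cs \<in> tuples C n"
      then have "cs \<in> tuples D n" using tuples_mono[OF that(1)] by auto
      from elem_tensor_embed[OF that(2) this that(3)]
      show "u cs * elem_tensor p cs (embed ds) = (if cs = ds then u cs else 0)" by simp
    qed
    then show ?thesis using C(1) by simp
  qed
  have b: "tsum B n \<Psi> \<le> (sqrt (\<Sum>cs\<in>tuples C n. (cmod (u cs))\<^sup>2))\<^sup>2" if B: "finite B" "orthonormal ip p B" for B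
  proof -
    obtain D where D: "finite D" "orthonormal ip p D" "C \<subseteq> D" "B \<subseteq> span D"
      using orthonormal_extend[OF B(1) C] by auto
    have "tsum B n \<Psi> \<le> tsum D n \<Psi>"
      by (rule tsum_le[OF Hneg_multilinear[OF 1] D(1,2) B _ D(4)]) simp
    also have "\<dots> = (\<Sum>ds\<in>tuples D n. if ds \<in> tuples C n then (cmod (u ds))\<^sup>2 else 0)"
      by (rule sum.cong[OF refl]) (simp add: ev[OF D(3,2)])
    also have "\<dots> = (\<Sum>cs\<in>tuples C n. (cmod (u cs))\<^sup>2)"
      using D(1) tuples_mono[OF D(3)] by (simp add: sum.inter_restrict[symmetric] Int_absorb1)
    finally show ?thesis by (simp add: sum_nonneg)
  qed
  show "Hneg_norm ip p n \<Psi> \<le> sqrt (\<Sum>cs\<in>tuples C n. (cmod (u cs))\<^sup>2)"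
    by (rule HnegI(2)[OF Hneg_multilinear[OF 1] _ b]) (auto intro: sum_nonneg)
qed

text \<open>The orthogonal projection onto the span of the elementary tensors over \<open>C\<close>;
  the coordinates of \<open>\<Phi>\<close> are its values on tuples from \<open>C\<close>.\<close>

definition proj :: "nat \<Rightarrow> nat \<Rightarrow> 'n set \<Rightarrow> 'n form \<Rightarrow> 'n form" where
  "proj p n C \<Phi> = (\<lambda>zs. \<Sum>cs\<in>tuples C n. \<Phi> (embed cs) * elem_tensor p cs zs)"

text \<open>Pythagoras: over any larger system the difference has the coordinates of
  \<open>\<Phi>\<close> off \<open>C\<close> and no others.\<close>

lemma proj_approx:
  assumes \<Phi>: "\<Phi> \<in> Hneg ip p n" and C: "finite C" "orthonormal ip p C"
  shows "(\<lambda>zs. \<Phi> zs - proj p n C \<Phi> zs) \<in> Hneg ip p n"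
    "(Hneg_norm ip p n (\<lambda>zs. \<Phi> zs - proj p n C \<Phi> zs))\<^sup>2 \<le> (Hneg_norm ip p n \<Phi>)\<^sup>2 - tsum C n \<Phi>"
proof -
  let ?\<Psi> = "\<lambda>zs. \<Phi> zs - proj p n C \<Phi> zs"
  have P: "proj p n C \<Phi> \<in> Hneg ip p n" unfolding proj_def by (rule Hneg_elem_tensor_sum(1)[OF C])
  show 1: "?\<Psi> \<in> Hneg ip p n" using Hneg_comb(1)[OF P \<Phi>, of "-1"] by simp
  let ?R = "(Hneg_norm ip p n \<Phi>)\<^sup>2 - tsum C n \<Phi>"
  have R: "?R \<ge> 0" using tsum_le_norm[OF \<Phi> C] by simp
  have b: "tsum B n ?\<Psi> \<le> (sqrt ?R)\<^sup>2" if B: "finite B" "orthonormal ip p B" for B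
  proof -
    obtain D where D: "finite D" "orthonormal ip p D" "C \<subseteq> D" "B \<subseteq> span D"
      using orthonormal_extend[OF B(1) C] by auto
    have "tsum B n ?\<Psi> \<le> tsum D n ?\<Psi>"
      by (rule tsum_le[OF Hneg_multilinear[OF 1] D(1,2) B _ D(4)]) simp
    also have "\<dots> = (\<Sum>ds\<in>tuples D n. (cmod (\<Phi> (embed ds)))\<^sup>2 - (if ds \<in> tuples C n then (cmod (\<Phi> (embed ds)))\<^sup>2 else 0))"
      unfolding proj_def by (rule sum.cong[OF refl]) (simp add: Hneg_elem_tensor_sum(3)[OF C D(3,2)])
    also have "\<dots> = tsum D n \<Phi> - (\<Sum>ds\<in>tuples D n. (if ds \<in> tuples C n then (cmod (\<Phi> (embed ds)))\<^sup>2 else 0))"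
      by (rule sum_subtractf)
    also have "(\<Sum>ds\<in>tuples D n. (if ds \<in> tuples C n then (cmod (\<Phi> (embed ds)))\<^sup>2 else 0)) = tsum C n \<Phi>"
      using D(1) tuples_mono[OF D(3)] by (simp add: sum.inter_restrict[symmetric] Int_absorb1)
    finally show ?thesis using tsum_le_norm[OF \<Phi> D(1,2)] R by simp
  qed
  have "Hneg_norm ip p n ?\<Psi> \<le> sqrt ?R"
    by (rule HnegI(2)[OF Hneg_multilinear[OF 1] _ b]) (use R in auto)
  then have "(Hneg_norm ip p n ?\<Psi>)\<^sup>2 \<le> (sqrt ?R)\<^sup>2"
    by (rule power_mono) (rule Hneg_norm_nonneg[OF 1])
  then show "(Hneg_norm ip p n ?\<Psi>)\<^sup>2 \<le> ?R" using R by simp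
qed

subsection \<open>Bounded symmetric functionals\<close>

text \<open>The condition that defines \<open>Hpos ip p n\<close>, without the convention on values off \<open>Hneg ip p n\<close>;
  thus an element of \<open>sym_tensors ip n\<close> satisfies it for every \<open>p\<close>, with no restriction map.\<close>

definition sym_fun :: "nat \<Rightarrow> nat \<Rightarrow> 'n tensor \<Rightarrow> bool" where
  "sym_fun p n \<phi> \<longleftrightarrow>
     (\<forall>\<Phi>\<in>Hneg ip p n. \<forall>\<Psi>\<in>Hneg ip p n. \<forall>c. \<phi> (\<lambda>es. c * \<Phi> es + \<Psi> es) = c * \<phi> \<Phi> + \<phi> \<Psi>) \<and>
     (\<forall>\<Phi>\<in>Hneg ip p n. \<forall>\<pi>. \<pi> permutes {..<n} \<longrightarrow> \<phi> (permute_form n \<pi> \<Phi>) = \<phi> \<Phi>) \<and>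
     (\<exists>K. \<forall>\<Phi>\<in>Hneg ip p n. cmod (\<phi> \<Phi>) \<le> K * Hneg_norm ip p n \<Phi>)"

lemma sym_fun_comb_arg:
  "sym_fun p n \<phi> \<Longrightarrow> \<Phi> \<in> Hneg ip p n \<Longrightarrow> \<Psi> \<in> Hneg ip p n \<Longrightarrow> \<phi> (\<lambda>es. c * \<Phi> es + \<Psi> es) = c * \<phi> \<Phi> + \<phi> \<Psi>"
  by (simp add: sym_fun_def)

lemma sym_fun_permute:
  "sym_fun p n \<phi> \<Longrightarrow> \<Phi> \<in> Hneg ip p n \<Longrightarrow> \<pi> permutes {..<n} \<Longrightarrow> \<phi> (permute_form n \<pi> \<Phi>) = \<phi> \<Phi>"
  by (simp add: sym_fun_def)

lemma sym_fun_zero_arg: "sym_fun p n \<phi> \<Longrightarrow> \<phi> (\<lambda>es. 0) = 0"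
  using sym_fun_comb_arg[OF _ Hneg_zero(1) Hneg_zero(1), of p n \<phi> 1] by simp

lemma sym_fun_scale_arg: "sym_fun p n \<phi> \<Longrightarrow> \<Phi> \<in> Hneg ip p n \<Longrightarrow> \<phi> (\<lambda>es. c * \<Phi> es) = c * \<phi> \<Phi>"
  using sym_fun_comb_arg[OF _ _ Hneg_zero(1), of p n \<phi> \<Phi> c] sym_fun_zero_arg by simp

lemma sym_fun_add_arg: "sym_fun p n \<phi> \<Longrightarrow> \<Phi> \<in> Hneg ip p n \<Longrightarrow> \<Psi> \<in> Hneg ip p n \<Longrightarrow> \<phi> (\<lambda>es. \<Phi> es + \<Psi> es) = \<phi> \<Phi> + \<phi> \<Psi>"
  using sym_fun_comb_arg[of p n \<phi> \<Phi> \<Psi> 1] by simp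

lemma sym_fun_diff_arg: "sym_fun p n \<phi> \<Longrightarrow> \<Phi> \<in> Hneg ip p n \<Longrightarrow> \<Psi> \<in> Hneg ip p n \<Longrightarrow> \<phi> (\<lambda>es. \<Phi> es - \<Psi> es) = \<phi> \<Phi> - \<phi> \<Psi>"
  using sym_fun_comb_arg[of p n \<phi> \<Psi> \<Phi> "-1"] by simp

lemma sym_fun_sum_arg:
  assumes "sym_fun p n \<phi>" "\<And>i. i \<in> I \<Longrightarrow> \<Phi> i \<in> Hneg ip p n"
  shows "\<phi> (\<lambda>es. \<Sum>i\<in>I. c i * \<Phi> i es) = (\<Sum>i\<in>I. c i * \<phi> (\<Phi> i))"
  using assms(2)
proof (induction I rule: infinite_finite_induct)
  case (insert i I)
  then show ?case
    using sym_fun_comb_arg[OF assms(1), of "\<Phi> i" "\<lambda>es. \<Sum>i\<in>I. c i * \<Phi> i es" "c i"] Hneg_sum(1)[of I \<Phi> p n c]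
    by simp
qed (simp_all add: sym_fun_zero_arg[OF assms(1)])

lemma Hpos_norm_set:
  assumes "sym_fun p n \<phi>"
  shows "bdd_above {cmod (\<phi> \<Phi>) |\<Phi>. \<Phi> \<in> Hneg ip p n \<and> Hneg_norm ip p n \<Phi> \<le> 1}"
proof -
  obtain K where K: "\<forall>\<Phi>\<in>Hneg ip p n. cmod (\<phi> \<Phi>) \<le> K * Hneg_norm ip p n \<Phi>"
    using assms unfolding sym_fun_def by blast
  have "cmod (\<phi> \<Phi>) \<le> \<bar>K\<bar>" if "\<Phi> \<in> Hneg ip p n" "Hneg_norm ip p n \<Phi> \<le> 1" for \<Phi>
  proof -
    have "cmod (\<phi> \<Phi>) \<le> K * Hneg_norm ip p n \<Phi>" using K that by simp
    also have "\<dots> \<le> \<bar>K\<bar> * 1" using that Hneg_norm_nonneg by (intro mult_mono) auto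
    finally show ?thesis by simp
  qed
  then show ?thesis by (intro bdd_aboveI[of _ "\<bar>K\<bar>"]) auto
qed

lemma Hpos_norm_nonneg: "sym_fun p n \<phi> \<Longrightarrow> Hpos_norm ip p n \<phi> \<ge> 0"
  unfolding Hpos_norm_def
  by (rule order_trans[of _ "cmod (\<phi> (\<lambda>es. 0))"], simp, rule cSup_upper[OF _ Hpos_norm_set])
    (use Hneg_zero in force)

lemma Hpos_norm_bound:
  assumes "sym_fun p n \<phi>" "\<Phi> \<in> Hneg ip p n"
  shows "cmod (\<phi> \<Phi>) \<le> Hpos_norm ip p n \<phi> * Hneg_norm ip p n \<Phi>"
proof (cases "Hneg_norm ip p n \<Phi> = 0")
  case True
  \<comment> \<open>\<open>\<Phi>\<close> cannot be normalized here, but boundedness with any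
    constant forces \<open>\<phi> \<Phi> = 0\<close>.\<close>
  obtain K where "\<forall>\<Phi>\<in>Hneg ip p n. cmod (\<phi> \<Phi>) \<le> K * Hneg_norm ip p n \<Phi>"
    using assms unfolding sym_fun_def by blast
  then show ?thesis using True assms(2) by fastforce
next
  case False
  let ?r = "Hneg_norm ip p n \<Phi>"
  have r: "?r > 0" using False Hneg_norm_nonneg[OF assms(2)] by simp
  let ?\<Phi> = "\<lambda>es. of_real (1 / ?r) * \<Phi> es"
  have "?\<Phi> \<in> Hneg ip p n" "Hneg_norm ip p n ?\<Phi> \<le> 1"
    using Hneg_scale[OF assms(2), of "of_real (1 / ?r)"] r by (auto simp: norm_divide)
  then have "cmod (\<phi> ?\<Phi>) \<le> Hpos_norm ip p n \<phi>"
    unfolding Hpos_norm_def by (intro cSup_upper Hpos_norm_set[OF assms(1)]) auto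
  moreover have "cmod (\<phi> ?\<Phi>) = cmod (\<phi> \<Phi>) / ?r"
    using sym_fun_scale_arg[OF assms, of "of_real (1 / ?r)"] r by (simp add: norm_mult norm_divide)
  ultimately have "cmod (\<phi> \<Phi>) / ?r \<le> Hpos_norm ip p n \<phi>" by linarith
  then show ?thesis using r by (simp add: pos_divide_le_eq)
qed

lemma Hpos_normI:
  assumes "\<And>\<Phi>. \<Phi> \<in> Hneg ip p n \<Longrightarrow> cmod (\<phi> \<Phi>) \<le> K * Hneg_norm ip p n \<Phi>" "K \<ge> 0"
  shows "Hpos_norm ip p n \<phi> \<le> K"
  unfolding Hpos_norm_def
proof (rule cSup_least)
  show "{cmod (\<phi> \<Phi>) |\<Phi>. \<Phi> \<in> Hneg ip p n \<and> Hneg_norm ip p n \<Phi> \<le> 1} \<noteq> {}"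
    using Hneg_zero by force
  fix x assume "x \<in> {cmod (\<phi> \<Phi>) |\<Phi>. \<Phi> \<in> Hneg ip p n \<and> Hneg_norm ip p n \<Phi> \<le> 1}"
  then obtain \<Phi> where \<Phi>: "x = cmod (\<phi> \<Phi>)" "\<Phi> \<in> Hneg ip p n" "Hneg_norm ip p n \<Phi> \<le> 1" by auto
  show "x \<le> K" using assms(1)[OF \<Phi>(2)] mult_left_mono[OF \<Phi>(3) assms(2)] \<Phi>(1) by simp
qed

lemma Hpos_norm_cong:
  "(\<And>\<Phi>. \<Phi> \<in> Hneg ip p n \<Longrightarrow> \<phi> \<Phi> = \<psi> \<Phi>) \<Longrightarrow> Hpos_norm ip p n \<phi> = Hpos_norm ip p n \<psi>"
  unfolding Hpos_norm_def by (rule arg_cong[where f = Sup]) (auto, metis)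

lemma sym_fun_cong:
  assumes "\<And>\<Phi>. \<Phi> \<in> Hneg ip p n \<Longrightarrow> \<phi> \<Phi> = \<psi> \<Phi>"
  shows "sym_fun p n \<phi> \<longleftrightarrow> sym_fun p n \<psi>"
  unfolding sym_fun_def using assms Hneg_comb(1) Hneg_permute(1) by auto

lemma sym_fun_comb:
  assumes "sym_fun p n \<phi>" "sym_fun p n \<psi>"
  shows "sym_fun p n (\<lambda>\<Phi>. c * \<phi> \<Phi> + \<psi> \<Phi>)"
    "Hpos_norm ip p n (\<lambda>\<Phi>. c * \<phi> \<Phi> + \<psi> \<Phi>) \<le> cmod c * Hpos_norm ip p n \<phi> + Hpos_norm ip p n \<psi>"
proof -
  let ?K = "cmod c * Hpos_norm ip p n \<phi> + Hpos_norm ip p n \<psi>"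
  have b: "cmod (c * \<phi> \<Phi> + \<psi> \<Phi>) \<le> ?K * Hneg_norm ip p n \<Phi>" if "\<Phi> \<in> Hneg ip p n" for \<Phi>
  proof -
    have "cmod (c * \<phi> \<Phi> + \<psi> \<Phi>) \<le> cmod c * cmod (\<phi> \<Phi>) + cmod (\<psi> \<Phi>)"
      by (metis norm_mult norm_triangle_ineq)
    also have "\<dots> \<le> cmod c * (Hpos_norm ip p n \<phi> * Hneg_norm ip p n \<Phi>) + Hpos_norm ip p n \<psi> * Hneg_norm ip p n \<Phi>"
      by (intro add_mono mult_left_mono Hpos_norm_bound assms that) auto
    finally show ?thesis by (simp add: algebra_simps)
  qed
  show "Hpos_norm ip p n (\<lambda>\<Phi>. c * \<phi> \<Phi> + \<psi> \<Phi>) \<le> ?K"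
    by (rule Hpos_normI[OF b]) (use Hpos_norm_nonneg assms in auto)
  show "sym_fun p n (\<lambda>\<Phi>. c * \<phi> \<Phi> + \<psi> \<Phi>)"
    unfolding sym_fun_def
  proof (intro conjI ballI allI impI)
    show "\<exists>K. \<forall>\<Phi>\<in>Hneg ip p n. cmod (c * \<phi> \<Phi> + \<psi> \<Phi>) \<le> K * Hneg_norm ip p n \<Phi>"
      using b by blast
  next
    fix \<Phi> \<Psi> d assume "\<Phi> \<in> Hneg ip p n" "\<Psi> \<in> Hneg ip p n"
    then show "c * \<phi> (\<lambda>es. d * \<Phi> es + \<Psi> es) + \<psi> (\<lambda>es. d * \<Phi> es + \<Psi> es)
        = d * (c * \<phi> \<Phi> + \<psi> \<Phi>) + (c * \<phi> \<Psi> + \<psi> \<Psi>)"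
      using sym_fun_comb_arg[OF assms(1), of \<Phi> \<Psi> d] sym_fun_comb_arg[OF assms(2), of \<Phi> \<Psi> d]
      by (simp only: mult_ac distrib_left add_ac)
  qed (simp add: sym_fun_permute[OF assms(1)] sym_fun_permute[OF assms(2)])
qed

lemma sym_fun_zero: "sym_fun p n (\<lambda>\<Phi>. 0)"
  by (auto simp: sym_fun_def intro: exI[of _ 0])

lemma Hpos_norm_zero: "Hpos_norm ip p n (\<lambda>\<Phi>. 0) = 0"
proof (rule order.antisym)
  show "Hpos_norm ip p n (\<lambda>\<Phi>. 0) \<le> 0" by (rule Hpos_normI) auto
qed (rule Hpos_norm_nonneg[OF sym_fun_zero])

lemma Hpos_sym_fun: "\<phi> \<in> Hpos ip p n \<Longrightarrow> sym_fun p n \<phi>"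
  by (simp add: Hpos_def sym_functional_def sym_fun_def)

lemma HposI: "sym_fun p n \<phi> \<Longrightarrow> (\<And>\<Phi>. \<Phi> \<notin> Hneg ip p n \<Longrightarrow> \<phi> \<Phi> = 0) \<Longrightarrow> \<phi> \<in> Hpos ip p n"
  by (simp add: Hpos_def sym_functional_def sym_fun_def)

lemma Hpos_off: "\<phi> \<in> Hpos ip p n \<Longrightarrow> \<Phi> \<notin> Hneg ip p n \<Longrightarrow> \<phi> \<Phi> = 0"
  by (simp add: Hpos_def sym_functional_def)

lemma Hneg_dual_tensors: "\<Phi> \<in> Hneg ip p n \<Longrightarrow> \<Phi> \<in> dual_tensors ip n"
  by (auto simp: dual_tensors_def)

lemma sym_tensors_sym_fun: "\<phi> \<in> sym_tensors ip n \<Longrightarrow> sym_fun p n \<phi>"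
  unfolding sym_tensors_def sym_functional_def sym_fun_def using Hneg_dual_tensors by blast

lemma dual_tensors_common:
  assumes "\<Phi> \<in> dual_tensors ip n" "\<Psi> \<in> dual_tensors ip n"
  obtains p where "\<Phi> \<in> Hneg ip p n" "\<Psi> \<in> Hneg ip p n"
proof -
  obtain p p' where "\<Phi> \<in> Hneg ip p n" "\<Psi> \<in> Hneg ip p' n" using assms by (auto simp: dual_tensors_def)
  then show ?thesis using that[of "max p p'"] Hneg_mono(1) by (meson max.cobounded1 max.cobounded2)
qed

lemma sym_tensorsI:
  assumes "\<And>p. sym_fun p n \<phi>" "\<And>\<Phi>. \<Phi> \<notin> dual_tensors ip n \<Longrightarrow> \<phi> \<Phi> = 0"
  shows "\<phi> \<in> sym_tensors ip n"
proof -
  have "\<phi> (\<lambda>es. c * \<Phi> es + \<Psi> es) = c * \<phi> \<Phi> + \<phi> \<Psi>"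
    if "\<Phi> \<in> dual_tensors ip n" "\<Psi> \<in> dual_tensors ip n" for \<Phi> \<Psi> c
    using dual_tensors_common[OF that] sym_fun_comb_arg[OF assms(1)] by metis
  moreover have "\<phi> (permute_form n \<pi> \<Phi>) = \<phi> \<Phi>"
    if "\<Phi> \<in> dual_tensors ip n" "\<pi> permutes {..<n}" for \<Phi> \<pi>
    using that sym_fun_permute[OF assms(1)] by (auto simp: dual_tensors_def)
  moreover have "\<exists>K. \<forall>\<Phi>\<in>Hneg ip p n. cmod (\<phi> \<Phi>) \<le> K * Hneg_norm ip p n \<Phi>" for p
    using assms(1)[of p] by (simp add: sym_fun_def)
  ultimately show ?thesis using assms(2) by (simp add: sym_tensors_def sym_functional_def)
qed

lemma sym_tensors_off: "\<phi> \<in> sym_tensors ip n \<Longrightarrow> \<Phi> \<notin> dual_tensors ip n \<Longrightarrow> \<phi> \<Phi> = 0"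
  by (simp add: sym_tensors_def sym_functional_def)

lemma sym_tensors_comb:
  "\<phi> \<in> sym_tensors ip n \<Longrightarrow> \<psi> \<in> sym_tensors ip n \<Longrightarrow> (\<lambda>\<Phi>. c * \<phi> \<Phi> + \<psi> \<Phi>) \<in> sym_tensors ip n"
  by (rule sym_tensorsI) (auto intro: sym_fun_comb sym_tensors_sym_fun simp: sym_tensors_off)

lemma sym_tensors_zero: "(\<lambda>\<Phi>. 0) \<in> sym_tensors ip n"
  by (rule sym_tensorsI) (auto intro: sym_fun_zero)

lemma elem_tensor_perm_invariant:
  assumes "sym_fun p n \<phi>" "mset cs = mset ds" "length ds = n"
  shows "\<phi> (elem_tensor p cs) = \<phi> (elem_tensor p ds)"
proof -
  obtain \<pi> where \<pi>: "\<pi> permutes {..<length ds}" "permute_list \<pi> ds = cs"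
    using mset_eq_permutation[OF assms(2)] .
  have "elem_tensor p cs = permute_form n (inv \<pi>) (elem_tensor p ds)"
    using elem_tensor_permute[OF \<pi>(1), of p] \<pi>(2) assms(3) by simp
  then show ?thesis
    using sym_fun_permute[OF assms(1) elem_tensor_Hneg[OF assms(3)] permutes_inv] \<pi>(1) assms(3) by simp
qed

lemma elem_tensor_Cons: "elem_tensor p (c # cs) (z # zs) = cext (ip p c) z * elem_tensor p cs zs" "elem_tensor p (c # cs) [] = 0"
  by (simp_all add: elem_tensor_def)

text \<open>The density of powers, in dual form. Polarization in the vectors \<open>e\<close> passes
  from powers to elementary tensors; projections approximate \<open>\<Phi>\<close> by combinations
  of these, and boundedness passes to the limit.\<close>

lemma sym_fun_zero_of_powers:
  assumes \<phi>: "sym_fun p n \<phi>" and diag: "\<And>e. \<phi> (form_power n (cext (ip p e))) = 0"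
    and \<Phi>: "\<Phi> \<in> Hneg ip p n"
  shows "\<phi> \<Phi> = 0"
proof -
  have e0: "\<phi> (elem_tensor p cs) = 0" if "length cs = n" for cs
  proof (cases n)
    case 0
    then show ?thesis using that diag[of undefined] by (simp add: elem_tensor_replicate[symmetric])
  next
    case (Suc m)
    \<comment> \<open>The cut-off by length lets the symmetry hypothesis of the polarization lemma
      hold for all lists, not only those of length \<open>n\<close>.\<close>
    define F where "F cs = (if length cs = n then \<phi> (elem_tensor p cs) else 0)" for cs
    have "F cs = 0"
    proof (rule polarization_zero[where n = m])
      show "F ((x + y) # zs) = F (x # zs) + F (y # zs)" if "length zs = m" for zs x y
      proof -
        have "elem_tensor p ((x + y) # zs) ws = elem_tensor p (x # zs) ws + elem_tensor p (y # zs) ws" for ws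
          by (cases ws) (auto simp: elem_tensor_Cons cext_def ip_add complex_eq_iff algebra_simps)
        then have "elem_tensor p ((x + y) # zs) = (\<lambda>ws. elem_tensor p (x # zs) ws + elem_tensor p (y # zs) ws)" by auto
        then show ?thesis
          using that Suc sym_fun_add_arg[OF \<phi> elem_tensor_Hneg elem_tensor_Hneg] by (simp add: F_def)
      qed
      show "F ((c *\<^sub>R x) # zs) = of_real c * F (x # zs)" if "length zs = m" for zs c x
      proof -
        have "elem_tensor p ((c *\<^sub>R x) # zs) ws = of_real c * elem_tensor p (x # zs) ws" for ws
          by (cases ws) (auto simp: elem_tensor_Cons cext_def ip_scaleR complex_eq_iff algebra_simps)
        then have "elem_tensor p ((c *\<^sub>R x) # zs) = (\<lambda>ws. of_real c * elem_tensor p (x # zs) ws)" by auto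
        then show ?thesis
          using that Suc sym_fun_scale_arg[OF \<phi> elem_tensor_Hneg] by (simp add: F_def)
      qed
      show "F xs = F ys" if "mset xs = mset ys" for xs ys
        using elem_tensor_perm_invariant[OF \<phi> that] mset_eq_length[OF that] by (simp add: F_def)
      show "F (replicate (Suc m) x) = 0" for x
        using diag[of x] Suc unfolding F_def elem_tensor_replicate by simp
    qed (use that Suc in auto)
    then show ?thesis using that by (simp add: F_def)
  qed
  have small: "cmod (\<phi> \<Phi>) \<le> 0 + e" if "e > 0" for e
  proof -
    \<comment> \<open>The added 1 allows division when the norm is 0.\<close>
    define K where "K = Hpos_norm ip p n \<phi> + 1"
    have K: "K > 0" using Hpos_norm_nonneg[OF \<phi>] by (simp add: K_def)
    have "(e / K)\<^sup>2 > 0" using that K by simp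
    then obtain C where C: "finite C" "orthonormal ip p C" "tsum C n \<Phi> > (Hneg_norm ip p n \<Phi>)\<^sup>2 - (e / K)\<^sup>2"
      using Hneg_tsum_approx[OF \<Phi>] by blast
    have "\<phi> (proj p n C \<Phi>) = (\<Sum>cs\<in>tuples C n. \<Phi> (embed cs) * \<phi> (elem_tensor p cs))"
      unfolding proj_def by (rule sym_fun_sum_arg[OF \<phi>]) (auto intro: elem_tensor_Hneg length_tuples)
    also have "\<dots> = 0" by (rule sum.neutral) (auto simp: e0 length_tuples)
    finally have "\<phi> \<Phi> = \<phi> (\<lambda>zs. \<Phi> zs - proj p n C \<Phi> zs)"
      using sym_fun_diff_arg[OF \<phi> \<Phi>, of "proj p n C \<Phi>"] Hneg_elem_tensor_sum(1)[OF C(1,2)]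
      by (simp add: proj_def)
    then have "cmod (\<phi> \<Phi>) \<le> Hpos_norm ip p n \<phi> * Hneg_norm ip p n (\<lambda>zs. \<Phi> zs - proj p n C \<Phi> zs)"
      using Hpos_norm_bound[OF \<phi> proj_approx(1)[OF \<Phi> C(1,2)]] by simp
    also have "\<dots> \<le> K * (e / K)"
    proof (rule mult_mono)
      have "(Hneg_norm ip p n (\<lambda>zs. \<Phi> zs - proj p n C \<Phi> zs))\<^sup>2 \<le> (e / K)\<^sup>2"
        using proj_approx(2)[OF \<Phi> C(1,2)] C(3) by simp
      then show "Hneg_norm ip p n (\<lambda>zs. \<Phi> zs - proj p n C \<Phi> zs) \<le> e / K"
        by (rule power2_le_imp_le) (use that K in auto)
    qed (use K Hneg_norm_nonneg[OF proj_approx(1)[OF \<Phi> C(1,2)]] in \<open>auto simp: K_def\<close>)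
    finally show ?thesis using K by simp
  qed
  then have "cmod (\<phi> \<Phi>) \<le> 0" by (rule field_le_epsilon)
  then show ?thesis by simp
qed

text \<open>\<open>\<phi>\<close> composed with the projection onto \<open>C\<close>. Only values of
  the form on vectors from N enter, so this makes sense for dual tensors of every level even if
  \<open>\<phi>\<close> itself lives at level \<open>p\<close> only.\<close>

definition finite_part :: "nat \<Rightarrow> nat \<Rightarrow> 'n set \<Rightarrow> 'n tensor \<Rightarrow> 'n tensor" where
  "finite_part p n C \<phi> = (\<lambda>\<Phi>. if \<Phi> \<in> dual_tensors ip n
     then \<Sum>cs\<in>tuples C n. \<Phi> (embed cs) * \<phi> (elem_tensor p cs) else 0)"

lemma finite_part_sym_tensors:
  assumes \<phi>: "sym_fun p n \<phi>" and C: "finite C"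
  shows "finite_part p n C \<phi> \<in> sym_tensors ip n"
proof (rule sym_tensorsI)
  fix r
  let ?S = "\<lambda>\<Phi> :: 'n form. \<Sum>cs\<in>tuples C n. \<Phi> (embed cs) * \<phi> (elem_tensor p cs)"
  have "sym_fun r n ?S"
    unfolding sym_fun_def
  proof (intro conjI ballI allI impI)
    show "?S (\<lambda>es. c * \<Phi> es + \<Psi> es) = c * ?S \<Phi> + ?S \<Psi>" for c and \<Phi> \<Psi> :: "'n form"
      by (simp add: sum_distrib_left sum.distrib[symmetric] algebra_simps)
    fix \<Phi> :: "'n form" and \<pi> assume \<pi>: "\<pi> permutes {..<n}"
    have "?S (permute_form n \<pi> \<Phi>) = (\<Sum>cs\<in>tuples C n. \<Phi> (embed (permute_list \<pi> cs)) * \<phi> (elem_tensor p (permute_list \<pi> cs)))"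
    proof (rule sum.cong[OF refl])
      fix cs assume "cs \<in> tuples C n"
      then have l: "length cs = n" by (rule length_tuples)
      have "\<phi> (elem_tensor p (permute_list \<pi> cs)) = \<phi> (elem_tensor p cs)"
        by (rule elem_tensor_perm_invariant[OF \<phi>]) (use \<pi> l in auto)
      moreover have "permute_form n \<pi> \<Phi> (embed cs) = \<Phi> (embed (permute_list \<pi> cs))"
        using \<pi> l permute_list_map[of \<pi> cs "\<lambda>e. (e, 0::'n)"] by (simp add: permute_form_def)
      ultimately show "permute_form n \<pi> \<Phi> (embed cs) * \<phi> (elem_tensor p cs)
          = \<Phi> (embed (permute_list \<pi> cs)) * \<phi> (elem_tensor p (permute_list \<pi> cs))" by simp
    qed
    also have "\<dots> = ?S \<Phi>" by (rule sum_tuples_permute[OF \<pi>])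
    finally show "?S (permute_form n \<pi> \<Phi>) = ?S \<Phi>" .
  next
    let ?K = "\<Sum>cs\<in>tuples C n. (\<Prod>z\<leftarrow>embed cs. cnorm ip r z) * cmod (\<phi> (elem_tensor p cs))"
    have "cmod (?S \<Phi>) \<le> ?K * Hneg_norm ip r n \<Phi>" if "\<Phi> \<in> Hneg ip r n" for \<Phi>
      unfolding sum_distrib_right
    proof (rule sum_norm_le)
      fix cs assume "cs \<in> tuples C n"
      then have "cmod (\<Phi> (embed cs)) \<le> (\<Prod>z\<leftarrow>embed cs. cnorm ip r z) * Hneg_norm ip r n \<Phi>"
        by (intro Hneg_eval_le that) (simp add: length_tuples)
      from mult_right_mono[OF this, of "cmod (\<phi> (elem_tensor p cs))"]
      show "cmod (\<Phi> (embed cs) * \<phi> (elem_tensor p cs))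
          \<le> (\<Prod>z\<leftarrow>embed cs. cnorm ip r z) * cmod (\<phi> (elem_tensor p cs)) * Hneg_norm ip r n \<Phi>"
        by (simp add: norm_mult mult_ac)
    qed
    then show "\<exists>K. \<forall>\<Phi>\<in>Hneg ip r n. cmod (?S \<Phi>) \<le> K * Hneg_norm ip r n \<Phi>" by blast
  qed
  then show "sym_fun r n (finite_part p n C \<phi>)"
    using sym_fun_cong[of r n "finite_part p n C \<phi>" ?S] by (simp add: finite_part_def Hneg_dual_tensors)
qed (simp add: finite_part_def)

text \<open>\<open>s C\<close> is the squared norm of the part of \<open>\<phi>\<close> over
  \<open>C\<close>. These numbers are bounded, and once \<open>s C\<close> is within
  \<open>e\<^sup>2\<close> of their supremum, the coordinates of \<open>\<phi>\<close> outside
  \<open>C\<close> contribute at most \<open>e\<close>.\<close>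

lemma Hpos_dense:
  assumes \<phi>: "sym_fun p n \<phi>" and e: "e > 0"
  shows "\<exists>\<psi>\<in>sym_tensors ip n. Hpos_norm ip p n (\<lambda>\<Phi>. \<phi> \<Phi> - \<psi> \<Phi>) \<le> e"
proof -
  define s where "s C = (\<Sum>cs\<in>tuples C n. (cmod (\<phi> (elem_tensor p cs)))\<^sup>2)" for C
  let ?N = "Hpos_norm ip p n \<phi>"
  let ?O = "{C. finite C \<and> orthonormal ip p C}"
  have s0: "s C \<ge> 0" for C unfolding s_def by (rule sum_nonneg) simp
  have N0: "?N \<ge> 0" by (rule Hpos_norm_nonneg[OF \<phi>])
  have bound: "s C \<le> ?N\<^sup>2" if C: "finite C" "orthonormal ip p C" for C
  proof -
    \<comment> \<open>Testing \<open>\<phi>\<close> on the conjugates of its own coordinates gives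
      \<open>s C\<close> on the left and only \<open>sqrt (s C)\<close> in the norm.\<close>
    define \<Psi> where "\<Psi> = (\<lambda>zs. \<Sum>cs\<in>tuples C n. cnj (\<phi> (elem_tensor p cs)) * elem_tensor p cs zs)"
    have "\<phi> \<Psi> = (\<Sum>cs\<in>tuples C n. cnj (\<phi> (elem_tensor p cs)) * \<phi> (elem_tensor p cs))"
      unfolding \<Psi>_def by (rule sym_fun_sum_arg[OF \<phi>]) (auto intro: elem_tensor_Hneg length_tuples)
    also have "\<dots> = of_real (s C)"
      by (simp add: s_def complex_norm_square[symmetric] mult.commute del: of_real_power)
    finally have "s C = cmod (\<phi> \<Psi>)" using s0 by simp
    also have "\<dots> \<le> ?N * Hneg_norm ip p n \<Psi>"
      unfolding \<Psi>_def by (rule Hpos_norm_bound[OF \<phi> Hneg_elem_tensor_sum(1)[OF C]])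
    also have "\<dots> \<le> ?N * sqrt (s C)"
      using Hneg_elem_tensor_sum(2)[OF C, of n "\<lambda>cs. cnj (\<phi> (elem_tensor p cs))"]
      by (intro mult_left_mono N0) (simp add: \<Psi>_def s_def)
    finally have "s C \<le> ?N * sqrt (s C)" .
    then have "sqrt (s C) * sqrt (s C) \<le> ?N * sqrt (s C)" using s0 by simp
    then have "sqrt (s C) \<le> ?N" using mult_right_le_imp_le[of "sqrt (s C)" "sqrt (s C)" ?N] s0[of C] N0
      by (cases "s C = 0") auto
    then show ?thesis using s0 by (simp add: sqrt_le_D)
  qed
  have bdd: "bdd_above (s ` ?O)" using bound by (auto intro!: bdd_aboveI[of _ "?N\<^sup>2"])
  have ne: "s ` ?O \<noteq> {}" using orthonormal_empty by blast
  obtain C where C: "finite C" "orthonormal ip p C" "s C > Sup (s ` ?O) - e\<^sup>2"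
    using less_cSupE[OF _ ne, of "Sup (s ` ?O) - e\<^sup>2"] e by auto
  have "cmod (\<phi> \<Phi> - finite_part p n C \<phi> \<Phi>) \<le> e * Hneg_norm ip p n \<Phi>" if \<Phi>: "\<Phi> \<in> Hneg ip p n" for \<Phi>
  proof (rule field_le_epsilon)
    fix h :: real assume h: "h > 0"
    define K where "K = ?N + 1"
    have K: "K > 0" using N0 by (simp add: K_def)
    have "(h / K)\<^sup>2 > 0" using h K by simp
    then obtain A where A: "finite A" "orthonormal ip p A" "tsum A n \<Phi> > (Hneg_norm ip p n \<Phi>)\<^sup>2 - (h / K)\<^sup>2"
      using Hneg_tsum_approx[OF \<Phi>] by blast
    \<comment> \<open>\<open>C\<close> determines the finite part and \<open>A\<close> nearly
      exhausts \<open>\<Phi>\<close>; over the common extension \<open>D\<close> the error splits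
      into a remainder of size \<open>h\<close> and the coordinates off \<open>C\<close>.\<close>
    obtain D where D: "finite D" "orthonormal ip p D" "C \<subseteq> D" "A \<subseteq> span D"
      using orthonormal_extend[OF A(1) C(1,2)] by auto
    have "tsum A n \<Phi> \<le> tsum D n \<Phi>"
      by (rule tsum_le[OF Hneg_multilinear[OF \<Phi>] D(1,2) A(1,2) _ D(4)]) simp
    then have tD: "(Hneg_norm ip p n \<Phi>)\<^sup>2 - tsum D n \<Phi> \<le> (h / K)\<^sup>2" using A(3) by simp
    let ?g = "\<lambda>cs. \<Phi> (embed cs) * \<phi> (elem_tensor p cs)"
    have pD: "\<phi> (proj p n D \<Phi>) = (\<Sum>cs\<in>tuples D n. ?g cs)"
      unfolding proj_def by (rule sym_fun_sum_arg[OF \<phi>]) (auto intro: elem_tensor_Hneg length_tuples)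
    have "proj p n D \<Phi> \<in> Hneg ip p n" unfolding proj_def by (rule Hneg_elem_tensor_sum(1)[OF D(1,2)])
    then have "\<phi> \<Phi> = \<phi> (\<lambda>zs. \<Phi> zs - proj p n D \<Phi> zs) + (\<Sum>cs\<in>tuples D n. ?g cs)"
      using sym_fun_diff_arg[OF \<phi> \<Phi>] pD by simp
    moreover have "finite_part p n C \<phi> \<Phi> = (\<Sum>cs\<in>tuples C n. ?g cs)"
      using Hneg_dual_tensors[OF \<Phi>] by (simp add: finite_part_def)
    moreover have "(\<Sum>cs\<in>tuples D n. ?g cs) = (\<Sum>cs\<in>tuples D n - tuples C n. ?g cs) + (\<Sum>cs\<in>tuples C n. ?g cs)"
      by (rule sum.subset_diff) (use D tuples_mono[OF D(3)] in auto)
    ultimately have "\<phi> \<Phi> - finite_part p n C \<phi> \<Phi>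
        = \<phi> (\<lambda>zs. \<Phi> zs - proj p n D \<Phi> zs) + (\<Sum>cs\<in>tuples D n - tuples C n. ?g cs)" by simp
    then have "cmod (\<phi> \<Phi> - finite_part p n C \<phi> \<Phi>)
        \<le> cmod (\<phi> (\<lambda>zs. \<Phi> zs - proj p n D \<Phi> zs)) + cmod (\<Sum>cs\<in>tuples D n - tuples C n. ?g cs)"
      by (simp add: norm_triangle_ineq)
    also have "cmod (\<phi> (\<lambda>zs. \<Phi> zs - proj p n D \<Phi> zs)) \<le> K * (h / K)"
    proof -
      have "cmod (\<phi> (\<lambda>zs. \<Phi> zs - proj p n D \<Phi> zs)) \<le> ?N * Hneg_norm ip p n (\<lambda>zs. \<Phi> zs - proj p n D \<Phi> zs)"
        by (rule Hpos_norm_bound[OF \<phi> proj_approx(1)[OF \<Phi> D(1,2)]])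
      also have "\<dots> \<le> K * (h / K)"
      proof (rule mult_mono)
        have "(Hneg_norm ip p n (\<lambda>zs. \<Phi> zs - proj p n D \<Phi> zs))\<^sup>2 \<le> (h / K)\<^sup>2"
          using proj_approx(2)[OF \<Phi> D(1,2)] tD by simp
        then show "Hneg_norm ip p n (\<lambda>zs. \<Phi> zs - proj p n D \<Phi> zs) \<le> h / K"
          by (rule power2_le_imp_le) (use h K in auto)
      qed (use K Hneg_norm_nonneg[OF proj_approx(1)[OF \<Phi> D(1,2)]] in \<open>auto simp: K_def\<close>)
      finally show ?thesis .
    qed
    also have "cmod (\<Sum>cs\<in>tuples D n - tuples C n. ?g cs) \<le> Hneg_norm ip p n \<Phi> * e"
    proof (rule power2_le_imp_le)
      let ?I = "tuples D n - tuples C n"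
      have "cmod (\<Sum>cs\<in>?I. ?g cs) \<le> (\<Sum>cs\<in>?I. cmod (\<Phi> (embed cs)) * cmod (\<phi> (elem_tensor p cs)))"
        using norm_sum[of ?g ?I] by (simp add: norm_mult)
      then have "(cmod (\<Sum>cs\<in>?I. ?g cs))\<^sup>2 \<le> (\<Sum>cs\<in>?I. cmod (\<Phi> (embed cs)) * cmod (\<phi> (elem_tensor p cs)))\<^sup>2"
        by (rule power_mono) simp
      also have "\<dots> \<le> (\<Sum>cs\<in>?I. (cmod (\<Phi> (embed cs)))\<^sup>2) * (\<Sum>cs\<in>?I. (cmod (\<phi> (elem_tensor p cs)))\<^sup>2)"
        by (rule Cauchy_Schwarz_ineq_sum)
      also have "\<dots> \<le> (Hneg_norm ip p n \<Phi>)\<^sup>2 * e\<^sup>2"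
      proof (rule mult_mono)
        have "(\<Sum>cs\<in>?I. (cmod (\<Phi> (embed cs)))\<^sup>2) \<le> tsum D n \<Phi>"
          by (rule sum_mono2) (use D in auto)
        then show "(\<Sum>cs\<in>?I. (cmod (\<Phi> (embed cs)))\<^sup>2) \<le> (Hneg_norm ip p n \<Phi>)\<^sup>2"
          using tsum_le_norm[OF \<Phi> D(1,2)] by simp
        \<comment> \<open>What \<open>D\<close> adds to \<open>C\<close> is squeezed between
          \<open>s C\<close> and the supremum.\<close>
        have "s D = (\<Sum>cs\<in>?I. (cmod (\<phi> (elem_tensor p cs)))\<^sup>2) + s C"
          unfolding s_def by (rule sum.subset_diff) (use D tuples_mono[OF D(3)] in auto)
        moreover have "s D \<le> Sup (s ` ?O)" by (rule cSup_upper[OF _ bdd]) (use D in auto)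
        ultimately show "(\<Sum>cs\<in>?I. (cmod (\<phi> (elem_tensor p cs)))\<^sup>2) \<le> e\<^sup>2" using C(3) by simp
      qed (auto intro: sum_nonneg)
      finally show "(cmod (\<Sum>cs\<in>?I. ?g cs))\<^sup>2 \<le> (Hneg_norm ip p n \<Phi> * e)\<^sup>2"
        by (simp add: power_mult_distrib)
    qed (use Hneg_norm_nonneg[OF \<Phi>] e in simp)
    finally show "cmod (\<phi> \<Phi> - finite_part p n C \<phi> \<Phi>) \<le> e * Hneg_norm ip p n \<Phi> + h"
      using K by (simp add: mult.commute)
  qed
  then have "Hpos_norm ip p n (\<lambda>\<Phi>. \<phi> \<Phi> - finite_part p n C \<phi> \<Phi>) \<le> e"
    by (rule Hpos_normI) (use e in auto)
  then show ?thesis using finite_part_sym_tensors[OF \<phi> C(1)] by blast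
qed

end

lemma sum_power2_le: "(x + y :: real)\<^sup>2 \<le> 2 * x\<^sup>2 + 2 * y\<^sup>2"
  using sum_squares_bound[of x y] by (simp add: power2_sum)

text \<open>To be used with \<open>d k\<close> the distance of the \<open>k\<close>-th approximant
  from the element being approximated.\<close>

lemma Cauchy_of_bound:
  fixes x :: "nat \<Rightarrow> complex"
  assumes "d \<longlonglongrightarrow> (0::real)" "\<And>k l. cmod (x k - x l) \<le> C * (d k + d l)"
  shows "Cauchy x"
proof (rule CauchyI)
  fix e :: real assume e: "e > 0"
  have "(\<lambda>k. C * d k) \<longlonglongrightarrow> 0" using tendsto_mult_right_zero[OF assms(1)] .
  then obtain M where M: "\<forall>k\<ge>M. norm (C * d k - 0) < e / 2" using LIMSEQ_D[of _ 0 "e / 2"] e by fastforce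
  have "norm (x m - x n) < e" if "m \<ge> M" "n \<ge> M" for m n
  proof -
    have "norm (x m - x n) \<le> C * d m + C * d n" using assms(2)[of m n] by (simp add: distrib_left)
    then show ?thesis using M[rule_format, OF that(1)] M[rule_format, OF that(2)] by (auto simp: abs_less_iff)
  qed
  then show "\<exists>M. \<forall>m\<ge>M. \<forall>n\<ge>M. norm (x m - x n) < e" by blast
qed

section \<open>The spaces of formal series\<close>

context nuclear_triple
begin

abbreviation kcomb :: "complex \<Rightarrow> (nat \<Rightarrow> 'n tensor) \<Rightarrow> (nat \<Rightarrow> 'n tensor) \<Rightarrow> nat \<Rightarrow> 'n tensor" where
  "kcomb c f g \<equiv> (\<lambda>n \<Phi>. c * f n \<Phi> + g n \<Phi>)"

abbreviation kdiff :: "(nat \<Rightarrow> 'n tensor) \<Rightarrow> (nat \<Rightarrow> 'n tensor) \<Rightarrow> nat \<Rightarrow> 'n tensor" where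
  "kdiff f g \<equiv> (\<lambda>n \<Phi>. f n \<Phi> - g n \<Phi>)"

text \<open>The square of \<open>pq_norm\<close>. Working with squares replaces Minkowski's
  inequality for infinite sums by a termwise estimate, at the price of a factor 2.\<close>

definition pqN :: "nat \<Rightarrow> nat \<Rightarrow> (nat \<Rightarrow> 'n tensor) \<Rightarrow> real" where
  "pqN p q f = (\<Sum>n. pq_terms ip p q f n)"

text \<open>Membership in (H_pq) up to the convention on values off \<open>Hneg\<close>, so that
  kernels of test functions qualify at every level without restriction.\<close>

definition pqfin :: "nat \<Rightarrow> nat \<Rightarrow> (nat \<Rightarrow> 'n tensor) \<Rightarrow> bool" where
  "pqfin p q f \<longleftrightarrow> (\<forall>n. sym_fun p n (f n)) \<and> summable (pq_terms ip p q f)"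

lemma pq_terms_nonneg: "pq_terms ip p q f n \<ge> 0"
  by (simp add: pq_terms_def)

lemma pqN_nonneg: "pqfin p q f \<Longrightarrow> pqN p q f \<ge> 0"
  unfolding pqN_def pqfin_def by (intro suminf_nonneg) (auto simp: pq_terms_nonneg)

lemma pq_norm_eq: "pq_norm ip p q f = sqrt (pqN p q f)"
  by (simp add: pq_norm_def pqN_def)

lemma pq_terms_comb:
  assumes "sym_fun p n (f n)" "sym_fun p n (g n)"
  shows "pq_terms ip p q (kcomb c f g) n \<le> 2 * (cmod c)\<^sup>2 * pq_terms ip p q f n + 2 * pq_terms ip p q g n"
proof -
  let ?H = "\<lambda>f. Hpos_norm ip p n (f n)"
  have "(?H (kcomb c f g))\<^sup>2 \<le> (cmod c * ?H f + ?H g)\<^sup>2"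
    by (intro power_mono sym_fun_comb(2) Hpos_norm_nonneg sym_fun_comb(1) assms)
  also have "\<dots> \<le> 2 * (cmod c * ?H f)\<^sup>2 + 2 * (?H g)\<^sup>2" by (rule sum_power2_le)
  finally have "(fact n)\<^sup>2 * 2 ^ (q * n) * (?H (kcomb c f g))\<^sup>2
      \<le> (fact n)\<^sup>2 * 2 ^ (q * n) * (2 * (cmod c * ?H f)\<^sup>2 + 2 * (?H g)\<^sup>2)"
    by (rule mult_left_mono) simp
  then show ?thesis unfolding pq_terms_def by (simp add: power_mult_distrib algebra_simps)
qed

lemma pqfin_comb:
  assumes "pqfin p q f" "pqfin p q g"
  shows "pqfin p q (kcomb c f g)" "pqN p q (kcomb c f g) \<le> 2 * (cmod c)\<^sup>2 * pqN p q f + 2 * pqN p q g"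
proof -
  have le: "pq_terms ip p q (kcomb c f g) n \<le> 2 * (cmod c)\<^sup>2 * pq_terms ip p q f n + 2 * pq_terms ip p q g n" for n
    using assms by (intro pq_terms_comb) (auto simp: pqfin_def)
  have s: "summable (\<lambda>n. 2 * (cmod c)\<^sup>2 * pq_terms ip p q f n + 2 * pq_terms ip p q g n)"
    using assms by (intro summable_add summable_mult) (auto simp: pqfin_def)
  have s': "summable (pq_terms ip p q (kcomb c f g))"
    by (rule summable_comparison_test'[OF s, of 0]) (use le pq_terms_nonneg in auto)
  then show "pqfin p q (kcomb c f g)"
    using assms sym_fun_comb(1) by (auto simp: pqfin_def)
  have "pqN p q (kcomb c f g) \<le> (\<Sum>n. 2 * (cmod c)\<^sup>2 * pq_terms ip p q f n + 2 * pq_terms ip p q g n)"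
    unfolding pqN_def by (rule suminf_le[OF le s' s])
  also have "\<dots> = 2 * (cmod c)\<^sup>2 * pqN p q f + 2 * pqN p q g"
    using assms unfolding pqN_def pqfin_def
    by (subst suminf_add[symmetric]) (auto intro: summable_mult simp: suminf_mult)
  finally show "pqN p q (kcomb c f g) \<le> 2 * (cmod c)\<^sup>2 * pqN p q f + 2 * pqN p q g" .
qed

lemma kdiff_eq: "kdiff f g = kcomb (-1) g f"
  by (intro ext) simp

lemma pqfin_diff:
  assumes "pqfin p q f" "pqfin p q g"
  shows "pqfin p q (kdiff f g)" "pqN p q (kdiff f g) \<le> 2 * pqN p q f + 2 * pqN p q g"
  using pqfin_comb[OF assms(2,1), of "-1"] unfolding kdiff_eq by auto

lemma pqfin_cong:
  assumes "\<And>n \<Phi>. \<Phi> \<in> Hneg ip p n \<Longrightarrow> f n \<Phi> = g n \<Phi>"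
  shows "pqfin p q f \<longleftrightarrow> pqfin p q g" "pqN p q f = pqN p q g"
proof -
  have "pq_terms ip p q f = pq_terms ip p q g"
    unfolding pq_terms_def using Hpos_norm_cong[OF assms] by simp
  then show "pqfin p q f \<longleftrightarrow> pqfin p q g" "pqN p q f = pqN p q g"
    unfolding pqfin_def pqN_def using sym_fun_cong[OF assms] by auto
qed

lemma pqfin_zero: "pqfin p q (\<lambda>n \<Phi>. 0)" "pqN p q (\<lambda>n \<Phi>. 0) = 0"
  by (simp_all add: pqfin_def sym_fun_zero pqN_def pq_terms_def[abs_def] Hpos_norm_zero)

lemma Hpos_norm_scale:
  assumes "sym_fun p n \<phi>"
  shows "Hpos_norm ip p n (\<lambda>\<Phi>. c * \<phi> \<Phi>) = cmod c * Hpos_norm ip p n \<phi>"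
proof (rule order.antisym)
  have le: "Hpos_norm ip p n (\<lambda>\<Phi>. d * \<psi> \<Phi>) \<le> cmod d * Hpos_norm ip p n \<psi>" if "sym_fun p n \<psi>" for d \<psi>
    using sym_fun_comb(2)[OF that sym_fun_zero, of d] Hpos_norm_zero by simp
  show "Hpos_norm ip p n (\<lambda>\<Phi>. c * \<phi> \<Phi>) \<le> cmod c * Hpos_norm ip p n \<phi>" by (rule le[OF assms])
  have s: "sym_fun p n (\<lambda>\<Phi>. c * \<phi> \<Phi>)" using sym_fun_comb(1)[OF assms sym_fun_zero, of c] by simp
  show "cmod c * Hpos_norm ip p n \<phi> \<le> Hpos_norm ip p n (\<lambda>\<Phi>. c * \<phi> \<Phi>)"
  proof (cases "c = 0")
    case False
    have "Hpos_norm ip p n \<phi> = Hpos_norm ip p n (\<lambda>\<Phi>. (1 / c) * (c * \<phi> \<Phi>))" using False by simp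
    also have "\<dots> \<le> cmod (1 / c) * Hpos_norm ip p n (\<lambda>\<Phi>. c * \<phi> \<Phi>)" by (rule le[OF s])
    finally show ?thesis using False by (simp add: norm_divide field_simps)
  qed (simp add: Hpos_norm_zero)
qed

lemma pqN_scale:
  assumes "pqfin p q f"
  shows "pqfin p q (\<lambda>n \<Phi>. c * f n \<Phi>)" "pqN p q (\<lambda>n \<Phi>. c * f n \<Phi>) = (cmod c)\<^sup>2 * pqN p q f"
proof -
  show "pqfin p q (\<lambda>n \<Phi>. c * f n \<Phi>)" using pqfin_comb(1)[OF assms pqfin_zero(1), of c] by simp
  have "pq_terms ip p q (\<lambda>n \<Phi>. c * f n \<Phi>) = (\<lambda>n. (cmod c)\<^sup>2 * pq_terms ip p q f n)"
    using assms unfolding pqfin_def by (auto simp: pq_terms_def Hpos_norm_scale power_mult_distrib)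
  then show "pqN p q (\<lambda>n \<Phi>. c * f n \<Phi>) = (cmod c)\<^sup>2 * pqN p q f"
    using assms unfolding pqN_def pqfin_def by (simp add: suminf_mult)
qed

lemma pq_terms_le_pqN:
  assumes "pqfin p q f"
  shows "pq_terms ip p q f n \<le> pqN p q f"
proof -
  have "sum (pq_terms ip p q f) {n} \<le> suminf (pq_terms ip p q f)"
    using assms unfolding pqfin_def by (intro sum_le_suminf) (auto simp: pq_terms_nonneg)
  then show ?thesis by (simp add: pqN_def)
qed

text \<open>The weight of one term read as decay of that component. From here come the factors
  2^(-q/2) that beat the growth of the moments and make the exponent of the final estimate
  small.\<close>

lemma pqfin_component:
  assumes "pqfin p q f"
  shows "fact n * Hpos_norm ip p n (f n) \<le> sqrt (pqN p q f) * (1 / sqrt (2 ^ q)) ^ n"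
proof -
  let ?H = "Hpos_norm ip p n (f n)"
  have s: "sqrt (2 ^ q) ^ n = sqrt (2 ^ (q * n))" by (simp add: real_sqrt_power power_mult)
  have "(fact n * ?H * sqrt (2 ^ q) ^ n)\<^sup>2 = pq_terms ip p q f n"
    unfolding s pq_terms_def by (simp add: power_mult_distrib)
  also have "\<dots> \<le> pqN p q f" by (rule pq_terms_le_pqN[OF assms])
  finally have "fact n * ?H * sqrt (2 ^ q) ^ n \<le> sqrt (pqN p q f)" by (rule real_le_rsqrt)
  then show ?thesis by (simp add: power_divide field_simps)
qed

lemma pqfin_eval:
  assumes "pqfin p q f" "\<Phi> \<in> Hneg ip p n"
  shows "cmod (f n \<Phi>) \<le> sqrt (pqN p q f) * (1 / sqrt (2 ^ q)) ^ n / fact n * Hneg_norm ip p n \<Phi>"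
proof -
  have "cmod (f n \<Phi>) \<le> Hpos_norm ip p n (f n) * Hneg_norm ip p n \<Phi>"
    using assms by (intro Hpos_norm_bound) (auto simp: pqfin_def)
  also have "Hpos_norm ip p n (f n) \<le> sqrt (pqN p q f) * (1 / sqrt (2 ^ q)) ^ n / fact n"
    using pqfin_component[OF assms(1), of n] by (simp add: field_simps)
  finally show ?thesis using Hneg_norm_nonneg[OF assms(2)] by (simp add: mult_right_mono)
qed

lemma pqfin_eval':
  assumes "pqfin p q f" "\<Phi> \<in> Hneg ip p n"
  shows "cmod (f n \<Phi>) \<le> sqrt (pqN p q f) * Hneg_norm ip p n \<Phi>"
proof -
  have "(1 / sqrt (2 ^ q)) ^ n / fact n \<le> (1::real) / 1"
    by (rule frac_le) (auto intro!: power_le_one simp: field_simps)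
  from mult_left_mono[OF this, of "sqrt (pqN p q f)"] pqN_nonneg[OF assms(1)]
  have "sqrt (pqN p q f) * (1 / sqrt (2 ^ q)) ^ n / fact n \<le> sqrt (pqN p q f)" by simp
  from mult_right_mono[OF this Hneg_norm_nonneg[OF assms(2)]]
  show ?thesis using pqfin_eval[OF assms] by linarith
qed

lemma test_kernels_pqfin: "f \<in> test_kernels ip \<Longrightarrow> pqfin p q f"
  by (auto simp: test_kernels_def pqfin_def sym_tensors_sym_fun)

lemma test_kernelsI:
  "(\<And>n. f n \<in> sym_tensors ip n) \<Longrightarrow> (\<And>p q. pqfin p q f) \<Longrightarrow> f \<in> test_kernels ip"
  by (simp add: test_kernels_def pqfin_def)

lemma test_kernels_comb:
  "f \<in> test_kernels ip \<Longrightarrow> g \<in> test_kernels ip \<Longrightarrow> kcomb c f g \<in> test_kernels ip"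
proof (rule test_kernelsI)
  assume "f \<in> test_kernels ip" "g \<in> test_kernels ip"
  then show "pqfin p q (kcomb c f g)" for p q by (intro pqfin_comb test_kernels_pqfin)
qed (simp add: test_kernels_def sym_tensors_comb)

lemma test_kernels_zero: "(\<lambda>n \<Phi>. 0) \<in> test_kernels ip"
  by (rule test_kernelsI) (auto intro: pqfin_zero sym_tensors_zero)

lemma test_kernels_diff:
  "f \<in> test_kernels ip \<Longrightarrow> g \<in> test_kernels ip \<Longrightarrow> kdiff f g \<in> test_kernels ip"
  unfolding kdiff_eq by (rule test_kernels_comb)

lemma test_kernels_finite:
  assumes "\<And>n. f n \<in> sym_tensors ip n" "\<And>n. n \<ge> N \<Longrightarrow> f n = (\<lambda>\<Phi>. 0)"
  shows "f \<in> test_kernels ip"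
proof (rule test_kernelsI)
  fix p q
  have "summable (pq_terms ip p q f)"
    by (rule summable_finite[of "{..<N}"]) (auto simp: pq_terms_def assms(2) Hpos_norm_zero)
  then show "pqfin p q f" using assms(1) by (simp add: pqfin_def sym_tensors_sym_fun)
qed (rule assms(1))

lemma Hpq_pqfin: "f \<in> Hpq ip p q \<Longrightarrow> pqfin p q f"
  by (simp add: Hpq_def pqfin_def Hpos_sym_fun)

lemma HpqI: "pqfin p q f \<Longrightarrow> (\<And>n \<Phi>. \<Phi> \<notin> Hneg ip p n \<Longrightarrow> f n \<Phi> = 0) \<Longrightarrow> f \<in> Hpq ip p q"
  by (simp add: Hpq_def pqfin_def HposI)

lemma Hpq_off: "f \<in> Hpq ip p q \<Longrightarrow> \<Phi> \<notin> Hneg ip p n \<Longrightarrow> f n \<Phi> = 0"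
  by (auto simp: Hpq_def dest: Hpos_off)

lemma Hpq_comb: "f \<in> Hpq ip p q \<Longrightarrow> g \<in> Hpq ip p q \<Longrightarrow> kcomb c f g \<in> Hpq ip p q"
  by (rule HpqI) (auto intro: pqfin_comb Hpq_pqfin simp: Hpq_off)

lemma res_kernels_pqfin:
  assumes "pqfin p q f"
  shows "res_kernels ip p f \<in> Hpq ip p q" "pqN p q (res_kernels ip p f) = pqN p q f"
proof -
  have *: "pqfin p q (res_kernels ip p f) \<longleftrightarrow> pqfin p q f" "pqN p q (res_kernels ip p f) = pqN p q f"
    by (rule pqfin_cong; simp add: res_kernels_def)+
  show "res_kernels ip p f \<in> Hpq ip p q"
    by (rule HpqI) (use * assms in \<open>auto simp: res_kernels_def\<close>)
  show "pqN p q (res_kernels ip p f) = pqN p q f" by (rule *(2))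
qed

text \<open>Components below some \<open>N\<close> are approximated in the nuclear tensor powers,
  the others dropped. Having finitely many components makes the result summable for all
  \<open>p\<close>, \<open>q\<close> at once.\<close>

lemma pq_dense:
  assumes f: "pqfin p q f" and e: "e > 0"
  shows "\<exists>g\<in>test_kernels ip. pqN p q (kdiff f g) \<le> e"
proof -
  have sf: "sym_fun p n (f n)" for n using f by (simp add: pqfin_def)
  have sum: "summable (pq_terms ip p q f)" using f by (simp add: pqfin_def)
  let ?w = "\<lambda>n. (fact n)\<^sup>2 * 2 ^ (q * n) :: real"
  \<comment> \<open>The admissible weighted squared error in degree \<open>n\<close>; these add up
    to \<open>e / 2\<close>, and the dropped tail takes the other half.\<close>
  let ?b = "\<lambda>n. e / 2 * (1 / 2) ^ Suc n"
  have "\<exists>\<psi>\<in>sym_tensors ip n. Hpos_norm ip p n (\<lambda>\<Phi>. f n \<Phi> - \<psi> \<Phi>) \<le> sqrt (?b n / ?w n)" for n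
    by (rule Hpos_dense[OF sf]) (use e in simp)
  then have "\<forall>n. \<exists>\<psi>. \<psi> \<in> sym_tensors ip n \<and> Hpos_norm ip p n (\<lambda>\<Phi>. f n \<Phi> - \<psi> \<Phi>) \<le> sqrt (?b n / ?w n)"
    by blast
  from choice[OF this] obtain g' where g': "\<And>n. g' n \<in> sym_tensors ip n"
      "\<And>n. Hpos_norm ip p n (\<lambda>\<Phi>. f n \<Phi> - g' n \<Phi>) \<le> sqrt (?b n / ?w n)"
    by blast
  have gw: "?w n * (Hpos_norm ip p n (\<lambda>\<Phi>. f n \<Phi> - g' n \<Phi>))\<^sup>2 \<le> ?b n" for n
  proof -
    have "sym_fun p n (\<lambda>\<Phi>. f n \<Phi> - g' n \<Phi>)"
      using sym_fun_comb(1)[OF sym_tensors_sym_fun[OF g'(1)] sf, where c = "-1"] by simp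
    from power_mono[OF g'(2)[of n] Hpos_norm_nonneg[OF this], of 2]
    have "(Hpos_norm ip p n (\<lambda>\<Phi>. f n \<Phi> - g' n \<Phi>))\<^sup>2 \<le> ?b n / ?w n" using e by simp
    then show ?thesis by (simp add: field_simps)
  qed
  obtain N where N: "norm (\<Sum>n. pq_terms ip p q f (n + N)) < e / 2"
    using suminf_exist_split[OF _ sum, of "e / 2"] e by auto
  define g where "g n = (if n < N then g' n else (\<lambda>\<Phi>. 0))" for n
  have gt: "g \<in> test_kernels ip"
    by (rule test_kernels_finite[of _ N]) (auto simp: g_def g' sym_tensors_zero)
  let ?t = "\<lambda>n. if n < N then 0 else pq_terms ip p q f n"
  have le: "pq_terms ip p q (kdiff f g) n \<le> ?b n + ?t n" for n
    using gw[of n] e by (auto simp: pq_terms_def g_def)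
  have tsum: "?t sums (\<Sum>n. pq_terms ip p q f (n + N))"
  proof -
    have "(\<lambda>n. ?t (n + N)) sums (\<Sum>n. pq_terms ip p q f (n + N))"
      using sum by (simp add: summable_sums)
    from sums_iff_shift[THEN iffD1, OF this] show ?thesis by simp
  qed
  have bsum: "?b sums (e / 2 * 1)" by (rule sums_mult[OF power_half_series])
  have s: "(\<lambda>n. ?b n + ?t n) sums (e / 2 * 1 + (\<Sum>n. pq_terms ip p q f (n + N)))"
    by (rule sums_add[OF bsum tsum])
  have "pqfin p q (kdiff f g)" by (rule pqfin_diff(1)[OF f test_kernels_pqfin[OF gt]])
  then have "pqN p q (kdiff f g) \<le> e / 2 * 1 + (\<Sum>n. pq_terms ip p q f (n + N))"
    unfolding pqN_def pqfin_def sums_unique[OF s] by (intro suminf_le[OF le _ sums_summable[OF s]]) auto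
  also have "\<dots> \<le> e" using N by simp
  finally show ?thesis using gt by blast
qed

subsection \<open>Extension by continuity\<close>

text \<open>The limit is taken pointwise: for fixed \<open>n\<close> and \<open>\<Phi>\<close> the
  values on approximating test kernels form a Cauchy sequence of complex numbers. Linearity and
  symmetry of each component pass to the limit, and the norm bound is recovered at the end from
  finite sums.\<close>

lemma extension_exists:
  fixes S :: "(nat \<Rightarrow> 'n tensor) \<Rightarrow> (nat \<Rightarrow> 'n tensor)"
  assumes S: "\<And>f. f \<in> test_kernels ip \<Longrightarrow> S f \<in> test_kernels ip"
    and lin: "\<And>f g c. f \<in> test_kernels ip \<Longrightarrow> g \<in> test_kernels ip \<Longrightarrow> S (kcomb c f g) = kcomb c (S f) (S g)"
    and K: "K \<ge> 0" "\<And>f. f \<in> test_kernels ip \<Longrightarrow> pqN r s (S f) \<le> K * pqN p q f"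
  shows "\<exists>T. T ` Hpq ip p q \<subseteq> Hpq ip r s \<and>
     (\<forall>f\<in>Hpq ip p q. \<forall>g\<in>Hpq ip p q. \<forall>c. T (kcomb c f g) = kcomb c (T f) (T g)) \<and>
     (\<exists>K. \<forall>f\<in>Hpq ip p q. pq_norm ip r s (T f) \<le> K * pq_norm ip p q f) \<and>
     (\<forall>f\<in>test_kernels ip. T (res_kernels ip p f) = res_kernels ip r (S f))"
proof -
  define d where "d f g = sqrt (pqN p q (kdiff f g))" for f g
  \<comment> \<open>The 2 is the constant in the quasi-triangle inequality for
    \<open>pqN\<close>.\<close>
  define C where "C = sqrt (2 * K)"
  have C0: "C \<ge> 0" using K by (simp add: C_def)
  have d0: "d f g \<ge> 0" if "pqfin p q f" "g \<in> test_kernels ip" for f g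
    using pqN_nonneg[OF pqfin_diff(1)[OF that(1) test_kernels_pqfin[OF that(2)]]] by (simp add: d_def)
  have Sdiff: "S (kdiff f g) = kdiff (S f) (S g)" if "f \<in> test_kernels ip" "g \<in> test_kernels ip" for f g
    unfolding kdiff_eq by (rule lin[OF that(2,1)])
  have key: "cmod (S g n \<Phi> - S h n \<Phi>) \<le> C * Hneg_norm ip r n \<Phi> * (d f g + d f h)"
    if f: "pqfin p q f" and g: "g \<in> test_kernels ip" and h: "h \<in> test_kernels ip" and \<Phi>: "\<Phi> \<in> Hneg ip r n"
    for f g h n \<Phi>
  proof -
    have gh: "kdiff g h \<in> test_kernels ip" by (rule test_kernels_diff[OF g h])
    have fg: "pqfin p q (kdiff f g)" "pqfin p q (kdiff f h)"
      using pqfin_diff(1)[OF f test_kernels_pqfin] g h by auto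
    have "cmod (S g n \<Phi> - S h n \<Phi>) \<le> sqrt (pqN r s (S (kdiff g h))) * Hneg_norm ip r n \<Phi>"
      using pqfin_eval'[OF test_kernels_pqfin[OF S[OF gh]] \<Phi>, of s] Sdiff[OF g h] by simp
    also have "\<dots> \<le> (C * (d f g + d f h)) * Hneg_norm ip r n \<Phi>"
    proof (rule mult_right_mono[OF _ Hneg_norm_nonneg[OF \<Phi>]])
      have "pqN r s (S (kdiff g h)) \<le> K * pqN p q (kdiff g h)" by (rule K(2)[OF gh])
      also have "kdiff g h = kdiff (kdiff f h) (kdiff f g)" by (intro ext) simp
      also have "pqN p q \<dots> \<le> 2 * pqN p q (kdiff f h) + 2 * pqN p q (kdiff f g)"
        by (rule pqfin_diff(2)[OF fg(2,1)])
      finally have "pqN r s (S (kdiff g h)) \<le> K * (2 * pqN p q (kdiff f h) + 2 * pqN p q (kdiff f g))"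
        using K(1) by (simp add: mult_left_mono)
      then have "sqrt (pqN r s (S (kdiff g h))) \<le> sqrt (2 * K * (pqN p q (kdiff f g) + pqN p q (kdiff f h)))"
        by (intro real_sqrt_le_mono) (simp add: algebra_simps)
      also have "\<dots> \<le> C * (d f g + d f h)"
        unfolding C_def d_def real_sqrt_mult[of "2 * K"]
        by (intro mult_left_mono sqrt_add_le_add_sqrt pqN_nonneg fg) (use K in auto)
      finally show "sqrt (pqN r s (S (kdiff g h))) \<le> C * (d f g + d f h)" .
    qed
    finally show ?thesis by (simp add: mult_ac)
  qed
  \<comment> \<open>One approximating sequence is fixed for every \<open>f\<close>, with an explicit
    rate.\<close>
  have "\<exists>a. \<forall>k. a k \<in> test_kernels ip \<and> d f (a k) \<le> 1 / real (Suc k)" if f: "pqfin p q f" for f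
  proof -
    have "\<exists>g. g \<in> test_kernels ip \<and> d f g \<le> 1 / real (Suc k)" for k
    proof -
      obtain g where g: "g \<in> test_kernels ip" "pqN p q (kdiff f g) \<le> (1 / real (Suc k))\<^sup>2"
        using pq_dense[OF f, of "(1 / real (Suc k))\<^sup>2"] by auto
      then have "d f g \<le> sqrt ((1 / real (Suc k))\<^sup>2)" unfolding d_def by (intro real_sqrt_le_mono)
      then show ?thesis using g(1) by auto
    qed
    then show ?thesis by metis
  qed
  then obtain a where a: "\<And>f k. pqfin p q f \<Longrightarrow> a f k \<in> test_kernels ip"
      "\<And>f k. pqfin p q f \<Longrightarrow> d f (a f k) \<le> 1 / real (Suc k)" by metis
  have alim: "(\<lambda>k. d f (a f k)) \<longlonglongrightarrow> 0" if f: "pqfin p q f" for f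
    by (rule tendsto_sandwich[OF _ _ tendsto_const LIMSEQ_inverse_real_of_nat])
      (use a[OF f] d0[OF f] in \<open>auto simp: inverse_eq_divide\<close>)
  define T where "T f n \<Phi> = (if \<Phi> \<in> Hneg ip r n then lim (\<lambda>k. S (a f k) n \<Phi>) else 0)" for f n \<Phi>
  have Ta: "(\<lambda>k. S (a f k) n \<Phi>) \<longlonglongrightarrow> T f n \<Phi>" if f: "pqfin p q f" and \<Phi>: "\<Phi> \<in> Hneg ip r n" for f n \<Phi>
  proof -
    have "Cauchy (\<lambda>k. S (a f k) n \<Phi>)"
      by (rule Cauchy_of_bound[OF alim[OF f]]) (rule key[OF f a(1)[OF f] a(1)[OF f] \<Phi>])
    then show ?thesis using \<Phi> by (simp add: T_def Cauchy_convergent_iff convergent_LIMSEQ_iff)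
  qed
  have Tg: "cmod (T f n \<Phi> - S g n \<Phi>) \<le> C * Hneg_norm ip r n \<Phi> * d f g"
    if f: "pqfin p q f" and g: "g \<in> test_kernels ip" and \<Phi>: "\<Phi> \<in> Hneg ip r n" for f g n \<Phi>
  proof (rule LIMSEQ_le)
    show "(\<lambda>k. cmod (S (a f k) n \<Phi> - S g n \<Phi>)) \<longlonglongrightarrow> cmod (T f n \<Phi> - S g n \<Phi>)"
      by (intro tendsto_intros Ta f \<Phi>)
    show "(\<lambda>k. C * Hneg_norm ip r n \<Phi> * (d f (a f k) + d f g)) \<longlonglongrightarrow> C * Hneg_norm ip r n \<Phi> * d f g"
      using tendsto_mult_left[OF tendsto_add[OF alim[OF f] tendsto_const]] by fastforce
    show "\<exists>N. \<forall>k\<ge>N. cmod (S (a f k) n \<Phi> - S g n \<Phi>) \<le> C * Hneg_norm ip r n \<Phi> * (d f (a f k) + d f g)"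
      using key[OF f a(1)[OF f] g \<Phi>] by blast
  qed
  \<comment> \<open>The limit does not depend on the approximating sequence. Linearity follows by
    combining sequences, and agreement with \<open>S\<close> by taking a constant one.\<close>
  have Tseq: "(\<lambda>k. S (g k) n \<Phi>) \<longlonglongrightarrow> T f n \<Phi>"
    if f: "pqfin p q f" and g: "\<And>k. g k \<in> test_kernels ip" and l: "(\<lambda>k. d f (g k)) \<longlonglongrightarrow> 0"
      and \<Phi>: "\<Phi> \<in> Hneg ip r n" for f g n \<Phi>
  proof (rule LIM_zero_cancel, rule Lim_null_comparison)
    show "\<forall>\<^sub>F k in sequentially. norm (S (g k) n \<Phi> - T f n \<Phi>) \<le> C * Hneg_norm ip r n \<Phi> * d f (g k)"
      using Tg[OF f g \<Phi>] by (simp add: norm_minus_commute)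
    show "(\<lambda>k. C * Hneg_norm ip r n \<Phi> * d f (g k)) \<longlonglongrightarrow> 0"
      using tendsto_mult_right_zero[OF l] .
  qed
  have Tres: "T (res_kernels ip p f) = res_kernels ip r (S f)" if f: "f \<in> test_kernels ip" for f
  proof (intro ext)
    fix n \<Phi>
    have rf: "pqfin p q (res_kernels ip p f)"
      by (rule Hpq_pqfin[OF res_kernels_pqfin(1)[OF test_kernels_pqfin[OF f]]])
    \<comment> \<open>Restriction changes values off \<open>Hneg\<close> only, so \<open>f\<close>
      itself approximates its restriction at distance 0.\<close>
    have "pqN p q (kdiff (res_kernels ip p f) f) = pqN p q (\<lambda>n \<Phi>. 0)"
      by (rule pqfin_cong) (simp add: res_kernels_def)
    then have "(\<lambda>k::nat. d (res_kernels ip p f) f) \<longlonglongrightarrow> 0" by (simp add: d_def pqfin_zero)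
    from Tseq[OF rf f this] show "T (res_kernels ip p f) n \<Phi> = res_kernels ip r (S f) n \<Phi>"
      by (cases "\<Phi> \<in> Hneg ip r n") (auto simp: res_kernels_def T_def LIMSEQ_const_iff)
  qed
  have Tlin: "T (kcomb c f g) = kcomb c (T f) (T g)" if f: "pqfin p q f" and g: "pqfin p q g" for f g c
  proof (intro ext)
    fix n \<Phi>
    show "T (kcomb c f g) n \<Phi> = c * T f n \<Phi> + T g n \<Phi>"
    proof (cases "\<Phi> \<in> Hneg ip r n")
      case True
      let ?h = "\<lambda>k. kcomb c (a f k) (a g k)"
      have h: "?h k \<in> test_kernels ip" for k by (rule test_kernels_comb[OF a(1)[OF f] a(1)[OF g]])
      have up: "d (kcomb c f g) (?h k) \<le> sqrt (2 * (cmod c)\<^sup>2 * (d f (a f k))\<^sup>2 + 2 * (d g (a g k))\<^sup>2)" for k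
      proof -
        have df: "pqfin p q (kdiff f (a f k))" "pqfin p q (kdiff g (a g k))"
          using pqfin_diff(1)[OF f test_kernels_pqfin[OF a(1)[OF f]]]
            pqfin_diff(1)[OF g test_kernels_pqfin[OF a(1)[OF g]]] by auto
        have e: "kdiff (kcomb c f g) (?h k) = kcomb c (kdiff f (a f k)) (kdiff g (a g k))"
          by (intro ext) (simp add: algebra_simps)
        show ?thesis unfolding d_def e
          using pqfin_comb(2)[OF df, of c] pqN_nonneg[OF df(1)] pqN_nonneg[OF df(2)] by simp
      qed
      have lo: "0 \<le> d (kcomb c f g) (?h k)" for k
        by (rule d0[OF pqfin_comb(1)[OF f g] h])
      have "(\<lambda>k. sqrt (2 * (cmod c)\<^sup>2 * (d f (a f k))\<^sup>2 + 2 * (d g (a g k))\<^sup>2))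
          \<longlonglongrightarrow> sqrt (2 * (cmod c)\<^sup>2 * 0\<^sup>2 + 2 * 0\<^sup>2)"
        by (intro tendsto_intros alim f g)
      then have lim: "(\<lambda>k. sqrt (2 * (cmod c)\<^sup>2 * (d f (a f k))\<^sup>2 + 2 * (d g (a g k))\<^sup>2)) \<longlonglongrightarrow> 0"
        by simp
      have "(\<lambda>k. d (kcomb c f g) (?h k)) \<longlonglongrightarrow> 0"
        by (rule tendsto_sandwich[OF always_eventually always_eventually tendsto_const lim])
          (use up lo in blast)+
      from Tseq[OF pqfin_comb(1)[OF f g] h this True]
      have "(\<lambda>k. c * S (a f k) n \<Phi> + S (a g k) n \<Phi>) \<longlonglongrightarrow> T (kcomb c f g) n \<Phi>"
        by (simp add: lin[OF a(1)[OF f] a(1)[OF g]])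
      moreover have "(\<lambda>k. c * S (a f k) n \<Phi> + S (a g k) n \<Phi>) \<longlonglongrightarrow> c * T f n \<Phi> + T g n \<Phi>"
        by (intro tendsto_intros Ta f g True)
      ultimately show ?thesis by (rule LIMSEQ_unique)
    qed (simp add: T_def)
  qed
  have Tsfun: "sym_fun r n (T f n)" if f: "pqfin p q f" for f n
    unfolding sym_fun_def
  proof (intro conjI ballI allI impI)
    have sS: "sym_fun r n (S (a f k) n)" for k
      using test_kernels_pqfin[OF S[OF a(1)[OF f]]] by (auto simp: pqfin_def)
    fix \<Phi> assume \<Phi>: "\<Phi> \<in> Hneg ip r n"
    show "T f n (\<lambda>es. c * \<Phi> es + \<Psi> es) = c * T f n \<Phi> + T f n \<Psi>" if \<Psi>: "\<Psi> \<in> Hneg ip r n" for \<Psi> c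
    proof (rule LIMSEQ_unique)
      show "(\<lambda>k. c * S (a f k) n \<Phi> + S (a f k) n \<Psi>) \<longlonglongrightarrow> T f n (\<lambda>es. c * \<Phi> es + \<Psi> es)"
        using Ta[OF f Hneg_comb(1)[OF \<Phi> \<Psi>, of c]] by (simp add: sym_fun_comb_arg[OF sS \<Phi> \<Psi>])
      show "(\<lambda>k. c * S (a f k) n \<Phi> + S (a f k) n \<Psi>) \<longlonglongrightarrow> c * T f n \<Phi> + T f n \<Psi>"
        by (intro tendsto_intros Ta f \<Phi> \<Psi>)
    qed
    show "T f n (permute_form n \<pi> \<Phi>) = T f n \<Phi>" if "\<pi> permutes {..<n}" for \<pi>
      using Ta[OF f Hneg_permute(1)[OF \<Phi> that]] Ta[OF f \<Phi>]
      by (simp add: sym_fun_permute[OF sS \<Phi> that] LIMSEQ_unique)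
  next
    let ?g = "a f 0"
    have "cmod (T f n \<Phi>) \<le> (C * d f ?g + sqrt (pqN r s (S ?g))) * Hneg_norm ip r n \<Phi>"
      if \<Phi>: "\<Phi> \<in> Hneg ip r n" for \<Phi>
    proof -
      have "cmod (T f n \<Phi>) \<le> cmod (T f n \<Phi> - S ?g n \<Phi>) + cmod (S ?g n \<Phi>)"
        by (metis diff_add_cancel norm_triangle_ineq)
      also have "\<dots> \<le> C * Hneg_norm ip r n \<Phi> * d f ?g + sqrt (pqN r s (S ?g)) * Hneg_norm ip r n \<Phi>"
        by (intro add_mono Tg f a(1) \<Phi> pqfin_eval' test_kernels_pqfin S)
      finally show ?thesis by (simp add: algebra_simps)
    qed
    then show "\<exists>K. \<forall>\<Phi>\<in>Hneg ip r n. cmod (T f n \<Phi>) \<le> K * Hneg_norm ip r n \<Phi>" by blast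
  qed
  \<comment> \<open>For fixed \<open>N\<close> the weights add up to a finite \<open>W\<close>, so
    the error of the pointwise limit vanishes as \<open>k\<close> grows. The 4 consists of two uses
    of the quasi-triangle inequality.\<close>
  have Tsum: "(\<Sum>n<N. pq_terms ip r s (T f) n) \<le> 4 * K * pqN p q f" if f: "pqfin p q f" for f N
  proof -
    define W where "W = (\<Sum>n<N. (fact n)\<^sup>2 * 2 ^ (s * n) :: real)"
    have "(\<Sum>n<N. pq_terms ip r s (T f) n)
       \<le> 2 * (W * (C * d f (a f k))\<^sup>2) + 2 * (K * (2 * pqN p q f + 2 * (d f (a f k))\<^sup>2))" for k
    proof -
      let ?g = "a f k"
      have g: "?g \<in> test_kernels ip" by (rule a(1)[OF f])
      have sS: "sym_fun r n (S ?g n)" for n using test_kernels_pqfin[OF S[OF g]] by (auto simp: pqfin_def)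
      have sD: "sym_fun r n (kdiff (T f) (S ?g) n)" for n
        using sym_fun_comb(1)[OF sS Tsfun[OF f], of n "-1"] by simp
      have D: "pq_terms ip r s (kdiff (T f) (S ?g)) n \<le> (fact n)\<^sup>2 * 2 ^ (s * n) * (C * d f ?g)\<^sup>2" for n
        unfolding pq_terms_def
      proof (intro mult_left_mono power_mono)
        show "Hpos_norm ip r n (\<lambda>\<Phi>. T f n \<Phi> - S ?g n \<Phi>) \<le> C * d f ?g"
          by (rule Hpos_normI) (use Tg[OF f g] C0 d0[OF f g] in \<open>auto simp: mult_ac\<close>)
        show "0 \<le> Hpos_norm ip r n (\<lambda>\<Phi>. T f n \<Phi> - S ?g n \<Phi>)" by (rule Hpos_norm_nonneg[OF sD])
      qed simp
      have "(\<Sum>n<N. pq_terms ip r s (T f) n)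
         \<le> (\<Sum>n<N. 2 * (fact n)\<^sup>2 * 2 ^ (s * n) * (C * d f ?g)\<^sup>2 + 2 * pq_terms ip r s (S ?g) n)"
      proof (rule sum_mono)
        fix n
        have "T f = kcomb 1 (kdiff (T f) (S ?g)) (S ?g)" by (intro ext) simp
        then have "pq_terms ip r s (T f) n \<le> 2 * (cmod 1)\<^sup>2 * pq_terms ip r s (kdiff (T f) (S ?g)) n
            + 2 * pq_terms ip r s (S ?g) n"
          using pq_terms_comb[where c = 1, of r n "kdiff (T f) (S ?g)" "S ?g" s, OF sD sS] by simp
        then show "pq_terms ip r s (T f) n
            \<le> 2 * (fact n)\<^sup>2 * 2 ^ (s * n) * (C * d f ?g)\<^sup>2 + 2 * pq_terms ip r s (S ?g) n"
          using D[of n] by simp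
      qed
      also have "\<dots> = 2 * (W * (C * d f ?g)\<^sup>2) + 2 * (\<Sum>n<N. pq_terms ip r s (S ?g) n)"
        unfolding W_def sum.distrib by (simp add: sum_distrib_left sum_distrib_right mult_ac)
      also have "(\<Sum>n<N. pq_terms ip r s (S ?g) n) \<le> pqN r s (S ?g)"
        unfolding pqN_def using test_kernels_pqfin[OF S[OF g], of r s]
        by (intro sum_le_suminf) (auto simp: pqfin_def pq_terms_nonneg)
      also have "pqN r s (S ?g) \<le> K * pqN p q ?g" by (rule K(2)[OF g])
      also have "pqN p q ?g \<le> 2 * pqN p q f + 2 * (d f ?g)\<^sup>2"
      proof -
        have e: "?g = kdiff f (kdiff f ?g)" by (intro ext) simp
        have fd: "pqfin p q (kdiff f ?g)" by (rule pqfin_diff(1)[OF f test_kernels_pqfin[OF g]])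
        show ?thesis
          using pqfin_diff(2)[OF f fd] e pqN_nonneg[OF fd] by (simp add: d_def)
      qed
      finally show ?thesis using K(1) by (simp add: mult_left_mono)
    qed
    moreover have "(\<lambda>k. 2 * (W * (C * d f (a f k))\<^sup>2) + 2 * (K * (2 * pqN p q f + 2 * (d f (a f k))\<^sup>2)))
       \<longlonglongrightarrow> 2 * (W * (C * 0)\<^sup>2) + 2 * (K * (2 * pqN p q f + 2 * 0\<^sup>2))"
      by (intro tendsto_intros alim f)
    ultimately have "(\<Sum>n<N. pq_terms ip r s (T f) n) \<le> 2 * (W * (C * 0)\<^sup>2) + 2 * (K * (2 * pqN p q f + 2 * 0\<^sup>2))"
      by (intro LIMSEQ_le_const) auto
    then show ?thesis by simp
  qed
  have Tfin: "pqfin r s (T f)" "pqN r s (T f) \<le> 4 * K * pqN p q f" if f: "pqfin p q f" for f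
  proof -
    have sm: "summable (pq_terms ip r s (T f))"
      by (rule summableI_nonneg_bounded[OF pq_terms_nonneg Tsum[OF f]])
    then show "pqfin r s (T f)" using Tsfun[OF f] by (simp add: pqfin_def)
    show "pqN r s (T f) \<le> 4 * K * pqN p q f"
      unfolding pqN_def[of r] by (rule suminf_le_const[OF sm Tsum[OF f]])
  qed
  show ?thesis
  proof (intro exI[of _ T] conjI)
    show "T ` Hpq ip p q \<subseteq> Hpq ip r s"
    proof (rule image_subsetI, rule HpqI)
      fix f assume "f \<in> Hpq ip p q"
      then show "pqfin r s (T f)" by (intro Tfin Hpq_pqfin)
    qed (simp add: T_def)
    show "\<forall>f\<in>Hpq ip p q. \<forall>g\<in>Hpq ip p q. \<forall>c. T (kcomb c f g) = kcomb c (T f) (T g)"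
      by (intro ballI allI Tlin Hpq_pqfin)
    show "\<exists>K. \<forall>f\<in>Hpq ip p q. pq_norm ip r s (T f) \<le> K * pq_norm ip p q f"
    proof (intro exI[of _ "sqrt (4 * K)"] ballI)
      fix f assume "f \<in> Hpq ip p q"
      from Tfin(2)[OF Hpq_pqfin[OF this]]
      show "pq_norm ip r s (T f) \<le> sqrt (4 * K) * pq_norm ip p q f"
        unfolding pq_norm_eq real_sqrt_mult[symmetric] by (rule real_sqrt_le_mono)
    qed
    show "\<forall>f\<in>test_kernels ip. T (res_kernels ip p f) = res_kernels ip r (S f)" by (intro ballI Tres)
  qed
qed

end

declare split_paired_All [simp del] split_paired_Ex [simp del]

section \<open>Exponential bounds for powers and products\<close>

lemma power_le_fact_exp:
  fixes x :: real
  assumes "x \<ge> 0"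
  shows "x ^ n \<le> fact n * exp x"
proof -
  have "(\<Sum>k\<in>{n}. x ^ k /\<^sub>R fact k) \<le> (\<Sum>k. x ^ k /\<^sub>R fact k)"
    by (rule sum_le_suminf[OF summable_exp_generic]) (use assms in auto)
  then show ?thesis by (simp add: exp_def field_simps)
qed

lemma le_sum_list_map:
  fixes f :: "'a \<Rightarrow> real"
  assumes "t \<in> set ts" "\<And>t. f t \<ge> 0"
  shows "f t \<le> sum_list (map f ts)"
  using assms(1)
proof (induction ts)
  case (Cons a ts)
  have "0 \<le> sum_list (map f ts)" by (rule sum_list_nonneg) (use assms(2) in auto)
  then show ?case using Cons assms(2)[of a] by (auto simp: add_increasing)
qed simp

text \<open>The product is at most the \<open>n\<close>-th power of the largest factor
  \<open>m\<close>, hence at most \<open>fact n * exp m\<close>, and \<open>exp m\<close> is one of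
  the summands, or 1 if \<open>m = 0\<close>. A mixed moment is thus dominated by a sum of single
  exponentials.\<close>

lemma prod_list_le_fact_exp:
  fixes ts :: "real list"
  assumes "\<And>t. t \<in> set ts \<Longrightarrow> t \<ge> 0"
  shows "prod_list ts \<le> fact (length ts) * (1 + sum_list (map exp ts))"
proof -
  define m where "m = Max (insert 0 (set ts))"
  have m: "m \<ge> 0" "\<And>t. t \<in> set ts \<Longrightarrow> t \<le> m" unfolding m_def by auto
  have "prod_list us \<le> m ^ length us" if "set us \<subseteq> set ts" for us
    using that
  proof (induction us)
    case (Cons u us)
    then show ?case using m assms by (auto intro!: mult_mono prod_list_nonneg)
  qed simp
  then have "prod_list ts \<le> m ^ length ts" by simp
  also have "\<dots> \<le> fact (length ts) * exp m" by (rule power_le_fact_exp[OF m(1)])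
  also have "exp m \<le> 1 + sum_list (map exp ts)"
  proof -
    have nn: "0 \<le> sum_list (map exp ts)" by (rule sum_list_nonneg) auto
    have "m \<in> insert 0 (set ts)" unfolding m_def by (rule Max_in) auto
    then show ?thesis using le_sum_list_map[of m ts exp] nn by auto
  qed
  finally show ?thesis by simp
qed

text \<open>The inequality of arithmetic and geometric means; it separates the real and imaginary
  parts of an argument.\<close>

lemma exp_abs_add_le: "exp (\<bar>s\<bar> + \<bar>t\<bar>) \<le> exp \<bar>2 * s\<bar> + exp (\<bar>2 * t\<bar> :: real)"
proof -
  have "2 * (exp \<bar>s\<bar> * exp \<bar>t\<bar>) \<le> (exp \<bar>s\<bar>)\<^sup>2 + (exp \<bar>t\<bar>)\<^sup>2"
    using sum_squares_bound[of "exp \<bar>s\<bar>" "exp \<bar>t\<bar>"] by simp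
  moreover have "(exp \<bar>s\<bar>)\<^sup>2 = exp \<bar>2 * s\<bar>" "(exp \<bar>t\<bar>)\<^sup>2 = exp \<bar>2 * t\<bar>"
    by (simp_all add: power2_eq_square exp_add[symmetric] abs_mult)
  moreover have "0 \<le> exp \<bar>s\<bar> * exp \<bar>t\<bar>" by (rule mult_nonneg_nonneg) simp_all
  ultimately show ?thesis unfolding exp_add by linarith
qed

lemma cext_cscale: "linear x \<Longrightarrow> cext x (cscale c z) = c * cext x z"
  using clinear_cext[of x] clinear_form_zero[of "cext x"] unfolding clinear_form_def
  by (metis add.right_neutral)

lemma cext_scaleR: "linear x \<Longrightarrow> cext x (r *\<^sub>R z) = of_real r * cext x z"
  by (simp add: cext_def linear_scale complex_eq_iff)

lemma (in nuclear_triple) cnorm_scaleR: "cnorm ip p (r *\<^sub>R z) = \<bar>r\<bar> * cnorm ip p z"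
  using cnorm_cscale[of p "of_real r" z] unfolding cscale_of_real by simp

lemma cmod_cext_le_abs: "cmod (cext x z) \<le> \<bar>x (fst z)\<bar> + \<bar>x (snd z)\<bar>"
  unfolding cext_def using cmod_le[of "Complex (x (fst z)) (x (snd z))"] by simp

section \<open>Moments of a measure with analytic Laplace transform\<close>

locale appell_measure = nuclear_triple ip for ip :: "nat \<Rightarrow> 'n::real_vector \<Rightarrow> 'n \<Rightarrow> real" +
  fixes \<mu> :: "('n \<Rightarrow> real) measure"
  assumes sets_mu: "sets \<mu> = sets (cylinder_algebra ip)"
    and laplace_mu: "analytic_laplace ip \<mu>"
    and nondeg_mu: "nondegenerate ip \<mu>"
begin

lemma space_mu: "space \<mu> = dual ip"
  using sets_eq_imp_space_eq[OF sets_mu] by (simp add: cylinder_algebra_def space_measure_of_conv)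

lemma linear_mu: "x \<in> space \<mu> \<Longrightarrow> linear x"
  by (simp add: space_mu dual_def)

lemma measurable_eval [measurable]: "(\<lambda>x. x \<xi>) \<in> borel_measurable \<mu>"
proof (rule measurableI)
  fix A :: "real set" assume A: "A \<in> sets borel"
  have "(\<lambda>x. x \<xi>) -` A \<inter> space \<mu> = {x \<in> dual ip. x \<xi> \<in> A}" by (auto simp: space_mu)
  also have "\<dots> \<in> sets (cylinder_algebra ip)"
    unfolding cylinder_algebra_def by (subst sets_measure_of) (use A in blast)+
  finally show "(\<lambda>x. x \<xi>) -` A \<inter> space \<mu> \<in> sets \<mu>" by (simp add: sets_mu)
qed simp

lemma measurable_cext [measurable]: "(\<lambda>x. cext x \<xi>) \<in> borel_measurable \<mu>"
  unfolding cext_def by (simp add: borel_measurable_complex_iff measurable_eval)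

lemma laplace_locally_bounded:
  "\<exists>p \<delta> M. \<delta> > 0 \<and> (\<forall>\<xi>. cnorm ip p \<xi> < \<delta> \<longrightarrow> integrable \<mu> (\<lambda>x. exp (cext x \<xi>)) \<and> cmod (laplace \<mu> \<xi>) \<le> M)"
proof -
  obtain U where U: "lc_open (cnorm ip) U" "0 \<in> U" "\<forall>\<xi>\<in>U. integrable \<mu> (\<lambda>x. exp (cext x \<xi>))"
      "lc_holomorphic_on cscale (cnorm ip) (laplace \<mu>) U"
    using laplace_mu unfolding analytic_laplace_def by blast
  obtain i d where i: "d > 0" "\<forall>w. cnorm ip i (w - 0) < d \<longrightarrow> w \<in> U"
    using U(1,2) unfolding lc_open_def by blast
  obtain j e M where j: "e > 0" "\<forall>w\<in>U. cnorm ip j (w - 0) < e \<longrightarrow> cmod (laplace \<mu> w) \<le> M"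
    using U(2,4) unfolding lc_holomorphic_on_def by blast
  have "integrable \<mu> (\<lambda>x. exp (cext x \<xi>)) \<and> cmod (laplace \<mu> \<xi>) \<le> M"
    if "cnorm ip (max i j) \<xi> < min d e" for \<xi>
  proof -
    have "cnorm ip i \<xi> < d" "cnorm ip j \<xi> < e"
      using that cnorm_le[of i "max i j" \<xi>] cnorm_le[of j "max i j" \<xi>] by auto
    then show ?thesis using i(2) j(2) U(3) by auto
  qed
  then show ?thesis using i(1) j(1) by (intro exI[of _ "max i j"] exI[of _ "min d e"] exI[of _ M]) auto
qed

text \<open>This index and the constants below are fixed by choice, so that later definitions and
  bounds can refer to them.\<close>

definition lap_index :: nat where
  "lap_index = (SOME p. \<exists>\<delta> M. \<delta> > 0 \<and>
     (\<forall>\<xi>. cnorm ip p \<xi> < \<delta> \<longrightarrow> integrable \<mu> (\<lambda>x. exp (cext x \<xi>)) \<and> cmod (laplace \<mu> \<xi>) \<le> M))"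

text \<open>At real arguments the Laplace transform is the integral of a positive function, so its
  local bound is a bound in L1. The absolute values, needed to dominate moments, come from adding
  the integrals at \<open>a\<close> and \<open>- a\<close>.\<close>

lemma exp_abs_integrable_ex:
  "\<exists>\<delta> M. \<delta> > 0 \<and> (\<forall>z. cnorm ip lap_index z < \<delta> \<longrightarrow>
     integrable \<mu> (\<lambda>x. exp (\<bar>x (fst z)\<bar> + \<bar>x (snd z)\<bar>)) \<and>
     (\<integral>x. exp (\<bar>x (fst z)\<bar> + \<bar>x (snd z)\<bar>) \<partial>\<mu>) \<le> M)"
proof -
  let ?p = lap_index
  have "\<exists>\<delta> M. \<delta> > 0 \<and> (\<forall>\<xi>. cnorm ip ?p \<xi> < \<delta> \<longrightarrow> integrable \<mu> (\<lambda>x. exp (cext x \<xi>)) \<and> cmod (laplace \<mu> \<xi>) \<le> M)"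
    unfolding lap_index_def by (rule someI_ex[OF laplace_locally_bounded])
  then obtain \<delta> M where d: "\<delta> > 0"
      and I: "\<And>\<xi>. cnorm ip ?p \<xi> < \<delta> \<Longrightarrow> integrable \<mu> (\<lambda>x. exp (cext x \<xi>))"
      and B: "\<And>\<xi>. cnorm ip ?p \<xi> < \<delta> \<Longrightarrow> cmod (laplace \<mu> \<xi>) \<le> M" by blast
  have real: "integrable \<mu> (\<lambda>x. exp (x a)) \<and> (\<integral>x. exp (x a) \<partial>\<mu>) \<le> M" if a: "hnorm ip ?p a < \<delta>" for a
  proof -
    have c: "exp (cext x (a, 0)) = of_real (exp (x a))" if "x \<in> space \<mu>" for x
    proof -
      have "cext x (a, 0) = of_real (x a)"
        using linear_0[OF linear_mu[OF that]] by (simp add: cext_def complex_of_real_def)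
      then show ?thesis by (simp add: exp_of_real)
    qed
    have "integrable \<mu> (\<lambda>x. exp (cext x (a, 0)))" using I[of "(a, 0)"] a by simp
    then have "integrable \<mu> (\<lambda>x. complex_of_real (exp (x a)))"
      using Bochner_Integration.integrable_cong[OF refl c, of \<mu>] by simp
    then have i: "integrable \<mu> (\<lambda>x. exp (x a))" by (simp add: complex_of_real_integrable_eq)
    have "laplace \<mu> (a, 0) = of_real (\<integral>x. exp (x a) \<partial>\<mu>)"
      unfolding laplace_def using Bochner_Integration.integral_cong[OF refl c, of \<mu>] by simp
    then have "\<bar>\<integral>x. exp (x a) \<partial>\<mu>\<bar> \<le> M" using B[of "(a, 0)"] a by simp
    then show ?thesis using i by simp
  qed
  have abs: "integrable \<mu> (\<lambda>x. exp \<bar>x a\<bar>) \<and> (\<integral>x. exp \<bar>x a\<bar> \<partial>\<mu>) \<le> 2 * M" if a: "hnorm ip ?p a < \<delta>" for a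
  proof -
    have a': "hnorm ip ?p (- a) < \<delta>" using a hnorm_scaleR[of ?p "-1" a] by simp
    note r = real[OF a] real[OF a']
    \<comment> \<open>One of the two exponentials equals the left-hand side, by the sign of
      \<open>x a\<close>.\<close>
    have le: "exp \<bar>x a\<bar> \<le> exp (x a) + exp (x (- a))" if "x \<in> space \<mu>" for x
      using linear_neg[OF linear_mu[OF that], of a] by (cases "x a \<ge> 0") auto
    have i: "integrable \<mu> (\<lambda>x. exp \<bar>x a\<bar>)"
      by (rule Bochner_Integration.integrable_bound[of \<mu> "\<lambda>x. exp (x a) + exp (x (- a))"])
        (use r le in \<open>auto intro!: AE_I2\<close>)
    have "(\<integral>x. exp \<bar>x a\<bar> \<partial>\<mu>) \<le> (\<integral>x. exp (x a) + exp (x (- a)) \<partial>\<mu>)"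
      by (rule integral_mono) (use i r le in auto)
    then show ?thesis using i r by simp
  qed
  have "integrable \<mu> (\<lambda>x. exp (\<bar>x (fst z)\<bar> + \<bar>x (snd z)\<bar>)) \<and>
     (\<integral>x. exp (\<bar>x (fst z)\<bar> + \<bar>x (snd z)\<bar>) \<partial>\<mu>) \<le> 4 * M" if z: "cnorm ip ?p z < \<delta> / 2" for z
  proof -
    \<comment> \<open>Separating the two components doubles both, hence the half radius; each of the
      two integrals is at most \<open>2 * M\<close>.\<close>
    have h: "hnorm ip ?p (2 *\<^sub>R fst z) < \<delta>" "hnorm ip ?p (2 *\<^sub>R snd z) < \<delta>"
      using z hnorm_fst_le[of ?p z] hnorm_snd_le[of ?p z] by (auto simp: hnorm_scaleR)
    note r = abs[OF h(1)] abs[OF h(2)]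
    have le: "exp (\<bar>x (fst z)\<bar> + \<bar>x (snd z)\<bar>) \<le> exp \<bar>x (2 *\<^sub>R fst z)\<bar> + exp \<bar>x (2 *\<^sub>R snd z)\<bar>"
      if "x \<in> space \<mu>" for x
      using exp_abs_add_le[of "x (fst z)" "x (snd z)"] linear_scale[OF linear_mu[OF that], of 2] by simp
    have i: "integrable \<mu> (\<lambda>x. exp (\<bar>x (fst z)\<bar> + \<bar>x (snd z)\<bar>))"
      by (rule Bochner_Integration.integrable_bound[of \<mu> "\<lambda>x. exp \<bar>x (2 *\<^sub>R fst z)\<bar> + exp \<bar>x (2 *\<^sub>R snd z)\<bar>"])
        (use r le in \<open>auto intro!: AE_I2\<close>)
    have "(\<integral>x. exp (\<bar>x (fst z)\<bar> + \<bar>x (snd z)\<bar>) \<partial>\<mu>) \<le> (\<integral>x. exp \<bar>x (2 *\<^sub>R fst z)\<bar> + exp \<bar>x (2 *\<^sub>R snd z)\<bar> \<partial>\<mu>)"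
      by (rule integral_mono) (use i r le in auto)
    then show ?thesis using i r by simp
  qed
  then show ?thesis using d by (intro exI[of _ "\<delta> / 2"] exI[of _ "4 * M"]) auto
qed

definition exp_weight :: "'n cx \<Rightarrow> ('n \<Rightarrow> real) \<Rightarrow> real" where
  "exp_weight z x = exp (\<bar>x (fst z)\<bar> + \<bar>x (snd z)\<bar>)"

definition exp_rad :: real where
  "exp_rad = (SOME \<delta>. \<exists>M. \<delta> > 0 \<and> (\<forall>z. cnorm ip lap_index z < \<delta> \<longrightarrow>
     integrable \<mu> (exp_weight z) \<and> (\<integral>x. exp_weight z x \<partial>\<mu>) \<le> M))"

lemma exp_weight_bound_ex:
  "\<exists>M. exp_rad > 0 \<and> (\<forall>z. cnorm ip lap_index z < exp_rad \<longrightarrow> integrable \<mu> (exp_weight z) \<and> (\<integral>x. exp_weight z x \<partial>\<mu>) \<le> M)"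
  unfolding exp_rad_def by (rule someI_ex) (use exp_abs_integrable_ex in \<open>simp add: exp_weight_def[abs_def]\<close>)

definition exp_bd :: real where
  "exp_bd = (SOME M. exp_rad > 0 \<and> (\<forall>z. cnorm ip lap_index z < exp_rad \<longrightarrow> integrable \<mu> (exp_weight z) \<and> (\<integral>x. exp_weight z x \<partial>\<mu>) \<le> M))"

lemma exp_rad_pos: "exp_rad > 0"
  and exp_weight_integrable: "cnorm ip lap_index z < exp_rad \<Longrightarrow> integrable \<mu> (exp_weight z)"
  and exp_weight_integral_le: "cnorm ip lap_index z < exp_rad \<Longrightarrow> (\<integral>x. exp_weight z x \<partial>\<mu>) \<le> exp_bd"
  using someI_ex[OF exp_weight_bound_ex] unfolding exp_bd_def[symmetric] by auto

lemma integrable_one: "integrable \<mu> (\<lambda>x. 1 :: real)"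
  and integral_one_le: "(\<integral>x. 1 \<partial>\<mu>) \<le> exp_bd"
proof -
  have c: "exp_weight 0 x = 1" if "x \<in> space \<mu>" for x
    using linear_0[OF linear_mu[OF that]] by (simp add: exp_weight_def)
  show "integrable \<mu> (\<lambda>x. 1 :: real)"
    using exp_weight_integrable[of 0] exp_rad_pos Bochner_Integration.integrable_cong[OF refl c, of \<mu>] by simp
  show "(\<integral>x. 1 \<partial>\<mu>) \<le> exp_bd"
    using exp_weight_integral_le[of 0] exp_rad_pos Bochner_Integration.integral_cong[OF refl c, of \<mu>] by simp
qed

lemma finite_mu: "finite_measure \<mu>"
  using integrable_one by (auto simp: integrable_iff_bounded intro!: finite_measureI)

lemma exp_bd_nonneg: "exp_bd \<ge> 0"
  using integral_one_le by (rule order_trans[rotated]) simp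

section \<open>Moment tensors and their growth\<close>

definition moment :: "nat \<Rightarrow> 'n form" where
  "moment n zs = (\<integral>x. form_power n (cext x) zs \<partial>\<mu>)"

text \<open>The Laplace transform at 0, by which the series of the reciprocal is divided.\<close>

definition mass :: real where "mass = (\<integral>x. 1 \<partial>\<mu>)"

text \<open>Here non-degeneracy enters: the constant polynomial 1 is not identically 0, so it is not
  0 almost everywhere, and the measure cannot be null.\<close>

lemma mass_pos: "mass > 0"
proof -
  define \<phi> :: "('n \<Rightarrow> real) \<Rightarrow> complex" where "\<phi> x = (if x \<in> dual ip then 1 else 0)" for x
  \<comment> \<open>The constant 1 as a tensor of degree 0: a form of degree 0 is its value at the
    empty list.\<close>
  define f :: "nat \<Rightarrow> 'n tensor" where
    "f n = (\<lambda>\<Phi>. if n = 0 \<and> \<Phi> \<in> dual_tensors ip n then \<Phi> [] else 0)" for n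
  have dt: "(\<lambda>es. c * \<Phi> es + \<Psi> es) \<in> dual_tensors ip n"
    if "\<Phi> \<in> dual_tensors ip n" "\<Psi> \<in> dual_tensors ip n" for \<Phi> \<Psi> c n
    using dual_tensors_common[OF that] Hneg_comb(1) Hneg_dual_tensors by metis
  have "f n \<in> sym_tensors ip n" for n
  proof (cases n)
    case 0
    have pf: "permute_form 0 \<pi> \<Phi> = \<Phi>" if "\<Phi> \<in> dual_tensors ip 0" for \<Phi> and \<pi> :: "nat \<Rightarrow> nat"
    proof
      fix es show "permute_form 0 \<pi> \<Phi> es = \<Phi> es"
        using that Hneg_multilinear[of \<Phi> _ 0] multilinear_form_length[of 0 \<Phi> es]
        by (auto simp: permute_form_def dual_tensors_def)
    qed
    show ?thesis unfolding 0
    proof (rule sym_tensorsI)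
      fix p
      have "cmod (f 0 \<Phi>) \<le> 1 * Hneg_norm ip p 0 \<Phi>" if "\<Phi> \<in> Hneg ip p 0" for \<Phi>
        using Hneg_eval_le[OF that, of "[]"] Hneg_dual_tensors[OF that] by (simp add: f_def)
      then show "sym_fun p 0 (f 0)"
        unfolding sym_fun_def
        using Hneg_dual_tensors[of _ p 0] dt pf by (auto simp: f_def intro!: exI[of _ 1])
    qed (simp add: f_def)
  next
    case (Suc m)
    then have "f n = (\<lambda>\<Phi>. 0)" by (auto simp: f_def)
    then show ?thesis by (simp add: sym_tensors_zero)
  qed
  moreover have "\<phi> x = (if x \<in> dual ip then \<Sum>n\<le>0. f n (form_power n (cext x)) else 0)" for x
  proof (cases "x \<in> dual ip")
    case True
    then obtain p K where x: "linear x" "\<And>\<xi>. \<bar>x \<xi>\<bar> \<le> K * hnorm ip p \<xi>" by (auto simp: dual_def)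
    then have "\<bar>x \<xi>\<bar> \<le> \<bar>K\<bar> * hnorm ip p \<xi>" for \<xi>
      using mult_right_mono[of K "\<bar>K\<bar>" "hnorm ip p \<xi>"] by (smt (verit) hnorm_nonneg)
    from Hneg_dual_tensors[OF Hneg_dual_power(1)[OF x(1) this]]
    have "form_power 0 (cext x) \<in> dual_tensors ip 0" by simp
    then show ?thesis using True by (simp add: \<phi>_def f_def form_power_def)
  qed (simp add: \<phi>_def)
  ultimately have "\<phi> \<in> polynomials ip"
    unfolding polynomials_def by blast
  then have "(AE x in \<mu>. \<phi> x = 0) \<longleftrightarrow> (\<forall>x\<in>dual ip. \<phi> x = 0)"
    using nondeg_mu by (simp add: nondegenerate_def)
  moreover have "(\<lambda>\<xi>. 0) \<in> dual ip" by (auto simp: dual_def linear_iff intro!: exI[of _ 0])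
  ultimately have "\<not> (AE x in \<mu>. \<phi> x = 0)" by (auto simp: \<phi>_def)
  then have "\<not> (AE x in \<mu>. False)" by (auto simp: \<phi>_def space_mu[symmetric] elim!: AE_mp[rotated])
  then have "emeasure \<mu> (space \<mu>) \<noteq> 0"
    by (simp add: AE_iff_measurable[OF sets.top])
  then have "measure \<mu> (space \<mu>) > 0"
    using finite_measure.emeasure_eq_measure[OF finite_mu, of "space \<mu>"]
    by (simp add: zero_less_measure_iff)
  then show ?thesis by (simp add: mass_def)
qed

text \<open>Each argument is rescaled before the product bound is used. A suitable \<open>s\<close>
  moves all rescaled vectors into the ball where \<open>exp_weight\<close> is integrable, and the
  prefactor keeps the bound multiplicative in the sizes of the arguments.\<close>

lemma form_power_le:
  assumes "x \<in> space \<mu>" "length zs = n" "\<And>z. s z > 0"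
  shows "cmod (form_power n (cext x) zs)
    \<le> (\<Prod>z\<leftarrow>zs. s z) * (fact n * (1 + (\<Sum>z\<leftarrow>zs. exp_weight ((1 / s z) *\<^sub>R z) x)))"
proof -
  have P0: "(\<Prod>z\<leftarrow>zs. s z) \<ge> 0" by (rule prod_list_nonneg) (use assms(3) less_imp_le in auto)
  let ?t = "\<lambda>z. cmod (cext x z) / s z"
  have t: "?t z \<le> \<bar>x (fst ((1 / s z) *\<^sub>R z))\<bar> + \<bar>x (snd ((1 / s z) *\<^sub>R z))\<bar>" for z
  proof -
    have "?t z = cmod (cext x ((1 / s z) *\<^sub>R z))"
      using assms(3)[of z] by (simp add: cext_scaleR[OF linear_mu[OF assms(1)]] norm_mult norm_divide)
    then show ?thesis using cmod_cext_le_abs[of x "(1 / s z) *\<^sub>R z"] by simp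
  qed
  have "cmod (form_power n (cext x) zs) = (\<Prod>z\<leftarrow>zs. cmod (cext x z))"
  proof -
    have "cmod (prod_list (map (cext x) zs)) = (\<Prod>z\<leftarrow>zs. cmod (cext x z))"
      by (induction zs) (auto simp: norm_mult)
    then show ?thesis using assms(2) by (simp add: form_power_def)
  qed
  also have "\<dots> = (\<Prod>z\<leftarrow>zs. s z) * prod_list (map ?t zs)"
    using assms(3) by (induction zs) (auto simp: less_imp_neq[THEN not_sym])
  also have "prod_list (map ?t zs) \<le> fact (length (map ?t zs)) * (1 + sum_list (map exp (map ?t zs)))"
    using assms(3) by (intro prod_list_le_fact_exp) (auto simp: less_imp_le)
  also have "sum_list (map exp (map ?t zs)) \<le> (\<Sum>z\<leftarrow>zs. exp_weight ((1 / s z) *\<^sub>R z) x)"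
    using t by (auto simp: exp_weight_def o_def intro!: sum_list_mono)
  finally show ?thesis using assms(2) P0 by (simp add: mult_left_mono)
qed

text \<open>Dividing by it brings a nonzero vector to norm \<open>exp_rad / 2\<close>. The value 1
  at 0 keeps it positive.\<close>

definition exp_scale :: "'n cx \<Rightarrow> real" where
  "exp_scale z = (if z = 0 then 1 else 2 / exp_rad * cnorm ip lap_index z)"

lemma exp_scale_pos: "exp_scale z > 0"
  using exp_rad_pos cnorm_eq_0[of lap_index z] cnorm_nonneg[of lap_index z]
  by (auto simp: exp_scale_def less_le simp del: cnorm_nonneg)

lemma cnorm_exp_scale: "cnorm ip lap_index ((1 / exp_scale z) *\<^sub>R z) < exp_rad"
proof -
  have "cnorm ip lap_index ((1 / exp_scale z) *\<^sub>R z) = cnorm ip lap_index z / exp_scale z"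
    using exp_scale_pos[of z] by (simp add: cnorm_scaleR)
  then show ?thesis
    using exp_rad_pos cnorm_eq_0[of lap_index z] by (auto simp: exp_scale_def)
qed

lemma wsum_integrable:
  "integrable \<mu> (\<lambda>x. \<Sum>z\<leftarrow>zs. exp_weight ((1 / exp_scale z) *\<^sub>R z) x)"
  "(\<integral>x. (\<Sum>z\<leftarrow>zs. exp_weight ((1 / exp_scale z) *\<^sub>R z) x) \<partial>\<mu>) \<le> real (length zs) * exp_bd"
proof -
  have "integrable \<mu> (\<lambda>x. \<Sum>z\<leftarrow>zs. exp_weight ((1 / exp_scale z) *\<^sub>R z) x) \<and>
    (\<integral>x. (\<Sum>z\<leftarrow>zs. exp_weight ((1 / exp_scale z) *\<^sub>R z) x) \<partial>\<mu>) \<le> real (length zs) * exp_bd"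
  proof (induction zs)
    case (Cons z zs)
    have "integrable \<mu> (exp_weight ((1 / exp_scale z) *\<^sub>R z))" "(\<integral>x. exp_weight ((1 / exp_scale z) *\<^sub>R z) x \<partial>\<mu>) \<le> exp_bd"
      using exp_weight_integrable exp_weight_integral_le cnorm_exp_scale by blast+
    then show ?case using Cons by (auto simp: algebra_simps)
  qed simp
  then show "integrable \<mu> (\<lambda>x. \<Sum>z\<leftarrow>zs. exp_weight ((1 / exp_scale z) *\<^sub>R z) x)"
    "(\<integral>x. (\<Sum>z\<leftarrow>zs. exp_weight ((1 / exp_scale z) *\<^sub>R z) x) \<partial>\<mu>) \<le> real (length zs) * exp_bd" by auto
qed

lemma measurable_form_power [measurable]: "(\<lambda>x. form_power n (cext x) zs) \<in> borel_measurable \<mu>"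
proof (cases "length zs = n")
  case True
  have "(\<lambda>x. prod_list (map (cext x) zs)) \<in> borel_measurable \<mu>"
    by (induction zs) auto
  then show ?thesis using True by (simp add: form_power_def)
qed (simp add: form_power_def)

lemma integrable_form_power: "integrable \<mu> (\<lambda>x. form_power n (cext x) zs)"
proof (cases "length zs = n")
  case True
  let ?g = "\<lambda>x. (\<Prod>z\<leftarrow>zs. exp_scale z) * (fact n * (1 + (\<Sum>z\<leftarrow>zs. exp_weight ((1 / exp_scale z) *\<^sub>R z) x)))"
  have "integrable \<mu> ?g"
    using wsum_integrable(1) integrable_one
    by (intro integrable_mult_right Bochner_Integration.integrable_add) auto
  then show ?thesis
  proof (rule Bochner_Integration.integrable_bound)
    show "AE x in \<mu>. norm (form_power n (cext x) zs) \<le> norm (?g x)"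
    proof (rule AE_I2)
      fix x assume "x \<in> space \<mu>"
      from form_power_le[where s = exp_scale, OF this True exp_scale_pos]
      show "norm (form_power n (cext x) zs) \<le> norm (?g x)" by simp
    qed
  qed simp
qed (simp add: form_power_def)

lemma moment_bound:
  assumes "length zs = n"
  shows "cmod (moment n zs) \<le> fact n * exp_bd * (4 / exp_rad) ^ n * (\<Prod>z\<leftarrow>zs. cnorm ip lap_index z)"
proof (cases "0 \<in> set zs")
  \<comment> \<open>\<open>exp_scale 0\<close> is 1 and not proportional to the norm, so zero
    arguments are treated apart: there the moment vanishes by multilinearity.\<close>
  case True
  have "form_power n (cext x) zs = 0" if "x \<in> space \<mu>" for x
  proof -
    have "multilinear_form (length (replicate n (cext x))) (elem_form (replicate n (cext x)))"
      by (rule multilinear_elem_form) (simp add: clinear_cext linear_mu[OF that])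
    from multilinear_form_zero_arg[OF this True] show ?thesis by (simp add: form_power_eq)
  qed
  then have "moment n zs = (\<integral>x. 0 \<partial>\<mu>)"
    unfolding moment_def by (intro Bochner_Integration.integral_cong) auto
  then show ?thesis
    using exp_bd_nonneg exp_rad_pos by (auto intro!: mult_nonneg_nonneg prod_list_nonneg)
next
  case False
  let ?W = "\<lambda>x. \<Sum>z\<leftarrow>zs. exp_weight ((1 / exp_scale z) *\<^sub>R z) x"
  let ?g = "\<lambda>x. (\<Prod>z\<leftarrow>zs. exp_scale z) * (fact n * (1 + ?W x))"
  have gi: "integrable \<mu> ?g"
    using wsum_integrable(1) integrable_one
    by (intro integrable_mult_right Bochner_Integration.integrable_add) auto
  have P: "(\<Prod>z\<leftarrow>zs. exp_scale z) = (2 / exp_rad) ^ n * (\<Prod>z\<leftarrow>zs. cnorm ip lap_index z)"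
    using False assms
  proof (induction zs arbitrary: n)
    case (Cons z zs)
    then show ?case by (cases n) (auto simp: exp_scale_def)
  qed simp
  have P0: "(\<Prod>z\<leftarrow>zs. exp_scale z) \<ge> 0" by (rule prod_list_nonneg) (use exp_scale_pos less_imp_le in auto)
  have "cmod (moment n zs) \<le> (\<integral>x. norm (form_power n (cext x) zs) \<partial>\<mu>)"
    unfolding moment_def by (rule integral_norm_bound)
  also have "\<dots> \<le> (\<integral>x. ?g x \<partial>\<mu>)"
    by (rule integral_mono[OF integrable_norm[OF integrable_form_power] gi])
      (rule form_power_le[OF _ assms exp_scale_pos])
  also have "\<dots> = (\<Prod>z\<leftarrow>zs. exp_scale z) * (fact n * ((\<integral>x. 1 \<partial>\<mu>) + (\<integral>x. ?W x \<partial>\<mu>)))"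
    using Bochner_Integration.integral_add[OF integrable_one wsum_integrable(1), of zs] by simp
  \<comment> \<open>There are \<open>n + 1\<close> integrals of size at most \<open>exp_bd\<close>,
    and \<open>n + 1\<close> is at most \<open>2 ^ n\<close>. Together with the 2 in
    \<open>exp_scale\<close> this gives the base 4.\<close>
  also have "\<dots> \<le> (\<Prod>z\<leftarrow>zs. exp_scale z) * (fact n * (exp_bd * 2 ^ n))"
  proof (intro mult_left_mono)
    have "(\<integral>x. 1 \<partial>\<mu>) + (\<integral>x. ?W x \<partial>\<mu>) \<le> exp_bd + real n * exp_bd"
      using integral_one_le wsum_integrable(2)[of zs] assms by simp
    also have "\<dots> = exp_bd * real (Suc n)" by (simp add: algebra_simps)
    also have "\<dots> \<le> exp_bd * 2 ^ n"
      using Suc_leI[OF less_exp[of n]] by (intro mult_left_mono exp_bd_nonneg) (metis of_nat_le_iff of_nat_numeral of_nat_power)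
    finally show "(\<integral>x. 1 \<partial>\<mu>) + (\<integral>x. ?W x \<partial>\<mu>) \<le> exp_bd * 2 ^ n" .
  qed (use P0 in auto)
  also have "\<dots> = fact n * exp_bd * ((2 / exp_rad) ^ n * 2 ^ n) * (\<Prod>z\<leftarrow>zs. cnorm ip lap_index z)"
    unfolding P by simp
  also have "(2 / exp_rad) ^ n * 2 ^ n = (4 / exp_rad) ^ n" by (simp add: power_mult_distrib[symmetric])
  finally show ?thesis .
qed

lemma multilinear_form_power: "clinear_form x \<Longrightarrow> multilinear_form n (form_power n x)"
  using multilinear_elem_form[of "replicate n x"] by (simp add: form_power_eq)

lemma multilinear_moment: "multilinear_form n (moment n)"
  unfolding multilinear_form_def
proof (intro conjI allI impI)
  fix es :: "'n cx list" assume "length es \<noteq> n"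
  then show "moment n es = 0" by (simp add: moment_def form_power_def)
next
  fix es :: "'n cx list" and i c \<xi> \<zeta> assume *: "length es = n \<and> i < n"
  have "moment n (es[i := cscale c \<xi> + \<zeta>])
     = (\<integral>x. c * form_power n (cext x) (es[i := \<xi>]) + form_power n (cext x) (es[i := \<zeta>]) \<partial>\<mu>)"
    unfolding moment_def
  proof (rule Bochner_Integration.integral_cong[OF refl])
    fix x assume "x \<in> space \<mu>"
    from multilinear_form_update[OF multilinear_form_power[OF clinear_cext[OF linear_mu[OF this]]], of es n i] *
    show "form_power n (cext x) (es[i := cscale c \<xi> + \<zeta>])
        = c * form_power n (cext x) (es[i := \<xi>]) + form_power n (cext x) (es[i := \<zeta>])" by blast
  qed
  also have "\<dots> = c * moment n (es[i := \<xi>]) + moment n (es[i := \<zeta>])"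
    unfolding moment_def by (simp add: integrable_form_power)
  finally show "moment n (es[i := cscale c \<xi> + \<zeta>]) = c * moment n (es[i := \<xi>]) + moment n (es[i := \<zeta>])" .
qed

lemma moment_0: "moment 0 zs = (if zs = [] then of_real mass else 0)"
  by (simp add: moment_def form_power_def mass_def scaleR_conv_of_real)

lemma sum_tuples_prod:
  fixes f :: "'a \<Rightarrow> real"
  assumes "finite A"
  shows "(\<Sum>es\<in>tuples A n. (\<Prod>e\<leftarrow>es. f e)) = (\<Sum>e\<in>A. f e) ^ n"
proof (induction n)
  case (Suc n)
  then show ?case using assms by (simp add: sum_tuples_Suc sum_distrib_left[symmetric] sum_distrib_right)
qed simp

text \<open>Squares of the pointwise bound, summed over a system orthonormal at level
  \<open>r\<close>, factor into powers of a single sum, which is bounded because H_r embeds into the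
  space of index \<open>lap_index\<close> by a Hilbert-Schmidt map. The constant is arranged to be
  \<open>mass\<close> so that it cancels in the bound for the reciprocal.\<close>

lemma moment_Hneg_ex:
  "\<exists>r E. E > 0 \<and> (\<forall>n. moment n \<in> Hneg ip r n \<and> Hneg_norm ip r n (moment n) \<le> fact n * mass * E ^ n)"
proof -
  obtain r M where r: "\<forall>A. finite A \<and> orthonormal ip r A \<longrightarrow> (\<Sum>e\<in>A. (hnorm ip lap_index e)\<^sup>2) \<le> M"
    using hilbert_schmidt by blast
  have M: "M \<ge> 0" using r[rule_format, of "{}"] orthonormal_empty by simp
  \<comment> \<open>Absorbs the Hilbert-Schmidt bound; the added 1 makes it positive.\<close>
  define D where "D = 4 / exp_rad * sqrt M + 1"
  have D: "D > 0" using exp_rad_pos M by (simp add: D_def add_nonneg_pos)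
  \<comment> \<open>The second factor trades \<open>exp_bd\<close> for \<open>mass\<close> as soon
    as \<open>n > 0\<close>; in degree 0 the moment is \<open>mass\<close> exactly.\<close>
  define E where "E = D * (1 + exp_bd / mass)"
  have wm: "exp_bd / mass \<ge> 0" using exp_bd_nonneg mass_pos by simp
  have E: "E > 0" using D wm by (simp add: E_def add_pos_nonneg)
  have "moment n \<in> Hneg ip r n \<and> Hneg_norm ip r n (moment n) \<le> fact n * mass * E ^ n" for n
  proof -
    let ?K = "fact n * mass * E ^ n"
    have b: "tsum A n (moment n) \<le> ?K\<^sup>2" if A: "finite A" "orthonormal ip r A" for A
    proof (cases n)
      case 0
      then show ?thesis by (simp add: moment_0)
    next
      case (Suc m)
      have "tsum A n (moment n) \<le> (\<Sum>es\<in>tuples A n. (fact n * exp_bd * (4 / exp_rad) ^ n)\<^sup>2 * (\<Prod>e\<leftarrow>es. (hnorm ip lap_index e)\<^sup>2))"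
      proof (rule sum_mono)
        fix es assume "es \<in> tuples A n"
        then have "cmod (moment n (embed es)) \<le> fact n * exp_bd * (4 / exp_rad) ^ n * (\<Prod>z\<leftarrow>embed es. cnorm ip lap_index z)"
          by (intro moment_bound) (simp add: length_tuples)
        from power_mono[OF this norm_ge_zero, of 2]
        have "(cmod (moment n (embed es)))\<^sup>2 \<le> (fact n * exp_bd * (4 / exp_rad) ^ n)\<^sup>2 * (\<Prod>e\<leftarrow>es. hnorm ip lap_index e)\<^sup>2"
          by (simp add: power_mult_distrib o_def)
        also have "(\<Prod>e\<leftarrow>es. hnorm ip lap_index e)\<^sup>2 = (\<Prod>e\<leftarrow>es. (hnorm ip lap_index e)\<^sup>2)"
          by (induction es) (auto simp: power_mult_distrib)
        finally show "(cmod (moment n (embed es)))\<^sup>2 \<le> (fact n * exp_bd * (4 / exp_rad) ^ n)\<^sup>2 * (\<Prod>e\<leftarrow>es. (hnorm ip lap_index e)\<^sup>2)" .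
      qed
      also have "\<dots> = (fact n * exp_bd * (4 / exp_rad) ^ n)\<^sup>2 * (\<Sum>e\<in>A. (hnorm ip lap_index e)\<^sup>2) ^ n"
        by (simp add: sum_distrib_left[symmetric] sum_tuples_prod[OF A(1)])
      also have "\<dots> \<le> (fact n * exp_bd * (4 / exp_rad) ^ n)\<^sup>2 * M ^ n"
        using r A by (intro mult_left_mono power_mono) (auto intro: sum_nonneg)
      also have "\<dots> = (fact n * exp_bd * (4 / exp_rad * sqrt M) ^ n)\<^sup>2"
      proof -
        have "M ^ n = (sqrt M ^ n)\<^sup>2" using M by (simp add: power_mult[symmetric] mult.commute[of n 2] power_mult)
        then show ?thesis by (simp add: power_mult_distrib power_divide)
      qed
      also have "\<dots> \<le> ?K\<^sup>2"
      proof (rule power_mono)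
        have "exp_bd * (4 / exp_rad * sqrt M) ^ n \<le> exp_bd * D ^ n"
          using exp_bd_nonneg exp_rad_pos M by (intro mult_left_mono power_mono) (auto simp: D_def)
        also have "exp_bd * D ^ n \<le> mass * (1 + exp_bd / mass) ^ n * D ^ n"
        proof (rule mult_right_mono)
          have "exp_bd / mass \<le> (1 + exp_bd / mass) ^ 1" by simp
          also have "\<dots> \<le> (1 + exp_bd / mass) ^ n" by (rule power_increasing) (use Suc wm in auto)
          finally show "exp_bd \<le> mass * (1 + exp_bd / mass) ^ n" using mass_pos by (simp add: field_simps)
        qed (use D in auto)
        also have "\<dots> = mass * E ^ n" by (simp add: E_def power_mult_distrib mult_ac)
        finally have "fact n * (exp_bd * (4 / exp_rad * sqrt M) ^ n) \<le> fact n * (mass * E ^ n)"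
          by (rule mult_left_mono) simp
        then show "fact n * exp_bd * (4 / exp_rad * sqrt M) ^ n \<le> ?K" by (simp add: mult.assoc)
      qed (use exp_bd_nonneg exp_rad_pos M in auto)
      finally show ?thesis .
    qed
    show ?thesis using HnegI[OF multilinear_moment _ b] E mass_pos by auto
  qed
  then show ?thesis using E by blast
qed

text \<open>The exponential series is integrated termwise. Passing to twice the argument supplies
  the geometric factor for domination, which halves the radius.\<close>

lemma laplace_sums:
  assumes "cnorm ip lap_index \<xi> < exp_rad / 2"
  shows "(\<lambda>n. moment n (replicate n \<xi>) / fact n) sums laplace \<mu> \<xi>"
proof -
  let ?z = "2 *\<^sub>R \<xi>"
  let ?f = "\<lambda>n x. form_power n (cext x) (replicate n \<xi>) / fact n"
  have z: "cnorm ip lap_index ?z < exp_rad"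
    using assms by (simp add: cnorm_scaleR)
  have f: "?f n x = cext x \<xi> ^ n / fact n" for n x by (simp add: form_power_def)
  have le: "norm (?f n x) \<le> (1 / 2) ^ n * exp_weight ?z x" if "x \<in> space \<mu>" for n x
  proof -
    let ?v = "\<bar>x (fst \<xi>)\<bar> + \<bar>x (snd \<xi>)\<bar>"
    have "norm (?f n x) = cmod (cext x \<xi>) ^ n / fact n" by (simp add: f norm_divide norm_power)
    also have "\<dots> \<le> ?v ^ n / fact n"
      by (intro divide_right_mono power_mono cmod_cext_le_abs) auto
    also have "\<dots> = (1 / 2) ^ n * ((2 * ?v) ^ n / fact n)"
      by (simp add: power_mult_distrib power_divide del: distrib_left_numeral)
    also have "\<dots> \<le> (1 / 2) ^ n * exp (2 * ?v)"
      using power_le_fact_exp[of "2 * ?v" n] by (intro mult_left_mono) (auto simp: field_simps)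
    also have "exp (2 * ?v) = exp_weight ?z x"
      using linear_scale[OF linear_mu[OF that], of 2] by (simp add: exp_weight_def abs_mult)
    finally show ?thesis .
  qed
  have s: "(\<lambda>n. \<integral>x. ?f n x \<partial>\<mu>) sums (\<integral>x. (\<Sum>n. ?f n x) \<partial>\<mu>)"
  proof (rule sums_integral)
    show i: "integrable \<mu> (?f n)" for n using integrable_form_power by simp
    have gs: "summable (\<lambda>n. (1 / 2) ^ n * c)" for c :: real
      by (intro summable_mult2 summable_geometric) simp
    show "AE x in \<mu>. summable (\<lambda>n. norm (?f n x))"
    proof (rule AE_I2)
      fix x assume x: "x \<in> space \<mu>"
      show "summable (\<lambda>n. norm (?f n x))"
        by (rule summable_comparison_test'[OF gs, of 0]) (use le[OF x] in auto)
    qed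
    show "summable (\<lambda>n. \<integral>x. norm (?f n x) \<partial>\<mu>)"
    proof (rule summable_comparison_test'[OF gs, of 0])
      fix n :: nat
      have "(\<integral>x. norm (?f n x) \<partial>\<mu>) \<le> (\<integral>x. (1 / 2) ^ n * exp_weight ?z x \<partial>\<mu>)"
        by (rule integral_mono) (use i le exp_weight_integrable[OF z] in auto)
      also have "\<dots> \<le> (1 / 2) ^ n * exp_bd"
        using exp_weight_integral_le[OF z] by (simp add: mult_left_mono)
      finally show "norm (\<integral>x. norm (?f n x) \<partial>\<mu>) \<le> (1 / 2) ^ n * exp_bd"
        using Bochner_Integration.integral_nonneg[of \<mu> "\<lambda>x. norm (?f n x)"] by simp
    qed
  qed
  have e: "(\<Sum>n. ?f n x) = exp (cext x \<xi>)" for x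
    unfolding f exp_def by (simp add: scaleR_conv_of_real field_simps)
  show ?thesis using s unfolding e laplace_def moment_def by simp
qed

lemma moment_replicate_cscale: "moment n (replicate n (cscale t \<xi>)) = t ^ n * moment n (replicate n \<xi>)"
proof -
  have "moment n (replicate n (cscale t \<xi>)) = (\<integral>x. t ^ n * form_power n (cext x) (replicate n \<xi>) \<partial>\<mu>)"
    unfolding moment_def
    by (intro Bochner_Integration.integral_cong refl)
      (simp add: form_power_def cext_cscale[OF linear_mu] power_mult_distrib)
  then show ?thesis by (simp add: moment_def)
qed

lemma laplace_fps:
  "(\<lambda>t. laplace \<mu> (cscale t \<xi>)) has_fps_expansion Abs_fps (\<lambda>n. moment n (replicate n \<xi>) / fact n)"
proof -
  let ?F = "Abs_fps (\<lambda>n. moment n (replicate n \<xi>) / fact n)"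
  \<comment> \<open>Keeps the disc on the line inside the ball of convergence; the added 1 covers
    \<open>\<xi> = 0\<close>.\<close>
  define r where "r = exp_rad / 2 / (cnorm ip lap_index \<xi> + 1)"
  have n1: "cnorm ip lap_index \<xi> + 1 > 0" by (simp add: add_nonneg_pos)
  have r: "r > 0" using exp_rad_pos n1 by (simp add: r_def)
  have s: "(\<lambda>n. fps_nth ?F n * t ^ n) sums laplace \<mu> (cscale t \<xi>)" if t: "cmod t < r" for t
  proof -
    have "cnorm ip lap_index (cscale t \<xi>) \<le> cmod t * (cnorm ip lap_index \<xi> + 1)"
      by (simp add: cnorm_cscale mult_left_mono)
    also have "\<dots> < exp_rad / 2" using t n1 by (simp add: r_def field_simps)
    finally show ?thesis
      using laplace_sums[of "cscale t \<xi>"] by (simp add: moment_replicate_cscale mult_ac)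
  qed
  show ?thesis
    unfolding has_fps_expansion_def
  proof
    have "summable (\<lambda>n. fps_nth ?F n * (of_real (r / 2)) ^ n)"
      using s[of "of_real (r / 2)"] r by (auto intro: sums_summable)
    from conv_radius_geI[OF this] have "ereal (r / 2) \<le> fps_conv_radius ?F"
      using r by (simp add: fps_conv_radius_def)
    then show "0 < fps_conv_radius ?F" using r by (metis ereal_less(2) half_gt_zero less_le_trans)
    have "\<forall>\<^sub>F z in nhds 0. z \<in> ball 0 r" by (rule eventually_nhds_in_open) (use r in auto)
    then show "\<forall>\<^sub>F z in nhds 0. eval_fps ?F z = laplace \<mu> (cscale z \<xi>)"
    proof (rule eventually_mono)
      fix z :: complex assume "z \<in> ball 0 r"
      then show "eval_fps ?F z = laplace \<mu> (cscale z \<xi>)"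
        unfolding eval_fps_def using sums_unique[OF s[of z]] by simp
    qed
  qed
qed

end

section \<open>Symmetrization of forms\<close>

definition symmetrize :: "nat \<Rightarrow> 'n form \<Rightarrow> 'n form" where
  "symmetrize n \<Phi> = (\<lambda>es. \<Sum>\<pi> | \<pi> permutes {..<n}. 1 / fact n * permute_form n \<pi> \<Phi> es)"

lemma permute_list_replicate:
  assumes "\<pi> permutes {..<n}"
  shows "permute_list \<pi> (replicate n \<xi>) = replicate n \<xi>"
proof (rule nth_equalityI)
  fix i assume "i < length (permute_list \<pi> (replicate n \<xi>))"
  then have i: "i < n" by simp
  then have "\<pi> i < n" using permutes_in_image[OF assms, of i] by simp
  then show "permute_list \<pi> (replicate n \<xi>) ! i = replicate n \<xi> ! i"
    using assms i by (simp add: permute_list_nth)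
qed simp

lemma symmetrize_diag: "symmetrize n \<Phi> (replicate n \<xi>) = \<Phi> (replicate n \<xi>)"
proof -
  have "symmetrize n \<Phi> (replicate n \<xi>) = (\<Sum>\<pi> | \<pi> permutes {..<n}. 1 / fact n * \<Phi> (replicate n \<xi>))"
    unfolding symmetrize_def by (intro sum.cong) (auto simp: permute_form_def permute_list_replicate)
  then show ?thesis by (simp add: card_permutations[of "{..<n}" n])
qed

lemma permute_form_symmetrize:
  assumes \<sigma>: "\<sigma> permutes {..<n}"
  shows "permute_form n \<sigma> (symmetrize n \<Phi>) = symmetrize n \<Phi>"
proof
  fix es
  show "permute_form n \<sigma> (symmetrize n \<Phi>) es = symmetrize n \<Phi> es"
  proof (cases "length es = n")
    case True
    have "permute_form n \<sigma> (symmetrize n \<Phi>) es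
        = (\<Sum>\<pi> | \<pi> permutes {..<n}. 1 / fact n * \<Phi> (permute_list (\<sigma> \<circ> \<pi>) es))"
      using True unfolding symmetrize_def permute_form_def
      by (auto simp: permute_list_compose intro!: sum.cong)
    also have "\<dots> = (\<Sum>\<pi> | \<pi> permutes {..<n}. 1 / fact n * \<Phi> (permute_list \<pi> es))"
      by (rule setum_permutations_compose_left[OF \<sigma>, symmetric])
    also have "\<dots> = symmetrize n \<Phi> es" using True by (simp add: symmetrize_def permute_form_def)
    finally show ?thesis .
  qed (simp add: symmetrize_def permute_form_def)
qed

text \<open>Polarization with the complexified space regarded as a real vector space.\<close>

lemma symmetric_form_eq_0:
  assumes "multilinear_form n \<Phi>" "\<And>\<pi>. \<pi> permutes {..<n} \<Longrightarrow> permute_form n \<pi> \<Phi> = \<Phi>"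
    "\<And>\<xi>. \<Phi> (replicate n \<xi>) = 0"
  shows "\<Phi> es = 0"
proof (cases "length es = n")
  case len: True
  show ?thesis
  proof (cases n)
    case 0
    then show ?thesis using assms(3)[of undefined] len by simp
  next
    case (Suc m)
    show ?thesis
    proof (rule polarization_zero[where n = m])
      note ml = assms(1)[unfolded Suc]
      show "\<Phi> ((x + y) # zs) = \<Phi> (x # zs) + \<Phi> (y # zs)" if "length zs = m" for zs x y
        using multilinear_form_head[OF ml that, of 1 x y] by simp
      show "\<Phi> ((c *\<^sub>R x) # zs) = of_real c * \<Phi> (x # zs)" if "length zs = m" for zs c x
        using multilinear_form_head[OF ml that, of "of_real c" x 0] multilinear_form_head_zero[OF ml]
        by (simp add: cscale_of_real)
      show "\<Phi> xs = \<Phi> ys" if ms: "mset xs = mset ys" for xs ys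
      proof (cases "length ys = n")
        case True
        obtain \<pi> where \<pi>: "\<pi> permutes {..<length ys}" "permute_list \<pi> ys = xs"
          using mset_eq_permutation[OF ms] .
        then show ?thesis using assms(2)[of \<pi>] True by (metis permute_form_def)
      next
        case False
        then show ?thesis using mset_eq_length[OF ms] assms(1) by (simp add: multilinear_form_length)
      qed
      show "\<Phi> (replicate (Suc m) x) = 0" for x using assms(3)[of x] Suc by simp
    qed (use len Suc in simp)
  qed
qed (use assms(1) in \<open>simp add: multilinear_form_length\<close>)

context nuclear_triple
begin

lemma symmetrize_Hneg: "\<Phi> \<in> Hneg ip p n \<Longrightarrow> symmetrize n \<Phi> \<in> Hneg ip p n"
  unfolding symmetrize_def by (rule Hneg_sum(1)) (auto intro: Hneg_permute)

lemma sym_fun_symmetrize: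
  assumes "sym_fun p n \<phi>" "\<Phi> \<in> Hneg ip p n"
  shows "\<phi> (symmetrize n \<Phi>) = \<phi> \<Phi>"
proof -
  have "\<phi> (symmetrize n \<Phi>) = (\<Sum>\<pi> | \<pi> permutes {..<n}. 1 / fact n * \<phi> (permute_form n \<pi> \<Phi>))"
    unfolding symmetrize_def by (rule sym_fun_sum_arg[OF assms(1)]) (auto intro: Hneg_permute assms)
  also have "\<dots> = (\<Sum>\<pi> | \<pi> permutes {..<n}. 1 / fact n * \<phi> \<Phi>)"
    by (rule sum.cong) (auto simp: sym_fun_permute[OF assms])
  finally show ?thesis by (simp add: card_permutations[of "{..<n}" n])
qed

text \<open>The uniqueness that the definite description in \<open>appell_kernel\<close>
  requires.\<close>

lemma sym_dual_tensors_eqI: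
  assumes "\<Phi> \<in> sym_dual_tensors ip n" "\<Psi> \<in> sym_dual_tensors ip n"
    "\<And>\<xi>. \<Phi> (replicate n \<xi>) = \<Psi> (replicate n \<xi>)"
  shows "\<Phi> = \<Psi>"
proof
  fix es
  obtain p where p: "\<Phi> \<in> Hneg ip p n" "\<Psi> \<in> Hneg ip p n"
    using dual_tensors_common[of \<Phi> n \<Psi>] assms(1,2) unfolding sym_dual_tensors_def by blast
  have "(\<lambda>es. -1 * \<Psi> es + \<Phi> es) es = 0"
  proof (rule symmetric_form_eq_0)
    show "multilinear_form n (\<lambda>es. -1 * \<Psi> es + \<Phi> es)"
      by (intro multilinear_form_comb Hneg_multilinear[OF p(1)] Hneg_multilinear[OF p(2)])
    fix \<pi> assume "\<pi> permutes {..<n}"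
    then have "permute_form n \<pi> \<Phi> = \<Phi>" "permute_form n \<pi> \<Psi> = \<Psi>"
      using assms(1,2) by (auto simp: sym_dual_tensors_def)
    then show "permute_form n \<pi> (\<lambda>es. -1 * \<Psi> es + \<Phi> es) = (\<lambda>es. -1 * \<Psi> es + \<Phi> es)"
      unfolding permute_form_def fun_eq_iff by (metis mult_zero_right add.right_neutral)
  qed (simp add: assms(3))
  then show "\<Phi> es = \<Psi> es" by simp
qed

lemma dual_bound:
  assumes "x \<in> dual ip"
  obtains p K where "K \<ge> 0" "\<And>\<xi>. \<bar>x \<xi>\<bar> \<le> K * hnorm ip p \<xi>"
proof -
  obtain p K where x: "\<And>\<xi>. \<bar>x \<xi>\<bar> \<le> K * hnorm ip p \<xi>" using assms by (auto simp: dual_def)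
  have "\<bar>x \<xi>\<bar> \<le> \<bar>K\<bar> * hnorm ip p \<xi>" for \<xi>
  proof -
    have "K * hnorm ip p \<xi> \<le> \<bar>K\<bar> * hnorm ip p \<xi>" by (rule mult_right_mono) auto
    then show ?thesis using x[of \<xi>] by linarith
  qed
  then show ?thesis using that[of "\<bar>K\<bar>" p] by simp
qed

lemma dual_linear: "x \<in> dual ip \<Longrightarrow> linear x"
  by (simp add: dual_def)

end

section \<open>Appell kernels\<close>

context appell_measure
begin

definition mom_idx :: nat where
  "mom_idx = (SOME r. \<exists>E. E > 0 \<and> (\<forall>n. moment n \<in> Hneg ip r n \<and> Hneg_norm ip r n (moment n) \<le> fact n * mass * E ^ n))"

definition mom_rate :: real where
  "mom_rate = (SOME E. E > 0 \<and> (\<forall>n. moment n \<in> Hneg ip mom_idx n \<and>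
     Hneg_norm ip mom_idx n (moment n) \<le> fact n * mass * E ^ n))"

lemma mom_rate_pos: "mom_rate > 0"
  and moment_Hneg0: "moment n \<in> Hneg ip mom_idx n"
  and moment_norm0: "Hneg_norm ip mom_idx n (moment n) \<le> fact n * mass * mom_rate ^ n"
proof -
  have "\<exists>E. E > 0 \<and> (\<forall>n. moment n \<in> Hneg ip mom_idx n \<and> Hneg_norm ip mom_idx n (moment n) \<le> fact n * mass * E ^ n)"
    unfolding mom_idx_def by (rule someI_ex[OF moment_Hneg_ex])
  from someI_ex[OF this] show "mom_rate > 0" "moment n \<in> Hneg ip mom_idx n"
    "Hneg_norm ip mom_idx n (moment n) \<le> fact n * mass * mom_rate ^ n"
    unfolding mom_rate_def[symmetric] by auto
qed

text \<open>\<open>recip_form n\<close> is the kernel of the \<open>n\<close>-th Taylor coefficient, times \<open>n!\<close>, of the reciprocal of the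
  Laplace transform, in a version that need not be symmetric.\<close>

fun recip_form :: "nat \<Rightarrow> 'n form" where
  "recip_form n = (\<lambda>zs. ((if n = 0 \<and> zs = [] then 1 else 0)
     - (\<Sum>j<n. of_nat (n choose j) * tprod j (recip_form j) (moment (n - j)) zs)) / of_real mass)"

declare recip_form.simps [simp del]

text \<open>Strong induction. By the binomial coefficient and the cancellation of
  \<open>mass\<close>, the \<open>j\<close>-th summand is at most
  \<open>fact n * mom_rate ^ n * 2 ^ j\<close>. The geometric sum is \<open>2 ^ n - 1\<close>,
  whence the doubled rate, and the missing 1 accommodates the term of degree 0.\<close>

lemma recip_form_Hneg0: "recip_form n \<in> Hneg ip mom_idx n \<and> Hneg_norm ip mom_idx n (recip_form n) \<le> fact n * (2 * mom_rate) ^ n / mass"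
proof (induction n rule: less_induct)
  case (less n)
  let ?r = mom_idx and ?E = mom_rate
  let ?\<delta> = "\<lambda>zs :: 'n cx list. if n = 0 \<and> zs = [] then 1 else 0 :: complex"
  let ?S = "\<lambda>zs. \<Sum>j<n. of_nat (n choose j) * tprod j (recip_form j) (moment (n - j)) zs"
  have \<delta>: "?\<delta> \<in> Hneg ip ?r n" "Hneg_norm ip ?r n ?\<delta> \<le> (if n = 0 then 1 else 0)"
  proof -
    have b: "tsum A n ?\<delta> \<le> (if n = 0 then 1 else 0)\<^sup>2" for A by (cases n) auto
    have m: "multilinear_form n ?\<delta>" by (cases "n = 0") (auto simp: multilinear_form_0 multilinear_form_zero)
    show "?\<delta> \<in> Hneg ip ?r n" "Hneg_norm ip ?r n ?\<delta> \<le> (if n = 0 then 1 else 0)"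
      using HnegI[OF m _ b] by auto
  qed
  have t: "tprod j (recip_form j) (moment (n - j)) \<in> Hneg ip ?r n"
    "Hneg_norm ip ?r n (tprod j (recip_form j) (moment (n - j)))
      \<le> (fact j * (2 * ?E) ^ j / mass) * (fact (n - j) * mass * ?E ^ (n - j))" if "j < n" for j
  proof -
    have j: "j + (n - j) = n" using that by simp
    note IH = less.IH[OF that]
    show "tprod j (recip_form j) (moment (n - j)) \<in> Hneg ip ?r n"
      using Hneg_tprod(1)[OF conjunct1[OF IH] moment_Hneg0[of "n - j"]] j by simp
    have "Hneg_norm ip ?r n (tprod j (recip_form j) (moment (n - j)))
       \<le> Hneg_norm ip ?r j (recip_form j) * Hneg_norm ip ?r (n - j) (moment (n - j))"
      using Hneg_tprod(2)[OF conjunct1[OF IH] moment_Hneg0[of "n - j"]] j by simp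
    also have "\<dots> \<le> (fact j * (2 * ?E) ^ j / mass) * (fact (n - j) * mass * ?E ^ (n - j))"
      using IH moment_norm0[of "n - j"] mass_pos mom_rate_pos
      by (intro mult_mono Hneg_norm_nonneg moment_Hneg0) auto
    finally show "Hneg_norm ip ?r n (tprod j (recip_form j) (moment (n - j)))
      \<le> (fact j * (2 * ?E) ^ j / mass) * (fact (n - j) * mass * ?E ^ (n - j))" .
  qed
  have S: "?S \<in> Hneg ip ?r n" by (rule Hneg_sum(1)) (use t in auto)
  have "Hneg_norm ip ?r n ?S \<le> (\<Sum>j<n. cmod (of_nat (n choose j)) * Hneg_norm ip ?r n (tprod j (recip_form j) (moment (n - j))))"
    by (rule Hneg_sum(2)) (use t in auto)
  also have "\<dots> \<le> (\<Sum>j<n. fact n * ?E ^ n * 2 ^ j)"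
  proof (rule sum_mono)
    fix j assume "j \<in> {..<n}"
    then have j: "j < n" by simp
    have "cmod (of_nat (n choose j)) * Hneg_norm ip ?r n (tprod j (recip_form j) (moment (n - j)))
       \<le> real (n choose j) * ((fact j * (2 * ?E) ^ j / mass) * (fact (n - j) * mass * ?E ^ (n - j)))"
      using t(2)[OF j] by (simp add: mult_left_mono)
    also have "\<dots> = (fact j * fact (n - j) * real (n choose j)) * (?E ^ j * ?E ^ (n - j)) * 2 ^ j"
      using mass_pos by (simp add: power_mult_distrib)
    also have "fact j * fact (n - j) * real (n choose j) = fact n"
      using binomial_fact_lemma[of j n] j by (metis less_imp_le of_nat_fact of_nat_mult)
    also have "?E ^ j * ?E ^ (n - j) = ?E ^ n" using j by (simp add: power_add[symmetric])
    finally show "cmod (of_nat (n choose j)) * Hneg_norm ip ?r n (tprod j (recip_form j) (moment (n - j)))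
       \<le> fact n * ?E ^ n * 2 ^ j" .
  qed
  also have "\<dots> = fact n * ?E ^ n * (2 ^ n - 1)"
    using power_diff_1_eq[of "2::real" n] by (simp add: sum_distrib_left[symmetric])
  finally have Sn: "Hneg_norm ip ?r n ?S \<le> fact n * ?E ^ n * (2 ^ n - 1)" .
  have "recip_form n = (\<lambda>zs. of_real (1 / mass) * (-1 * ?S zs + ?\<delta> zs))"
    by (subst recip_form.simps) (auto simp: field_simps)
  moreover have c: "(\<lambda>zs. -1 * ?S zs + ?\<delta> zs) \<in> Hneg ip ?r n"
    by (rule Hneg_comb(1)[OF S \<delta>(1)])
  moreover have "Hneg_norm ip ?r n (\<lambda>zs. -1 * ?S zs + ?\<delta> zs) \<le> fact n * (2 * ?E) ^ n"
  proof -
    have "Hneg_norm ip ?r n (\<lambda>zs. -1 * ?S zs + ?\<delta> zs) \<le> cmod (-1) * Hneg_norm ip ?r n ?S + Hneg_norm ip ?r n ?\<delta>"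
      by (rule Hneg_comb(2)[OF S \<delta>(1)])
    also have "\<dots> \<le> fact n * ?E ^ n * (2 ^ n - 1) + (if n = 0 then 1 else 0)"
      using Sn \<delta>(2) by (intro add_mono) auto
    also have "\<dots> \<le> fact n * (2 * ?E) ^ n"
      using mom_rate_pos by (simp add: power_mult_distrib algebra_simps)
    finally show ?thesis .
  qed
  ultimately show ?case
    using Hneg_scale[OF c, of "of_real (1 / mass)"] mass_pos
    by (auto simp: norm_divide field_simps intro: order_trans)
qed

text \<open>The recursion read backwards: its left-hand side is the term \<open>j = n\<close>, in
  which \<open>moment 0\<close> is the scalar \<open>mass\<close>. In terms of power series, the
  reciprocal times the Laplace transform is 1.\<close>

lemma recip_form_moment_conv:
  "(\<Sum>j\<le>n. of_nat (n choose j) * tprod j (recip_form j) (moment (n - j)) zs) = (if n = 0 \<and> zs = [] then 1 else 0)"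
proof -
  have m: "multilinear_form n (recip_form n)" using recip_form_Hneg0[of n] Hneg_multilinear by blast
  \<comment> \<open>On a list longer than \<open>n\<close> both sides vanish, the left one because
    \<open>moment 0\<close> meets a nonempty tail.\<close>
  have "tprod n (recip_form n) (moment 0) zs = of_real mass * recip_form n zs"
    using multilinear_form_length[OF m, of zs] multilinear_form_length[OF m, of "take n zs"]
    by (cases "length zs \<le> n") (auto simp: tprod_def moment_0)
  also have "\<dots> = (if n = 0 \<and> zs = [] then 1 else 0)
     - (\<Sum>j<n. of_nat (n choose j) * tprod j (recip_form j) (moment (n - j)) zs)"
    using mass_pos by (subst recip_form.simps) simp
  finally show ?thesis by (simp add: lessThan_Suc_atMost[symmetric])
qed

definition appell_form :: "nat \<Rightarrow> ('n \<Rightarrow> real) \<Rightarrow> 'n form" where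
  "appell_form n x = (\<lambda>zs. \<Sum>k\<le>n. of_nat (n choose k) * tprod k (recip_form k) (form_power (n - k) (cext x)) zs)"

lemma tprod_diag: "k \<le> n \<Longrightarrow> tprod k \<Phi> \<Psi> (replicate n \<xi>) = \<Phi> (replicate k \<xi>) * \<Psi> (replicate (n - k) \<xi>)"
  by (simp add: tprod_def min_def)

text \<open>On a complex line the tensors become formal power series: the convolution identity says
  that \<open>HF\<close> is the inverse of \<open>LF\<close>, so dividing the exponential by the
  Laplace transform is multiplication by \<open>HF\<close>, and coefficients are compared.\<close>

lemma appell_form_diag:
  assumes "linear x"
  shows "appell_form n x (replicate n \<xi>) = (deriv ^^ n) (\<lambda>t. normalized_exp \<mu> (cscale t \<xi>) x) 0"
proof -
  define LF where "LF = Abs_fps (\<lambda>n. moment n (replicate n \<xi>) / fact n)"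
  define HF where "HF = Abs_fps (\<lambda>n. recip_form n (replicate n \<xi>) / fact n)"
  have bin: "of_nat (n choose k) / fact n = (1 / (fact k * fact (n - k)) :: complex)" if "k \<le> n" for k n
    using binomial_fact[OF that, where 'a = complex] by simp
  have HL: "HF * LF = 1"
  proof (rule fps_ext)
    fix n
    have "fps_nth (HF * LF) n = (\<Sum>k\<le>n. recip_form k (replicate k \<xi>) / fact k * (moment (n - k) (replicate (n - k) \<xi>) / fact (n - k)))"
      by (simp add: fps_mult_nth HF_def LF_def atLeast0AtMost)
    also have "\<dots> = (\<Sum>k\<le>n. (of_nat (n choose k) * tprod k (recip_form k) (moment (n - k)) (replicate n \<xi>)) / fact n)"
    proof (rule sum.cong[OF refl])
      fix k assume "k \<in> {..n}"
      then have k: "k \<le> n" by simp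
      show "recip_form k (replicate k \<xi>) / fact k * (moment (n - k) (replicate (n - k) \<xi>) / fact (n - k))
          = (of_nat (n choose k) * tprod k (recip_form k) (moment (n - k)) (replicate n \<xi>)) / fact n"
        using bin[OF k] by (simp add: tprod_diag[OF k] field_simps)
    qed
    also have "\<dots> = (if n = 0 then 1 else 0)"
      using recip_form_moment_conv[of n "replicate n \<xi>"] by (simp add: sum_divide_distrib[symmetric])
    finally show "fps_nth (HF * LF) n = fps_nth 1 n" by simp
  qed
  have L0: "fps_nth LF 0 \<noteq> 0" using mass_pos by (simp add: LF_def moment_0)
  define z where "z = cext x \<xi>"
  have "(\<lambda>t. exp (z * t) / laplace \<mu> (cscale t \<xi>)) has_fps_expansion fps_exp z / LF"
    using L0 unfolding LF_def
    by (intro has_fps_expansion_divide' has_fps_expansion_exp laplace_fps)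
  also have "(\<lambda>t. exp (z * t) / laplace \<mu> (cscale t \<xi>)) = (\<lambda>t. normalized_exp \<mu> (cscale t \<xi>) x)"
    using cext_cscale[OF assms] by (auto simp: normalized_exp_def z_def mult.commute)
  also have "fps_exp z / LF = fps_exp z * HF"
  proof -
    have "inverse LF = HF" using HL by (metis fps_inverse_unique mult.commute)
    then show ?thesis using L0 by (simp add: fps_divide_unit)
  qed
  finally have "(deriv ^^ n) (\<lambda>t. normalized_exp \<mu> (cscale t \<xi>) x) 0 = fact n * fps_nth (HF * fps_exp z) n"
    by (simp add: fps_nth_fps_expansion mult.commute)
  also have "\<dots> = (\<Sum>k\<le>n. fact n * (recip_form k (replicate k \<xi>) / fact k * (z ^ (n - k) / fact (n - k))))"
    by (simp add: fps_mult_nth HF_def sum_distrib_left atLeast0AtMost)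
  also have "\<dots> = appell_form n x (replicate n \<xi>)"
    unfolding appell_form_def
  proof (rule sum.cong[OF refl])
    fix k assume "k \<in> {..n}"
    then have k: "k \<le> n" by simp
    show "fact n * (recip_form k (replicate k \<xi>) / fact k * (z ^ (n - k) / fact (n - k)))
        = of_nat (n choose k) * tprod k (recip_form k) (form_power (n - k) (cext x)) (replicate n \<xi>)"
      using binomial_fact[OF k, where 'a = complex] by (simp add: tprod_diag[OF k] form_power_def z_def)
  qed
  finally show ?thesis by simp
qed

lemma recip_form_Hneg: "mom_idx \<le> p \<Longrightarrow> recip_form n \<in> Hneg ip p n"
  and recip_form_norm: "mom_idx \<le> p \<Longrightarrow> Hneg_norm ip p n (recip_form n) \<le> fact n * (2 * mom_rate) ^ n / mass"
  and moment_Hneg: "mom_idx \<le> p \<Longrightarrow> moment n \<in> Hneg ip p n"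
  and moment_norm: "mom_idx \<le> p \<Longrightarrow> Hneg_norm ip p n (moment n) \<le> fact n * mass * mom_rate ^ n"
proof -
  assume p: "mom_idx \<le> p"
  note h = conjunct1[OF recip_form_Hneg0[of n]] conjunct2[OF recip_form_Hneg0[of n]]
  show "recip_form n \<in> Hneg ip p n" "moment n \<in> Hneg ip p n"
    by (rule Hneg_mono(1)[OF _ p], rule h moment_Hneg0)+
  show "Hneg_norm ip p n (recip_form n) \<le> fact n * (2 * mom_rate) ^ n / mass"
    using Hneg_mono(2)[OF h(1) p] h(2) by linarith
  show "Hneg_norm ip p n (moment n) \<le> fact n * mass * mom_rate ^ n"
    using Hneg_mono(2)[OF moment_Hneg0[of n] p] moment_norm0[of n] by linarith
qed

lemma appell_form_term_Hneg:
  assumes "mom_idx \<le> p" "linear x" "\<And>\<xi>. \<bar>x \<xi>\<bar> \<le> K * hnorm ip p \<xi>" "K \<ge> 0" "k \<le> n"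
  shows "tprod k (recip_form k) (form_power (n - k) (cext x)) \<in> Hneg ip p n"
  using Hneg_tprod(1)[OF recip_form_Hneg[OF assms(1)] Hneg_dual_power(1)[OF assms(2-4)], of k "n - k"] assms(5)
  by simp

lemma dual_bound_idx:
  assumes "x \<in> dual ip"
  obtains p K where "mom_idx \<le> p" "K \<ge> 0" "\<And>\<xi>. \<bar>x \<xi>\<bar> \<le> K * hnorm ip p \<xi>"
proof -
  obtain p K where x: "K \<ge> 0" "\<And>\<xi>. \<bar>x \<xi>\<bar> \<le> K * hnorm ip p \<xi>" using dual_bound[OF assms] by metis
  have "\<bar>x \<xi>\<bar> \<le> K * hnorm ip (max mom_idx p) \<xi>" for \<xi>
    using x(2)[of \<xi>] mult_left_mono[OF hnorm_le[of p "max mom_idx p" \<xi>] x(1)] by simp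
  then show ?thesis using that[of "max mom_idx p" K] x(1) by simp
qed

lemma appell_form_Hneg:
  assumes "mom_idx \<le> p" "linear x" "\<And>\<xi>. \<bar>x \<xi>\<bar> \<le> K * hnorm ip p \<xi>" "K \<ge> 0"
  shows "appell_form n x \<in> Hneg ip p n"
  unfolding appell_form_def by (rule Hneg_sum(1)) (use appell_form_term_Hneg[OF assms] in auto)

text \<open>\<open>appell_form\<close> has the right diagonal but is not symmetric; symmetrizing
  keeps the diagonal and meets the description.\<close>

lemma appell_kernel_eq:
  assumes x: "x \<in> dual ip"
  shows "appell_kernel ip \<mu> n x = symmetrize n (appell_form n x)"
  unfolding appell_kernel_def
proof (rule the_equality)
  obtain p K where p: "mom_idx \<le> p" "K \<ge> 0" "\<And>\<xi>. \<bar>x \<xi>\<bar> \<le> K * hnorm ip p \<xi>" by (rule dual_bound_idx[OF x]) blast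
  have "symmetrize n (appell_form n x) \<in> Hneg ip p n"
    by (rule symmetrize_Hneg[OF appell_form_Hneg[OF p(1) dual_linear[OF x] p(3,2)]])
  then have sd: "symmetrize n (appell_form n x) \<in> sym_dual_tensors ip n"
    by (auto simp: sym_dual_tensors_def permute_form_symmetrize intro: Hneg_dual_tensors)
  then show *: "symmetrize n (appell_form n x) \<in> sym_dual_tensors ip n \<and>
    (\<forall>\<xi>. symmetrize n (appell_form n x) (replicate n \<xi>) = (deriv ^^ n) (\<lambda>t. normalized_exp \<mu> (cscale t \<xi>) x) 0)"
    by (simp add: symmetrize_diag appell_form_diag[OF dual_linear[OF x]])
  fix \<Phi> assume \<Phi>: "\<Phi> \<in> sym_dual_tensors ip n \<and>
    (\<forall>\<xi>. \<Phi> (replicate n \<xi>) = (deriv ^^ n) (\<lambda>t. normalized_exp \<mu> (cscale t \<xi>) x) 0)"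
  show "\<Phi> = symmetrize n (appell_form n x)"
    by (rule sym_dual_tensors_eqI) (use \<Phi> * in auto)
qed

text \<open>A symmetric functional does not see the symmetrization, so the pairing opens into
  unsymmetrized products.\<close>

lemma appell_kernel_pairing:
  assumes x: "x \<in> dual ip" and \<phi>: "\<phi> \<in> sym_tensors ip n"
  shows "\<phi> (appell_kernel ip \<mu> n x)
    = (\<Sum>k\<le>n. of_nat (n choose k) * \<phi> (tprod k (recip_form k) (form_power (n - k) (cext x))))"
proof -
  obtain p K where p: "mom_idx \<le> p" "K \<ge> 0" "\<And>\<xi>. \<bar>x \<xi>\<bar> \<le> K * hnorm ip p \<xi>" by (rule dual_bound_idx[OF x]) blast
  note P = appell_form_Hneg[OF p(1) dual_linear[OF x] p(3,2)]
  note s = sym_tensors_sym_fun[OF \<phi>]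
  have "\<phi> (appell_kernel ip \<mu> n x) = \<phi> (appell_form n x)"
    unfolding appell_kernel_eq[OF x] by (rule sym_fun_symmetrize[OF s P])
  also have "\<dots> = (\<Sum>k\<le>n. of_nat (n choose k) * \<phi> (tprod k (recip_form k) (form_power (n - k) (cext x))))"
    unfolding appell_form_def
    by (rule sym_fun_sum_arg[OF s]) (use appell_form_term_Hneg[OF p(1) dual_linear[OF x] p(3,2)] in auto)
  finally show ?thesis .
qed

end

section \<open>Double series and vanishing power series\<close>

lemma triangle_sums:
  fixes a :: "nat \<Rightarrow> nat \<Rightarrow> complex"
  assumes le: "\<And>k m. cmod (a k m) \<le> u k * v m"
    and u: "summable u" "\<And>k. u k \<ge> 0" and v: "summable v" "\<And>m. v m \<ge> 0"
  obtains S where "(\<lambda>n. \<Sum>k\<le>n. a k (n - k)) sums S" "(\<lambda>m. \<Sum>k. a k m) sums S"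
proof -
  let ?F = "\<lambda>(m, k). a k m"
  \<comment> \<open>A product majorant bounds all finite sums, which gives summability over pairs;
    the two conclusions sum the same family along antidiagonals and along fixed
    \<open>m\<close>.\<close>
  have bound: "(\<Sum>x\<in>X. norm (?F x)) \<le> suminf u * suminf v" if "finite X" for X
  proof -
    obtain M N where MN: "X \<subseteq> {..<M} \<times> {..<N}"
    proof -
      have "finite (fst ` X)" "finite (snd ` X)" using \<open>finite X\<close> by auto
      then obtain M N where "\<forall>m\<in>fst ` X. m < M" "\<forall>n\<in>snd ` X. n < N"
        unfolding finite_nat_set_iff_bounded by blast
      then have "X \<subseteq> {..<M} \<times> {..<N}" by force
      then show ?thesis using that by blast
    qed
    have "(\<Sum>x\<in>X. norm (?F x)) \<le> (\<Sum>x\<in>{..<M} \<times> {..<N}. norm (?F x))"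
      using MN by (intro sum_mono2) auto
    also have "\<dots> \<le> (\<Sum>(m, k)\<in>{..<M} \<times> {..<N}. v m * u k)"
      using le by (intro sum_mono) (auto simp: mult.commute)
    also have "\<dots> = (\<Sum>m<M. v m) * (\<Sum>k<N. u k)" by (simp add: sum_product sum.cartesian_product)
    also have "\<dots> \<le> suminf v * suminf u"
      using u v by (intro mult_mono sum_le_suminf suminf_nonneg sum_nonneg) auto
    finally show ?thesis by (simp add: mult.commute)
  qed
  have "(\<lambda>x. norm (?F x)) summable_on UNIV \<times> UNIV"
    by (rule nonneg_bdd_above_summable_on) (use bound in \<open>auto intro!: bdd_aboveI2[where M = "suminf u * suminf v"]\<close>)
  then have "?F summable_on UNIV \<times> UNIV" by (rule abs_summable_summable)
  then obtain S where S: "(?F has_sum S) (UNIV \<times> UNIV)" by (auto simp: summable_on_def)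
  have "((\<lambda>m. \<Sum>k. a k m) has_sum S) UNIV"
  proof (rule has_sum_SigmaD[OF S])
    fix m
    have s: "summable (\<lambda>k. norm (a k m))"
      by (rule summable_comparison_test'[OF summable_mult2[OF u(1), of "v m"], of 0]) (use le in simp)
    show "((\<lambda>k. ?F (m, k)) has_sum (\<Sum>k. a k m)) UNIV"
      using norm_summable_imp_has_sum[OF s summable_sums[OF summable_norm_cancel[OF s]]] by simp
  qed
  moreover have "((\<lambda>n. \<Sum>k\<le>n. a k (n - k)) has_sum S) UNIV"
  proof (rule has_sum_SigmaD)
    have "bij_betw (\<lambda>(n, k). (n - k, k)) (SIGMA n:UNIV. {..n}) (UNIV \<times> UNIV :: (nat \<times> nat) set)"
      by (rule bij_betwI[where g = "\<lambda>(m, k). (m + k, k)"]) auto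
    from has_sum_reindex_bij_betw[OF this, of ?F S] S
    show "((\<lambda>(n, k). a k (n - k)) has_sum S) (SIGMA n:UNIV. {..n})" by (simp add: case_prod_unfold)
  qed simp
  ultimately show ?thesis using that has_sum_imp_sums by blast
qed

text \<open>Zeros of a nonzero power series are isolated. The isolation lemma asks for a nonzero
  coefficient of positive index, so index 0 is read off at \<open>t = 0\<close>.\<close>

lemma powser_zero_real:
  fixes a :: "nat \<Rightarrow> real"
  assumes "\<And>t. (\<lambda>n. a n * t ^ n) sums 0"
  shows "a m = 0"
proof (cases "m = 0")
  case True
  then show ?thesis using sums_unique2[OF assms[of 0] powser_sums_zero[of a]] by simp
next
  case False
  show ?thesis
  proof (rule ccontr)
    assume "a m \<noteq> 0"
    then obtain s where "0 < s" "\<And>z. z \<in> cball (0::real) s - {0} \<Longrightarrow> (\<lambda>_. 0::real) z \<noteq> 0"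
      using powser_0_nonzero[of 1 0 a "\<lambda>_. 0" m] assms False by auto
    then show False by (auto dest!: meta_spec[of _ s])
  qed
qed

text \<open>Only real \<open>t\<close> are available, because \<open>x\<close> is a real functional
  that can be scaled by reals only.\<close>

lemma powser_zero_complex:
  fixes a :: "nat \<Rightarrow> complex"
  assumes "\<And>t::real. (\<lambda>n. a n * of_real t ^ n) sums 0"
  shows "a m = 0"
proof (rule complex_eqI)
  show "Re (a m) = Re 0"
    using powser_zero_real[of "\<lambda>n. Re (a n)"] sums_Re[OF assms] by (simp add: of_real_power[symmetric] del: of_real_power)
  show "Im (a m) = Im 0"
    using powser_zero_real[of "\<lambda>n. Im (a n)"] sums_Im[OF assms] by (simp add: of_real_power[symmetric] del: of_real_power)
qed

text \<open>\<open>\<sigma>\<close> fixes the first \<open>k\<close> places and acts as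
  \<open>\<pi>\<close> on the rest. Hence tensoring with a fixed form on the left turns symmetric
  functionals of degree \<open>k + m\<close> into symmetric functionals of degree
  \<open>m\<close>.\<close>

lemma tprod_permute_right:
  assumes \<pi>: "\<pi> permutes {..<m}"
  obtains \<sigma> where "\<sigma> permutes {..<k + m}"
    "\<And>\<Phi> \<Psi> :: 'n form. (\<And>es. length es \<noteq> m \<Longrightarrow> \<Psi> es = 0) \<Longrightarrow> (\<And>es. length es \<noteq> k \<Longrightarrow> \<Phi> es = 0) \<Longrightarrow>
      tprod k \<Phi> (permute_form m \<pi> \<Psi>) = permute_form (k + m) \<sigma> (tprod k \<Phi> \<Psi>)"
proof -
  define \<sigma> where "\<sigma> i = (if i < k then i else k + \<pi> (i - k))" for i
  have \<pi>lt: "\<pi> i < m \<longleftrightarrow> i < m" for i using permutes_in_image[OF \<pi>, of i] by simp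
  have \<sigma>: "\<sigma> permutes {..<k + m}"
  proof (rule bij_imp_permutes)
    show "bij_betw \<sigma> {..<k + m} {..<k + m}"
    proof (rule bij_betwI[where g = "\<lambda>i. if i < k then i else k + inv \<pi> (i - k)"])
      have ilt: "inv \<pi> i < m \<longleftrightarrow> i < m" for i using permutes_in_image[OF permutes_inv[OF \<pi>], of i] by simp
      show "\<sigma> \<in> {..<k + m} \<rightarrow> {..<k + m}"
        using \<pi>lt by (fastforce simp: \<sigma>_def)
      show "(\<lambda>i. if i < k then i else k + inv \<pi> (i - k)) \<in> {..<k + m} \<rightarrow> {..<k + m}"
        using ilt by fastforce
    qed (auto simp: \<sigma>_def permutes_inverses[OF \<pi>])
    fix i assume "i \<notin> {..<k + m}"
    then show "\<sigma> i = i" using permutes_not_in[OF \<pi>, of "i - k"] by (auto simp: \<sigma>_def)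
  qed
  show ?thesis
  proof (rule that[OF \<sigma>])
    fix \<Phi> \<Psi> :: "'n form"
    assume z: "\<And>es. length es \<noteq> m \<Longrightarrow> \<Psi> es = 0" "\<And>es. length es \<noteq> k \<Longrightarrow> \<Phi> es = 0"
    show "tprod k \<Phi> (permute_form m \<pi> \<Psi>) = permute_form (k + m) \<sigma> (tprod k \<Phi> \<Psi>)"
    proof
      fix es
      show "tprod k \<Phi> (permute_form m \<pi> \<Psi>) es = permute_form (k + m) \<sigma> (tprod k \<Phi> \<Psi>) es"
      proof (cases "length es = k + m")
        case True
        have "take k (permute_list \<sigma> es) = take k es"
          by (rule nth_equalityI) (use True \<sigma> in \<open>auto simp: permute_list_nth \<sigma>_def\<close>)
        moreover have "drop k (permute_list \<sigma> es) = permute_list \<pi> (drop k es)"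
          by (rule nth_equalityI) (use True \<sigma> \<pi> \<pi>lt in \<open>auto simp: permute_list_nth \<sigma>_def\<close>)
        ultimately show ?thesis using True by (simp add: tprod_def permute_form_def)
      next
        case False
        then have "length (take k es) \<noteq> k \<or> length (drop k es) \<noteq> m" by auto
        then show ?thesis using False z(2)[of "take k es"] by (auto simp: tprod_def permute_form_def)
      qed
    qed
  qed
qed

section \<open>Uniqueness of Appell expansions\<close>

context appell_measure
begin

text \<open>\<open>2 * mom_rate\<close> is the growth rate of the reciprocal tensors; the bound 1/2
  leaves a geometric series.\<close>

lemma rate_ex: "\<exists>q. 2 * mom_rate * (1 / sqrt (2 ^ q)) \<le> 1 / 2"
proof -
  obtain q where q: "(4 * mom_rate)\<^sup>2 < 2 ^ q" using real_arch_pow[of 2 "(4 * mom_rate)\<^sup>2"] by auto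
  then have "4 * mom_rate \<le> sqrt (2 ^ q)" by (intro real_le_rsqrt) simp
  then show ?thesis by (intro exI[of _ q]) (simp add: field_simps)
qed

definition decay_idx :: nat where "decay_idx = (SOME q. 2 * mom_rate * (1 / sqrt (2 ^ q)) \<le> 1 / 2)"

definition decay :: real where "decay = 1 / sqrt (2 ^ decay_idx)"

lemma decay: "decay > 0" "2 * mom_rate * decay \<le> 1 / 2"
  using someI_ex[OF rate_ex] unfolding decay_idx_def[symmetric] decay_def by auto

text \<open>The choice of \<open>decay_idx\<close> makes the factor \<open>decay ^ n\<close> beat the growth of \<open>recip_form n\<close> and \<open>moment n\<close>.\<close>

lemma kernel_bound:
  assumes "f \<in> test_kernels ip" "\<Phi> \<in> Hneg ip p n"
  shows "cmod (f n \<Phi>) \<le> sqrt (pqN p decay_idx f) * decay ^ n / fact n * Hneg_norm ip p n \<Phi>"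
  using pqfin_eval[OF test_kernels_pqfin[OF assms(1)] assms(2), of decay_idx] by (simp add: decay_def)

text \<open>The \<open>k\<close>-th term in the coefficient of t^m of the overview, with the
  unsymmetrized tensor in place of h_k.\<close>

definition shift_term :: "(nat \<Rightarrow> 'n tensor) \<Rightarrow> nat \<Rightarrow> nat \<Rightarrow> 'n form \<Rightarrow> complex" where
  "shift_term f m k \<Phi> = of_nat (k + m choose k) * f (k + m) (tprod k (recip_form k) \<Phi>)"

text \<open>The binomial coefficient cancels the factorials of \<open>k\<close> and
  \<open>k + m\<close> and leaves \<open>1 / fact m\<close>, so the bound is a function of
  \<open>k\<close> times a function of \<open>m\<close>, as the rearrangement of the double series
  requires.\<close>

lemma shift_term_bound:
  assumes f: "f \<in> test_kernels ip" and p: "mom_idx \<le> p" and \<Phi>: "\<Phi> \<in> Hneg ip p m"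
  shows "cmod (shift_term f m k \<Phi>)
    \<le> (sqrt (pqN p decay_idx f) / mass * (1 / 2) ^ k) * (decay ^ m / fact m * Hneg_norm ip p m \<Phi>)"
proof -
  let ?A = "sqrt (pqN p decay_idx f)"
  have A: "?A \<ge> 0" using pqN_nonneg[OF test_kernels_pqfin[OF f]] by simp
  have N: "Hneg_norm ip p m \<Phi> \<ge> 0" by (rule Hneg_norm_nonneg[OF \<Phi>])
  note T = Hneg_tprod[OF recip_form_Hneg[OF p, of k] \<Phi>]
  have "cmod (f (k + m) (tprod k (recip_form k) \<Phi>)) \<le> ?A * decay ^ (k + m) / fact (k + m) * Hneg_norm ip p (k + m) (tprod k (recip_form k) \<Phi>)"
    by (rule kernel_bound[OF f T(1)])
  also have "\<dots> \<le> ?A * decay ^ (k + m) / fact (k + m) * ((fact k * (2 * mom_rate) ^ k / mass) * Hneg_norm ip p m \<Phi>)"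
  proof (rule mult_left_mono)
    show "Hneg_norm ip p (k + m) (tprod k (recip_form k) \<Phi>) \<le> fact k * (2 * mom_rate) ^ k / mass * Hneg_norm ip p m \<Phi>"
      using T(2) mult_right_mono[OF recip_form_norm[OF p, of k] N] by linarith
  qed (use A decay(1) in simp)
  finally have "cmod (shift_term f m k \<Phi>) \<le> real (k + m choose k) *
     (?A * decay ^ (k + m) / fact (k + m) * ((fact k * (2 * mom_rate) ^ k / mass) * Hneg_norm ip p m \<Phi>))"
    unfolding shift_term_def norm_mult norm_of_nat by (rule mult_left_mono) simp
  also have "\<dots> = ?A / mass * (2 * mom_rate * decay) ^ k * (decay ^ m / fact m * Hneg_norm ip p m \<Phi>)"
    by (simp add: binomial_fact power_add power_mult_distrib field_simps)
  also have "\<dots> \<le> ?A / mass * (1 / 2) ^ k * (decay ^ m / fact m * Hneg_norm ip p m \<Phi>)"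
    using A N decay mom_rate_pos mass_pos by (intro mult_right_mono mult_left_mono power_mono) auto
  finally show ?thesis .
qed

lemma half_summable: "summable (\<lambda>k. c * (1 / 2 :: real) ^ k)"
  by (intro summable_mult summable_geometric) simp

lemma shift_term_summable:
  assumes "f \<in> test_kernels ip" "mom_idx \<le> p" "\<Phi> \<in> Hneg ip p m"
  shows "summable (\<lambda>k. shift_term f m k \<Phi>)"
proof (rule summable_comparison_test'[OF summable_mult2[OF half_summable], of 0])
  show "norm (shift_term f m k \<Phi>) \<le> sqrt (pqN p decay_idx f) / mass * (1 / 2) ^ k * (decay ^ m / fact m * Hneg_norm ip p m \<Phi>)" for k
    by (rule shift_term_bound[OF assms])
qed

lemma shift_term_comb:
  assumes f: "f \<in> test_kernels ip" and p: "mom_idx \<le> p" and \<Phi>: "\<Phi> \<in> Hneg ip p m" "\<Psi> \<in> Hneg ip p m"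
  shows "shift_term f m k (\<lambda>es. c * \<Phi> es + \<Psi> es) = c * shift_term f m k \<Phi> + shift_term f m k \<Psi>"
proof -
  have s: "sym_fun p (k + m) (f (k + m))" using test_kernels_pqfin[OF f] by (auto simp: pqfin_def)
  have "tprod k (recip_form k) (\<lambda>es. c * \<Phi> es + \<Psi> es) = (\<lambda>es. c * tprod k (recip_form k) \<Phi> es + tprod k (recip_form k) \<Psi> es)"
    by (auto simp: tprod_def algebra_simps)
  then show ?thesis
    using sym_fun_comb_arg[OF s Hneg_tprod(1)[OF recip_form_Hneg[OF p] \<Phi>(1)] Hneg_tprod(1)[OF recip_form_Hneg[OF p] \<Phi>(2)], of c]
    by (simp add: shift_term_def algebra_simps)
qed

lemma shift_term_power_scale:
  assumes f: "f \<in> test_kernels ip" and p: "mom_idx \<le> p" and \<Phi>: "\<Phi> \<in> Hneg ip p m"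
  shows "shift_term f m k (\<lambda>es. c * \<Phi> es) = c * shift_term f m k \<Phi>"
  using shift_term_comb[OF f p \<Phi> Hneg_zero(1), of k c] shift_term_comb[OF f p Hneg_zero(1) Hneg_zero(1), of m k 1]
  by simp

lemma shift_term_permute:
  assumes f: "f \<in> test_kernels ip" and p: "mom_idx \<le> p" and \<Phi>: "\<Phi> \<in> Hneg ip p m" and \<pi>: "\<pi> permutes {..<m}"
  shows "shift_term f m k (permute_form m \<pi> \<Phi>) = shift_term f m k \<Phi>"
proof -
  have s: "sym_fun p (k + m) (f (k + m))" using test_kernels_pqfin[OF f] by (auto simp: pqfin_def)
  obtain \<sigma> where \<sigma>: "\<sigma> permutes {..<k + m}"
    "\<And>\<Phi> \<Psi> :: 'n form. (\<And>es. length es \<noteq> m \<Longrightarrow> \<Psi> es = 0) \<Longrightarrow> (\<And>es. length es \<noteq> k \<Longrightarrow> \<Phi> es = 0) \<Longrightarrow>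
      tprod k \<Phi> (permute_form m \<pi> \<Psi>) = permute_form (k + m) \<sigma> (tprod k \<Phi> \<Psi>)"
    by (rule tprod_permute_right[OF \<pi>, where 'n = 'n and k = k]) blast
  have "tprod k (recip_form k) (permute_form m \<pi> \<Phi>) = permute_form (k + m) \<sigma> (tprod k (recip_form k) \<Phi>)"
    by (rule \<sigma>(2)) (auto intro: multilinear_form_length Hneg_multilinear \<Phi> recip_form_Hneg[OF p])
  then show ?thesis
    using sym_fun_permute[OF s Hneg_tprod(1)[OF recip_form_Hneg[OF p] \<Phi>] \<sigma>(1)] by (simp add: shift_term_def)
qed

text \<open>Makes the density of powers applicable to the whole sum over \<open>k\<close>, not just
  to its terms.\<close>

lemma shift_sum_sym_fun:
  assumes f: "f \<in> test_kernels ip" and p: "mom_idx \<le> p"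
  shows "sym_fun p m (\<lambda>\<Phi>. \<Sum>k. shift_term f m k \<Phi>)"
  unfolding sym_fun_def
proof (intro conjI ballI allI impI)
  fix \<Phi> \<Psi> c assume *: "\<Phi> \<in> Hneg ip p m" "\<Psi> \<in> Hneg ip p m"
  note s = shift_term_summable[OF f p]
  have "(\<Sum>k. shift_term f m k (\<lambda>es. c * \<Phi> es + \<Psi> es)) = (\<Sum>k. c * shift_term f m k \<Phi> + shift_term f m k \<Psi>)"
    by (simp add: shift_term_comb[OF f p *])
  also have "\<dots> = c * (\<Sum>k. shift_term f m k \<Phi>) + (\<Sum>k. shift_term f m k \<Psi>)"
    by (simp add: suminf_add[OF summable_mult[OF s[OF *(1)]] s[OF *(2)], symmetric] suminf_mult[OF s[OF *(1)]])
  finally show "(\<Sum>k. shift_term f m k (\<lambda>es. c * \<Phi> es + \<Psi> es)) = c * (\<Sum>k. shift_term f m k \<Phi>) + (\<Sum>k. shift_term f m k \<Psi>)" .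
next
  fix \<Phi> \<pi> assume "\<Phi> \<in> Hneg ip p m" "\<pi> permutes {..<m}"
  then show "(\<Sum>k. shift_term f m k (permute_form m \<pi> \<Phi>)) = (\<Sum>k. shift_term f m k \<Phi>)"
    by (simp add: shift_term_permute[OF f p])
next
  let ?c = "sqrt (pqN p decay_idx f) / mass"
  have "cmod (\<Sum>k. shift_term f m k \<Phi>) \<le> ((\<Sum>k. ?c * (1 / 2) ^ k) * (decay ^ m / fact m)) * Hneg_norm ip p m \<Phi>"
    if \<Phi>: "\<Phi> \<in> Hneg ip p m" for \<Phi>
  proof -
    let ?b = "\<lambda>k. ?c * (1 / 2) ^ k * (decay ^ m / fact m * Hneg_norm ip p m \<Phi>)"
    have "cmod (\<Sum>k. shift_term f m k \<Phi>) \<le> (\<Sum>k. ?b k)"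
      by (rule norm_suminf_le[OF shift_term_bound[OF f p \<Phi>] summable_mult2[OF half_summable]])
    also have "\<dots> = (\<Sum>k. ?c * (1 / 2) ^ k) * (decay ^ m / fact m * Hneg_norm ip p m \<Phi>)"
      by (rule suminf_mult2[OF half_summable, symmetric])
    finally show ?thesis by (simp add: mult.assoc)
  qed
  then show "\<exists>K. \<forall>\<Phi>\<in>Hneg ip p m. cmod (\<Sum>k. shift_term f m k \<Phi>) \<le> K * Hneg_norm ip p m \<Phi>" by blast
qed

lemma dual_scale: "x \<in> dual ip \<Longrightarrow> (\<lambda>\<xi>. t * x \<xi>) \<in> dual ip"
proof -
  assume x: "x \<in> dual ip"
  obtain p K where b: "K \<ge> 0" "\<And>\<xi>. \<bar>x \<xi>\<bar> \<le> K * hnorm ip p \<xi>" using dual_bound[OF x] by metis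
  have "linear (\<lambda>\<xi>. t * x \<xi>)"
    using dual_linear[OF x] by (simp add: linear_iff algebra_simps)
  moreover have "\<bar>t * x \<xi>\<bar> \<le> (\<bar>t\<bar> * K) * hnorm ip p \<xi>" for \<xi>
    using mult_left_mono[OF b(2)[of \<xi>], of "\<bar>t\<bar>"] by (simp add: abs_mult mult.assoc)
  ultimately show ?thesis by (auto simp: dual_def)
qed

lemma form_power_scale:
  fixes x :: "'n \<Rightarrow> real"
  shows "form_power n (cext (\<lambda>\<xi>. t * x \<xi>)) = (\<lambda>es. of_real t ^ n * form_power n (cext x) es)"
proof
  fix es :: "'n cx list"
  have c: "cext (\<lambda>\<xi>. t * x \<xi>) = (\<lambda>z. of_real t * cext x z)"
    by (auto simp: cext_def complex_eq_iff)
  have "prod_list (map (\<lambda>z. of_real t * cext x z) es) = of_real t ^ length es * prod_list (map (cext x) es)"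
    by (induction es) auto
  then show "form_power n (cext (\<lambda>\<xi>. t * x \<xi>)) es = of_real t ^ n * form_power n (cext x) es"
    by (simp add: c form_power_def)
qed

text \<open>The Appell series regrouped by the degree in \<open>x\<close>. Convergence comes along,
  so every element of \<open>test_kernels\<close> defines a function on the dual.\<close>

lemma appell_sums:
  assumes f: "f \<in> test_kernels ip" and x: "x \<in> dual ip"
  obtains S where "(\<lambda>n. f n (appell_kernel ip \<mu> n x)) sums S"
    "(\<lambda>m. \<Sum>k. shift_term f m k (form_power m (cext x))) sums S"
proof -
  obtain p K where p: "mom_idx \<le> p" "K \<ge> 0" "\<And>\<xi>. \<bar>x \<xi>\<bar> \<le> K * hnorm ip p \<xi>" by (rule dual_bound_idx[OF x]) blast
  note P = Hneg_dual_power[OF dual_linear[OF x] p(3,2)]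
  let ?u = "\<lambda>k. sqrt (pqN p decay_idx f) / mass * (1 / 2) ^ k" and ?v = "\<lambda>m. (decay * K) ^ m / fact m"
  have A: "sqrt (pqN p decay_idx f) / mass \<ge> 0" using pqN_nonneg[OF test_kernels_pqfin[OF f]] mass_pos by simp
  have le: "cmod (shift_term f m k (form_power m (cext x))) \<le> ?u k * ?v m" for k m
  proof -
    have "decay ^ m / fact m * Hneg_norm ip p m (form_power m (cext x)) \<le> ?v m"
      using P(2)[of m] decay(1) by (simp add: power_mult_distrib divide_right_mono mult_left_mono)
    then show ?thesis
      using shift_term_bound[OF f p(1) P(1), of m k] mult_left_mono[of _ "?v m" "?u k"] A
      by (meson order_trans mult_nonneg_nonneg zero_le_power zero_le_divide_1_iff zero_le_numeral)
  qed
  have v: "summable ?v" using summable_exp[of "decay * K"] by (simp add: field_simps)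
  obtain S where S: "(\<lambda>n. \<Sum>k\<le>n. shift_term f (n - k) k (form_power (n - k) (cext x))) sums S"
     "(\<lambda>m. \<Sum>k. shift_term f m k (form_power m (cext x))) sums S"
  proof (rule triangle_sums[OF le half_summable _ v])
    show "?u k \<ge> 0" for k by (rule mult_nonneg_nonneg[OF A]) simp
  qed (use decay(1) p(2) that in auto)
  have "(\<Sum>k\<le>n. shift_term f (n - k) k (form_power (n - k) (cext x))) = f n (appell_kernel ip \<mu> n x)" for n
    using f appell_kernel_pairing[OF x, of "f n" n] by (simp add: shift_term_def test_kernels_def)
  then show ?thesis using S that by simp
qed

lemma shift_sum_power_zero:
  assumes f: "f \<in> test_kernels ip" and z: "\<And>x. x \<in> dual ip \<Longrightarrow> (\<lambda>n. f n (appell_kernel ip \<mu> n x)) sums 0"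
    and x: "x \<in> dual ip"
  shows "(\<Sum>k. shift_term f m k (form_power m (cext x))) = 0"
proof (rule powser_zero_complex)
  fix t :: real
  obtain p K where p: "mom_idx \<le> p" "K \<ge> 0" "\<And>\<xi>. \<bar>x \<xi>\<bar> \<le> K * hnorm ip p \<xi>" by (rule dual_bound_idx[OF x]) blast
  note P = Hneg_dual_power[OF dual_linear[OF x] p(3,2)]
  obtain S where S: "(\<lambda>n. f n (appell_kernel ip \<mu> n (\<lambda>\<xi>. t * x \<xi>))) sums S"
      "(\<lambda>m. \<Sum>k. shift_term f m k (form_power m (cext (\<lambda>\<xi>. t * x \<xi>)))) sums S"
    by (rule appell_sums[OF f dual_scale[OF x]]) blast
  have "S = 0" by (rule sums_unique2[OF S(1) z[OF dual_scale[OF x]]])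
  moreover have "(\<Sum>k. shift_term f m k (form_power m (cext (\<lambda>\<xi>. t * x \<xi>))))
      = (\<Sum>k. shift_term f m k (form_power m (cext x))) * of_real t ^ m" for m
  proof -
    have "(\<Sum>k. shift_term f m k (form_power m (cext (\<lambda>\<xi>. t * x \<xi>)))) = (\<Sum>k. of_real t ^ m * shift_term f m k (form_power m (cext x)))"
      unfolding form_power_scale by (simp add: shift_term_power_scale[OF f p(1) P(1)])
    then show ?thesis by (simp add: suminf_mult[OF shift_term_summable[OF f p(1) P(1)]] mult.commute)
  qed
  ultimately show "(\<lambda>m. (\<Sum>k. shift_term f m k (form_power m (cext x))) * of_real t ^ m) sums 0"
    using S(2) by simp
qed

lemma shift_sum_zero:
  assumes f: "f \<in> test_kernels ip" and z: "\<And>x. x \<in> dual ip \<Longrightarrow> (\<lambda>n. f n (appell_kernel ip \<mu> n x)) sums 0"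
    and p: "mom_idx \<le> p" and \<Phi>: "\<Phi> \<in> Hneg ip p m"
  shows "(\<Sum>k. shift_term f m k \<Phi>) = 0"
proof (rule sym_fun_zero_of_powers[OF shift_sum_sym_fun[OF f p] _ \<Phi>])
  fix e
  have "ip p e \<in> dual ip"
    using linear_ip abs_ip_le by (auto simp: dual_def intro!: exI[of _ p] exI[of _ "hnorm ip p e"])
  then show "(\<Sum>k. shift_term f m k (form_power m (cext (ip p e)))) = 0"
    by (intro shift_sum_power_zero[OF f] z)
qed

text \<open>The family \<open>a\<close> is summed in two ways. For fixed \<open>j\<close> the sum
  over \<open>k\<close> vanishes by the preceding lemma; along antidiagonals
  \<open>k + j = n\<close> the convolution identity collapses everything but \<open>n = 0\<close>,
  which leaves \<open>f i \<Psi>\<close>.\<close>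

lemma kernel_zero:
  assumes f: "f \<in> test_kernels ip" and z: "\<And>x. x \<in> dual ip \<Longrightarrow> (\<lambda>n. f n (appell_kernel ip \<mu> n x)) sums 0"
    and p: "mom_idx \<le> p" and \<Psi>: "\<Psi> \<in> Hneg ip p i"
  shows "f i \<Psi> = 0"
proof -
  let ?A = "sqrt (pqN p decay_idx f)"
  define a where "a k j = of_nat (j + i choose j) * shift_term f (j + i) k (tprod j (moment j) \<Psi>)" for k j
  have A: "?A \<ge> 0" using pqN_nonneg[OF test_kernels_pqfin[OF f]] by simp
  have N: "Hneg_norm ip p i \<Psi> \<ge> 0" by (rule Hneg_norm_nonneg[OF \<Psi>])
  note T = Hneg_tprod[OF moment_Hneg[OF p] \<Psi>]
  let ?c = "decay ^ i / fact i * Hneg_norm ip p i \<Psi> * mass"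
  have c: "?c \<ge> 0" using N decay(1) mass_pos by simp
  have le: "cmod (a k j) \<le> (?A / mass * (1 / 2) ^ k) * (?c * (1 / 2) ^ j)" for k j
  proof -
    let ?B = "?A / mass * (1 / 2) ^ k"
    have B: "?B \<ge> 0" using A mass_pos by simp
    have "cmod (shift_term f (j + i) k (tprod j (moment j) \<Psi>))
        \<le> ?B * (decay ^ (j + i) / fact (j + i) * Hneg_norm ip p (j + i) (tprod j (moment j) \<Psi>))"
      by (rule shift_term_bound[OF f p T(1)])
    also have "\<dots> \<le> ?B * (decay ^ (j + i) / fact (j + i) * ((fact j * mass * mom_rate ^ j) * Hneg_norm ip p i \<Psi>))"
    proof (intro mult_left_mono)
      show "Hneg_norm ip p (j + i) (tprod j (moment j) \<Psi>) \<le> fact j * mass * mom_rate ^ j * Hneg_norm ip p i \<Psi>"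
        using T(2)[of j] mult_right_mono[OF moment_norm[OF p, of j] N] by linarith
    qed (use B decay(1) in auto)
    finally have "cmod (a k j) \<le> real (j + i choose j) *
      (?B * (decay ^ (j + i) / fact (j + i) * ((fact j * mass * mom_rate ^ j) * Hneg_norm ip p i \<Psi>)))"
      unfolding a_def norm_mult norm_of_nat by (rule mult_left_mono) simp
    also have "\<dots> = ?B * (?c * (mom_rate * decay) ^ j)"
      by (simp add: binomial_fact power_add power_mult_distrib field_simps)
    also have "\<dots> \<le> ?B * (?c * (1 / 2) ^ j)"
    proof (intro mult_left_mono power_mono)
      have "0 \<le> mom_rate * decay" using decay(1) mom_rate_pos by simp
      then show "mom_rate * decay \<le> 1 / 2" using decay(2) by linarith
    qed (use B c decay(1) mom_rate_pos in auto)
    finally show ?thesis .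
  qed
  obtain S where S: "(\<lambda>n. \<Sum>k\<le>n. a k (n - k)) sums S" "(\<lambda>j. \<Sum>k. a k j) sums S"
  proof (rule triangle_sums[OF le half_summable _ half_summable])
    show "?c * (1 / 2) ^ j \<ge> 0" for j by (rule mult_nonneg_nonneg[OF c]) simp
  qed (use A mass_pos that in auto)
  have "(\<Sum>k. a k j) = 0" for j
  proof -
    have "(\<Sum>k. shift_term f (j + i) k (tprod j (moment j) \<Psi>)) = 0"
      by (rule shift_sum_zero[OF f _ p T(1)]) (rule z)
    then show ?thesis unfolding a_def suminf_mult[OF shift_term_summable[OF f p T(1)]] by simp
  qed
  then have "S = 0" using S(2) sums_unique2[OF sums_zero] by simp
  moreover have "(\<Sum>k\<le>n. a k (n - k)) = (if n = 0 then f i \<Psi> else 0)" for n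
  proof -
    have s: "sym_fun p (n + i) (f (n + i))" using test_kernels_pqfin[OF f] by (auto simp: pqfin_def)
    have "a k (n - k) = of_nat (n + i choose n) * (of_nat (n choose k) *
        f (n + i) (tprod n (tprod k (recip_form k) (moment (n - k))) \<Psi>))" if k: "k \<le> n" for k
    proof -
      \<comment> \<open>The weight in \<open>a\<close> was chosen for this identity: a factor
        independent of \<open>k\<close> comes out, and the coefficient of the convolution
        remains.\<close>
      have "(n + i choose k) * (n + i - k choose (n - k)) = (n + i choose n) * (n choose k)"
        using choose_mult[OF k, of "n + i"] by simp
      then have "of_nat (n + i choose k) * of_nat (n + i - k choose (n - k))
          = (of_nat (n + i choose n) * of_nat (n choose k) :: complex)"
        by (metis of_nat_mult)
      moreover have "k + (n - k + i) = n + i" "n - k + i = n + i - k" using k by auto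
      moreover have "tprod k (recip_form k) (tprod (n - k) (moment (n - k)) \<Psi>) = tprod n (tprod k (recip_form k) (moment (n - k))) \<Psi>"
        using tprod_assoc[of k "n - k" "recip_form k" "moment (n - k)" \<Psi>] k by simp
      ultimately show ?thesis by (simp add: a_def shift_term_def mult_ac)
    qed
    then have "(\<Sum>k\<le>n. a k (n - k)) = of_nat (n + i choose n) *
       (\<Sum>k\<le>n. of_nat (n choose k) * f (n + i) (tprod n (tprod k (recip_form k) (moment (n - k))) \<Psi>))"
      by (simp add: sum_distrib_left)
    also have "(\<Sum>k\<le>n. of_nat (n choose k) * f (n + i) (tprod n (tprod k (recip_form k) (moment (n - k))) \<Psi>))
       = f (n + i) (\<lambda>es. \<Sum>k\<le>n. of_nat (n choose k) * tprod n (tprod k (recip_form k) (moment (n - k))) \<Psi> es)"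
    proof (rule sym_fun_sum_arg[OF s, symmetric])
      fix k assume "k \<in> {..n}"
      then have "tprod k (recip_form k) (moment (n - k)) \<in> Hneg ip p n"
        using Hneg_tprod(1)[OF recip_form_Hneg[OF p, of k] moment_Hneg[OF p, of "n - k"]] by simp
      then show "tprod n (tprod k (recip_form k) (moment (n - k))) \<Psi> \<in> Hneg ip p (n + i)"
        by (rule Hneg_tprod(1)[OF _ \<Psi>])
    qed
    also have "(\<lambda>es. \<Sum>k\<le>n. of_nat (n choose k) * tprod n (tprod k (recip_form k) (moment (n - k))) \<Psi> es)
       = (\<lambda>es. (if n = 0 \<and> take n es = [] then 1 else 0) * \<Psi> (drop n es))"
      unfolding recip_form_moment_conv[symmetric] by (simp add: tprod_def[of n _ \<Psi>] sum_distrib_right mult.assoc)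
    finally show ?thesis using sym_fun_zero_arg[OF s] by (cases "n = 0") auto
  qed
  then have "(\<lambda>n. \<Sum>k\<le>n. a k (n - k)) sums f i \<Psi>"
    using sums_single[of 0 "\<lambda>_. f i \<Psi>"] by simp
  then have "S = f i \<Psi>" by (rule sums_unique2[OF S(1)])
  ultimately show ?thesis by simp
qed

section \<open>Test functions and their kernels\<close>

lemma appell_expansion_unique:
  assumes "appell_expansion ip \<mu> \<phi> f" "appell_expansion ip \<mu> \<phi> g"
  shows "f = g"
proof -
  have fg: "f \<in> test_kernels ip" "g \<in> test_kernels ip" using assms by (auto simp: appell_expansion_def)
  have d: "kdiff f g \<in> test_kernels ip" by (rule test_kernels_diff[OF fg])
  have z: "(\<lambda>n. kdiff f g n (appell_kernel ip \<mu> n x)) sums 0" if "x \<in> dual ip" for x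
  proof -
    have "(\<lambda>n. f n (appell_kernel ip \<mu> n x)) sums \<phi> x" "(\<lambda>n. g n (appell_kernel ip \<mu> n x)) sums \<phi> x"
      using assms that by (auto simp: appell_expansion_def)
    from sums_diff[OF this] show ?thesis by simp
  qed
  have "kdiff f g n \<Phi> = 0" for n \<Phi>
  proof (cases "\<Phi> \<in> dual_tensors ip n")
    case True
    then obtain p where "\<Phi> \<in> Hneg ip p n" by (auto simp: dual_tensors_def)
    then have "\<Phi> \<in> Hneg ip (max mom_idx p) n" by (rule Hneg_mono) simp
    from kernel_zero[OF d z _ this] show ?thesis by simp
  next
    case False
    have "kdiff f g n \<in> sym_tensors ip n" using d by (auto simp: test_kernels_def)
    from sym_tensors_off[OF this False] show ?thesis .
  qed
  then show ?thesis by (simp add: fun_eq_iff)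
qed

lemma kernels_eqI: "appell_expansion ip \<mu> \<phi> f \<Longrightarrow> kernels ip \<mu> \<phi> = f"
  unfolding kernels_def by (rule the_equality) (auto intro: appell_expansion_unique)

lemma kernels_expansion: "\<phi> \<in> test_space ip \<mu> \<Longrightarrow> appell_expansion ip \<mu> \<phi> (kernels ip \<mu> \<phi>)"
proof -
  assume "\<phi> \<in> test_space ip \<mu>"
  then obtain f where f: "appell_expansion ip \<mu> \<phi> f" by (auto simp: test_space_def)
  then show ?thesis by (simp only: kernels_eqI[OF f])
qed

lemma kernels_test_kernels: "\<phi> \<in> test_space ip \<mu> \<Longrightarrow> kernels ip \<mu> \<phi> \<in> test_kernels ip"
  using kernels_expansion by (simp add: appell_expansion_def)

text \<open>The inverse of \<open>kernels\<close>; the pair transports operators on functions to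
  maps on kernels.\<close>

definition appell_fun :: "(nat \<Rightarrow> 'n tensor) \<Rightarrow> ('n \<Rightarrow> real) \<Rightarrow> complex" where
  "appell_fun f x = (if x \<in> dual ip then \<Sum>n. f n (appell_kernel ip \<mu> n x) else 0)"

lemma appell_fun_expansion: "f \<in> test_kernels ip \<Longrightarrow> appell_expansion ip \<mu> (appell_fun f) f"
proof -
  assume f: "f \<in> test_kernels ip"
  have "(\<lambda>n. f n (appell_kernel ip \<mu> n x)) sums appell_fun f x" if x: "x \<in> dual ip" for x
  proof -
    obtain S where S: "(\<lambda>n. f n (appell_kernel ip \<mu> n x)) sums S" by (rule appell_sums[OF f x])
    then show ?thesis using x sums_unique[OF S] by (simp add: appell_fun_def)
  qed
  then show ?thesis using f by (simp add: appell_expansion_def appell_fun_def)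
qed

lemma appell_fun_test_space: "f \<in> test_kernels ip \<Longrightarrow> appell_fun f \<in> test_space ip \<mu>"
  using appell_fun_expansion by (auto simp: test_space_def)

lemma kernels_appell_fun: "f \<in> test_kernels ip \<Longrightarrow> kernels ip \<mu> (appell_fun f) = f"
  by (rule kernels_eqI[OF appell_fun_expansion])

lemma appell_fun_kernels: "\<phi> \<in> test_space ip \<mu> \<Longrightarrow> appell_fun (kernels ip \<mu> \<phi>) = \<phi>"
  using kernels_expansion[of \<phi>] by (auto simp: appell_expansion_def appell_fun_def fun_eq_iff sums_iff)

lemma appell_expansion_comb:
  assumes "appell_expansion ip \<mu> \<phi> f" "appell_expansion ip \<mu> \<psi> g"
  shows "appell_expansion ip \<mu> (\<lambda>x. c * \<phi> x + \<psi> x) (kcomb c f g)"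
  unfolding appell_expansion_def
proof (intro conjI ballI allI impI)
  show "kcomb c f g \<in> test_kernels ip"
    using assms by (intro test_kernels_comb) (simp_all add: appell_expansion_def)
qed (use assms in \<open>simp_all add: appell_expansion_def sums_add sums_mult\<close>)

lemma kernels_comb:
  assumes "\<phi> \<in> test_space ip \<mu>" "\<psi> \<in> test_space ip \<mu>"
  shows "(\<lambda>x. c * \<phi> x + \<psi> x) \<in> test_space ip \<mu>"
    "kernels ip \<mu> (\<lambda>x. c * \<phi> x + \<psi> x) = kcomb c (kernels ip \<mu> \<phi>) (kernels ip \<mu> \<psi>)"
proof -
  note * = appell_expansion_comb[OF assms[THEN kernels_expansion], of c]
  show "(\<lambda>x. c * \<phi> x + \<psi> x) \<in> test_space ip \<mu>" using * by (auto simp: test_space_def)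
  show "kernels ip \<mu> (\<lambda>x. c * \<phi> x + \<psi> x) = kcomb c (kernels ip \<mu> \<phi>) (kernels ip \<mu> \<psi>)"
    by (rule kernels_eqI[OF *])
qed

lemma appell_fun_comb:
  assumes "f \<in> test_kernels ip" "g \<in> test_kernels ip"
  shows "appell_fun (kcomb c f g) = (\<lambda>x. c * appell_fun f x + appell_fun g x)"
proof -
  note t = appell_fun_test_space[OF assms(1)] appell_fun_test_space[OF assms(2)]
  have "kernels ip \<mu> (\<lambda>x. c * appell_fun f x + appell_fun g x) = kcomb c f g"
    using kernels_comb(2)[OF t, of c] by (simp add: kernels_appell_fun[OF assms(1)] kernels_appell_fun[OF assms(2)])
  then show ?thesis using appell_fun_kernels[OF kernels_comb(1)[OF t, of c]] by simp
qed

end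

section \<open>Lagrange interpolation\<close>

text \<open>Along a complex line a multilinear expression is a polynomial of known degree. Written
  as a combination of its values at 0, ..., m, its dependence on \<open>l\<close> sits in scalar
  weights, which can be pulled through a map known only to be linear.\<close>

definition lagrange :: "nat \<Rightarrow> nat \<Rightarrow> complex \<Rightarrow> complex" where
  "lagrange m i l = (\<Prod>j\<in>{..m} - {i}. (l - of_nat j) / (of_nat i - of_nat j))"

lemma lagrange_holomorphic: "lagrange m i holomorphic_on A"
  unfolding lagrange_def by (intro holomorphic_intros) auto

lemma lagrange_interpolation:
  assumes "degree P \<le> m"
  shows "poly P l = (\<Sum>i\<le>m. lagrange m i l * poly P (of_nat i))"
proof -
  define Q where "Q = (\<Sum>i\<le>m. smult (poly P (of_nat i))
    (\<Prod>j\<in>{..m} - {i}. [:- of_nat j / (of_nat i - of_nat j), 1 / (of_nat i - of_nat j):]))"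
  have eval: "poly Q l = (\<Sum>i\<le>m. lagrange m i l * poly P (of_nat i))" for l
    unfolding Q_def lagrange_def
    by (simp add: poly_sum poly_prod diff_divide_distrib mult.commute)
  have deg: "degree Q \<le> m"
    unfolding Q_def
  proof (rule degree_sum_le)
    fix i assume i: "i \<in> {..m}"
    have "degree (smult (poly P (of_nat i)) (\<Prod>j\<in>{..m} - {i}. [:- of_nat j / (of_nat i - of_nat j), 1 / (of_nat i - of_nat j):]))
       \<le> degree (\<Prod>j\<in>{..m} - {i}. [:- of_nat j / (of_nat i - of_nat j), 1 / (of_nat i - of_nat j) :: complex:])"
      by (rule degree_smult_le)
    also have "\<dots> \<le> (\<Sum>j\<in>{..m} - {i}. degree [:- of_nat j / (of_nat i - of_nat j), 1 / (of_nat i - of_nat j) :: complex:])"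
      by (rule degree_prod_sum_le[unfolded o_def]) simp
    also have "\<dots> \<le> (\<Sum>j\<in>{..m} - {i}. 1)" by (rule sum_mono) simp
    also have "\<dots> = m" using i by simp
    finally show "degree (smult (poly P (of_nat i)) (\<Prod>j\<in>{..m} - {i}. [:- of_nat j / (of_nat i - of_nat j), 1 / (of_nat i - of_nat j):])) \<le> m" .
  qed simp
  \<comment> \<open>Both have degree at most \<open>m\<close> and agree at the \<open>m + 1\<close>
    nodes.\<close>
  have "P = Q"
  proof (rule poly_eqI_degree)
    fix x :: complex assume "x \<in> of_nat ` {..m}"
    then obtain k where k: "k \<le> m" "x = of_nat k" by auto
    have "lagrange m i (of_nat k) = (if i = k then 1 else 0)" if "i \<le> m" for i
      using that k by (auto simp: lagrange_def)
    then have "poly Q x = (\<Sum>i\<le>m. if i = k then poly P (of_nat i) else 0)"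
      unfolding eval k by (intro sum.cong) auto
    then show "poly P x = poly Q x" using k by simp
  qed (use assms deg in \<open>simp_all add: card_image inj_on_def\<close>)
  show ?thesis using eval[of l] unfolding \<open>P = Q\<close>[symmetric] .
qed

lemma multilinear_line_poly:
  assumes "multilinear_form (length ps) \<Phi>"
  shows "\<exists>P. degree P \<le> length ps \<and> (\<forall>l. poly P l = \<Phi> (map (\<lambda>(a, b). a + cscale l b) ps))"
  using assms
proof (induction ps arbitrary: \<Phi>)
  case Nil
  show ?case by (intro exI[of _ "[:\<Phi> []:]"]) simp
next
  case (Cons p ps)
  obtain a b where p: "p = (a, b)" by (cases p)
  have ml: "multilinear_form (Suc (length ps)) \<Phi>" using Cons.prems by simp
  obtain P Q where P: "degree P \<le> length ps" "\<forall>l. poly P l = \<Phi> (a # map (\<lambda>(a, b). a + cscale l b) ps)"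
    and Q: "degree Q \<le> length ps" "\<forall>l. poly Q l = \<Phi> (b # map (\<lambda>(a, b). a + cscale l b) ps)"
    using Cons.IH[OF multilinear_form_Cons[OF ml, of a]] Cons.IH[OF multilinear_form_Cons[OF ml, of b]] by blast
  have "degree (pCons 0 Q) \<le> Suc (length ps)" using Q(1) by (simp add: le_trans[OF degree_pCons_le])
  then have d: "degree (pCons 0 Q + P) \<le> Suc (length ps)" using P(1) by (intro degree_add_le) auto
  have "poly (pCons 0 Q + P) l = \<Phi> (map (\<lambda>(a, b). a + cscale l b) (p # ps))" for l
    using multilinear_form_head[OF ml, of "map (\<lambda>(a, b). a + cscale l b) ps" l b a] P(2) Q(2)
    by (simp add: p add.commute[of a])
  then show ?case using d by auto
qed

lemma multilinear_line_interpolation: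
  assumes "multilinear_form m \<Phi>"
  shows "\<Phi> (replicate m (a + cscale l b)) = (\<Sum>i\<le>m. lagrange m i l * \<Phi> (replicate m (a + cscale (of_nat i) b)))"
proof -
  obtain P where P: "degree P \<le> m" "\<And>l. poly P l = \<Phi> (map (\<lambda>(a, b). a + cscale l b) (replicate m (a, b)))"
    using multilinear_line_poly[of "replicate m (a, b)" \<Phi>] assms by auto
  show ?thesis using lagrange_interpolation[OF P(1), of l] by (simp add: P(2))
qed

text \<open>The counterpart for a line of functionals with fixed arguments; it serves the variable
  \<open>\<xi>\<close>, as the interpolation of forms serves \<open>\<eta>\<close>.\<close>

lemma prod_list_line_interpolation:
  "(\<Prod>z\<leftarrow>es. (f z + l * g z)) = (\<Sum>i\<le>length es. lagrange (length es) i l * (\<Prod>z\<leftarrow>es. (f z + of_nat i * g z)))"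
proof -
  have "\<exists>P. degree P \<le> length es \<and> (\<forall>l. poly P l = (\<Prod>z\<leftarrow>es. (f z + l * g z)))"
  proof (induction es)
    case Nil
    show ?case by (intro exI[of _ 1]) simp
  next
    case (Cons e es)
    then obtain P where P: "degree P \<le> length es" "\<forall>l. poly P l = (\<Prod>z\<leftarrow>es. (f z + l * g z))" by blast
    have "degree ([:f e, g e:] * P) \<le> 1 + length es"
      using degree_mult_le[of "[:f e, g e:]" P] P(1) by (simp split: if_splits)
    then show ?case using P(2) by (intro exI[of _ "[:f e, g e:] * P"]) (auto simp: algebra_simps)
  qed
  then obtain P where P: "degree P \<le> length es" "\<And>l. poly P l = (\<Prod>z\<leftarrow>es. (f z + l * g z))" by blast
  show ?thesis using lagrange_interpolation[OF P(1), of l] by (simp add: P(2))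
qed

section \<open>Exponential kernels and the pairing with \<open>\<rho>\<close>\<close>

context nuclear_triple
begin

lemma exp_kernels_sym_fun:
  "sym_fun p n (exp_kernels \<eta> n)"
  "Hpos_norm ip p n (exp_kernels \<eta> n) \<le> cnorm ip p \<eta> ^ n / fact n"
proof -
  have b: "cmod (exp_kernels \<eta> n \<Phi>) \<le> cnorm ip p \<eta> ^ n / fact n * Hneg_norm ip p n \<Phi>" if "\<Phi> \<in> Hneg ip p n" for \<Phi>
    using Hneg_eval_le[OF that, of "replicate n \<eta>"]
    by (simp add: exp_kernels_def tensor_power_def norm_divide divide_right_mono prod_list_replicate)
  show "Hpos_norm ip p n (exp_kernels \<eta> n) \<le> cnorm ip p \<eta> ^ n / fact n"
    by (rule Hpos_normI[OF b]) auto
  show "sym_fun p n (exp_kernels \<eta> n)"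
    unfolding sym_fun_def
  proof (intro conjI ballI allI impI)
    show "\<exists>K. \<forall>\<Phi>\<in>Hneg ip p n. cmod (exp_kernels \<eta> n \<Phi>) \<le> K * Hneg_norm ip p n \<Phi>" using b by blast
  qed (simp_all add: exp_kernels_def tensor_power_def permute_form_def permute_list_replicate add_divide_distrib)
qed

definition exp_tensor :: "'n cx \<Rightarrow> nat \<Rightarrow> 'n tensor" where
  "exp_tensor \<eta> n = (\<lambda>\<Phi>. if \<Phi> \<in> dual_tensors ip n then exp_kernels \<eta> n \<Phi> else 0)"

lemma exp_tensor_sym_tensors: "exp_tensor \<eta> n \<in> sym_tensors ip n"
proof (rule sym_tensorsI)
  show "sym_fun p n (exp_tensor \<eta> n)" for p
    using exp_kernels_sym_fun(1)[of p n \<eta>] sym_fun_cong[of p n "exp_tensor \<eta> n" "exp_kernels \<eta> n"]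
    by (simp add: exp_tensor_def Hneg_dual_tensors)
qed (simp add: exp_tensor_def)

definition exp_term :: "'n cx \<Rightarrow> nat \<Rightarrow> nat \<Rightarrow> 'n tensor" where
  "exp_term \<eta> m n = (if n = m then exp_tensor \<eta> n else (\<lambda>\<Phi>. 0))"

text \<open>The full exponential kernels are shown to lie in (H_pq) for \<open>\<eta>\<close> in
  \<open>Upq\<close>; their truncations are test kernels for every \<open>\<eta>\<close>, so the
  operator itself applies to them.\<close>

definition exp_partial :: "'n cx \<Rightarrow> nat \<Rightarrow> nat \<Rightarrow> 'n tensor" where
  "exp_partial \<eta> N n = (if n < N then exp_tensor \<eta> n else (\<lambda>\<Phi>. 0))"

lemma exp_term_test_kernels: "exp_term \<eta> m \<in> test_kernels ip"
  by (rule test_kernels_finite[of _ "Suc m"]) (auto simp: exp_term_def exp_tensor_sym_tensors sym_tensors_zero)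

lemma exp_partial_test_kernels: "exp_partial \<eta> N \<in> test_kernels ip"
  by (rule test_kernels_finite[of _ N]) (auto simp: exp_partial_def exp_tensor_sym_tensors sym_tensors_zero)

lemma exp_partial_0: "exp_partial \<eta> 0 = (\<lambda>n \<Phi>. 0)"
  by (auto simp: exp_partial_def)

lemma exp_partial_Suc: "exp_partial \<eta> (Suc N) = kcomb 1 (exp_term \<eta> N) (exp_partial \<eta> N)"
  by (auto simp: exp_partial_def exp_term_def fun_eq_iff)

text \<open>The radius in \<open>Upq\<close> is what makes the ratio 1/2.\<close>

lemma exp_pq_terms:
  assumes "\<eta> \<in> Upq ip p q"
  shows "pq_terms ip p q (exp_kernels \<eta>) n \<le> (1 / 2) ^ n"
proof -
  let ?h = "cnorm ip p \<eta>"
  have h: "?h\<^sup>2 * 2 ^ q \<le> 1 / 2" using assms by (simp add: Upq_def field_simps)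
  have "pq_terms ip p q (exp_kernels \<eta>) n \<le> (fact n)\<^sup>2 * 2 ^ (q * n) * (?h ^ n / fact n)\<^sup>2"
    unfolding pq_terms_def
    by (intro mult_left_mono power_mono exp_kernels_sym_fun(2) Hpos_norm_nonneg exp_kernels_sym_fun(1)) auto
  also have "\<dots> = (?h\<^sup>2 * 2 ^ q) ^ n"
    by (simp add: power_divide power_mult_distrib power_mult[symmetric] mult.commute)
  also have "\<dots> \<le> (1 / 2) ^ n" by (rule power_mono[OF h]) simp
  finally show ?thesis .
qed

lemma half_geometric: "summable (\<lambda>n. (1 / 2 :: real) ^ n)" "(\<Sum>n. (1 / 2 :: real) ^ n) = 2"
  using summable_geometric[of "1 / 2 :: real"] suminf_geometric[of "1 / 2 :: real"] by auto

lemma pqN_half_le: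
  assumes "\<And>n. sym_fun p n (f n)" "\<And>n. pq_terms ip p q f n \<le> (1 / 2) ^ n"
  shows "pqfin p q f" "pqN p q f \<le> 2"
proof -
  have s: "summable (pq_terms ip p q f)"
    by (rule summable_comparison_test'[OF half_geometric(1), of 0]) (use assms(2) pq_terms_nonneg in auto)
  then show "pqfin p q f" using assms(1) by (simp add: pqfin_def)
  show "pqN p q f \<le> 2"
    using suminf_le[OF assms(2) s half_geometric(1)] half_geometric(2) by (simp add: pqN_def)
qed

lemma exp_pqfin:
  assumes "\<eta> \<in> Upq ip p q"
  shows "pqfin p q (exp_kernels \<eta>)" "pqN p q (exp_kernels \<eta>) \<le> 2"
  using pqN_half_le[OF exp_kernels_sym_fun(1) exp_pq_terms[OF assms]] by auto

lemma exp_partial_terms: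
  "pq_terms ip p q (exp_partial \<eta> N) n = (if n < N then pq_terms ip p q (exp_kernels \<eta>) n else 0)"
proof (cases "n < N")
  case True
  have "Hpos_norm ip p n (exp_tensor \<eta> n) = Hpos_norm ip p n (exp_kernels \<eta> n)"
    by (rule Hpos_norm_cong) (simp add: exp_tensor_def Hneg_dual_tensors)
  then show ?thesis using True by (simp add: pq_terms_def exp_partial_def)
qed (simp add: pq_terms_def exp_partial_def Hpos_norm_zero)

lemma exp_partial_pqN:
  assumes "\<eta> \<in> Upq ip p q"
  shows "pqN p q (exp_partial \<eta> N) \<le> 2"
proof (rule pqN_half_le(2))
  show "sym_fun p n (exp_partial \<eta> N n)" for n
    using exp_partial_test_kernels[of \<eta> N] by (auto simp: test_kernels_def intro: sym_tensors_sym_fun)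
  show "pq_terms ip p q (exp_partial \<eta> N) n \<le> (1 / 2) ^ n" for n
    unfolding exp_partial_terms using exp_pq_terms[OF assms] by simp
qed

lemma exp_diff_pqN:
  assumes "\<eta> \<in> Upq ip p q"
  shows "pqfin p q (kdiff (exp_kernels \<eta>) (exp_partial \<eta> N))" "pqN p q (kdiff (exp_kernels \<eta>) (exp_partial \<eta> N)) \<le> 2 * (1 / 2) ^ N"
proof -
  let ?d = "kdiff (exp_kernels \<eta>) (exp_partial \<eta> N)"
  show fin: "pqfin p q ?d"
    by (rule pqfin_diff(1)[OF exp_pqfin(1)[OF assms] test_kernels_pqfin[OF exp_partial_test_kernels]])
  have z: "pq_terms ip p q ?d n = 0" if "n < N" for n
  proof -
    have "Hpos_norm ip p n (?d n) = Hpos_norm ip p n (\<lambda>\<Phi>. 0)"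
      by (rule Hpos_norm_cong) (use that in \<open>simp add: exp_partial_def exp_tensor_def Hneg_dual_tensors\<close>)
    then show ?thesis by (simp add: pq_terms_def Hpos_norm_zero)
  qed
  have le: "pq_terms ip p q ?d (n + N) \<le> (1 / 2) ^ N * (1 / 2) ^ n" for n
    using exp_pq_terms[OF assms, of "n + N"] by (simp add: pq_terms_def exp_partial_def power_add mult.commute)
  have s: "summable (pq_terms ip p q ?d)" using fin by (simp add: pqfin_def)
  have "pqN p q ?d = (\<Sum>n. pq_terms ip p q ?d (n + N)) + (\<Sum>n<N. pq_terms ip p q ?d n)"
    unfolding pqN_def by (rule suminf_split_initial_segment[OF s])
  also have "\<dots> = (\<Sum>n. pq_terms ip p q ?d (n + N))" using z by simp
  also have "\<dots> \<le> (\<Sum>n. (1 / 2) ^ N * (1 / 2) ^ n)"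
    by (rule suminf_le[OF le]) (use s half_geometric(1) in \<open>auto intro: summable_ignore_initial_segment summable_mult\<close>)
  also have "\<dots> = 2 * (1 / 2) ^ N" using half_geometric by (simp add: suminf_mult)
  finally show "pqN p q ?d \<le> 2 * (1 / 2) ^ N" .
qed

subsection \<open>The canonical embedding\<close>

lemma clinear_cembed: "clinear_form (cembed ip \<xi>)"
  unfolding clinear_form_def cembed_def cscale_def
  by (simp add: complex_eq_iff ip_add_right ip_diff ip_scaleR_right algebra_simps)

lemma cembed_line: "cembed ip (a + cscale l b) z = cembed ip a z + l * cembed ip b z"
  unfolding cembed_def cscale_def
  by (simp add: complex_eq_iff ip_add ip_diff ip_scaleR algebra_simps)

text \<open>Real and imaginary part consist of two real inner products each, whence the 4. The bound
  keeps the supremum in \<open>neg_norm\<close> finite and later yields local boundedness in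
  \<open>\<xi>\<close>.\<close>

lemma cembed_bound: "cmod (cembed ip \<xi> \<zeta>) \<le> 4 * cnorm ip 0 \<xi> * cnorm ip 0 \<zeta>"
proof -
  have *: "\<bar>ip 0 a b\<bar> \<le> cnorm ip 0 \<xi> * cnorm ip 0 \<zeta>"
    if "hnorm ip 0 a \<le> cnorm ip 0 \<xi>" "hnorm ip 0 b \<le> cnorm ip 0 \<zeta>" for a b
    using abs_ip_le[of 0 a b] mult_mono[OF that] by simp
  have "cmod (cembed ip \<xi> \<zeta>) \<le> \<bar>Re (cembed ip \<xi> \<zeta>)\<bar> + \<bar>Im (cembed ip \<xi> \<zeta>)\<bar>" by (rule cmod_le)
  then show ?thesis
    using *[OF hnorm_fst_le hnorm_fst_le] *[OF hnorm_snd_le hnorm_snd_le]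
      *[OF hnorm_fst_le hnorm_snd_le] *[OF hnorm_snd_le hnorm_fst_le]
    by (simp add: cembed_def)
qed

lemma neg_norm_set_bound:
  assumes "cnorm ip p \<zeta> \<le> 1"
  shows "cmod (cembed ip \<xi> \<zeta>) \<le> 4 * cnorm ip 0 \<xi>"
proof -
  have "cnorm ip 0 \<zeta> \<le> 1" using cnorm_le[of 0 p \<zeta>] assms by simp
  then have "4 * cnorm ip 0 \<xi> * cnorm ip 0 \<zeta> \<le> 4 * cnorm ip 0 \<xi> * 1" by (intro mult_left_mono) auto
  then show ?thesis using cembed_bound[of \<xi> \<zeta>] by simp
qed

lemma neg_norm_set:
  assumes "x \<in> {cmod (cembed ip \<xi> \<zeta>) |\<zeta>. cnorm ip p \<zeta> \<le> 1}"
  shows "x \<le> 4 * cnorm ip 0 \<xi>"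
proof -
  obtain \<zeta> where "x = cmod (cembed ip \<xi> \<zeta>)" "cnorm ip p \<zeta> \<le> 1" using assms by blast
  then show ?thesis using neg_norm_set_bound by blast
qed

lemma neg_norm_cembed_le: "neg_norm ip p (cembed ip \<xi>) \<le> 4 * cnorm ip 0 \<xi>"
  unfolding neg_norm_def
proof (rule cSup_least)
  have "cmod (cembed ip \<xi> 0) \<in> {cmod (cembed ip \<xi> \<zeta>) |\<zeta>. cnorm ip p \<zeta> \<le> 1}"
    by (intro CollectI exI[of _ 0]) simp
  then show "{cmod (cembed ip \<xi> \<zeta>) |\<zeta>. cnorm ip p \<zeta> \<le> 1} \<noteq> {}" by blast
qed (rule neg_norm_set)

lemma neg_norm_upper:
  assumes "cnorm ip p \<zeta> \<le> 1"
  shows "cmod (cembed ip \<xi> \<zeta>) \<le> neg_norm ip p (cembed ip \<xi>)"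
  unfolding neg_norm_def
proof (rule cSup_upper)
  show "cmod (cembed ip \<xi> \<zeta>) \<in> {cmod (cembed ip \<xi> \<zeta>) |\<zeta>. cnorm ip p \<zeta> \<le> 1}"
    using assms by blast
  show "bdd_above {cmod (cembed ip \<xi> \<zeta>) |\<zeta>. cnorm ip p \<zeta> \<le> 1}"
    by (rule bdd_aboveI[of _ "4 * cnorm ip 0 \<xi>"]) (rule neg_norm_set)
qed

lemma cembed_le_neg_norm: "cmod (cembed ip \<xi> \<zeta>) \<le> neg_norm ip p (cembed ip \<xi>) * cnorm ip p \<zeta>"
proof (cases "\<zeta> = 0")
  case True
  then show ?thesis using clinear_form_zero[OF clinear_cembed] by simp
next
  case False
  then have h: "cnorm ip p \<zeta> > 0" using cnorm_eq_0[of p \<zeta>] cnorm_nonneg[of p \<zeta>] by linarith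
  let ?c = "complex_of_real (1 / cnorm ip p \<zeta>)"
  have "cnorm ip p (cscale ?c \<zeta>) \<le> 1" using h by (simp add: cnorm_cscale norm_divide)
  then have "cmod (cembed ip \<xi> (cscale ?c \<zeta>)) \<le> neg_norm ip p (cembed ip \<xi>)" by (rule neg_norm_upper)
  moreover have "cembed ip \<xi> (cscale ?c \<zeta>) = ?c * cembed ip \<xi> \<zeta>"
    using clinear_cembed[of \<xi>] clinear_form_zero[OF clinear_cembed, of \<xi>]
    unfolding clinear_form_def by (metis add.right_neutral)
  ultimately have "cmod (?c * cembed ip \<xi> \<zeta>) \<le> neg_norm ip p (cembed ip \<xi>)" by (simp only:)
  then show ?thesis using h by (simp add: norm_mult norm_divide field_simps)
qed

lemma neg_norm_nonneg: "neg_norm ip p (cembed ip \<xi>) \<ge> 0"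
  using order_trans[OF norm_ge_zero neg_norm_upper[of p 0 \<xi>]] by simp

abbreviation cpow :: "nat \<Rightarrow> 'n cx \<Rightarrow> 'n form" where
  "cpow n \<xi> \<equiv> form_power n (cembed ip \<xi>)"

lemma cpow_Hneg: "cpow n \<xi> \<in> Hneg ip p n"
  and cpow_norm: "Hneg_norm ip p n (cpow n \<xi>) \<le> neg_norm ip p (cembed ip \<xi>) ^ n"
  using Hneg_form_power[OF clinear_cembed clinear_bound_sum[OF clinear_cembed cembed_le_neg_norm] neg_norm_nonneg]
  by auto

lemma cpow_line: "cpow n (a + cscale l b) = (\<lambda>es. \<Sum>i\<le>n. lagrange n i l * cpow n (a + cscale (of_nat i) b) es)"
proof
  fix es :: "'n cx list"
  have c: "cembed ip (a + cscale l b) = (\<lambda>z. cembed ip a z + l * cembed ip b z)" for l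
    by (rule ext) (rule cembed_line)
  show "cpow n (a + cscale l b) es = (\<Sum>i\<le>n. lagrange n i l * cpow n (a + cscale (of_nat i) b) es)"
  proof (cases "length es = n")
    case True
    then show ?thesis
      using prod_list_line_interpolation[where f = "cembed ip a" and g = "cembed ip b" and es = es and l = l]
      by (simp add: form_power_def c)
  qed (simp add: form_power_def)
qed

section \<open>The pairing with the coherent functionals\<close>

definition rho_sum :: "'n cx \<Rightarrow> (nat \<Rightarrow> 'n tensor) \<Rightarrow> complex" where
  "rho_sum \<xi> F = (\<Sum>n. F n (cpow n \<xi>))"

text \<open>The sign in \<open>rho\<close> cancels against that of the functional
  \<open>- cembed ip \<xi>\<close>, and the factorial in \<open>Q\<close> against the
  denominator.\<close>

lemma rho_eq_rho_sum:
  assumes F: "pqfin r s F"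
  shows "rho (\<lambda>\<zeta>. - cembed ip \<xi> \<zeta>) F = rho_sum \<xi> F"
proof -
  have "(-1) ^ n * Q n (\<lambda>es. form_power n (\<lambda>\<zeta>. - cembed ip \<xi> \<zeta>) es / fact n) F = F n (cpow n \<xi>)" for n
  proof -
    have "prod_list (map (\<lambda>\<zeta>. - cembed ip \<xi> \<zeta>) es) = (-1) ^ length es * prod_list (map (cembed ip \<xi>) es)" for es
      by (induction es) auto
    then have "(\<lambda>es. form_power n (\<lambda>\<zeta>. - cembed ip \<xi> \<zeta>) es / fact n) = (\<lambda>es. ((-1) ^ n / fact n) * cpow n \<xi> es)"
      by (auto simp: form_power_def)
    then show ?thesis
      using F sym_fun_scale_arg[of r n "F n" "cpow n \<xi>" "(-1) ^ n / fact n"] cpow_Hneg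
      by (simp add: Q_def pqfin_def power_mult_distrib[symmetric] del: power_mult_distrib)

  qed
  then show ?thesis by (simp add: rho_def rho_sum_def)
qed

lemma exp_series: "summable (\<lambda>n. Y ^ n / fact n)" "(\<Sum>n. Y ^ n / fact n) = exp (Y :: real)"
  using summable_exp[of Y] by (simp_all add: exp_def field_simps)

text \<open>The weight 2^(sn/2) divides the norm of \<open>\<xi>\<close> by 2^(s/2); this is where
  the exponent becomes small. \<open>Y\<close> is an arbitrary majorant, so that one tail estimate
  is uniform on a disc, and \<open>N = 0\<close> gives the plain bound.\<close>

lemma rho_sum_tail:
  assumes F: "pqfin r s F" and Y: "neg_norm ip r (cembed ip \<xi>) / sqrt (2 ^ s) \<le> Y"
  shows "summable (\<lambda>n. F n (cpow n \<xi>))"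
    "cmod (rho_sum \<xi> F - (\<Sum>n<N. F n (cpow n \<xi>))) \<le> sqrt (pqN r s F) * (exp Y - (\<Sum>n<N. Y ^ n / fact n))"
proof -
  let ?A = "sqrt (pqN r s F)" and ?v = "neg_norm ip r (cembed ip \<xi>)"
  have A: "?A \<ge> 0" using pqN_nonneg[OF F] by simp
  have le: "cmod (F n (cpow n \<xi>)) \<le> ?A * (Y ^ n / fact n)" for n
  proof -
    have "cmod (F n (cpow n \<xi>)) \<le> ?A * (1 / sqrt (2 ^ s)) ^ n / fact n * Hneg_norm ip r n (cpow n \<xi>)"
      by (rule pqfin_eval[OF F cpow_Hneg])
    also have "\<dots> \<le> ?A * (1 / sqrt (2 ^ s)) ^ n / fact n * ?v ^ n"
      using A by (intro mult_left_mono cpow_norm) auto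
    also have "\<dots> = ?A * ((?v / sqrt (2 ^ s)) ^ n / fact n)" by (simp add: power_divide)
    also have "\<dots> \<le> ?A * (Y ^ n / fact n)"
      using neg_norm_nonneg[of r \<xi>] A by (intro mult_left_mono divide_right_mono power_mono Y) auto
    finally show ?thesis .
  qed
  have sb: "summable (\<lambda>n. ?A * (Y ^ n / fact n))" by (intro summable_mult exp_series)
  have sn: "summable (\<lambda>n. norm (F n (cpow n \<xi>)))"
    by (rule summable_comparison_test'[OF sb, of 0]) (use le in simp)
  show s: "summable (\<lambda>n. F n (cpow n \<xi>))" by (rule summable_norm_cancel[OF sn])
  have "rho_sum \<xi> F - (\<Sum>n<N. F n (cpow n \<xi>)) = (\<Sum>n. F (n + N) (cpow (n + N) \<xi>))"
    unfolding rho_sum_def by (rule suminf_minus_initial_segment[OF s, symmetric])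
  also have "cmod \<dots> \<le> (\<Sum>n. ?A * (Y ^ (n + N) / fact (n + N)))"
    by (rule norm_suminf_le[OF le summable_ignore_initial_segment[OF sb]])
  also have "\<dots> = (\<Sum>n. ?A * (Y ^ n / fact n)) - (\<Sum>n<N. ?A * (Y ^ n / fact n))"
    by (rule suminf_minus_initial_segment[OF sb])
  also have "\<dots> = ?A * (exp Y - (\<Sum>n<N. Y ^ n / fact n))"
    by (simp add: suminf_mult[OF exp_series(1)] exp_series(2) sum_distrib_left right_diff_distrib del: times_divide_eq_right)
  finally show "cmod (rho_sum \<xi> F - (\<Sum>n<N. F n (cpow n \<xi>))) \<le> ?A * (exp Y - (\<Sum>n<N. Y ^ n / fact n))" .
qed

lemma rho_sum_bound:
  assumes "pqfin r s F" "neg_norm ip r (cembed ip \<xi>) / sqrt (2 ^ s) \<le> Y"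
  shows "cmod (rho_sum \<xi> F) \<le> sqrt (pqN r s F) * exp Y"
  using rho_sum_tail(2)[OF assms, of 0] by simp

lemma rho_sum_diff:
  assumes "pqfin r s F" "pqfin r s G"
  shows "rho_sum \<xi> (kdiff F G) = rho_sum \<xi> F - rho_sum \<xi> G"
  unfolding rho_sum_def using rho_sum_tail(1)[OF assms(1) order_refl] rho_sum_tail(1)[OF assms(2) order_refl]
  by (rule suminf_diff[symmetric])

lemma rho_sum_res: "rho_sum \<xi> (res_kernels ip r F) = rho_sum \<xi> F"
  by (simp add: rho_sum_def res_kernels_def cpow_Hneg)

end

section \<open>The local symbol\<close>

locale symbol_setup = M: appell_measure ip \<mu> + N: appell_measure ip \<nu>
  for ip :: "nat \<Rightarrow> 'n::real_vector \<Rightarrow> 'n \<Rightarrow> real" and \<mu> \<nu> +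
  fixes B :: "(('n \<Rightarrow> real) \<Rightarrow> complex) \<Rightarrow> (('n \<Rightarrow> real) \<Rightarrow> complex)"
  assumes cont: "continuous_operator ip \<mu> \<nu> B"
begin

definition kernel_map :: "(nat \<Rightarrow> 'n tensor) \<Rightarrow> nat \<Rightarrow> 'n tensor" where
  "kernel_map f = kernels ip \<mu> (B (N.appell_fun f))"

lemma B_test_space: "\<phi> \<in> test_space ip \<nu> \<Longrightarrow> B \<phi> \<in> test_space ip \<mu>"
  using cont by (auto simp: continuous_operator_def)

lemma B_linear:
  "\<phi> \<in> test_space ip \<nu> \<Longrightarrow> \<psi> \<in> test_space ip \<nu> \<Longrightarrow> B (\<lambda>x. c * \<phi> x + \<psi> x) = (\<lambda>x. c * B \<phi> x + B \<psi> x)"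
  using cont by (simp add: continuous_operator_def)

lemma kernel_map_test_kernels: "f \<in> test_kernels ip \<Longrightarrow> kernel_map f \<in> test_kernels ip"
  unfolding kernel_map_def by (intro M.kernels_test_kernels B_test_space N.appell_fun_test_space)

lemma kernel_map_linear:
  assumes "f \<in> test_kernels ip" "g \<in> test_kernels ip"
  shows "kernel_map (\<lambda>n \<Phi>. c * f n \<Phi> + g n \<Phi>) = (\<lambda>n \<Phi>. c * kernel_map f n \<Phi> + kernel_map g n \<Phi>)"
  unfolding kernel_map_def N.appell_fun_comb[OF assms]
    B_linear[OF N.appell_fun_test_space[OF assms(1)] N.appell_fun_test_space[OF assms(2)]]
  by (rule M.kernels_comb(2)) (intro B_test_space N.appell_fun_test_space assms)+

lemma kernel_map_zero: "kernel_map (\<lambda>n \<Phi>. 0) = (\<lambda>n \<Phi>. 0)"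
  using kernel_map_linear[OF M.test_kernels_zero M.test_kernels_zero, of "-1"] by simp

lemma kernel_map_scale:
  assumes "f \<in> test_kernels ip"
  shows "kernel_map (\<lambda>n \<Phi>. c * f n \<Phi>) = (\<lambda>n \<Phi>. c * kernel_map f n \<Phi>)"
  using kernel_map_linear[OF assms M.test_kernels_zero, of c] by (simp add: kernel_map_zero)

text \<open>Membership is proved along with the formula because the induction step uses it.\<close>

lemma kernel_map_sum:
  assumes "\<And>i. i \<in> I \<Longrightarrow> f i \<in> test_kernels ip" "finite I"
  shows "kernel_map (\<lambda>n \<Phi>. \<Sum>i\<in>I. c i * f i n \<Phi>) = (\<lambda>n \<Phi>. \<Sum>i\<in>I. c i * kernel_map (f i) n \<Phi>)
    \<and> (\<lambda>n \<Phi>. \<Sum>i\<in>I. c i * f i n \<Phi>) \<in> test_kernels ip"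
  using assms(2,1)
proof (induction I rule: finite_induct)
  case empty
  then show ?case by (simp add: kernel_map_zero M.test_kernels_zero)
next
  case (insert i I)
  have t: "f i \<in> test_kernels ip" "(\<lambda>n \<Phi>. \<Sum>i\<in>I. c i * f i n \<Phi>) \<in> test_kernels ip"
    and e: "kernel_map (\<lambda>n \<Phi>. \<Sum>i\<in>I. c i * f i n \<Phi>) = (\<lambda>n \<Phi>. \<Sum>i\<in>I. c i * kernel_map (f i) n \<Phi>)"
    using insert by auto
  show ?case
    using kernel_map_linear[OF t, of "c i"] M.test_kernels_comb[OF t, of "c i"] insert(1,2) by (simp add: e)
qed

text \<open>A bound at a single point of continuity scales to a global one by homogeneity.\<close>

lemma kernel_map_bound: "\<exists>p q K. K \<ge> 0 \<and> (\<forall>f\<in>test_kernels ip. M.pqN r s (kernel_map f) \<le> K * M.pqN p q f)"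
proof -
  have z: "N.appell_fun (\<lambda>n \<Phi>. 0) = (\<lambda>x. 0)" by (auto simp: N.appell_fun_def)
  have zt: "(\<lambda>x. 0) \<in> test_space ip \<nu>" using N.appell_fun_test_space[OF M.test_kernels_zero] by (simp add: z)
  have Bz: "B (\<lambda>x. 0) = (\<lambda>x. 0)" using B_linear[OF zt zt, of "-1"] by simp
  obtain p q d where d: "d > 0" and c: "\<And>\<psi>. \<psi> \<in> test_space ip \<nu> \<Longrightarrow>
      test_norm ip \<nu> p q (\<lambda>x. \<psi> x - 0) < d \<Longrightarrow> test_norm ip \<mu> r s (\<lambda>x. B \<psi> x - B (\<lambda>x. 0) x) < 1"
  proof -
    have "\<forall>\<phi>\<in>test_space ip \<nu>. \<forall>p\<^sub>o q\<^sub>o. \<forall>\<epsilon>>0. \<exists>p q. \<exists>\<delta>>0. \<forall>\<psi>\<in>test_space ip \<nu>.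
        test_norm ip \<nu> p q (\<lambda>x. \<psi> x - \<phi> x) < \<delta> \<longrightarrow> test_norm ip \<mu> p\<^sub>o q\<^sub>o (\<lambda>x. B \<psi> x - B \<phi> x) < \<epsilon>"
      using cont unfolding continuous_operator_def by (elim conjE) assumption
    from this[rule_format, OF zt, of 1 r s] show ?thesis using that by auto
  qed
  have small: "M.pqN r s (kernel_map f) < 1" if f: "f \<in> test_kernels ip" and l: "sqrt (M.pqN p q f) < d" for f
  proof -
    have "test_norm ip \<nu> p q (\<lambda>x. N.appell_fun f x - 0) < d"
      using l by (simp add: test_norm_def N.kernels_appell_fun[OF f] M.pq_norm_eq)
    from c[OF N.appell_fun_test_space[OF f] this]
    have "sqrt (M.pqN r s (kernel_map f)) < 1"
      by (simp add: Bz test_norm_def M.pq_norm_eq kernel_map_def)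
    then show ?thesis by simp
  qed
  have "M.pqN r s (kernel_map f) \<le> 4 / d\<^sup>2 * M.pqN p q f" if f: "f \<in> test_kernels ip" for f
  proof (rule field_le_epsilon)
    fix e :: real assume e: "e > 0"
    let ?a = "M.pqN p q f"
    \<comment> \<open>The surplus keeps \<open>w\<close> positive when \<open>?a = 0\<close> and
      turns into \<open>e\<close> at the end. The factor \<open>t\<close> brings the norm of the
      scaled kernels to at most \<open>d / 2\<close>.\<close>
    define w where "w = ?a + e * d\<^sup>2 / 4"
    have a: "?a \<ge> 0" by (rule M.pqN_nonneg[OF M.test_kernels_pqfin[OF f]])
    have ed: "e * d\<^sup>2 / 4 > 0" using e d by simp
    then have w: "w > 0" using a by (simp add: w_def)
    define t where "t = d / (2 * sqrt w)"
    have t: "t > 0" using d w by (simp add: t_def)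
    have t2: "t\<^sup>2 = d\<^sup>2 / (4 * w)" using w by (simp add: t_def power_divide power_mult_distrib)
    let ?g = "\<lambda>n \<Phi>. complex_of_real t * f n \<Phi>"
    have g: "?g \<in> test_kernels ip"
      using M.test_kernels_comb[OF f M.test_kernels_zero, of "of_real t"] by simp
    have gN: "M.pqN p q ?g = t\<^sup>2 * ?a"
      using M.pqN_scale(2)[OF M.test_kernels_pqfin[OF f], of p q "of_real t"] by simp
    have "t\<^sup>2 * ?a \<le> t\<^sup>2 * w" using ed by (intro mult_left_mono) (auto simp: w_def)
    also have "\<dots> = d\<^sup>2 / 4" using w by (simp add: t2)
    also have "\<dots> < d\<^sup>2" using d by simp
    finally have "sqrt (M.pqN p q ?g) < d"
      unfolding gN using d by (intro real_less_lsqrt) auto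
    from small[OF g this] have "t\<^sup>2 * M.pqN r s (kernel_map f) < 1"
      unfolding kernel_map_scale[OF f]
      using M.pqN_scale(2)[OF M.test_kernels_pqfin[OF kernel_map_test_kernels[OF f]], of r s "of_real t"] by simp
    then have "M.pqN r s (kernel_map f) < 4 * w / d\<^sup>2"
      using t2 w d by (simp add: field_simps)
    also have "\<dots> = 4 / d\<^sup>2 * ?a + e" using d by (simp add: w_def field_simps)
    finally show "M.pqN r s (kernel_map f) \<le> 4 / d\<^sup>2 * ?a + e" by simp
  qed
  then show ?thesis by (intro exI[of _ p] exI[of _ q] exI[of _ "4 / d\<^sup>2"]) auto
qed

section \<open>Extensions of the operator and the values they give\<close>

lemma extension_ex: "\<exists>p q T. extends_to ip \<mu> \<nu> B r s p q T"
proof -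
  obtain p q K where K: "K \<ge> 0" "\<And>f. f \<in> test_kernels ip \<Longrightarrow> M.pqN r s (kernel_map f) \<le> K * M.pqN p q f"
    using kernel_map_bound[of r s] by blast
  obtain T where T: "T ` Hpq ip p q \<subseteq> Hpq ip r s"
     "\<forall>f\<in>Hpq ip p q. \<forall>g\<in>Hpq ip p q. \<forall>c. T (\<lambda>n \<Phi>. c * f n \<Phi> + g n \<Phi>) = (\<lambda>n \<Phi>. c * T f n \<Phi> + T g n \<Phi>)"
     "\<exists>K. \<forall>f\<in>Hpq ip p q. pq_norm ip r s (T f) \<le> K * pq_norm ip p q f"
     "\<forall>f\<in>test_kernels ip. T (res_kernels ip p f) = res_kernels ip r (kernel_map f)"
    using M.extension_exists[OF kernel_map_test_kernels kernel_map_linear K] by blast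
  have "T (res_kernels ip p (kernels ip \<nu> \<phi>)) = res_kernels ip r (kernels ip \<mu> (B \<phi>))"
    if \<phi>: "\<phi> \<in> test_space ip \<nu>" for \<phi>
    using T(4) N.kernels_test_kernels[OF \<phi>] by (simp add: kernel_map_def N.appell_fun_kernels[OF \<phi>])
  then show ?thesis unfolding extends_to_def using T(1-3) by blast
qed

lemma extends_to_kernel_map:
  assumes T: "extends_to ip \<mu> \<nu> B r s p q T" and f: "f \<in> test_kernels ip"
  shows "T (res_kernels ip p f) = res_kernels ip r (kernel_map f)"
proof -
  have "\<forall>\<phi>\<in>test_space ip \<nu>. T (res_kernels ip p (kernels ip \<nu> \<phi>)) = res_kernels ip r (kernels ip \<mu> (B \<phi>))"
    using T unfolding extends_to_def by (elim conjE) assumption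
  from this[rule_format, OF N.appell_fun_test_space[OF f]]
  show ?thesis by (simp add: N.kernels_appell_fun[OF f] kernel_map_def)
qed

lemma extends_to_bound:
  assumes T: "extends_to ip \<mu> \<nu> B r s p q T"
  obtains K where "K \<ge> 0" "\<And>f. f \<in> Hpq ip p q \<Longrightarrow> sqrt (M.pqN r s (T f)) \<le> K * sqrt (M.pqN p q f)"
proof -
  obtain K where K: "\<forall>f\<in>Hpq ip p q. pq_norm ip r s (T f) \<le> K * pq_norm ip p q f"
    using T unfolding extends_to_def by (elim conjE) blast
  have "sqrt (M.pqN r s (T f)) \<le> \<bar>K\<bar> * sqrt (M.pqN p q f)" if "f \<in> Hpq ip p q" for f
  proof -
    have "sqrt (M.pqN r s (T f)) \<le> K * sqrt (M.pqN p q f)"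
      using K that by (simp add: M.pq_norm_eq)
    also have "\<dots> \<le> \<bar>K\<bar> * sqrt (M.pqN p q f)"
      using M.pqN_nonneg[OF M.Hpq_pqfin[OF that]] by (intro mult_right_mono) auto
    finally show ?thesis .
  qed
  then show ?thesis using that[of "\<bar>K\<bar>"] by simp
qed

text \<open>The right-hand side involves the extension \<open>T\<close> only through the error bound, whence the values of
  all extensions agree.\<close>

lemma value_approx:
  assumes T: "extends_to ip \<mu> \<nu> B r s p q T"
    and K: "\<And>f. f \<in> Hpq ip p q \<Longrightarrow> sqrt (M.pqN r s (T f)) \<le> K * sqrt (M.pqN p q f)" "K \<ge> 0"
    and \<eta>: "\<eta> \<in> Upq ip p q" and Y: "neg_norm ip r (cembed ip \<xi>) / sqrt (2 ^ s) \<le> Y"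
  defines "v \<equiv> rho (\<lambda>\<zeta>. - cembed ip \<xi> \<zeta>) (T (res_kernels ip p (exp_kernels \<eta>)))"
  shows "cmod (v - M.rho_sum \<xi> (kernel_map (M.exp_partial \<eta> N))) \<le> K * sqrt (2 * (1 / 2) ^ N) * exp Y"
    "cmod v \<le> K * sqrt 2 * exp Y"
    "cmod (M.rho_sum \<xi> (kernel_map (M.exp_partial \<eta> N)) - (\<Sum>n<N. kernel_map (M.exp_partial \<eta> N) n (M.cpow n \<xi>)))
      \<le> K * sqrt 2 * (exp Y - (\<Sum>n<N. Y ^ n / fact n))"
proof -
  let ?E = "res_kernels ip p (exp_kernels \<eta>)" and ?C = "res_kernels ip p (M.exp_partial \<eta> N)"
  have TH: "T f \<in> Hpq ip r s" if "f \<in> Hpq ip p q" for f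
    using T that unfolding extends_to_def by blast
  have E: "?E \<in> Hpq ip p q" by (rule M.res_kernels_pqfin(1)[OF M.exp_pqfin(1)[OF \<eta>]])
  have C: "?C \<in> Hpq ip p q"
    by (rule M.res_kernels_pqfin(1)[OF M.test_kernels_pqfin[OF M.exp_partial_test_kernels]])
  let ?D = "\<lambda>n \<Phi>. (-1) * ?C n \<Phi> + ?E n \<Phi>"
  have D: "?D \<in> Hpq ip p q" by (rule M.Hpq_comb[OF C E])
  have TD: "T ?D = (\<lambda>n \<Phi>. T ?E n \<Phi> - T ?C n \<Phi>)"
  proof -
    have "\<forall>f\<in>Hpq ip p q. \<forall>g\<in>Hpq ip p q. \<forall>c. T (\<lambda>n \<Phi>. c * f n \<Phi> + g n \<Phi>) = (\<lambda>n \<Phi>. c * T f n \<Phi> + T g n \<Phi>)"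
      using T unfolding extends_to_def by (elim conjE) assumption
    from this[rule_format, OF C E, of "-1"] show ?thesis by simp
  qed
  have DN: "M.pqN p q ?D \<le> 2 * (1 / 2) ^ N"
  proof -
    have "M.pqN p q ?D = M.pqN p q (\<lambda>n \<Phi>. exp_kernels \<eta> n \<Phi> - M.exp_partial \<eta> N n \<Phi>)"
      by (rule M.pqfin_cong) (simp add: res_kernels_def)
    then show ?thesis using M.exp_diff_pqN(2)[OF \<eta>, of N] by simp
  qed
  have v: "v = M.rho_sum \<xi> (T ?E)"
    unfolding v_def by (rule M.rho_eq_rho_sum[OF M.Hpq_pqfin[OF TH[OF E]]])
  have TC: "T ?C = res_kernels ip r (kernel_map (M.exp_partial \<eta> N))"
    by (rule extends_to_kernel_map[OF T M.exp_partial_test_kernels])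
  have RC: "M.rho_sum \<xi> (kernel_map (M.exp_partial \<eta> N)) = M.rho_sum \<xi> (T ?C)"
    unfolding TC by (rule M.rho_sum_res[symmetric])
  have eq: "v - M.rho_sum \<xi> (kernel_map (M.exp_partial \<eta> N)) = M.rho_sum \<xi> (T ?D)"
    unfolding v RC TD
    by (rule M.rho_sum_diff[OF M.Hpq_pqfin[OF TH[OF E]] M.Hpq_pqfin[OF TH[OF C]], symmetric])
  have "cmod (v - M.rho_sum \<xi> (kernel_map (M.exp_partial \<eta> N))) \<le> sqrt (M.pqN r s (T ?D)) * exp Y"
    unfolding eq by (rule M.rho_sum_bound[OF M.Hpq_pqfin[OF TH[OF D]] Y])
  also have "\<dots> \<le> K * sqrt (2 * (1 / 2) ^ N) * exp Y"
  proof (rule mult_right_mono)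
    have "sqrt (M.pqN r s (T ?D)) \<le> K * sqrt (M.pqN p q ?D)" by (rule K(1)[OF D])
    also have "\<dots> \<le> K * sqrt (2 * (1 / 2) ^ N)" by (intro mult_left_mono real_sqrt_le_mono DN K(2))
    finally show "sqrt (M.pqN r s (T ?D)) \<le> K * sqrt (2 * (1 / 2) ^ N)" .
  qed simp
  finally show "cmod (v - M.rho_sum \<xi> (kernel_map (M.exp_partial \<eta> N))) \<le> K * sqrt (2 * (1 / 2) ^ N) * exp Y" .
  have "cmod v \<le> sqrt (M.pqN r s (T ?E)) * exp Y"
    unfolding v by (rule M.rho_sum_bound[OF M.Hpq_pqfin[OF TH[OF E]] Y])
  also have "\<dots> \<le> K * sqrt 2 * exp Y"
  proof (rule mult_right_mono)
    have "sqrt (M.pqN r s (T ?E)) \<le> K * sqrt (M.pqN p q ?E)" by (rule K(1)[OF E])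
    also have "\<dots> \<le> K * sqrt 2"
      using M.exp_pqfin(2)[OF \<eta>] M.res_kernels_pqfin(2)[OF M.exp_pqfin(1)[OF \<eta>]] K(2)
      by (intro mult_left_mono real_sqrt_le_mono) auto
    finally show "sqrt (M.pqN r s (T ?E)) \<le> K * sqrt 2" .
  qed simp
  finally show "cmod v \<le> K * sqrt 2 * exp Y" .
  have "(\<Sum>n<N. kernel_map (M.exp_partial \<eta> N) n (M.cpow n \<xi>)) = (\<Sum>n<N. T ?C n (M.cpow n \<xi>))"
    unfolding TC by (simp add: res_kernels_def M.cpow_Hneg)
  then have "cmod (M.rho_sum \<xi> (kernel_map (M.exp_partial \<eta> N)) - (\<Sum>n<N. kernel_map (M.exp_partial \<eta> N) n (M.cpow n \<xi>)))
      \<le> sqrt (M.pqN r s (T ?C)) * (exp Y - (\<Sum>n<N. Y ^ n / fact n))"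
    unfolding RC using M.rho_sum_tail(2)[OF M.Hpq_pqfin[OF TH[OF C]] Y, of N] by simp
  also have "\<dots> \<le> K * sqrt 2 * (exp Y - (\<Sum>n<N. Y ^ n / fact n))"
  proof (rule mult_right_mono)
    have "sqrt (M.pqN r s (T ?C)) \<le> K * sqrt (M.pqN p q ?C)" by (rule K(1)[OF C])
    also have "\<dots> \<le> K * sqrt 2"
      using M.exp_partial_pqN[OF \<eta>, of N] M.res_kernels_pqfin(2)[OF M.test_kernels_pqfin[OF M.exp_partial_test_kernels]] K(2)
      by (intro mult_left_mono real_sqrt_le_mono) auto
    finally show "sqrt (M.pqN r s (T ?C)) \<le> K * sqrt 2" .
    have "Y \<ge> 0" using Y M.neg_norm_nonneg[of r \<xi>] by (meson divide_nonneg_nonneg order_trans real_sqrt_ge_zero zero_le_numeral zero_le_power)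
    then have "(\<Sum>n<N. Y ^ n / fact n) \<le> (\<Sum>n. Y ^ n / fact n)"
      by (intro sum_le_suminf M.exp_series(1)) auto
    then show "0 \<le> exp Y - (\<Sum>n<N. Y ^ n / fact n)" by (simp add: M.exp_series(2))
  qed
  finally show "cmod (M.rho_sum \<xi> (kernel_map (M.exp_partial \<eta> N)) - (\<Sum>n<N. kernel_map (M.exp_partial \<eta> N) n (M.cpow n \<xi>)))
      \<le> K * sqrt 2 * (exp Y - (\<Sum>n<N. Y ^ n / fact n))" .
qed

lemma value_limit:
  assumes T: "extends_to ip \<mu> \<nu> B r s p q T" and \<eta>: "\<eta> \<in> Upq ip p q"
  shows "(\<lambda>N. M.rho_sum \<xi> (kernel_map (M.exp_partial \<eta> N))) \<longlonglongrightarrow>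
    rho (\<lambda>\<zeta>. - cembed ip \<xi> \<zeta>) (T (res_kernels ip p (exp_kernels \<eta>)))"
proof -
  obtain K where K: "K \<ge> 0" "\<And>f. f \<in> Hpq ip p q \<Longrightarrow> sqrt (M.pqN r s (T f)) \<le> K * sqrt (M.pqN p q f)"
    by (rule extends_to_bound[OF T]) blast
  let ?v = "rho (\<lambda>\<zeta>. - cembed ip \<xi> \<zeta>) (T (res_kernels ip p (exp_kernels \<eta>)))"
  let ?Y = "neg_norm ip r (cembed ip \<xi>) / sqrt (2 ^ s)"
  show ?thesis
  proof (rule LIM_zero_cancel, rule Lim_null_comparison)
    show "\<forall>\<^sub>F N in sequentially. norm (M.rho_sum \<xi> (kernel_map (M.exp_partial \<eta> N)) - ?v) \<le> K * sqrt (2 * (1 / 2) ^ N) * exp ?Y"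
      using value_approx(1)[OF T K(2,1) \<eta> order_refl] by (simp add: norm_minus_commute)
    have "(\<lambda>N. K * sqrt (2 * (1 / 2) ^ N) * exp ?Y) \<longlonglongrightarrow> K * sqrt (2 * 0) * exp ?Y"
      by (intro tendsto_intros LIMSEQ_power_zero) simp
    then show "(\<lambda>N. K * sqrt (2 * (1 / 2) ^ N) * exp ?Y) \<longlonglongrightarrow> 0" by simp
  qed
qed

lemma symbol_value_unique:
  "symbol_value ip \<mu> \<nu> B \<xi> \<eta> v \<Longrightarrow> symbol_value ip \<mu> \<nu> B \<xi> \<eta> w \<Longrightarrow> v = w"
  unfolding symbol_value_def using value_limit LIMSEQ_unique by metis

lemma symbol_eq:
  assumes T: "extends_to ip \<mu> \<nu> B r s p q T" and \<eta>: "\<eta> \<in> Upq ip p q"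
  shows "(\<xi>, \<eta>) \<in> symbol_domain ip \<mu> \<nu> B"
    "symbol ip \<mu> \<nu> B \<xi> \<eta> = rho (\<lambda>\<zeta>. - cembed ip \<xi> \<zeta>) (T (res_kernels ip p (exp_kernels \<eta>)))"
proof -
  have v: "symbol_value ip \<mu> \<nu> B \<xi> \<eta> (rho (\<lambda>\<zeta>. - cembed ip \<xi> \<zeta>) (T (res_kernels ip p (exp_kernels \<eta>))))"
    unfolding symbol_value_def using T \<eta> by blast
  show "(\<xi>, \<eta>) \<in> symbol_domain ip \<mu> \<nu> B"
    unfolding symbol_domain_def using v symbol_value_unique by blast
  show "symbol ip \<mu> \<nu> B \<xi> \<eta> = rho (\<lambda>\<zeta>. - cembed ip \<xi> \<zeta>) (T (res_kernels ip p (exp_kernels \<eta>)))"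
    unfolding symbol_def by (rule the_equality, rule v, rule symbol_value_unique[OF _ v])
qed

section \<open>Holomorphy and the estimate\<close>

lemma kernel_map_exp_partial: "kernel_map (M.exp_partial \<eta> N) n \<Phi> = (\<Sum>m<N. kernel_map (M.exp_term \<eta> m) n \<Phi>)"
proof (induction N)
  case 0
  then show ?case by (simp add: M.exp_partial_0 kernel_map_zero)
next
  case (Suc N)
  have "kernel_map (M.exp_partial \<eta> (Suc N)) = (\<lambda>n \<Phi>. 1 * kernel_map (M.exp_term \<eta> N) n \<Phi> + kernel_map (M.exp_partial \<eta> N) n \<Phi>)"
    unfolding M.exp_partial_Suc by (rule kernel_map_linear[OF M.exp_term_test_kernels M.exp_partial_test_kernels])
  then show ?case using Suc by simp
qed

lemma exp_term_line: "M.exp_term (a + cscale l b) m = (\<lambda>n \<Phi>. \<Sum>i\<le>m. lagrange m i l * M.exp_term (a + cscale (of_nat i) b) m n \<Phi>)"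
proof (intro ext)
  fix n \<Phi>
  show "M.exp_term (a + cscale l b) m n \<Phi> = (\<Sum>i\<le>m. lagrange m i l * M.exp_term (a + cscale (of_nat i) b) m n \<Phi>)"
  proof (cases "n = m \<and> \<Phi> \<in> dual_tensors ip n")
    case True
    then have "multilinear_form m \<Phi>" by (auto simp: dual_tensors_def dest: M.Hneg_multilinear)
    from multilinear_line_interpolation[OF this, of a l b] True show ?thesis
      by (simp add: M.exp_term_def M.exp_tensor_def exp_kernels_def tensor_power_def sum_divide_distrib)
  qed (auto simp: M.exp_term_def M.exp_tensor_def)
qed

text \<open>Both dependences on \<open>l\<close> are interpolated, in degree \<open>m\<close> for
  \<open>\<eta>\<close> and in degree \<open>n\<close> for \<open>\<xi>\<close>. The operator then
  acts only on fixed test kernels, and what remains is a polynomial in \<open>l\<close>.\<close>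

lemma kernel_map_line_holomorphic:
  "(\<lambda>l. kernel_map (M.exp_partial (\<eta>0 + cscale l \<eta>) N) n (M.cpow n (\<xi>0 + cscale l \<xi>))) holomorphic_on A"
proof -
  have "kernel_map (M.exp_term (\<eta>0 + cscale l \<eta>) m) n (M.cpow n (\<xi>0 + cscale l \<xi>))
     = (\<Sum>i\<le>m. \<Sum>j\<le>n. lagrange m i l * lagrange n j l *
         kernel_map (M.exp_term (\<eta>0 + cscale (of_nat i) \<eta>) m) n (M.cpow n (\<xi>0 + cscale (of_nat j) \<xi>)))" for l m
  proof -
    have "kernel_map (M.exp_term (\<eta>0 + cscale l \<eta>) m) = (\<lambda>n \<Phi>. \<Sum>i\<le>m. lagrange m i l * kernel_map (M.exp_term (\<eta>0 + cscale (of_nat i) \<eta>) m) n \<Phi>)"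
      unfolding exp_term_line[of \<eta>0 l \<eta> m]
      by (rule conjunct1[OF kernel_map_sum]) (auto intro: M.exp_term_test_kernels)
    moreover have "kernel_map (M.exp_term \<zeta> m) n (M.cpow n (\<xi>0 + cscale l \<xi>))
       = (\<Sum>j\<le>n. lagrange n j l * kernel_map (M.exp_term \<zeta> m) n (M.cpow n (\<xi>0 + cscale (of_nat j) \<xi>)))" for \<zeta>
    proof -
      have "M.sym_fun 0 n (kernel_map (M.exp_term \<zeta> m) n)"
        using M.test_kernels_pqfin[OF kernel_map_test_kernels[OF M.exp_term_test_kernels]] by (simp add: M.pqfin_def)
      then show ?thesis
        unfolding M.cpow_line[of n \<xi>0 l \<xi>] by (rule M.sym_fun_sum_arg) (rule M.cpow_Hneg)
    qed
    ultimately show ?thesis by (simp add: sum_distrib_left mult.assoc)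
  qed
  then show ?thesis
    unfolding kernel_map_exp_partial by (auto intro!: holomorphic_intros lagrange_holomorphic)
qed

lemma Upq_iff: "\<eta> \<in> Upq ip p q \<longleftrightarrow> cnorm ip p \<eta> < sqrt (1 / 2 ^ (q + 1))"
proof -
  have "(cnorm ip p \<eta>)\<^sup>2 < 1 / 2 ^ (q + 1) \<longleftrightarrow> (cnorm ip p \<eta>)\<^sup>2 < (sqrt (1 / 2 ^ (q + 1)))\<^sup>2" by simp
  also have "\<dots> \<longleftrightarrow> cnorm ip p \<eta> < sqrt (1 / 2 ^ (q + 1))"
    using power_mono_iff[of "sqrt (1 / 2 ^ (q + 1))" "cnorm ip p \<eta>" 2] by (simp add: not_le[symmetric])
  finally show ?thesis by (simp add: Upq_def)
qed

lemma Upq_open: "lc_open (cnorm ip) (Upq ip p q)"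
  unfolding lc_open_def
proof (intro ballI)
  fix z assume z: "z \<in> Upq ip p q"
  let ?d = "sqrt (1 / 2 ^ (q + 1)) - cnorm ip p z"
  have "w \<in> Upq ip p q" if "cnorm ip p (w - z) < ?d" for w
    using M.cnorm_diff_le[of p w z] that by (simp add: Upq_iff del: power_add)
  then show "\<exists>i. \<exists>\<delta>>0. \<forall>w. cnorm ip i (w - z) < \<delta> \<longrightarrow> w \<in> Upq ip p q"
    using z by (intro exI[of _ p] exI[of _ ?d]) (auto simp: Upq_iff simp del: power_add)
qed

lemma symbol_analytic_line:
  assumes T: "extends_to ip \<mu> \<nu> B r s p q T" and \<eta>0: "\<eta>0 \<in> Upq ip p q"
  shows "(\<lambda>l. symbol ip \<mu> \<nu> B (\<xi>0 + cscale l \<xi>) (\<eta>0 + cscale l \<eta>)) analytic_on {0}"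
proof -
  obtain K where K: "K \<ge> 0" "\<And>f. f \<in> Hpq ip p q \<Longrightarrow> sqrt (M.pqN r s (T f)) \<le> K * sqrt (M.pqN p q f)"
    by (rule extends_to_bound[OF T]) blast
  let ?G = "\<lambda>l. symbol ip \<mu> \<nu> B (\<xi>0 + cscale l \<xi>) (\<eta>0 + cscale l \<eta>)"
  let ?F = "\<lambda>N l. \<Sum>n<N. kernel_map (M.exp_partial (\<eta>0 + cscale l \<eta>) N) n (M.cpow n (\<xi>0 + cscale l \<xi>))"
  \<comment> \<open>The disc of radius \<open>b\<close> keeps the line inside \<open>Upq\<close>;
    the added 1 covers \<open>\<eta> = 0\<close>.\<close>
  define b where "b = (sqrt (1 / 2 ^ (q + 1)) - cnorm ip p \<eta>0) / (cnorm ip p \<eta> + 1)"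
  have n1: "cnorm ip p \<eta> + 1 > 0" by (simp add: add_nonneg_pos)
  have b: "b > 0" using \<eta>0 n1 by (simp add: b_def Upq_iff)
  have inU: "\<eta>0 + cscale l \<eta> \<in> Upq ip p q" if "l \<in> ball 0 b" for l
  proof -
    have "cnorm ip p (\<eta>0 + cscale l \<eta>) \<le> cnorm ip p \<eta>0 + cmod l * (cnorm ip p \<eta> + 1)"
    proof -
      have "cmod l * cnorm ip p \<eta> \<le> cmod l * (cnorm ip p \<eta> + 1)" by (rule mult_left_mono) auto
      then show ?thesis
        using M.cnorm_triangle[of p \<eta>0 "cscale l \<eta>"] unfolding M.cnorm_cscale by linarith
    qed
    also have "cmod l * (cnorm ip p \<eta> + 1) < b * (cnorm ip p \<eta> + 1)"
      using that n1 by (intro mult_strict_right_mono) auto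
    also have "b * (cnorm ip p \<eta> + 1) = sqrt (1 / 2 ^ (q + 1)) - cnorm ip p \<eta>0"
      using n1 by (simp add: b_def)
    finally show ?thesis by (simp add: Upq_iff del: power_add)
  qed
  \<comment> \<open>A majorant of the exponent valid on the whole disc, so that the error below does
    not depend on \<open>l\<close>.\<close>
  define Y where "Y = 4 * (cnorm ip 0 \<xi>0 + b * cnorm ip 0 \<xi>)"
  have Y: "neg_norm ip r (cembed ip (\<xi>0 + cscale l \<xi>)) / sqrt (2 ^ s) \<le> Y" if "l \<in> ball 0 b" for l
  proof -
    have "neg_norm ip r (cembed ip (\<xi>0 + cscale l \<xi>)) / sqrt (2 ^ s) \<le> neg_norm ip r (cembed ip (\<xi>0 + cscale l \<xi>)) / 1"
      by (rule divide_left_mono) (auto simp: M.neg_norm_nonneg)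
    also have "\<dots> \<le> 4 * cnorm ip 0 (\<xi>0 + cscale l \<xi>)" using M.neg_norm_cembed_le by simp
    also have "cnorm ip 0 (\<xi>0 + cscale l \<xi>) \<le> cnorm ip 0 \<xi>0 + cmod l * cnorm ip 0 \<xi>"
      using M.cnorm_triangle[of 0 \<xi>0 "cscale l \<xi>"] by (simp add: M.cnorm_cscale)
    also have "cmod l * cnorm ip 0 \<xi> \<le> b * cnorm ip 0 \<xi>"
      using that by (intro mult_right_mono) auto
    finally show ?thesis by (simp add: Y_def)
  qed
  \<comment> \<open>Two errors share the index \<open>N\<close>: cutting the exponential kernels,
    and cutting the series of the pairing.\<close>
  define err where "err N = K * sqrt (2 * (1 / 2) ^ N) * exp Y + K * sqrt 2 * (exp Y - (\<Sum>n<N. Y ^ n / fact n))" for N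
  have "(\<lambda>N. \<Sum>n<N. Y ^ n / fact n) \<longlonglongrightarrow> exp Y"
    using summable_LIMSEQ[OF M.exp_series(1)[of Y]] by (simp add: M.exp_series(2))
  then have "err \<longlonglongrightarrow> K * sqrt (2 * 0) * exp Y + K * sqrt 2 * (exp Y - exp Y)"
    unfolding err_def by (intro tendsto_intros LIMSEQ_power_zero) simp_all
  then have err: "err \<longlonglongrightarrow> 0" by simp
  have close: "dist (?F N l) (?G l) \<le> err N" if l: "l \<in> ball 0 b" for N l
  proof -
    note v = value_approx[OF T K(2,1) inU[OF l] Y[OF l]]
    let ?R = "M.rho_sum (\<xi>0 + cscale l \<xi>) (kernel_map (M.exp_partial (\<eta>0 + cscale l \<eta>) N))"
    have "cmod (?G l - ?F N l) \<le> cmod (?G l - ?R) + cmod (?R - ?F N l)"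
      using norm_triangle_ineq[of "?G l - ?R" "?R - ?F N l"] by simp
    also have "\<dots> \<le> err N"
      unfolding err_def symbol_eq(2)[OF T inU[OF l]] by (intro add_mono v)
    finally show ?thesis by (simp add: dist_norm norm_minus_commute)
  qed
  have "?G holomorphic_on ball 0 b"
  proof (rule holomorphic_uniform_sequence)
    show "?F N holomorphic_on ball 0 b" for N
      by (intro holomorphic_intros kernel_map_line_holomorphic)
    fix x :: complex assume "x \<in> ball 0 b"
    then obtain d where d: "d > 0" "cball x d \<subseteq> ball 0 b"
      using open_contains_cball[of "ball (0::complex) b"] open_ball by blast
    have "uniform_limit (cball x d) ?F ?G sequentially"
    proof (rule uniform_limitI)
      fix e :: real assume "e > 0"
      then have "\<forall>\<^sub>F N in sequentially. err N < e" by (rule order_tendstoD(2)[OF err])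
      then show "\<forall>\<^sub>F N in sequentially. \<forall>y\<in>cball x d. dist (?F N y) (?G y) < e"
        by (rule eventually_mono) (use close d(2) in \<open>blast intro: le_less_trans\<close>)
    qed
    then show "\<exists>d>0. cball x d \<subseteq> ball 0 b \<and> uniform_limit (cball x d) ?F ?G sequentially"
      using d by blast
  qed simp
  then have "?G analytic_on ball 0 b" by (simp add: analytic_on_open)
  then show ?thesis by (rule analytic_on_subset) (use b in simp)
qed

lemma symbol_estimate:
  assumes T: "extends_to ip \<mu> \<nu> B r s p q T" and s: "1 / sqrt (2 ^ s) \<le> \<epsilon>"
  obtains C where "C > 0" "\<And>\<xi> \<eta>. \<eta> \<in> Upq ip p q \<Longrightarrow>
    cmod (symbol ip \<mu> \<nu> B \<xi> \<eta>) \<le> C * exp (\<epsilon> * neg_norm ip r (cembed ip \<xi>))"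
proof -
  obtain K where K: "K \<ge> 0" "\<And>f. f \<in> Hpq ip p q \<Longrightarrow> sqrt (M.pqN r s (T f)) \<le> K * sqrt (M.pqN p q f)"
    by (rule extends_to_bound[OF T]) blast
  \<comment> \<open>The added 1 makes the constant positive even if \<open>K = 0\<close>.\<close>
  have "cmod (symbol ip \<mu> \<nu> B \<xi> \<eta>) \<le> (K * sqrt 2 + 1) * exp (\<epsilon> * neg_norm ip r (cembed ip \<xi>))"
    if \<eta>: "\<eta> \<in> Upq ip p q" for \<xi> \<eta>
  proof -
    let ?Y = "\<epsilon> * neg_norm ip r (cembed ip \<xi>)"
    have "neg_norm ip r (cembed ip \<xi>) / sqrt (2 ^ s) \<le> ?Y"
      using mult_right_mono[OF s M.neg_norm_nonneg[of r \<xi>]] by simp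
    from value_approx(2)[OF T K(2,1) \<eta> this]
    have "cmod (symbol ip \<mu> \<nu> B \<xi> \<eta>) \<le> K * sqrt 2 * exp ?Y"
      by (simp add: symbol_eq(2)[OF T \<eta>])
    also have "\<dots> \<le> (K * sqrt 2 + 1) * exp ?Y" by (intro mult_right_mono) auto
    finally show ?thesis .
  qed
  moreover have "K * sqrt 2 + 1 > 0" using K(1) by (simp add: add_nonneg_pos)
  ultimately show ?thesis using that by blast
qed

lemma symbol_holomorphic:
  assumes T: "extends_to ip \<mu> \<nu> B r s p q T" and s: "1 / sqrt (2 ^ s) \<le> \<epsilon>"
  shows "lc_holomorphic_on cscale2 (cnorm2 ip) (\<lambda>(\<xi>, \<eta>). symbol ip \<mu> \<nu> B \<xi> \<eta>) (UNIV \<times> Upq ip p q)"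
  unfolding lc_holomorphic_on_def
proof (intro conjI ballI allI)
  show "lc_open (cnorm2 ip) (UNIV \<times> Upq ip p q)"
    unfolding lc_open_def
  proof (intro ballI)
    fix z :: "'n cx \<times> 'n cx" assume "z \<in> UNIV \<times> Upq ip p q"
    then have "snd z \<in> Upq ip p q" by auto
    then obtain i d where d: "d > 0" "\<forall>w. cnorm ip i (w - snd z) < d \<longrightarrow> w \<in> Upq ip p q"
      using Upq_open unfolding lc_open_def by blast
    have "w \<in> UNIV \<times> Upq ip p q" if "cnorm2 ip i (w - z) < d" for w
    proof -
      have "cnorm ip i (snd w - snd z) < d"
        using that M.cnorm_nonneg[of i "fst (w - z)"] by (simp add: cnorm2_def del: M.cnorm_nonneg)
      then show ?thesis using d(2) by (simp add: mem_Times_iff)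
    qed
    then show "\<exists>i. \<exists>\<delta>>0. \<forall>w. cnorm2 ip i (w - z) < \<delta> \<longrightarrow> w \<in> UNIV \<times> Upq ip p q"
      using d(1) by blast
  qed
next
  fix z0 z :: "'n cx \<times> 'n cx" assume "z0 \<in> UNIV \<times> Upq ip p q"
  then have "snd z0 \<in> Upq ip p q" by auto
  from symbol_analytic_line[OF T this, of "fst z0" "fst z" "snd z"]
  show "(\<lambda>l. (\<lambda>(\<xi>, \<eta>). symbol ip \<mu> \<nu> B \<xi> \<eta>) (z0 + cscale2 l z)) analytic_on {0}"
    by (simp add: case_prod_unfold cscale2_def)
next
  fix z0 :: "'n cx \<times> 'n cx"
  obtain C where C: "C > 0" "\<And>\<xi> \<eta>. \<eta> \<in> Upq ip p q \<Longrightarrow>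
    cmod (symbol ip \<mu> \<nu> B \<xi> \<eta>) \<le> C * exp (\<epsilon> * neg_norm ip r (cembed ip \<xi>))"
    by (rule symbol_estimate[OF T s]) blast
  have e: "\<epsilon> \<ge> 0" by (rule order_trans[OF _ s]) simp
  \<comment> \<open>Local boundedness comes from the growth estimate: the dual norm of
    \<open>\<xi>\<close> is at most four times its norm in H, so a unit ball at level 0
    serves.\<close>
  have "cmod ((\<lambda>(\<xi>, \<eta>). symbol ip \<mu> \<nu> B \<xi> \<eta>) w) \<le> C * exp (\<epsilon> * (4 * (cnorm ip 0 (fst z0) + 1)))"
    if w: "w \<in> UNIV \<times> Upq ip p q" "cnorm2 ip 0 (w - z0) < 1" for w
  proof -
    have "cnorm ip 0 (fst w - fst z0) < 1"
      using w(2) M.cnorm_nonneg[of 0 "snd (w - z0)"] by (simp add: cnorm2_def del: M.cnorm_nonneg)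
    then have "cnorm ip 0 (fst w) \<le> cnorm ip 0 (fst z0) + 1"
      using M.cnorm_diff_le[of 0 "fst w" "fst z0"] by simp
    then have "neg_norm ip r (cembed ip (fst w)) \<le> 4 * (cnorm ip 0 (fst z0) + 1)"
      using M.neg_norm_cembed_le[of r "fst w"] by simp
    then have "exp (\<epsilon> * neg_norm ip r (cembed ip (fst w))) \<le> exp (\<epsilon> * (4 * (cnorm ip 0 (fst z0) + 1)))"
      using e by (simp add: mult_left_mono)
    then have "C * exp (\<epsilon> * neg_norm ip r (cembed ip (fst w))) \<le> C * exp (\<epsilon> * (4 * (cnorm ip 0 (fst z0) + 1)))"
      using C(1) by (intro mult_left_mono) auto
    moreover have "cmod (symbol ip \<mu> \<nu> B (fst w) (snd w)) \<le> C * exp (\<epsilon> * neg_norm ip r (cembed ip (fst w)))"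
      by (rule C(2)) (use w(1) in auto)
    ultimately show ?thesis by (simp add: case_prod_unfold)
  qed
  then show "\<exists>i. \<exists>\<delta>>0. \<exists>M. \<forall>w\<in>UNIV \<times> Upq ip p q. cnorm2 ip i (w - z0) < \<delta> \<longrightarrow>
      cmod ((\<lambda>(\<xi>, \<eta>). symbol ip \<mu> \<nu> B \<xi> \<eta>) w) \<le> M"
    by (intro exI[of _ 0] exI[of _ 1] conjI exI[of _ "C * exp (\<epsilon> * (4 * (cnorm ip 0 (fst z0) + 1)))"]) auto
qed

end

theorem theorem3p3:
  fixes ip :: "nat \<Rightarrow> 'n::real_vector \<Rightarrow> 'n \<Rightarrow> real"
    and \<mu> \<nu> :: "('n \<Rightarrow> real) measure"
    and B :: "(('n \<Rightarrow> real) \<Rightarrow> complex) \<Rightarrow> (('n \<Rightarrow> real) \<Rightarrow> complex)"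
    and p\<^sub>o :: nat and \<epsilon> :: real
  assumes "nuclear_triple ip"
    and "sets \<mu> = sets (cylinder_algebra ip)" "analytic_laplace ip \<mu>" "nondegenerate ip \<mu>"
    and "sets \<nu> = sets (cylinder_algebra ip)" "analytic_laplace ip \<nu>" "nondegenerate ip \<nu>"
    and "continuous_operator ip \<mu> \<nu> B"
    and "\<epsilon> > 0"
  shows "\<exists>C>0. \<exists>U. lc_open (cnorm ip) U \<and> 0 \<in> U
           \<and> UNIV \<times> U \<subseteq> symbol_domain ip \<mu> \<nu> B
           \<and> lc_holomorphic_on cscale2 (cnorm2 ip) (\<lambda>(\<xi>, \<eta>). symbol ip \<mu> \<nu> B \<xi> \<eta>) (UNIV \<times> U)
           \<and> (\<forall>\<xi>. \<forall>\<eta>\<in>U. cmod (symbol ip \<mu> \<nu> B \<xi> \<eta>)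
                 \<le> C * exp (\<epsilon> * neg_norm ip p\<^sub>o (cembed ip \<xi>)))"
proof -
  interpret symbol_setup ip \<mu> \<nu> B
    using assms(1-8) by (simp add: symbol_setup_def appell_measure_def appell_measure_axioms_def symbol_setup_axioms_def)
  \<comment> \<open>\<open>s\<close> plays the part of \<open>q\<^sub>o\<close>: it depends on
    \<open>\<epsilon>\<close> alone. Continuity of the operator then yields \<open>p\<close>,
    \<open>q\<close> and with them the neighbourhood \<open>Upq ip p q\<close>.\<close>
  obtain s :: nat where "(1 / \<epsilon>)\<^sup>2 < 2 ^ s" using real_arch_pow[of 2 "(1 / \<epsilon>)\<^sup>2"] by auto
  then have "1 / \<epsilon> \<le> sqrt (2 ^ s)" by (intro real_le_rsqrt) simp
  then have s: "1 / sqrt (2 ^ s) \<le> \<epsilon>" using assms(9) by (simp add: field_simps)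
  obtain p q T where T: "extends_to ip \<mu> \<nu> B p\<^sub>o s p q T" using extension_ex by blast
  obtain C where C: "C > 0" "\<And>\<xi> \<eta>. \<eta> \<in> Upq ip p q \<Longrightarrow>
    cmod (symbol ip \<mu> \<nu> B \<xi> \<eta>) \<le> C * exp (\<epsilon> * neg_norm ip p\<^sub>o (cembed ip \<xi>))"
    by (rule symbol_estimate[OF T s]) blast
  have "0 \<in> Upq ip p q" by (simp add: Upq_def)
  moreover have "UNIV \<times> Upq ip p q \<subseteq> symbol_domain ip \<mu> \<nu> B"
    using symbol_eq(1)[OF T] by auto
  ultimately show ?thesis
    using C Upq_open symbol_holomorphic[OF T s] by (intro exI[of _ C] conjI exI[of _ "Upq ip p q"]) auto
qed

end
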